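(* Let $\mathcal L$ be the law of $M_\star$. Then $$\mathcal W\Big(\frac1n\sum_{i=1}^n\delta_{n\pi_\star(i)},\ \mathcal L\Big)\to0$$ in probability as $n\to\infty$.
   Context: Configuration model: for each $n$, let $(d_i^-)_{1\le i\le n}$, $(d_i^+)_{1\le i\le n}$ be positive integers with $\sum_i d_i^-=\sum_i d_i^+=m$. Each vertex $i\in V=\{1,\dots,n\}$ carries a set $E_i^+$ of $d_i^+$ tails and a set $E_i^-$ of $d_i^-$ heads. The environment $\omega$ is a uniformly random bijection from tails to heads; $\omega(e)=f$ is an arc from the vertex of $e$ to that of $f$, giving a random directed multigraph $G$. The walk has transition matrix $P(i,j)=\frac{1}{d_i^+}|\{e\in E_i^+:\omega(e)\in E_j^-\}|$. Standing assumption: $\delta:=\min_i\min(d_i^+,d_i^-)\ge2$ and $\Delta:=\max_i\max(d_i^+,d_i^-)$ bounded uniformly in $n$. $\pi_\star$ is the invariant probability measure of $P$ (unique with high probability). The random variable $M_\star$ is defined by $M_\star=\frac nm\sum_{k=1}^{d^-_{\mathcal I}}Z_k$, where $\mathcal I$ is uniform on $V$ and independent of $(Z_k)_{k\ge1}$, and the $Z_k$ are i.i.d. mean-one random variables whose law is determined by the distributional fixed-point equation $Z_1\overset{d}{=}\frac{1}{d^+_{\mathcal J}}\sum_{k=1}^{d^-_{\mathcal J}}Z_k$, with $\mathcal J$ independent of $(Z_k)$ and distributed according to the out-degree distribution $\mathbf P(\mathcal J=i)=d_i^+/m$. $\mathcal W$ is the $1$-Wasserstein distance on probability measures on $\mathbb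 R$: $\mathcal W(\mathcal L_1,\mathcal L_2)=\sup_f|\int f\,d\mathcal L_1-\int f\,d\mathcal L_2|$ over all $f:\mathbb R\to\mathbb R$ with $|f(x)-f(y)|\le|x-y|$. *)

theory Defs
  imports "HOL-Probability.Probability"
begin

text \<open>Vertices of the n-th graph are 0,...,n-1. dout n i and din n i are the
out- and in-degrees of vertex i in the n-th degree sequence.\<close>

definition tails :: "(nat \<Rightarrow> nat \<Rightarrow> nat) \<Rightarrow> nat \<Rightarrow> (nat \<times> nat) set" where
  "tails dout n = Sigma {..<n} (\<lambda>i. {..<dout n i})"

definition heads :: "(nat \<Rightarrow> nat \<Rightarrow> nat) \<Rightarrow> nat \<Rightarrow> (nat \<times> nat) set" where
  "heads din n = Sigma {..<n} (\<lambda>j. {..<din n j})"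

definition num_arcs :: "(nat \<Rightarrow> nat \<Rightarrow> nat) \<Rightarrow> nat \<Rightarrow> nat" where
  "num_arcs dout n = (\<Sum>i<n. dout n i)"

text \<open>Environments: bijections from tails to heads (extensional outside the tails).
A tail (i,k) matched to a head (j,l) is an arc from i to j.\<close>
definition environments ::
  "(nat \<Rightarrow> nat \<Rightarrow> nat) \<Rightarrow> (nat \<Rightarrow> nat \<Rightarrow> nat) \<Rightarrow> nat \<Rightarrow> ((nat \<times> nat) \<Rightarrow> (nat \<times> nat)) set" where
  "environments dout din n =
     {\<omega> \<in> tails dout n \<rightarrow>\<^sub>E heads din n. bij_betw \<omega> (tails dout n) (heads din n)}"

definition env_pmf ::
  "(nat \<Rightarrow> nat \<Rightarrow> nat) \<Rightarrow> (nat \<Rightarrow> nat \<Rightarrow> nat) \<Rightarrow> nat \<Rightarrow> ((nat \<times> nat) \<Rightarrow> (nat \<times> nat)) pmf" where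
  "env_pmf dout din n = pmf_of_set (environments dout din n)"

definition trans_mat ::
  "(nat \<Rightarrow> nat \<Rightarrow> nat) \<Rightarrow> nat \<Rightarrow> ((nat \<times> nat) \<Rightarrow> (nat \<times> nat)) \<Rightarrow> nat \<Rightarrow> nat \<Rightarrow> real" where
  "trans_mat dout n \<omega> i j =
     real (card {k. k < dout n i \<and> fst (\<omega> (i, k)) = j}) / real (dout n i)"

definition invariant_prob ::
  "(nat \<Rightarrow> nat \<Rightarrow> nat) \<Rightarrow> nat \<Rightarrow> ((nat \<times> nat) \<Rightarrow> (nat \<times> nat)) \<Rightarrow> (nat \<Rightarrow> real) \<Rightarrow> bool" where
  "invariant_prob dout n \<omega> \<pi> \<longleftrightarrow>
     (\<forall>i. i \<ge> n \<longrightarrow> \<pi> i = 0) \<and> (\<forall>i<n. 0 \<le> \<pi> i) \<and> (\<Sum>i<n. \<pi> i) = 1 \<and>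
     (\<forall>j<n. (\<Sum>i<n. \<pi> i * trans_mat dout n \<omega> i j) = \<pi> j)"

definition pi_star ::
  "(nat \<Rightarrow> nat \<Rightarrow> nat) \<Rightarrow> nat \<Rightarrow> ((nat \<times> nat) \<Rightarrow> (nat \<times> nat)) \<Rightarrow> nat \<Rightarrow> real" where
  "pi_star dout n \<omega> = (THE \<pi>. invariant_prob dout n \<omega> \<pi>)"

definition empirical :: "nat \<Rightarrow> (nat \<Rightarrow> real) \<Rightarrow> real measure" where
  "empirical n \<pi> = measure_pmf (map_pmf (\<lambda>i. real n * \<pi> i) (pmf_of_set {..<n}))"

definition wasserstein1 :: "real measure \<Rightarrow> real measure \<Rightarrow> real" where
  "wasserstein1 L1 L2 =
     (SUP f \<in> {f :: real \<Rightarrow> real. \<forall>x y. \<bar>f x - f y\<bar> \<le> \<bar>x - y\<bar>}.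
        \<bar>(\<integral>x. f x \<partial>L1) - (\<integral>x. f x \<partial>L2)\<bar>)"

text \<open>Out-degree-biased vertex J: P(J = i) = d_i^+ / m (vertex of a uniform tail).\<close>
definition out_biased :: "(nat \<Rightarrow> nat \<Rightarrow> nat) \<Rightarrow> nat \<Rightarrow> nat pmf" where
  "out_biased dout n = map_pmf fst (pmf_of_set (tails dout n))"

definition smoothing_map ::
  "(nat \<Rightarrow> nat \<Rightarrow> nat) \<Rightarrow> (nat \<Rightarrow> nat \<Rightarrow> nat) \<Rightarrow> nat \<Rightarrow> real measure \<Rightarrow> real measure" where
  "smoothing_map dout din n \<mu> =
     measure_pmf (out_biased dout n) \<bind>
       (\<lambda>j. distr (PiM {..<din n j} (\<lambda>_. \<mu>)) borel
               (\<lambda>z. (\<Sum>k<din n j. z k) / real (dout n j)))"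

definition Z_law ::
  "(nat \<Rightarrow> nat \<Rightarrow> nat) \<Rightarrow> (nat \<Rightarrow> nat \<Rightarrow> nat) \<Rightarrow> nat \<Rightarrow> real measure \<Rightarrow> bool" where
  "Z_law dout din n \<mu> \<longleftrightarrow>
     prob_space \<mu> \<and> sets \<mu> = sets borel \<and> (AE x in \<mu>. 0 \<le> x) \<and>
     integrable \<mu> (\<lambda>x. x) \<and> (\<integral>x. x \<partial>\<mu>) = 1 \<and>
     \<mu> = smoothing_map dout din n \<mu>"

definition M_star_law ::
  "(nat \<Rightarrow> nat \<Rightarrow> nat) \<Rightarrow> (nat \<Rightarrow> nat \<Rightarrow> nat) \<Rightarrow> nat \<Rightarrow> real measure \<Rightarrow> real measure" where
  "M_star_law dout din n \<mu> =
     measure_pmf (pmf_of_set {..<n}) \<bind>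
       (\<lambda>i. distr (PiM {..<din n i} (\<lambda>_. \<mu>)) borel
               (\<lambda>z. real n / real (num_arcs dout n) * (\<Sum>k<din n i. z k)))"

end

theory Submission
  imports Defs
begin

text \<open>The environment is revealed one arc at a time, so every estimate rests on the conditional
  law of a uniform bijection whose values on an explored set of tails are known. Fix \<open>h\<close> and let
  \<open>b\<^sub>h\<close> be the law at time \<open>h\<close> of the walk started with the in-degree distribution.

  First, \<open>\<pi>\<^sub>\<star>\<close> is close to \<open>b\<^sub>h\<close> in total variation. Conditionally on a self-avoiding
  path of length \<open>s \<approx> 2 log\<^sub>2 n\<close> into \<open>z\<close>, which carries at most \<open>2\<^sup>-\<^sup>k\<close> of the mass after \<open>k\<close> further steps,
  the mean of \<open>b\<^sub>k(z)\<close> changes with \<open>k\<close> by at most \<open>2\<^sup>-\<^sup>k / m\<close> up to a negligible error.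
  A second moment computation therefore gives that \<open>b\<^sub>s\<close> is close to \<open>b\<^sub>h\<close>, and that
  for all but a polylogarithmic number of starting vertices the walk has law
  close to \<open>b\<^sub>s\<close> at time \<open>s\<close>. Small sets expand, hence the walk leaves the exceptional vertices within a
  polylogarithmic time from everywhere. So the walk forgets its starting point,
  the invariant law is unique, and it is close to \<open>b\<^sub>h\<close>.

  Second, \<open>m b\<^sub>h(i)\<close> is determined by the backward neighbourhood of \<open>i\<close> of radius \<open>h\<close>, which is a tree with
  high probability and nearly independent for two vertices. The empirical Laplace
  transform of \<open>m b\<^sub>h\<close> thus concentrates around the one of the \<open>h\<close>-th iterate of the smoothing
  transformation started at \<open>1\<close>, and the latter converges geometrically to that of \<open>Z\<^sub>1\<close>.

  Third, for mean-one laws on the half-line the Wasserstein distance is controlled by finitely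
  many values of the Laplace transforms: a value near \<open>0\<close> bounds the mass at large values, and
  Bernstein polynomials in \<open>exp (- x)\<close> handle truncated Lipschitz functions.\<close>

section \<open>Uniform bijections\<close>

text \<open>A single coincidence, where a newly revealed tail hits a known vertex, has probability
  of order polylog(n) / n. Up to logarithms this is as large as a typical mass of the walk, so
  comparisons of means need errors of order polylog(n) / n^2. The second factor comes from a
  symmetry: exchanging the targets of two fresh tails preserves the conditional law, and a walk
  notices the exchange only if it meets one of the two departure vertices and then still reaches
  \<open>z\<close>, which takes two coincidences. Squares are linearised. The sum over
  \<open>z\<close> of \<open>inlaw \<omega> s z * g z\<close> is the mean of \<open>g\<close> at the
  endpoint of a walk, so a second moment becomes a first moment conditional on the path of that
  walk. The lower degree bound 2 enters as a factor 1/2 in the mass along a path and in the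
  contraction of Laplace transforms, and as two tails per vertex in the expansion estimate. The law
  of \<open>Z\<close> changes with \<open>n\<close> and need not converge. All comparisons are
  therefore explicit inequalities whose constants depend on the degree bound and on finitely many
  parameters fixed before \<open>n\<close> grows.\<close>

definition bijs :: "'a set \<Rightarrow> 'b set \<Rightarrow> ('a \<Rightarrow> 'b) set" where
  "bijs A B = {\<omega> \<in> A \<rightarrow>\<^sub>E B. bij_betw \<omega> A B}"

definition agreeing :: "'a set \<Rightarrow> 'b set \<Rightarrow> 'a set \<Rightarrow> ('a \<Rightarrow> 'b) \<Rightarrow> ('a \<Rightarrow> 'b) set" where
  "agreeing A B D \<omega>0 = {\<omega> \<in> bijs A B. \<forall>e\<in>D. \<omega> e = \<omega>0 e}"

text \<open>Conditional expectation, for a uniform bijection, given its values on a set.\<close>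
definition cexp :: "'a set \<Rightarrow> 'b set \<Rightarrow> 'a set \<Rightarrow> (('a \<Rightarrow> 'b) \<Rightarrow> real) \<Rightarrow> ('a \<Rightarrow> 'b) \<Rightarrow> real" where
  "cexp A B D \<phi> \<omega>0 = (\<Sum>\<omega>\<in>agreeing A B D \<omega>0. \<phi> \<omega>) / real (card (agreeing A B D \<omega>0))"

locale equicard =
  fixes A :: "'a set" and B :: "'b set"
  assumes finA: "finite A" and finB: "finite B" and card_eq: "card A = card B"
begin

abbreviation "\<Omega> \<equiv> bijs A B"
abbreviation "agr \<equiv> agreeing A B"
abbreviation "\<EE> \<equiv> cexp A B"

lemma finite_bijs: "finite \<Omega>"
proof (rule finite_subset)
  show "\<Omega> \<subseteq> A \<rightarrow>\<^sub>E B" by (auto simp: bijs_def)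
  show "finite (A \<rightarrow>\<^sub>E B)" using finA finB by (intro finite_PiE) auto
qed

lemma bijs_nonempty: "\<Omega> \<noteq> {}"
proof -
  obtain h where "bij_betw h A B" using finA finB card_eq by (metis bij_betw_iff_card)
  hence "restrict h A \<in> \<Omega>" by (auto simp: bijs_def bij_betw_def inj_on_def)
  thus ?thesis by blast
qed

lemma bijs_in: "\<omega> \<in> \<Omega> \<Longrightarrow> e \<in> A \<Longrightarrow> \<omega> e \<in> B"
  by (auto simp: bijs_def bij_betw_def)

lemma bijs_inj: "\<omega> \<in> \<Omega> \<Longrightarrow> inj_on \<omega> A"
  by (auto simp: bijs_def bij_betw_def)

lemma bijs_bij: "\<omega> \<in> \<Omega> \<Longrightarrow> bij_betw \<omega> A B"
  by (auto simp: bijs_def)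

lemma finite_agr: "finite (agr D \<omega>0)"
  using finite_bijs by (auto simp: agreeing_def)

lemma agr_self: "\<omega>0 \<in> \<Omega> \<Longrightarrow> \<omega>0 \<in> agr D \<omega>0"
  by (simp add: agreeing_def)

lemma card_agr_pos: "\<omega>0 \<in> \<Omega> \<Longrightarrow> card (agr D \<omega>0) > 0"
  using agr_self finite_agr by (metis card_gt_0_iff empty_iff)

lemma agr_bijs: "\<omega> \<in> agr D \<omega>0 \<Longrightarrow> \<omega> \<in> \<Omega>"
  by (simp add: agreeing_def)

lemma agr_eq: "\<omega> \<in> agr D \<omega>0 \<Longrightarrow> e \<in> D \<Longrightarrow> \<omega> e = \<omega>0 e"
  by (simp add: agreeing_def)

lemma agr_class: "\<omega> \<in> agr D \<omega>0 \<Longrightarrow> agr D \<omega> = agr D \<omega>0"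
  by (auto simp: agreeing_def)

lemma cexp_mono:
  assumes "\<omega>0 \<in> \<Omega>" "\<And>\<omega>. \<omega> \<in> agr D \<omega>0 \<Longrightarrow> \<phi> \<omega> \<le> \<psi> \<omega>"
  shows "\<EE> D \<phi> \<omega>0 \<le> \<EE> D \<psi> \<omega>0"
  unfolding cexp_def by (intro divide_right_mono sum_mono assms) auto

lemma cexp_cong:
  assumes "\<And>\<omega>. \<omega> \<in> agr D \<omega>0 \<Longrightarrow> \<phi> \<omega> = \<psi> \<omega>"
  shows "\<EE> D \<phi> \<omega>0 = \<EE> D \<psi> \<omega>0"
  unfolding cexp_def using assms by simp

lemma cexp_const: "\<omega>0 \<in> \<Omega> \<Longrightarrow> \<EE> D (\<lambda>_. c) \<omega>0 = c"
  using card_agr_pos[of \<omega>0 D] by (simp add: cexp_def)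

lemma cexp_constI:
  "\<omega>0 \<in> \<Omega> \<Longrightarrow> (\<And>\<omega>. \<omega> \<in> agr D \<omega>0 \<Longrightarrow> \<phi> \<omega> = c) \<Longrightarrow> \<EE> D \<phi> \<omega>0 = c"
  using cexp_const[of \<omega>0 D c] cexp_cong[of D \<omega>0 \<phi> "\<lambda>_. c"] by simp

lemma cexp_add: "\<EE> D (\<lambda>\<omega>. \<phi> \<omega> + \<psi> \<omega>) \<omega>0 = \<EE> D \<phi> \<omega>0 + \<EE> D \<psi> \<omega>0"
  by (simp add: cexp_def sum.distrib add_divide_distrib)

lemma cexp_diff: "\<EE> D (\<lambda>\<omega>. \<phi> \<omega> - \<psi> \<omega>) \<omega>0 = \<EE> D \<phi> \<omega>0 - \<EE> D \<psi> \<omega>0"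
  by (simp add: cexp_def sum_subtractf diff_divide_distrib)

lemma cexp_cmult: "\<EE> D (\<lambda>\<omega>. c * \<phi> \<omega>) \<omega>0 = c * \<EE> D \<phi> \<omega>0"
  by (simp add: cexp_def sum_distrib_left)

lemma cexp_divide: "\<EE> D (\<lambda>\<omega>. \<phi> \<omega> / c) \<omega>0 = \<EE> D \<phi> \<omega>0 / c"
  by (simp add: cexp_def flip: sum_divide_distrib)

lemma cexp_sum: "\<EE> D (\<lambda>\<omega>. \<Sum>i\<in>I. \<phi> i \<omega>) \<omega>0 = (\<Sum>i\<in>I. \<EE> D (\<phi> i) \<omega>0)"
  unfolding cexp_def by (subst sum.swap) (simp add: sum_divide_distrib)

lemma cexp_nonneg: "\<omega>0 \<in> \<Omega> \<Longrightarrow> (\<And>\<omega>. \<omega> \<in> agr D \<omega>0 \<Longrightarrow> 0 \<le> \<phi> \<omega>) \<Longrightarrow> 0 \<le> \<EE> D \<phi> \<omega>0"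
  using cexp_mono[of \<omega>0 D "\<lambda>_. 0" \<phi>] by (simp add: cexp_const)

lemma cexp_le_const:
  "\<omega>0 \<in> \<Omega> \<Longrightarrow> (\<And>\<omega>. \<omega> \<in> agr D \<omega>0 \<Longrightarrow> \<phi> \<omega> \<le> c) \<Longrightarrow> \<EE> D \<phi> \<omega>0 \<le> c"
  using cexp_mono[of \<omega>0 D \<phi> "\<lambda>_. c"] by (simp add: cexp_const)

lemma cexp_abs_le: "\<bar>\<EE> D \<phi> \<omega>0\<bar> \<le> \<EE> D (\<lambda>\<omega>. \<bar>\<phi> \<omega>\<bar>) \<omega>0"
  unfolding cexp_def by (simp add: abs_divide divide_right_mono sum_abs)

text \<open>Agreement on \<open>D'\<close> is an equivalence relation that refines agreement on
  \<open>D\<close>. After the two sums are exchanged, each \<open>\<omega>'\<close> receives the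
  inverse size of its class from every member of that class, hence total weight one.\<close>

lemma cexp_tower:
  assumes "D \<subseteq> D'"
  shows "\<EE> D (\<EE> D' \<phi>) \<omega>0 = \<EE> D \<phi> \<omega>0"
proof -
  let ?K = "agr D \<omega>0"
  have sub: "agr D' \<omega> \<subseteq> ?K" if "\<omega> \<in> ?K" for \<omega>
    using that assms by (auto simp: agreeing_def)
  have sym: "\<omega>' \<in> agr D' \<omega> \<longleftrightarrow> \<omega> \<in> agr D' \<omega>'" if "\<omega> \<in> ?K" "\<omega>' \<in> ?K" for \<omega> \<omega>'
    using that by (auto simp: agreeing_def)
  have "(\<Sum>\<omega>\<in>?K. \<EE> D' \<phi> \<omega>) =
     (\<Sum>\<omega>\<in>?K. \<Sum>\<omega>'\<in>?K. if \<omega>' \<in> agr D' \<omega> then \<phi> \<omega>' / real (card (agr D' \<omega>)) else 0)"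
  proof (intro sum.cong refl)
    fix \<omega> assume w: "\<omega> \<in> ?K"
    have "(\<Sum>\<omega>'\<in>?K. if \<omega>' \<in> agr D' \<omega> then \<phi> \<omega>' / real (card (agr D' \<omega>)) else 0)
       = (\<Sum>\<omega>'\<in>?K \<inter> agr D' \<omega>. \<phi> \<omega>' / real (card (agr D' \<omega>)))"
      by (rule sum.inter_restrict[OF finite_agr, symmetric])
    also have "?K \<inter> agr D' \<omega> = agr D' \<omega>" using sub[OF w] by blast
    finally show "\<EE> D' \<phi> \<omega> = (\<Sum>\<omega>'\<in>?K. if \<omega>' \<in> agr D' \<omega> then \<phi> \<omega>' / real (card (agr D' \<omega>)) else 0)"
      by (simp add: cexp_def flip: sum_divide_distrib)
  qed
  also have "\<dots> = (\<Sum>\<omega>'\<in>?K. \<Sum>\<omega>\<in>?K. if \<omega>' \<in> agr D' \<omega> then \<phi> \<omega>' / real (card (agr D' \<omega>)) else 0)"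
    by (rule sum.swap)
  also have "\<dots> = (\<Sum>\<omega>'\<in>?K. \<Sum>\<omega>\<in>?K. if \<omega> \<in> agr D' \<omega>' then \<phi> \<omega>' / real (card (agr D' \<omega>')) else 0)"
  proof (intro sum.cong refl)
    fix \<omega>' \<omega> assume "\<omega>' \<in> ?K" "\<omega> \<in> ?K"
    then show "(if \<omega>' \<in> agr D' \<omega> then \<phi> \<omega>' / real (card (agr D' \<omega>)) else 0) =
      (if \<omega> \<in> agr D' \<omega>' then \<phi> \<omega>' / real (card (agr D' \<omega>')) else 0)"
      using sym agr_class by metis
  qed
  also have "\<dots> = (\<Sum>\<omega>'\<in>?K. \<phi> \<omega>')"
  proof (intro sum.cong refl)
    fix \<omega>' assume w: "\<omega>' \<in> ?K"
    have "(\<Sum>\<omega>\<in>?K. if \<omega> \<in> agr D' \<omega>' then \<phi> \<omega>' / real (card (agr D' \<omega>')) else 0)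
       = (\<Sum>\<omega>\<in>?K \<inter> agr D' \<omega>'. \<phi> \<omega>' / real (card (agr D' \<omega>')))"
      by (rule sum.inter_restrict[OF finite_agr, symmetric])
    also have "?K \<inter> agr D' \<omega>' = agr D' \<omega>'" using sub[OF w] by blast
    finally show "(\<Sum>\<omega>\<in>?K. if \<omega> \<in> agr D' \<omega>' then \<phi> \<omega>' / real (card (agr D' \<omega>')) else 0) = \<phi> \<omega>'"
      using card_agr_pos[OF agr_bijs[OF w], of D'] by simp
  qed
  finally show ?thesis by (simp add: cexp_def)
qed

text \<open>The restriction keeps the map extensional, since the transposition could move the
  default value \<open>undefined\<close> taken outside \<open>A\<close>. On the tail side this is
  not an issue: a transposition of two points of \<open>A\<close> fixes everything outside
  \<open>A\<close>.\<close>

lemma comp_left_bijs: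
  assumes "\<omega> \<in> \<Omega>" "f \<in> B" "g \<in> B"
  shows "restrict (Transposition.transpose f g \<circ> \<omega>) A \<in> \<Omega>"
proof -
  have "bij_betw (Transposition.transpose f g) B B"
    using assms by (simp add: bij_betw_transpose_iff)
  hence "bij_betw (Transposition.transpose f g \<circ> \<omega>) A B" using bijs_bij[OF assms(1)] bij_betw_trans by blast
  hence "bij_betw (restrict (Transposition.transpose f g \<circ> \<omega>) A) A B"
    by (subst bij_betw_cong[of A _ "Transposition.transpose f g \<circ> \<omega>"]) auto
  thus ?thesis by (auto simp: bijs_def bij_betw_def)
qed

lemma comp_right_bijs:
  assumes "\<omega> \<in> \<Omega>" "e \<in> A" "e' \<in> A"
  shows "\<omega> \<circ> Transposition.transpose e e' \<in> \<Omega>"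
proof -
  have "bij_betw (Transposition.transpose e e') A A"
    using assms by (simp add: bij_betw_transpose_iff)
  hence b: "bij_betw (\<omega> \<circ> Transposition.transpose e e') A B" using bijs_bij[OF assms(1)] bij_betw_trans by blast
  moreover have "(\<omega> \<circ> Transposition.transpose e e') x = undefined" if "x \<notin> A" for x
    using that assms by (auto simp: bijs_def Transposition.transpose_def PiE_def extensional_def)
  ultimately show ?thesis by (auto simp: bijs_def bij_betw_def PiE_def extensional_def)
qed

text \<open>Exchanging the targets of two unexplored tails is an involution of the conditioning
  class. This symmetry is the source of \<open>tail_exchange\<close>.\<close>

lemma cexp_swap:
  assumes "e \<in> A - D" "e' \<in> A - D" "\<omega>0 \<in> \<Omega>"
  shows "\<EE> D (\<lambda>\<omega>. \<phi> (\<omega> \<circ> Transposition.transpose e e')) \<omega>0 = \<EE> D \<phi> \<omega>0"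
proof -
  have "bij_betw (\<lambda>\<omega>. \<omega> \<circ> Transposition.transpose e e') (agr D \<omega>0) (agr D \<omega>0)"
  proof (rule bij_betw_byWitness[where f' = "\<lambda>\<omega>. \<omega> \<circ> Transposition.transpose e e'"])
    show "\<forall>a\<in>agr D \<omega>0. a \<circ> Transposition.transpose e e' \<circ> Transposition.transpose e e' = a" by (simp add: comp_assoc)
    show "\<forall>a\<in>agr D \<omega>0. a \<circ> Transposition.transpose e e' \<circ> Transposition.transpose e e' = a" by (simp add: comp_assoc)
    have "\<omega> \<circ> Transposition.transpose e e' \<in> agr D \<omega>0" if "\<omega> \<in> agr D \<omega>0" for \<omega>
      using comp_right_bijs[of \<omega> e e'] assms that by (auto simp: agreeing_def Transposition.transpose_def)
    thus "(\<lambda>\<omega>. \<omega> \<circ> Transposition.transpose e e') ` agr D \<omega>0 \<subseteq> agr D \<omega>0"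
      "(\<lambda>\<omega>. \<omega> \<circ> Transposition.transpose e e') ` agr D \<omega>0 \<subseteq> agr D \<omega>0" by auto
  qed
  from sum.reindex_bij_betw[OF this, of \<phi>] show ?thesis by (simp add: cexp_def)
qed

lemma card_agr_fibre:
  assumes e: "e \<in> A - D" and w: "\<omega>0 \<in> \<Omega>" and D: "D \<subseteq> A" and f: "f \<in> B - \<omega>0 ` D"
  shows "card {\<omega>\<in>agr D \<omega>0. \<omega> e = f} * (card A - card D) = card (agr D \<omega>0)"
proof -
  let ?F = "B - \<omega>0 ` D"
  let ?N = "\<lambda>f. {\<omega>\<in>agr D \<omega>0. \<omega> e = f}"
  have le: "card (?N f) \<le> card (?N g)" if f: "f \<in> ?F" and g: "g \<in> ?F" for f g
  proof (rule card_inj_on_le)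
    let ?T = "\<lambda>\<omega>. restrict (Transposition.transpose f g \<circ> \<omega>) A"
    show "inj_on ?T (?N f)"
    proof (rule inj_onI)
      fix \<omega> \<omega>' assume a: "\<omega> \<in> ?N f" "\<omega>' \<in> ?N f" "?T \<omega> = ?T \<omega>'"
      have "\<omega> x = \<omega>' x" for x
      proof (cases "x \<in> A")
        case True
        hence "Transposition.transpose f g (\<omega> x) = Transposition.transpose f g (\<omega>' x)"
          using fun_cong[OF a(3), of x] by simp
        thus ?thesis by (metis transpose_involutory)
      next
        case False thus ?thesis using a by (auto simp: agreeing_def bijs_def PiE_def extensional_def)
      qed
      thus "\<omega> = \<omega>'" by blast
    qed
    show "?T ` ?N f \<subseteq> ?N g"
    proof
      fix \<omega>' assume "\<omega>' \<in> ?T ` ?N f"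
      then obtain \<omega> where a: "\<omega> \<in> agr D \<omega>0" "f = \<omega> e" and w': "\<omega>' = ?T \<omega>" by auto
      have "?T \<omega> d = \<omega>0 d" if "d \<in> D" for d
      proof -
        have "\<omega> d = \<omega>0 d" using a that by (simp add: agreeing_def)
        moreover have "\<omega>0 d \<noteq> f" "\<omega>0 d \<noteq> g" using f g that by auto
        ultimately show ?thesis using that D by (auto simp: Transposition.transpose_def)
      qed
      hence "?T \<omega> \<in> agr D \<omega>0" using comp_left_bijs[OF agr_bijs[OF a(1)], of f g] f g
        by (auto simp: agreeing_def)
      moreover have "?T \<omega> e = g" using a(2) e by simp
      ultimately show "\<omega>' \<in> ?N g" using w' by simp
    qed
    show "finite (?N g)" using finite_agr by simp
  qed
  have eq: "card (?N g) = card (?N f)" if "g \<in> ?F" for g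
    using le[OF that f] le[OF f that] by simp
  have "agr D \<omega>0 = (\<Union>g\<in>?F. ?N g)"
  proof -
    have "\<omega> e \<in> ?F" if "\<omega> \<in> agr D \<omega>0" for \<omega>
    proof -
      have "\<omega> e \<notin> \<omega> ` D"
        using e D bijs_inj[OF agr_bijs[OF that]] by (auto simp: inj_on_def)
      moreover have "\<omega> ` D = \<omega>0 ` D" using that by (intro image_cong) (auto simp: agreeing_def)
      ultimately show ?thesis using bijs_in[OF agr_bijs[OF that], of e] e by auto
    qed
    thus ?thesis by blast
  qed
  hence "card (agr D \<omega>0) = (\<Sum>g\<in>?F. card (?N g))"
    using finB finite_agr by (subst card_UN_disjoint[symmetric]) auto
  also have "\<dots> = card ?F * card (?N f)" using eq by simp
  also have "card ?F = card A - card D"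
    using card_image[OF inj_on_subset[OF bijs_inj[OF w] D]] D bijs_in[OF w] card_eq finA
    by (subst card_Diff_subset) (auto intro: finite_subset)
  finally show ?thesis by simp
qed

lemma cexp_fresh:
  assumes e: "e \<in> A - D" and w: "\<omega>0 \<in> \<Omega>" and D: "D \<subseteq> A"
  shows "\<EE> D (\<lambda>\<omega>. g (\<omega> e)) \<omega>0 = (\<Sum>f\<in>B - \<omega>0 ` D. g f) / real (card A - card D)"
proof -
  let ?F = "B - \<omega>0 ` D" and ?K = "agr D \<omega>0"
  have lt: "card D < card A" using e D finA by (intro psubset_card_mono) auto
  have inF: "\<omega> e \<in> ?F" if "\<omega> \<in> ?K" for \<omega>
  proof -
    have "\<omega> e \<notin> \<omega> ` D"
      using e D bijs_inj[OF agr_bijs[OF that]] by (auto simp: inj_on_def)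
    moreover have "\<omega> ` D = \<omega>0 ` D" using that by (intro image_cong) (auto simp: agreeing_def)
    ultimately show ?thesis using bijs_in[OF agr_bijs[OF that], of e] e by auto
  qed
  have "(\<Sum>\<omega>\<in>?K. g (\<omega> e)) = (\<Sum>f\<in>?F. \<Sum>\<omega>\<in>{\<omega>\<in>?K. \<omega> e = f}. g (\<omega> e))"
    using inF finite_agr finB by (intro sum.group[symmetric]) auto
  also have "\<dots> = (\<Sum>f\<in>?F. real (card {\<omega>\<in>?K. \<omega> e = f}) * g f)"
    by (intro sum.cong refl) simp
  also have "\<dots> = (\<Sum>f\<in>?F. real (card ?K) / real (card A - card D) * g f)"
  proof (intro sum.cong refl)
    fix f assume "f \<in> ?F"
    from arg_cong[OF card_agr_fibre[OF e w D this], of real]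
    have "real (card {\<omega>\<in>?K. \<omega> e = f}) * real (card A - card D) = real (card ?K)"
      unfolding of_nat_mult .
    moreover have "real (card A - card D) \<noteq> 0" using lt by linarith
    ultimately have "real (card {\<omega>\<in>?K. \<omega> e = f}) = real (card ?K) / real (card A - card D)"
      by (intro eq_divide_imp)
    thus "real (card {\<omega>\<in>?K. \<omega> e = f}) * g f = real (card ?K) / real (card A - card D) * g f"
      by (rule arg_cong)
  qed
  also have "\<dots> = real (card ?K) * ((\<Sum>f\<in>?F. g f) / real (card A - card D))"
    unfolding sum_distrib_left[symmetric] by simp
  finally show ?thesis
    using card_agr_pos[OF w, of D] unfolding cexp_def by simp
qed

lemma cexp_fresh_prob:
  assumes e: "e \<in> A - D" and w: "\<omega>0 \<in> \<Omega>" and D: "D \<subseteq> A"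
  shows "\<EE> D (\<lambda>\<omega>. of_bool (\<omega> e \<in> X)) \<omega>0 \<le> real (card (X \<inter> B)) / real (card A - card D)"
proof -
  have "(\<Sum>f\<in>B - \<omega>0 ` D. of_bool (f \<in> X)) = real (card ((B - \<omega>0 ` D) \<inter> X))"
    using finB by (simp add: of_bool_def sum.If_cases Int_def)
  also have "\<dots> \<le> real (card (X \<inter> B))"
    using finB by (intro of_nat_mono card_mono) auto
  finally show ?thesis
    unfolding cexp_fresh[OF assms, of "\<lambda>f. of_bool (f \<in> X)"] by (intro divide_right_mono) auto
qed

text \<open>One step of exploration: inside a class of \<open>insert e D\<close> the value at
  \<open>e\<close> is constant, so this occurrence of \<open>\<omega> e\<close> may be frozen to
  \<open>\<omega>1 e\<close> while the rest of \<open>\<omega>\<close> stays random.\<close>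

lemma cexp_reveal:
  "\<EE> D (\<lambda>\<omega>. g \<omega> (\<omega> e)) \<omega>0 = \<EE> D (\<lambda>\<omega>1. \<EE> (insert e D) (\<lambda>\<omega>. g \<omega> (\<omega>1 e)) \<omega>1) \<omega>0"
proof -
  have "\<EE> D (\<lambda>\<omega>. g \<omega> (\<omega> e)) \<omega>0 = \<EE> D (\<EE> (insert e D) (\<lambda>\<omega>. g \<omega> (\<omega> e))) \<omega>0"
    by (rule cexp_tower[symmetric]) auto
  also have "\<dots> = \<EE> D (\<lambda>\<omega>1. \<EE> (insert e D) (\<lambda>\<omega>. g \<omega> (\<omega>1 e)) \<omega>1) \<omega>0"
    by (intro cexp_cong) (simp add: agreeing_def)
  finally show ?thesis .
qed

end

section \<open>Walks along explored arcs\<close>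

locale digraph_env =
  fixes n :: nat and dout din :: "nat \<Rightarrow> nat" and \<Delta> :: nat
  assumes n_pos: "n > 0"
    and degree_sums: "(\<Sum>i<n. din i) = (\<Sum>i<n. dout i)"
    and degrees: "\<And>i. i < n \<Longrightarrow> 2 \<le> dout i \<and> dout i \<le> \<Delta> \<and> 2 \<le> din i \<and> din i \<le> \<Delta>"
begin

definition "E = Sigma {..<n} (\<lambda>i. {..<dout i})"
definition "F = Sigma {..<n} (\<lambda>i. {..<din i})"
definition "m = (\<Sum>i<n. dout i)"

lemma finite_E: "finite E" and finite_F: "finite F"
  by (auto simp: E_def F_def)

lemma card_E: "card E = m" and card_F: "card F = m"
  by (simp_all add: E_def F_def m_def degree_sums)

sublocale equicard E F
  by standard (simp_all add: finite_E finite_F card_E card_F)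

lemma mem_E: "(v, l) \<in> E \<longleftrightarrow> v < n \<and> l < dout v"
  by (auto simp: E_def)

lemma m_ge: "2 * n \<le> m"
proof -
  have "(\<Sum>i<n. 2) \<le> m" unfolding m_def by (intro sum_mono) (use degrees in auto)
  thus ?thesis by simp
qed

lemma Delta_ge: "2 \<le> \<Delta>"
  using degrees[OF n_pos] by auto

lemma head_lt: "\<omega> \<in> \<Omega> \<Longrightarrow> e \<in> E \<Longrightarrow> fst (\<omega> e) < n"
  using bijs_in[of \<omega> e] by (auto simp: F_def)

lemma card_heads_at: "card (fst -` X \<inter> F) \<le> \<Delta> * card X" if "finite X"
proof -
  have "fst -` X \<inter> F \<subseteq> Sigma (X \<inter> {..<n}) (\<lambda>i. {..<din i})" by (auto simp: F_def)
  hence "card (fst -` X \<inter> F) \<le> card (Sigma (X \<inter> {..<n}) (\<lambda>i. {..<din i}))"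
    using that by (intro card_mono) auto
  also have "\<dots> = (\<Sum>i\<in>X \<inter> {..<n}. din i)" using that by simp
  also have "\<dots> \<le> (\<Sum>i\<in>X \<inter> {..<n}. \<Delta>)" using degrees by (intro sum_mono) auto
  also have "\<dots> \<le> \<Delta> * card X" using that by (simp add: card_mono)
  finally show ?thesis .
qed

text \<open>By the lower degree bound there are at least \<open>2 * n\<close> heads, so after at
  most \<open>n\<close> revelations at least \<open>n\<close> of them are free, and at most
  \<open>\<Delta> * card X\<close> heads belong to \<open>X\<close>.\<close>

lemma landing_prob:
  assumes e: "e \<in> E - D" and D: "D \<subseteq> E" "card D \<le> n" and w: "\<omega>0 \<in> \<Omega>" and X: "finite X"
  shows "\<EE> D (\<lambda>\<omega>. of_bool (fst (\<omega> e) \<in> X)) \<omega>0 \<le> real \<Delta> * card X / n"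
proof -
  have "\<EE> D (\<lambda>\<omega>. of_bool (\<omega> e \<in> fst -` X)) \<omega>0 \<le> real (card (fst -` X \<inter> F)) / real (card E - card D)"
    by (rule cexp_fresh_prob) (use e D w in auto)
  also have "\<dots> \<le> (real \<Delta> * card X) / n"
  proof (intro frac_le)
    show "real (card (fst -` X \<inter> F)) \<le> real \<Delta> * real (card X)"
      using card_heads_at[OF X] by (metis of_nat_le_iff of_nat_mult)
    show "real n \<le> real (card E - card D)" using m_ge D(2) card_E by simp
  qed (use n_pos in auto)
  finally show ?thesis by (simp add: vimage_def)
qed

text \<open>The induction step shared by the estimates below: \<open>b\<close> bounds the
  conditional mean when the fresh tail avoids \<open>X\<close>, and \<open>a\<close> is the
  surcharge for landing in \<open>X\<close>, paid with probability at most \<open>p\<close>.\<close>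

lemma reveal_bound:
  assumes e: "e \<in> E - D" and D: "D \<subseteq> E" "card D \<le> n" and w: "\<omega>0 \<in> \<Omega>" and X: "finite X"
    and a: "0 \<le> a" and X_le: "real \<Delta> * card X / n \<le> p"
    and inX: "\<And>\<omega>1. \<omega>1 \<in> agr D \<omega>0 \<Longrightarrow> fst (\<omega>1 e) \<in> X \<Longrightarrow>
       \<EE> (insert e D) (\<lambda>\<omega>. g \<omega> (fst (\<omega>1 e))) \<omega>1 \<le> b + a"
    and notX: "\<And>\<omega>1. \<omega>1 \<in> agr D \<omega>0 \<Longrightarrow> fst (\<omega>1 e) \<notin> X \<Longrightarrow>
       \<EE> (insert e D) (\<lambda>\<omega>. g \<omega> (fst (\<omega>1 e))) \<omega>1 \<le> b"
  shows "\<EE> D (\<lambda>\<omega>. g \<omega> (fst (\<omega> e))) \<omega>0 \<le> b + p * a"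
proof -
  have "\<EE> D (\<lambda>\<omega>. g \<omega> (fst (\<omega> e))) \<omega>0
      = \<EE> D (\<lambda>\<omega>1. \<EE> (insert e D) (\<lambda>\<omega>. g \<omega> (fst (\<omega>1 e))) \<omega>1) \<omega>0"
    by (rule cexp_reveal[of D "\<lambda>\<omega> h. g \<omega> (fst h)"])
  also have "\<dots> \<le> \<EE> D (\<lambda>\<omega>1. b + a * of_bool (fst (\<omega>1 e) \<in> X)) \<omega>0"
  proof (rule cexp_mono[OF w])
    fix \<omega>1 assume "\<omega>1 \<in> agr D \<omega>0"
    from inX[OF this] notX[OF this]
    show "\<EE> (insert e D) (\<lambda>\<omega>. g \<omega> (fst (\<omega>1 e))) \<omega>1 \<le> b + a * of_bool (fst (\<omega>1 e) \<in> X)"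
      by (cases "fst (\<omega>1 e) \<in> X") auto
  qed
  also have "\<dots> = b + a * \<EE> D (\<lambda>\<omega>1. of_bool (fst (\<omega>1 e) \<in> X)) \<omega>0"
    using w by (simp add: cexp_add cexp_const cexp_cmult)
  also have "\<dots> \<le> b + a * p"
    using landing_prob[OF e D w X] X_le a by (intro add_left_mono mult_left_mono) auto
  finally show ?thesis by (simp add: mult.commute)
qed

text \<open>Quenched probability that the walk from \<open>v\<close> is at \<open>z\<close> after \<open>k\<close> steps, has used only
  tails in \<open>D\<close>, and, unless the flag \<open>b\<close> is set, has visited \<open>S\<close>.\<close>
primrec hit :: "nat set \<Rightarrow> nat \<Rightarrow> (nat \<times> nat) set \<Rightarrow> (nat \<times> nat \<Rightarrow> nat \<times> nat) \<Rightarrow> nat \<Rightarrow> bool \<Rightarrow> nat \<Rightarrow> real" where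
  "hit S z D \<omega> 0 b v = of_bool ((b \<or> v \<in> S) \<and> v = z)"
| "hit S z D \<omega> (Suc k) b v =
     (\<Sum>l<dout v. if (v, l) \<in> D then hit S z D \<omega> k (b \<or> v \<in> S) (fst (\<omega> (v, l))) else 0) / dout v"

lemma hit_nonneg: "0 \<le> hit S z D \<omega> k b v"
  by (induction k arbitrary: b v) (auto intro!: divide_nonneg_nonneg sum_nonneg)

lemma sum_div_le:
  assumes "\<And>l. l < d \<Longrightarrow> f l \<le> (c::real)" "0 \<le> c"
  shows "(\<Sum>l<(d::nat). f l) / d \<le> c"
proof (cases "d = 0")
  case False
  have "(\<Sum>l<d. f l) \<le> (\<Sum>l<d. c)" using assms by (intro sum_mono) auto
  thus ?thesis using False by (simp add: field_simps)
qed (use assms in auto)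

lemma hit_le_1: "hit S z D \<omega> k b v \<le> 1"
proof (induction k arbitrary: b v)
  case (Suc k)
  show ?case unfolding hit.simps by (intro sum_div_le) (use Suc in auto)
qed auto

lemma hit_flag: "hit S z D \<omega> k True v = hit S' z D \<omega> k True v"
  by (induction k arbitrary: v) (auto cong: if_cong)

lemma hit_in: "v \<in> S \<Longrightarrow> hit S z D \<omega> k b v = hit S z D \<omega> k True v"
  by (cases k) (auto cong: if_cong)

lemma hit_untouched:
  assumes "v \<notin> fst ` D" "v \<noteq> z" shows "hit S z D \<omega> k b v = 0"
proof (cases k)
  case (Suc k')
  have "(v, l) \<notin> D" for l using assms by force
  thus ?thesis using Suc by simp
qed (use assms in auto)

lemma hit_Suc_E:
  assumes "v < n"
  shows "hit S z E \<omega> (Suc k) b v = (\<Sum>l<dout v. hit S z E \<omega> k (b \<or> v \<in> S) (fst (\<omega> (v, l)))) / dout v"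
  using assms by (simp add: mem_E)

text \<open>Bounds the conditional probability that a fresh tail is matched to a head of one of at
  most \<open>N + 2\<close> given vertices.\<close>
definition \<tau> :: "nat \<Rightarrow> real" where "\<tau> N = real \<Delta> * (N + 2) / n"

lemma tau_nonneg: "0 \<le> \<tau> N" by (simp add: \<tau>_def)

lemma tau_ge: "c \<le> N + 2 \<Longrightarrow> real \<Delta> * real c / n \<le> \<tau> N"
  unfolding \<tau>_def by (intro divide_right_mono mult_left_mono) auto

lemma card_fst_insert: "finite D \<Longrightarrow> card (fst ` insert e D) \<le> card D + 1"
  by (rule order_trans[OF card_image_le]) (auto simp: card_insert_if)

text \<open>Either the walk uses explored tails only, which is the first term, or some step goes
  through a fresh tail. If that tail leads to \<open>z\<close> or to a vertex owning a revealed
  tail, this costs \<open>\<tau> N\<close>; otherwise the walk is at a vertex where only further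
  fresh tails can help. Each step reveals at most one arc, hence the budget
  \<open>card D + k \<le> N\<close>.\<close>

lemma hit_first_order:
  assumes "D \<subseteq> E" "\<omega>0 \<in> \<Omega>" "v < n" "card D + k \<le> N" "N \<le> n"
  shows "\<EE> D (\<lambda>\<omega>. hit S z E \<omega> k b v) \<omega>0 \<le> hit S z D \<omega>0 k b v + k * \<tau> N"
  using assms
proof (induction k arbitrary: D \<omega>0 v b)
  case 0
  thus ?case by (simp add: cexp_const)
next
  case (Suc k)
  note D = Suc.prems(1) and w = Suc.prems(2) and v = Suc.prems(3)
  have finD: "finite D" using D finite_E finite_subset by blast
  let ?b = "b \<or> v \<in> S"
  let ?h = "\<lambda>\<omega> u. hit S z E \<omega> k ?b u"
  have tail: "\<EE> D (\<lambda>\<omega>. ?h \<omega> (fst (\<omega> (v, l)))) \<omega>0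
     \<le> (if (v, l) \<in> D then hit S z D \<omega>0 k ?b (fst (\<omega>0 (v, l))) else 0) + (k + 1) * \<tau> N"
    if l: "l < dout v" for l
  proof (cases "(v, l) \<in> D")
    case True
    have "\<EE> D (\<lambda>\<omega>. ?h \<omega> (fst (\<omega> (v, l)))) \<omega>0 = \<EE> D (\<lambda>\<omega>. ?h \<omega> (fst (\<omega>0 (v, l)))) \<omega>0"
      by (intro cexp_cong) (use agr_eq True in fastforce)
    also have "\<dots> \<le> hit S z D \<omega>0 k ?b (fst (\<omega>0 (v, l))) + k * \<tau> N"
      by (rule Suc.IH) (use Suc.prems D head_lt[OF w] True in auto)
    finally show ?thesis using True tau_nonneg[of N] by (simp add: algebra_simps)
  next
    case False
    let ?e = "(v, l)" and ?X = "insert z (fst ` insert (v, l) D)"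
    have e: "?e \<in> E - D" using False v l by (simp add: mem_E)
    have cX: "card ?X \<le> N + 2"
      using card_fst_insert[OF finD, of ?e] Suc.prems(4) by (intro card_insert_le_m1) auto
    have "\<EE> D (\<lambda>\<omega>. ?h \<omega> (fst (\<omega> ?e))) \<omega>0 \<le> k * \<tau> N + \<tau> N * 1"
    proof (rule reveal_bound[where X = ?X])
      fix \<omega>1 assume \<omega>1: "\<omega>1 \<in> agr D \<omega>0"
      let ?u = "fst (\<omega>1 ?e)"
      have IH: "\<EE> (insert ?e D) (\<lambda>\<omega>. ?h \<omega> ?u) \<omega>1 \<le> hit S z (insert ?e D) \<omega>1 k ?b ?u + k * \<tau> N"
        by (rule Suc.IH) (use Suc.prems D e head_lt[OF agr_bijs[OF \<omega>1]] agr_bijs[OF \<omega>1] finD in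
            \<open>auto simp: card_insert_if\<close>)
      show "\<EE> (insert ?e D) (\<lambda>\<omega>. ?h \<omega> ?u) \<omega>1 \<le> k * \<tau> N + 1"
        using IH hit_le_1[of S z "insert ?e D" \<omega>1 k ?b ?u] by linarith
      show "\<EE> (insert ?e D) (\<lambda>\<omega>. ?h \<omega> ?u) \<omega>1 \<le> k * \<tau> N" if "?u \<notin> ?X"
        using IH hit_untouched[of ?u "insert ?e D" z] that by simp
    qed (use e D Suc.prems w finD cX tau_ge in auto)
    thus ?thesis using False by (simp add: algebra_simps)
  qed
  have d: "dout v > 0" using degrees[OF v] by simp
  have "\<EE> D (\<lambda>\<omega>. hit S z E \<omega> (Suc k) b v) \<omega>0
     = (\<Sum>l<dout v. \<EE> D (\<lambda>\<omega>. ?h \<omega> (fst (\<omega> (v, l)))) \<omega>0) / dout v"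
    unfolding hit_Suc_E[OF v] cexp_divide cexp_sum ..
  also have "\<dots> \<le> (\<Sum>l<dout v. (if (v, l) \<in> D then hit S z D \<omega>0 k ?b (fst (\<omega>0 (v, l))) else 0) + (k + 1) * \<tau> N) / dout v"
    by (intro divide_right_mono sum_mono tail) auto
  also have "\<dots> = hit S z D \<omega>0 (Suc k) b v + Suc k * \<tau> N"
    using d by (simp add: sum.distrib add_divide_distrib)
  finally show ?case .
qed

lemma hit_fresh_tail:
  assumes "D \<subseteq> E" "\<omega>0 \<in> \<Omega>" "e \<in> E - D" "card D + k + 1 \<le> N" "N \<le> n"
  shows "\<EE> D (\<lambda>\<omega>. hit S z E \<omega> k b (fst (\<omega> e))) \<omega>0 \<le> (k + 1) * \<tau> N"
proof -
  have finD: "finite D" using assms finite_E finite_subset by blast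
  let ?X = "insert z (fst ` insert e D)"
  have cX: "card ?X \<le> N + 2"
    using card_fst_insert[OF finD, of e] assms(4) by (intro card_insert_le_m1) auto
  have "\<EE> D (\<lambda>\<omega>. hit S z E \<omega> k b (fst (\<omega> e))) \<omega>0 \<le> k * \<tau> N + \<tau> N * 1"
  proof (rule reveal_bound[where X = ?X])
    fix \<omega>1 assume \<omega>1: "\<omega>1 \<in> agr D \<omega>0"
    let ?u = "fst (\<omega>1 e)"
    have IH: "\<EE> (insert e D) (\<lambda>\<omega>. hit S z E \<omega> k b ?u) \<omega>1 \<le> hit S z (insert e D) \<omega>1 k b ?u + k * \<tau> N"
      by (rule hit_first_order) (use assms head_lt[OF agr_bijs[OF \<omega>1]] agr_bijs[OF \<omega>1] finD in
          \<open>auto simp: card_insert_if\<close>)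
    show "\<EE> (insert e D) (\<lambda>\<omega>. hit S z E \<omega> k b ?u) \<omega>1 \<le> k * \<tau> N + 1"
      using IH hit_le_1[of S z "insert e D" \<omega>1 k b ?u] by linarith
    show "\<EE> (insert e D) (\<lambda>\<omega>. hit S z E \<omega> k b ?u) \<omega>1 \<le> k * \<tau> N" if "?u \<notin> ?X"
      using IH hit_untouched[of ?u "insert e D" z] that by simp
  qed (use assms finD cX tau_ge in auto)
  thus ?thesis by (simp add: algebra_simps)
qed

text \<open>\<open>lv\<close> is a lower bound for the number of explored steps to \<open>z\<close>:
  it vanishes at \<open>z\<close> and drops by at most one along an explored arc.\<close>

lemma hit_too_far:
  assumes "\<And>e. e \<in> D \<Longrightarrow> lv (fst e) \<le> lv (fst (\<omega> e)) + (1::nat)" "lv z = 0" "k < lv v"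
  shows "hit S z D \<omega> k b v = 0"
  using assms(3)
proof (induction k arbitrary: b v)
  case 0
  thus ?case using assms(2) by auto
next
  case (Suc k)
  have "hit S z D \<omega> k (b \<or> v \<in> S) (fst (\<omega> (v, l))) = 0" if "(v, l) \<in> D" for l
    using Suc.IH[of "fst (\<omega> (v, l))"] assms(1)[OF that] Suc.prems by simp
  thus ?case by (simp cong: if_cong)
qed

lemma hit_closed:
  assumes "\<And>e. e \<in> D \<Longrightarrow> fst e \<in> C \<Longrightarrow> fst (\<omega> e) \<in> C" "S \<inter> C = {}" "v \<in> C"
  shows "hit S z D \<omega> k False v = 0"
  using assms(3)
proof (induction k arbitrary: v)
  case 0
  thus ?case using assms(2) by auto
next
  case (Suc k)
  have vS: "v \<notin> S" using Suc.prems assms(2) by blast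
  have "hit S z D \<omega> k False (fst (\<omega> (v, l))) = 0" if "(v, l) \<in> D" for l
    using Suc.IH assms(1)[OF that] Suc.prems by simp
  thus ?case using vS by (simp cong: if_cong)
qed

text \<open>Starting through a fresh tail, visiting \<open>S\<close> and then \<open>z\<close> costs two coincidences. The
  explored arcs cannot help: they never lead from \<open>C\<close> to \<open>S\<close>, and from outside \<open>C\<close> they
  need at least \<open>K\<close> steps to reach \<open>z\<close>.\<close>
lemma hit_second_order:
  assumes "D \<subseteq> E" "\<omega>0 \<in> \<Omega>" "e \<in> E - D" "fst e \<notin> C" "finite C" "finite S" "z \<in> C" "S \<inter> C = {}"
    and "\<And>d. d \<in> D \<Longrightarrow> fst d \<in> C \<Longrightarrow> fst (\<omega>0 d) \<in> C"
    and "\<And>d. d \<in> D \<Longrightarrow> lv (fst d) \<le> lv (fst (\<omega>0 d)) + (1::nat)"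
    and "lv z = 0" "\<And>u. u \<notin> C \<Longrightarrow> lv u = K" "k < K"
    and "card C + card S + card D + k + 1 \<le> N" "N \<le> n"
  shows "\<EE> D (\<lambda>\<omega>. hit S z E \<omega> k False (fst (\<omega> e))) \<omega>0 \<le> (real (k + 1))\<^sup>2 * (\<tau> N)\<^sup>2"
  using assms(1-4,9,10,13,14)
proof (induction k arbitrary: D \<omega>0 e)
  case (0 D \<omega>0 e)
  have "\<EE> D (\<lambda>\<omega>. hit S z E \<omega> 0 False (fst (\<omega> e))) \<omega>0 = 0"
    using 0 assms by (intro cexp_constI) auto
  thus ?case by simp
next
  case (Suc k)
  note D = Suc.prems(1) and w = Suc.prems(2) and e = Suc.prems(3)
  have finD: "finite D" using D finite_E finite_subset by blast
  let ?X = "C \<union> S \<union> fst ` insert e D"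
  let ?D = "insert e D"
  have cX: "card ?X \<le> N + 2"
  proof -
    have "card ?X \<le> card C + card S + card (fst ` ?D)"
      by (meson add_mono card_Un_le le_refl le_trans)
    also have "card (fst ` ?D) \<le> card D + 1"
      by (rule card_fst_insert[OF finD])
    finally show ?thesis using Suc.prems by simp
  qed
  have t0: "0 \<le> \<tau> N" by (rule tau_nonneg)
  have "\<EE> D (\<lambda>\<omega>. hit S z E \<omega> (Suc k) False (fst (\<omega> e))) \<omega>0
      \<le> (real (k + 1))\<^sup>2 * (\<tau> N)\<^sup>2 + \<tau> N * (real (Suc k) * \<tau> N)"
  proof (rule reveal_bound[where X = ?X])
    fix \<omega>1 assume \<omega>1: "\<omega>1 \<in> agr D \<omega>0"
    let ?u = "fst (\<omega>1 e)"
    have w1: "\<omega>1 \<in> \<Omega>" using agr_bijs[OF \<omega>1] .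
    have u: "?u < n" using head_lt[OF w1] e by auto
    have cD: "card ?D \<le> card D + 1" using finD by (simp add: card_insert_if)
    have clo: "fst (\<omega>1 d) \<in> C" if "d \<in> ?D" "fst d \<in> C" for d
      using that Suc.prems(4,5) agr_eq[OF \<omega>1] by (cases "d = e") auto
    \<comment> \<open>The new arc starts outside \<open>C\<close>, at level \<open>K\<close>, and
      for \<open>?u \<notin> C\<close> it also ends at level \<open>K\<close>. A landing inside
      \<open>C\<close> could break the level condition; that case is settled by closedness of
      \<open>C\<close> instead.\<close>
    have lam: "lv (fst d) \<le> lv (fst (\<omega>1 d)) + 1" if "d \<in> ?D" "?u \<notin> C" for d
      using that Suc.prems(4,6) agr_eq[OF \<omega>1] assms(12) by (cases "d = e") auto
    show "\<EE> ?D (\<lambda>\<omega>. hit S z E \<omega> (Suc k) False ?u) \<omega>1 \<le> (real (k + 1))\<^sup>2 * (\<tau> N)\<^sup>2 + real (Suc k) * \<tau> N"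
    proof -
      \<comment> \<open>Explored arcs alone do not suffice: from \<open>C\<close> the walk never
        meets \<open>S\<close>, and from outside \<open>C\<close> it needs at least \<open>K\<close>
        steps to \<open>z\<close>. What remains is the first-order term, and it is multiplied by the
        probability of landing in \<open>?X\<close>.\<close>
      have "hit S z ?D \<omega>1 (Suc k) False ?u = 0"
      proof (cases "?u \<in> C")
        case True thus ?thesis using clo assms(8) by (intro hit_closed) auto
      next
        case False thus ?thesis
          using lam assms(11,12) Suc.prems(7) by (intro hit_too_far[of _ lv]) auto
      qed
      moreover have "\<EE> ?D (\<lambda>\<omega>. hit S z E \<omega> (Suc k) False ?u) \<omega>1
          \<le> hit S z ?D \<omega>1 (Suc k) False ?u + Suc k * \<tau> N"
        by (rule hit_first_order) (use D e w1 u cD Suc.prems(8) assms(15) in auto)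
      moreover have "0 \<le> (real (k + 1))\<^sup>2 * (\<tau> N)\<^sup>2" by simp
      ultimately show ?thesis by linarith
    qed
    \<comment> \<open>At an unseen vertex all out-tails are fresh and start outside
      \<open>C\<close>, so the induction hypothesis applies to each of them.\<close>
    show "\<EE> ?D (\<lambda>\<omega>. hit S z E \<omega> (Suc k) False ?u) \<omega>1 \<le> (real (k + 1))\<^sup>2 * (\<tau> N)\<^sup>2" if nX: "?u \<notin> ?X"
    proof -
      have tail: "\<EE> ?D (\<lambda>\<omega>. hit S z E \<omega> k False (fst (\<omega> (?u, l)))) \<omega>1 \<le> (real (k + 1))\<^sup>2 * (\<tau> N)\<^sup>2"
        if l: "l < dout ?u" for l
      proof (rule Suc.IH)
        have "(?u, l) \<notin> ?D" using nX by (metis UnCI fst_conv imageI)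
        thus "(?u, l) \<in> E - ?D" using l u by (simp add: mem_E)
      qed (use D e w1 nX clo lam Suc.prems(7,8) cD in auto)
      have "\<EE> ?D (\<lambda>\<omega>. hit S z E \<omega> (Suc k) False ?u) \<omega>1
         = (\<Sum>l<dout ?u. \<EE> ?D (\<lambda>\<omega>. hit S z E \<omega> k False (fst (\<omega> (?u, l)))) \<omega>1) / dout ?u"
        using nX unfolding hit_Suc_E[OF u] cexp_divide cexp_sum by simp
      also have "\<dots> \<le> (real (k + 1))\<^sup>2 * (\<tau> N)\<^sup>2"
        using tail by (intro sum_div_le) auto
      finally show ?thesis .
    qed
  qed (use e D w finD cX tau_ge t0 Suc.prems(8) assms(5,6,15) in auto)
  also have "\<dots> \<le> (real (Suc k + 1))\<^sup>2 * (\<tau> N)\<^sup>2"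
  proof -
    have "(real (k + 1))\<^sup>2 + real (Suc k) \<le> (real (Suc k + 1))\<^sup>2"
      by (simp add: power2_eq_square algebra_simps)
    from mult_right_mono[OF this, of "(\<tau> N)\<^sup>2"] show ?thesis
      by (simp add: algebra_simps power2_eq_square)
  qed
  finally show ?case .
qed

text \<open>The walks in the two environments agree until they first visit \<open>S\<close>. From a
  vertex of \<open>S\<close> the flag makes no difference, and there the difference of two
  nonnegative numbers is bounded by their sum.\<close>

lemma hit_swap_diff:
  assumes w: "\<omega> \<in> \<Omega>" and e: "e \<in> E" "e' \<in> E" and S: "S = {fst e, fst e'}" and v: "v < n"
  shows "\<bar>hit S z E (\<omega> \<circ> Transposition.transpose e e') k True v - hit S z E \<omega> k True v\<bar>
    \<le> hit S z E (\<omega> \<circ> Transposition.transpose e e') k False v + hit S z E \<omega> k False v"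
  using v
proof (induction k arbitrary: v)
  case (Suc k)
  let ?w = "\<omega> \<circ> Transposition.transpose e e'"
  have w': "?w \<in> \<Omega>" using comp_right_bijs[OF w e] .
  show ?case
  proof (cases "v \<in> S")
    case True
    show ?thesis using hit_in[OF True, of z E ?w "Suc k" False] hit_in[OF True, of z E \<omega> "Suc k" False]
        hit_nonneg[of S z E ?w "Suc k" True v] hit_nonneg[of S z E \<omega> "Suc k" True v] by linarith
  next
    case False
    have eq: "?w (v, l) = \<omega> (v, l)" for l
      using False S by (auto simp: Transposition.transpose_def)
    have "\<bar>(\<Sum>l<dout v. hit S z E ?w k True (fst (\<omega> (v, l)))) - (\<Sum>l<dout v. hit S z E \<omega> k True (fst (\<omega> (v, l))))\<bar>
       \<le> (\<Sum>l<dout v. hit S z E ?w k False (fst (\<omega> (v, l))) + hit S z E \<omega> k False (fst (\<omega> (v, l))))"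
      unfolding sum_subtractf[symmetric]
      by (intro order_trans[OF sum_abs] sum_mono Suc.IH head_lt[OF w]) (use Suc.prems in \<open>simp add: mem_E\<close>)
    hence "\<bar>(\<Sum>l<dout v. hit S z E ?w k True (fst (\<omega> (v, l)))) - (\<Sum>l<dout v. hit S z E \<omega> k True (fst (\<omega> (v, l))))\<bar> / dout v
       \<le> (\<Sum>l<dout v. hit S z E ?w k False (fst (\<omega> (v, l))) + hit S z E \<omega> k False (fst (\<omega> (v, l)))) / dout v"
      by (rule divide_right_mono) simp
    thus ?thesis using False unfolding hit_Suc_E[OF Suc.prems] eq
      by (simp add: sum.distrib add_divide_distrib diff_divide_distrib[symmetric] abs_divide)
  qed
qed (auto simp: hit_nonneg)

text \<open>By \<open>cexp_swap\<close> the mean through \<open>e\<close> equals the mean through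
  \<open>e'\<close> in the swapped environment, and the effect of the swap is bounded by the walks
  that visit one of the two departure vertices before \<open>z\<close>.\<close>

lemma tail_exchange:
  assumes D: "D \<subseteq> E" and w: "\<omega>0 \<in> \<Omega>" and e: "e \<in> E - D" "e' \<in> E - D" and S: "S = {fst e, fst e'}"
  shows "\<bar>\<EE> D (\<lambda>\<omega>. hit S z E \<omega> k True (fst (\<omega> e))) \<omega>0 - \<EE> D (\<lambda>\<omega>. hit S z E \<omega> k True (fst (\<omega> e'))) \<omega>0\<bar>
    \<le> \<EE> D (\<lambda>\<omega>. hit S z E \<omega> k False (fst (\<omega> e))) \<omega>0 + \<EE> D (\<lambda>\<omega>. hit S z E \<omega> k False (fst (\<omega> e'))) \<omega>0"
proof -
  let ?t = "Transposition.transpose e e'"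
  have "\<EE> D (\<lambda>\<omega>. hit S z E \<omega> k b (fst (\<omega> e))) \<omega>0
      = \<EE> D (\<lambda>\<omega>. hit S z E (\<omega> \<circ> ?t) k b (fst (\<omega> e'))) \<omega>0" for b
    using cexp_swap[OF e w, of "\<lambda>\<omega>. hit S z E \<omega> k b (fst (\<omega> e))"] by simp
  hence "\<bar>\<EE> D (\<lambda>\<omega>. hit S z E \<omega> k True (fst (\<omega> e))) \<omega>0 - \<EE> D (\<lambda>\<omega>. hit S z E \<omega> k True (fst (\<omega> e'))) \<omega>0\<bar>
     = \<bar>\<EE> D (\<lambda>\<omega>. hit S z E (\<omega> \<circ> ?t) k True (fst (\<omega> e')) - hit S z E \<omega> k True (fst (\<omega> e'))) \<omega>0\<bar>"
    by (simp add: cexp_diff)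
  also have "\<dots> \<le> \<EE> D (\<lambda>\<omega>. \<bar>hit S z E (\<omega> \<circ> ?t) k True (fst (\<omega> e')) - hit S z E \<omega> k True (fst (\<omega> e'))\<bar>) \<omega>0"
    by (rule cexp_abs_le)
  also have "\<dots> \<le> \<EE> D (\<lambda>\<omega>. hit S z E (\<omega> \<circ> ?t) k False (fst (\<omega> e')) + hit S z E \<omega> k False (fst (\<omega> e'))) \<omega>0"
    by (intro cexp_mono[OF w] hit_swap_diff S) (use e agr_bijs head_lt in auto)
  also have "\<dots> = \<EE> D (\<lambda>\<omega>. hit S z E \<omega> k False (fst (\<omega> e))) \<omega>0 + \<EE> D (\<lambda>\<omega>. hit S z E \<omega> k False (fst (\<omega> e'))) \<omega>0"
    using cexp_swap[OF e w, of "\<lambda>\<omega>. hit S z E \<omega> k False (fst (\<omega> e))"] by (simp add: cexp_add)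
  finally show ?thesis .
qed

section \<open>Transition probabilities and the walk started from the in-degree distribution\<close>

abbreviation pr :: "(nat \<times> nat \<Rightarrow> nat \<times> nat) \<Rightarrow> nat \<Rightarrow> nat \<Rightarrow> nat \<Rightarrow> real" where
  "pr \<omega> k x z \<equiv> hit {} z E \<omega> k True x"

definition inlaw :: "(nat \<times> nat \<Rightarrow> nat \<times> nat) \<Rightarrow> nat \<Rightarrow> nat \<Rightarrow> real" where
  "inlaw \<omega> k z = (\<Sum>x<n. real (din x) / m * pr \<omega> k x z)"

lemma m_pos: "m > 0" using m_ge n_pos by simp

lemma din_mass: "(\<Sum>x<n. real (din x) / m) = 1"
proof -
  have "real (\<Sum>x<n. din x) = real m" using degree_sums by (simp add: m_def)
  thus ?thesis using m_pos by (simp flip: sum_divide_distrib)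
qed

lemma inlaw_nonneg: "0 \<le> inlaw \<omega> k z"
  unfolding inlaw_def by (intro sum_nonneg mult_nonneg_nonneg hit_nonneg) auto

lemma sum_E: "(\<Sum>e\<in>E. g e) = (\<Sum>x<n. \<Sum>l<dout x. g (x, l))" for g :: "_ \<Rightarrow> real"
  unfolding E_def by (subst sum.Sigma) auto

lemma sum_F: "(\<Sum>f\<in>F. g f) = (\<Sum>x<n. \<Sum>l<din x. g (x, l))" for g :: "_ \<Rightarrow> real"
  unfolding F_def by (subst sum.Sigma) auto

lemma inlaw_tails:
  assumes "\<omega> \<in> \<Omega>"
  shows "inlaw \<omega> k z = (\<Sum>e\<in>E. 1 * pr \<omega> k (fst (\<omega> e)) z) / m"
proof -
  have "(\<Sum>e\<in>E. pr \<omega> k (fst (\<omega> e)) z) = (\<Sum>f\<in>F. pr \<omega> k (fst f) z)"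
    by (rule sum.reindex_bij_betw[OF bijs_bij[OF assms]])
  also have "\<dots> = (\<Sum>x<n. real (din x) * pr \<omega> k x z)" by (simp add: sum_F)
  finally show ?thesis by (simp add: inlaw_def sum_divide_distrib)
qed

text \<open>Together with \<open>inlaw_tails\<close> this writes the laws at times \<open>k\<close>
  and \<open>k + 1\<close> as averages of the same function of a tail, with weights \<open>1\<close>
  and \<open>din / dout\<close>, both of total \<open>m\<close>. They nearly agree once the
  conditional mean of that function is nearly constant over the tails. The factor \<open>1\<close>
  written out in \<open>inlaw_tails\<close> matches this weighted form.\<close>

lemma inlaw_Suc:
  "inlaw \<omega> (Suc k) z = (\<Sum>e\<in>E. real (din (fst e)) / dout (fst e) * pr \<omega> k (fst (\<omega> e)) z) / m"
proof -
  have "inlaw \<omega> (Suc k) z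
      = (\<Sum>x<n. real (din x) / m * ((\<Sum>l<dout x. pr \<omega> k (fst (\<omega> (x, l))) z) / dout x))"
    unfolding inlaw_def by (intro sum.cong refl) (simp add: mem_E)
  also have "\<dots> = (\<Sum>x<n. \<Sum>l<dout x. real (din x) / dout x * pr \<omega> k (fst (\<omega> (x, l))) z) / m"
    by (simp add: sum_divide_distrib sum_distrib_left algebra_simps)
  finally show ?thesis by (simp add: sum_E)
qed

lemma weights_mass: "(\<Sum>e\<in>E. real (din (fst e)) / dout (fst e)) = m"
proof -
  have "(\<Sum>e\<in>E. real (din (fst e)) / dout (fst e)) = (\<Sum>x<n. real (din x))"
    unfolding sum_E using degrees by (intro sum.cong refl) fastforce
  thus ?thesis using degree_sums by (simp add: m_def flip: of_nat_sum)
qed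

lemma weights_le: "e \<in> E \<Longrightarrow> real (din (fst e)) / dout (fst e) \<le> \<Delta>"
proof -
  assume "e \<in> E"
  hence d: "2 \<le> dout (fst e)" "din (fst e) \<le> \<Delta>" using degrees[of "fst e"] by (auto simp: E_def)
  have "real (din (fst e)) / dout (fst e) \<le> real (din (fst e)) / 1"
    using d by (intro divide_left_mono) auto
  thus ?thesis using d by simp
qed

section \<open>Exploration around a self-avoiding path\<close>

definition explored :: "(nat \<times> nat) set \<Rightarrow> (nat \<times> nat \<Rightarrow> nat \<times> nat) \<Rightarrow> nat set \<Rightarrow> nat \<Rightarrow> nat \<Rightarrow> nat \<Rightarrow> bool" where
  "explored D \<omega>0 C z k N \<longleftrightarrow> D \<subseteq> E \<and> \<omega>0 \<in> \<Omega> \<and> finite C \<and> z \<in> C \<and> fst ` D \<subseteq> C \<and>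
     (\<forall>d\<in>D. fst (\<omega>0 d) \<in> C) \<and> card C + card D + k + 3 \<le> N \<and> N \<le> n"

lemma explored_mono: "explored D \<omega>0 C z k N \<Longrightarrow> k' \<le> k \<Longrightarrow> explored D \<omega>0 C z k' N"
  by (auto simp: explored_def)

text \<open>\<open>D\<close> is the set of explored tails. \<open>J\<close> is the annealed probability of reaching \<open>z\<close> through the
  tail \<open>e\<close>, and \<open>U\<close> is the annealed law at \<open>z\<close> of the walk that starts at the vertex of a uniform head;
  \<open>W / m\<close> is the part of it carried by explored arcs only.\<close>
definition J where "J D \<omega>0 z k e = \<EE> D (\<lambda>\<omega>. pr \<omega> k (fst (\<omega> e)) z) \<omega>0"

definition U where "U D \<omega>0 z k = \<EE> D (\<lambda>\<omega>. inlaw \<omega> k z) \<omega>0"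

definition W where "W D \<omega>0 z k = (\<Sum>e\<in>D. hit {} z D \<omega>0 k True (fst (\<omega>0 e)))"

definition \<eta> where "\<eta> D \<omega>0 z k N = real \<Delta> * (W D \<omega>0 z k / m + 2 * (real k + 1)\<^sup>2 * (\<tau> N)\<^sup>2)"

lemma J_nonneg: "\<omega>0 \<in> \<Omega> \<Longrightarrow> 0 \<le> J D \<omega>0 z k e"
  unfolding J_def by (rule cexp_nonneg) (auto simp: hit_nonneg)

lemma J_le_1: "\<omega>0 \<in> \<Omega> \<Longrightarrow> J D \<omega>0 z k e \<le> 1"
  unfolding J_def by (rule cexp_le_const) (auto simp: hit_le_1)

text \<open>No explored tail starts outside \<open>C\<close>, so both tails are fresh. Explored arcs
  stay inside \<open>C\<close>, hence the level function with value \<open>0\<close> on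
  \<open>C\<close> and \<open>k + 1\<close> elsewhere is admissible in
  \<open>hit_second_order\<close>.\<close>

lemma J_off:
  assumes ex: "explored D \<omega>0 C z k N" and e: "e \<in> E" "fst e \<notin> C" "e' \<in> E" "fst e' \<notin> C"
  shows "\<bar>J D \<omega>0 z k e - J D \<omega>0 z k e'\<bar> \<le> 2 * (real k + 1)\<^sup>2 * (\<tau> N)\<^sup>2"
proof -
  let ?S = "{fst e, fst e'}"
  have D: "D \<subseteq> E" "\<omega>0 \<in> \<Omega>" "finite C" "z \<in> C" "fst ` D \<subseteq> C" "card C + card D + k + 3 \<le> N" "N \<le> n"
    and arcs: "\<And>d. d \<in> D \<Longrightarrow> fst (\<omega>0 d) \<in> C"
    using ex by (auto simp: explored_def)
  have cS: "card ?S \<le> 2" by (simp add: card_insert_if)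
  have so: "\<EE> D (\<lambda>\<omega>. hit ?S z E \<omega> k False (fst (\<omega> d))) \<omega>0 \<le> (real (k + 1))\<^sup>2 * (\<tau> N)\<^sup>2"
    if "d \<in> E" "fst d \<notin> C" for d
  proof (rule hit_second_order[where C = C and lv = "\<lambda>u. if u \<in> C then 0 else Suc k" and K = "Suc k"])
    show "d \<in> E - D" using that D by auto
  qed (use D arcs e that cS in auto)
  have eD: "e \<in> E - D" "e' \<in> E - D" using e D by auto
  have fl: "\<EE> D (\<lambda>\<omega>. hit ?S z E \<omega> k True (fst (\<omega> d))) \<omega>0 = J D \<omega>0 z k d" for d
    unfolding J_def by (intro cexp_cong hit_flag)
  from tail_exchange[OF D(1,2) eD refl, of z k] show ?thesis
    unfolding fl using so[OF e(1,2)] so[OF e(3,4)] by (simp add: add.commute)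
qed

lemma J_fresh: "explored D \<omega>0 C z k N \<Longrightarrow> e \<in> E - D \<Longrightarrow> J D \<omega>0 z k e \<le> (real k + 1) * \<tau> N"
  unfolding J_def using hit_fresh_tail[of D \<omega>0 e k N "{}" z True]
  by (auto simp: explored_def add.commute)

lemma J_explored:
  assumes ex: "explored D \<omega>0 C z k N" and e: "e \<in> D"
  shows "J D \<omega>0 z k e \<le> hit {} z D \<omega>0 k True (fst (\<omega>0 e)) + (real k + 1) * \<tau> N"
proof -
  have D: "D \<subseteq> E" "\<omega>0 \<in> \<Omega>" "card C + card D + k + 3 \<le> N" "N \<le> n"
    using ex by (auto simp: explored_def)
  have "J D \<omega>0 z k e = \<EE> D (\<lambda>\<omega>. pr \<omega> k (fst (\<omega>0 e)) z) \<omega>0"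
    unfolding J_def by (intro cexp_cong) (simp add: agr_eq[OF _ e])
  also have "\<dots> \<le> hit {} z D \<omega>0 k True (fst (\<omega>0 e)) + k * \<tau> N"
    by (rule hit_first_order) (use D head_lt[OF D(2) subsetD[OF D(1) e]] in auto)
  finally show ?thesis using tau_nonneg[of N] by (simp add: algebra_simps)
qed

lemma card_tails_le:
  assumes "finite C" shows "card {e \<in> E. fst e \<in> C} \<le> \<Delta> * card C"
proof -
  have "{e \<in> E. fst e \<in> C} \<subseteq> Sigma (C \<inter> {..<n}) (\<lambda>i. {..<dout i})" by (auto simp: E_def)
  hence "card {e \<in> E. fst e \<in> C} \<le> card (Sigma (C \<inter> {..<n}) (\<lambda>i. {..<dout i}))"
    using assms by (intro card_mono) auto
  also have "\<dots> = (\<Sum>i\<in>C \<inter> {..<n}. dout i)" using assms by simp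
  also have "\<dots> \<le> (\<Sum>i\<in>C \<inter> {..<n}. \<Delta>)" using degrees by (intro sum_mono) auto
  also have "\<dots> \<le> \<Delta> * card C" using assms by (simp add: card_mono)
  finally show ?thesis .
qed

text \<open>All tails off \<open>C\<close> have nearly the same \<open>J\<close>, and the tails at \<open>C\<close> carry little mass.\<close>
lemma weighted_J_close:
  fixes w :: "nat \<times> nat \<Rightarrow> real"
  assumes ex: "explored D \<omega>0 C z k N" and e': "e' \<in> E" "fst e' \<notin> C"
    and w: "\<And>e. e \<in> E \<Longrightarrow> 0 \<le> w e \<and> w e \<le> \<Delta>" "(\<Sum>e\<in>E. w e) = real m"
  shows "\<bar>(\<Sum>e\<in>E. w e * J D \<omega>0 z k e) / m - J D \<omega>0 z k e'\<bar> \<le> \<eta> D \<omega>0 z k N"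
proof -
  let ?J = "J D \<omega>0 z k" and ?t = "\<tau> N" and ?h = "\<lambda>e. hit {} z D \<omega>0 k True (fst (\<omega>0 e))"
  have D: "D \<subseteq> E" "\<omega>0 \<in> \<Omega>" "finite C" "z \<in> C" "fst ` D \<subseteq> C" "card C + card D + k + 3 \<le> N" "N \<le> n"
    using ex by (auto simp: explored_def)
  have finD: "finite D" using D(1) finite_E finite_subset by blast
  let ?A = "2 * (real k + 1)\<^sup>2 * ?t\<^sup>2" and ?B = "(real k + 1) * ?t"
  have t0: "0 \<le> ?t" by (rule tau_nonneg)
  have e'D: "e' \<in> E - D" using e' D by auto
  \<comment> \<open>Off \<open>C\<close> the difference is of second order. A tail at
    \<open>C\<close> may add a first-order term \<open>?B\<close> and, if it is explored, its
    explored mass \<open>?h\<close>.\<close>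
  have close: "\<bar>?J e - ?J e'\<bar> \<le> ?A + (if e \<in> D then ?h e else 0) + (if fst e \<in> C then ?B else 0)"
    if e: "e \<in> E" for e
  proof (cases "fst e \<in> C")
    case False
    thus ?thesis using J_off[OF ex e False e'] D hit_nonneg[of "{}" z D \<omega>0 k True "fst (\<omega>0 e)"]
      by auto
  next
    case True
    have "0 \<le> ?A" by simp
    moreover have "?J e \<le> (if e \<in> D then ?h e else 0) + ?B"
      using J_explored[OF ex, of e] J_fresh[OF ex, of e] e by auto
    moreover have "?J e' \<le> ?B" using J_fresh[OF ex e'D] .
    moreover have "0 \<le> (if e \<in> D then ?h e else 0)" by (simp add: hit_nonneg)
    ultimately have "\<bar>?J e - ?J e'\<bar> \<le> ?A + (if e \<in> D then ?h e else 0) + ?B"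
      using J_nonneg[OF D(2), of D z k e] J_nonneg[OF D(2), of D z k e'] by linarith
    thus ?thesis using True by simp
  qed
  have eq: "(\<Sum>e\<in>E. w e * ?J e) / m - ?J e' = (\<Sum>e\<in>E. w e * (?J e - ?J e')) / m"
    using w(2) m_pos by (simp add: right_diff_distrib sum_subtractf diff_divide_distrib flip: sum_distrib_right)
  have "\<bar>(\<Sum>e\<in>E. w e * ?J e) / m - ?J e'\<bar> \<le> (\<Sum>e\<in>E. w e * \<bar>?J e - ?J e'\<bar>) / m"
    unfolding eq using w(1) by (auto simp: abs_mult intro!: divide_right_mono order_trans[OF sum_abs] sum_mono)
  also have "\<dots> \<le> (\<Sum>e\<in>E. w e * ?A + \<Delta> * (if e \<in> D then ?h e else 0) + \<Delta> * (if fst e \<in> C then ?B else 0)) / m"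
  proof (intro divide_right_mono sum_mono)
    fix e assume e: "e \<in> E"
    have "w e * \<bar>?J e - ?J e'\<bar> \<le> w e * (?A + (if e \<in> D then ?h e else 0) + (if fst e \<in> C then ?B else 0))"
      by (rule mult_left_mono[OF close[OF e]]) (use w(1)[OF e] in simp)
    also have "\<dots> = w e * ?A + w e * (if e \<in> D then ?h e else 0) + w e * (if fst e \<in> C then ?B else 0)"
      by (simp only: distrib_left)
    also have "\<dots> \<le> w e * ?A + \<Delta> * (if e \<in> D then ?h e else 0) + \<Delta> * (if fst e \<in> C then ?B else 0)"
    proof -
      have "w e \<le> \<Delta>" using w(1)[OF e] by simp
      moreover have "0 \<le> (if e \<in> D then ?h e else 0)" by (simp add: hit_nonneg)
      moreover have "0 \<le> (if fst e \<in> C then ?B else 0)" using t0 by simp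
      ultimately show ?thesis by (intro add_mono[OF add_mono[OF order_refl]] mult_right_mono)
    qed
    finally show "w e * \<bar>?J e - ?J e'\<bar> \<le> w e * ?A + \<Delta> * (if e \<in> D then ?h e else 0) + \<Delta> * (if fst e \<in> C then ?B else 0)" .
  qed simp
  also have "\<dots> = ?A + \<Delta> * W D \<omega>0 z k / m + \<Delta> * (card {e\<in>E. fst e \<in> C} / m * ?B)"
  proof -
    have "(\<Sum>e\<in>E. w e * ?A) = m * ?A" by (simp add: w(2) flip: sum_distrib_right)
    moreover have "(\<Sum>e\<in>E. \<Delta> * (if e \<in> D then ?h e else 0)) = \<Delta> * W D \<omega>0 z k"
      using D(1) finite_E by (simp add: W_def sum.If_cases Int_absorb1 flip: sum_distrib_left)
    moreover have "(\<Sum>e\<in>E. \<Delta> * (if fst e \<in> C then ?B else 0)) = \<Delta> * (card {e\<in>E. fst e \<in> C} * ?B)"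
      using finite_E by (simp add: sum.If_cases Int_def flip: sum_distrib_left)
    ultimately show ?thesis using m_pos by (simp add: sum.distrib add_divide_distrib)
  qed
  \<comment> \<open>The tails at \<open>C\<close> form a fraction of at most \<open>\<tau> N\<close>
    of all tails, so their first-order term \<open>?B\<close> becomes one of second order.\<close>
  also have "\<dots> \<le> ?A + \<Delta> * W D \<omega>0 z k / m + \<Delta> * (?t * ?B)"
  proof (intro add_left_mono mult_left_mono mult_right_mono)
    have "card {e\<in>E. fst e \<in> C} / m \<le> real (\<Delta> * card C) / n"
      using card_tails_le[OF D(3)] m_ge n_pos by (intro frac_le of_nat_mono) auto
    thus "card {e\<in>E. fst e \<in> C} / m \<le> ?t" using tau_ge[of "card C" N] D(6) by simp
  qed (use t0 in auto)
  also have "\<dots> \<le> \<eta> D \<omega>0 z k N"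
  proof -
    have "2 * ((real k + 1)\<^sup>2 * ?t\<^sup>2) \<le> \<Delta> * ((real k + 1)\<^sup>2 * ?t\<^sup>2)"
      by (rule mult_right_mono) (use Delta_ge in auto)
    hence "?A \<le> \<Delta> * ((real k + 1)\<^sup>2 * ?t\<^sup>2)" by (simp only: mult.assoc)
    moreover have "?t * ?B \<le> (real k + 1)\<^sup>2 * ?t\<^sup>2"
    proof -
      have "(real k + 1) * 1 \<le> (real k + 1) * (real k + 1)" by (intro mult_left_mono) auto
      from mult_right_mono[OF this, of "?t\<^sup>2"] show ?thesis by (simp add: power2_eq_square algebra_simps)
    qed
    hence "\<Delta> * (?t * ?B) \<le> \<Delta> * ((real k + 1)\<^sup>2 * ?t\<^sup>2)" by (rule mult_left_mono) simp
    moreover have "\<eta> D \<omega>0 z k N = \<Delta> * W D \<omega>0 z k / m + \<Delta> * ((real k + 1)\<^sup>2 * ?t\<^sup>2) + \<Delta> * ((real k + 1)\<^sup>2 * ?t\<^sup>2)"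
      by (simp add: \<eta>_def algebra_simps)
    ultimately show ?thesis by linarith
  qed
  finally show ?thesis .
qed

lemma U_tails: "\<omega>0 \<in> \<Omega> \<Longrightarrow> U D \<omega>0 z k = (\<Sum>e\<in>E. 1 * J D \<omega>0 z k e) / m"
  unfolding U_def J_def cexp_cmult[symmetric] cexp_sum[symmetric] cexp_divide[symmetric]
  by (intro cexp_cong inlaw_tails agr_bijs)

lemma U_Suc: "U D \<omega>0 z (Suc k) = (\<Sum>e\<in>E. real (din (fst e)) / dout (fst e) * J D \<omega>0 z k e) / m"
  unfolding U_def J_def cexp_cmult[symmetric] cexp_sum[symmetric] cexp_divide[symmetric] inlaw_Suc ..

lemma U_J_close:
  assumes ex: "explored D \<omega>0 C z k N" and e': "e' \<in> E" "fst e' \<notin> C"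
  shows "\<bar>U D \<omega>0 z k - J D \<omega>0 z k e'\<bar> \<le> \<eta> D \<omega>0 z k N"
    and "\<bar>U D \<omega>0 z (Suc k) - J D \<omega>0 z k e'\<bar> \<le> \<eta> D \<omega>0 z k N"
proof -
  have w: "\<omega>0 \<in> \<Omega>" using ex by (simp add: explored_def)
  show "\<bar>U D \<omega>0 z k - J D \<omega>0 z k e'\<bar> \<le> \<eta> D \<omega>0 z k N"
    unfolding U_tails[OF w] using Delta_ge card_E
    by (intro weighted_J_close[OF ex e', where w = "\<lambda>_. 1"]) auto
  show "\<bar>U D \<omega>0 z (Suc k) - J D \<omega>0 z k e'\<bar> \<le> \<eta> D \<omega>0 z k N"
    unfolding U_Suc by (rule weighted_J_close[OF ex e']) (use weights_mass weights_le in auto)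
qed

lemma off_tail:
  assumes ex: "explored D \<omega>0 C z k N"
  obtains e' where "e' \<in> E" "fst e' \<notin> C"
proof -
  have "card C < n" "finite C" using ex by (auto simp: explored_def)
  hence "\<not> {..<n} \<subseteq> C" by (metis card_lessThan card_mono linorder_not_less)
  then obtain v where "v < n" "v \<notin> C" by auto
  hence "(v, 0) \<in> E" using degrees[of v] by (auto simp: mem_E)
  thus ?thesis using that \<open>v \<notin> C\<close> by fastforce
qed

text \<open>Both means are compared with the same number, the value of \<open>J\<close> at some tail
  off \<open>C\<close>.\<close>

lemma U_step:
  assumes ex: "explored D \<omega>0 C z k N"
  shows "\<bar>U D \<omega>0 z (Suc k) - U D \<omega>0 z k\<bar> \<le> 2 * \<eta> D \<omega>0 z k N"
proof -
  obtain e' where "e' \<in> E" "fst e' \<notin> C" using off_tail[OF ex] .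
  from U_J_close[OF ex this] show ?thesis by linarith
qed

lemma U_shift:
  assumes ex: "explored D \<omega>0 C z s N" and "h \<le> s"
  shows "\<bar>U D \<omega>0 z s - U D \<omega>0 z h\<bar> \<le> (\<Sum>k=h..<s. 2 * \<eta> D \<omega>0 z k N)"
  using assms(2,1)
proof (induction s rule: dec_induct)
  case (step s)
  have ex: "explored D \<omega>0 C z s N" using explored_mono[OF step.prems] by simp
  have "(\<Sum>k=h..<Suc s. 2 * \<eta> D \<omega>0 z k N) = (\<Sum>k=h..<s. 2 * \<eta> D \<omega>0 z k N) + 2 * \<eta> D \<omega>0 z s N"
    using step.hyps by simp
  thus ?case using step.IH[OF ex] U_step[OF ex] by linarith
qed simp

text \<open>Explored tails are bounded trivially by 1 and form a fraction of at most
  \<open>\<tau> N\<close>; every other tail contributes at first order.\<close>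

lemma U_le:
  assumes ex: "explored D \<omega>0 C z k N"
  shows "U D \<omega>0 z k \<le> (real k + 2) * \<tau> N"
proof -
  have D: "D \<subseteq> E" "\<omega>0 \<in> \<Omega>" "card C + card D + k + 3 \<le> N" "N \<le> n"
    using ex by (auto simp: explored_def)
  have t0: "0 \<le> \<tau> N" by (rule tau_nonneg)
  have "(\<Sum>e\<in>E. 1 * J D \<omega>0 z k e) \<le> (\<Sum>e\<in>E. (if e \<in> D then 1 else 0) + (real k + 1) * \<tau> N)"
  proof (intro sum_mono)
    fix e assume "e \<in> E"
    moreover have "0 \<le> (real k + 1) * \<tau> N" using t0 by simp
    ultimately show "1 * J D \<omega>0 z k e \<le> (if e \<in> D then 1 else 0) + (real k + 1) * \<tau> N"
      using J_le_1[OF D(2), of D z k e] J_fresh[OF ex, of e] by auto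
  qed
  also have "\<dots> = real (card D) + m * ((real k + 1) * \<tau> N)"
    using D(1) finite_E card_E by (simp add: sum.distrib sum.If_cases Int_absorb1)
  finally have "U D \<omega>0 z k \<le> (real (card D) + m * ((real k + 1) * \<tau> N)) / m"
    unfolding U_tails[OF D(2)] by (rule divide_right_mono) simp
  also have "\<dots> = real (card D) / m + (real k + 1) * \<tau> N" using m_pos by (simp add: add_divide_distrib)
  also have "real (card D) / m \<le> \<tau> N"
  proof -
    have "real (card D) / m \<le> real \<Delta> * card D / n"
      using m_ge n_pos Delta_ge by (intro frac_le) (auto simp: mult_le_cancel_right1)
    thus ?thesis using tau_ge[of "card D" N] D by simp
  qed
  finally show ?thesis by (simp add: algebra_simps)
qed

lemma U_nonneg: "\<omega>0 \<in> \<Omega> \<Longrightarrow> 0 \<le> U D \<omega>0 z k"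
  unfolding U_def by (rule cexp_nonneg) (auto simp: inlaw_nonneg)

text \<open>Paths are lists of tails; \<open>xav\<close> is the quenched expectation over the path of the walk and
  its endpoint.\<close>
primrec xav :: "(nat \<times> nat \<Rightarrow> nat \<times> nat) \<Rightarrow> nat \<Rightarrow> nat \<Rightarrow> ((nat \<times> nat) list \<Rightarrow> nat \<Rightarrow> real) \<Rightarrow> real" where
  "xav \<omega> 0 v \<phi> = \<phi> [] v"
| "xav \<omega> (Suc k) v \<phi> = (\<Sum>l<dout v. xav \<omega> k (fst (\<omega> (v, l))) (\<lambda>p z. \<phi> ((v, l) # p) z)) / dout v"

primrec path :: "(nat \<times> nat \<Rightarrow> nat \<times> nat) \<Rightarrow> nat \<Rightarrow> (nat \<times> nat) list \<Rightarrow> nat \<Rightarrow> bool" where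
  "path \<omega> v [] z \<longleftrightarrow> v = z"
| "path \<omega> v (e # p) z \<longleftrightarrow> e \<in> E \<and> fst e = v \<and> path \<omega> (fst (\<omega> e)) p z"

definition saw :: "(nat \<times> nat) list \<Rightarrow> nat \<Rightarrow> bool" where
  "saw p z \<longleftrightarrow> distinct (map fst p @ [z])"

lemma xav_mono:
  assumes "\<omega> \<in> \<Omega>" "v < n" "\<And>p z. length p = k \<Longrightarrow> path \<omega> v p z \<Longrightarrow> \<phi> p z \<le> \<psi> p z"
  shows "xav \<omega> k v \<phi> \<le> xav \<omega> k v \<psi>"
  using assms(2,3)
proof (induction k arbitrary: v \<phi> \<psi>)
  case (Suc k)
  show ?case unfolding xav.simps
  proof (intro divide_right_mono sum_mono Suc.IH)
    fix l assume "l \<in> {..<dout v}"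
    hence e: "(v, l) \<in> E" using Suc.prems by (simp add: mem_E)
    show "fst (\<omega> (v, l)) < n" using head_lt[OF assms(1) e] .
    fix p z assume "length p = k" "path \<omega> (fst (\<omega> (v, l))) p z"
    thus "\<phi> ((v, l) # p) z \<le> \<psi> ((v, l) # p) z" using e by (intro Suc.prems) auto
  qed auto
qed auto

lemma xav_const: "\<omega> \<in> \<Omega> \<Longrightarrow> v < n \<Longrightarrow> xav \<omega> k v (\<lambda>_ _. c) = c"
proof (induction k arbitrary: v)
  case (Suc k)
  have "xav \<omega> k (fst (\<omega> (v, l))) (\<lambda>_ _. c) = c" if "l < dout v" for l
    using Suc that head_lt[of \<omega> "(v, l)"] by (simp add: mem_E)
  thus ?case using degrees[OF Suc.prems(2)] by simp
qed auto

lemma xav_add: "xav \<omega> k v (\<lambda>p z. \<phi> p z + \<psi> p z) = xav \<omega> k v \<phi> + xav \<omega> k v \<psi>"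
  by (induction k arbitrary: v \<phi> \<psi>) (auto simp: sum.distrib add_divide_distrib)

lemma xav_diff: "xav \<omega> k v (\<lambda>p z. \<phi> p z - \<psi> p z) = xav \<omega> k v \<phi> - xav \<omega> k v \<psi>"
  by (induction k arbitrary: v \<phi> \<psi>) (auto simp: sum_subtractf diff_divide_distrib)

lemma xav_cmult: "xav \<omega> k v (\<lambda>p z. c * \<phi> p z) = c * xav \<omega> k v \<phi>"
  by (induction k arbitrary: v \<phi>) (auto simp: sum_distrib_left)

lemma xav_sum: "xav \<omega> k v (\<lambda>p z. \<Sum>i\<in>I. \<phi> i p z) = (\<Sum>i\<in>I. xav \<omega> k v (\<phi> i))"
proof (induction k arbitrary: v \<phi>)
  case (Suc k)
  show ?case unfolding xav.simps Suc.IH by (subst sum.swap) (simp add: sum_divide_distrib)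
qed auto

lemma xav_le_const:
  "\<omega> \<in> \<Omega> \<Longrightarrow> v < n \<Longrightarrow> (\<And>p z. length p = k \<Longrightarrow> path \<omega> v p z \<Longrightarrow> \<phi> p z \<le> c) \<Longrightarrow> xav \<omega> k v \<phi> \<le> c"
  using xav_mono[of \<omega> v k \<phi> "\<lambda>_ _. c"] by (simp add: xav_const)

lemma pr_xav: "pr \<omega> k x z = xav \<omega> k x (\<lambda>p y. of_bool (y = z))" if "\<omega> \<in> \<Omega>" "x < n"
  using that
proof (induction k arbitrary: x)
  case (Suc k)
  have "pr \<omega> k (fst (\<omega> (x, l))) z = xav \<omega> k (fst (\<omega> (x, l))) (\<lambda>p y. of_bool (y = z))" if "l < dout x" for l
    using Suc that head_lt[of \<omega> "(x, l)"] by (simp add: mem_E)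
  thus ?case unfolding hit_Suc_E[OF Suc.prems(2)] xav.simps by simp
qed (auto simp: of_bool_def)

lemma xav_endpoint:
  assumes "\<omega> \<in> \<Omega>" "x < n"
  shows "(\<Sum>z<n. pr \<omega> k x z * g z) = xav \<omega> k x (\<lambda>p z. g z)"
  using assms(2)
proof (induction k arbitrary: x)
  case 0
  thus ?case by (auto simp: of_bool_def if_distrib[of "\<lambda>x. x * _"] cong: if_cong)
next
  case (Suc k)
  have IH: "(\<Sum>z<n. pr \<omega> k (fst (\<omega> (x, l))) z * g z) = xav \<omega> k (fst (\<omega> (x, l))) (\<lambda>p z. g z)"
    if "l < dout x" for l using Suc that head_lt[OF assms(1), of "(x, l)"] by (simp add: mem_E)
  have "(\<Sum>z<n. pr \<omega> (Suc k) x z * g z)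
     = (\<Sum>z<n. \<Sum>l<dout x. pr \<omega> k (fst (\<omega> (x, l))) z * g z) / dout x"
    unfolding hit_Suc_E[OF Suc.prems] by (simp add: sum_distrib_right sum_divide_distrib)
  also have "\<dots> = (\<Sum>l<dout x. \<Sum>z<n. pr \<omega> k (fst (\<omega> (x, l))) z * g z) / dout x"
    by (subst sum.swap) simp
  finally show ?case using IH by simp
qed

text \<open>Whether the walk follows \<open>p\<close> is decided by the values of
  \<open>\<omega>\<close> on \<open>set p\<close>, so \<open>\<phi>\<close> may first be averaged
  given \<open>D \<union> set p\<close>. This turns means over environment and walk into conditional
  means given the path.\<close>

lemma cexp_xav:
  "\<EE> D (\<lambda>\<omega>. xav \<omega> k v (\<phi> \<omega>)) \<omega>0
    = \<EE> D (\<lambda>\<omega>. xav \<omega> k v (\<lambda>p z. \<EE> (D \<union> set p) (\<lambda>\<omega>'. \<phi> \<omega>' p z) \<omega>)) \<omega>0"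
proof (induction k arbitrary: D v \<phi> \<omega>0)
  case 0
  show ?case by (simp add: cexp_tower)
next
  case (Suc k)
  have "\<EE> D (\<lambda>\<omega>. xav \<omega> k (fst (\<omega> e)) (\<lambda>p. \<phi> \<omega> (e # p))) \<omega>0
     = \<EE> D (\<lambda>\<omega>. xav \<omega> k (fst (\<omega> e)) (\<lambda>p z. \<EE> (D \<union> set (e # p)) (\<lambda>\<omega>'. \<phi> \<omega>' (e # p) z) \<omega>)) \<omega>0" for e
  proof -
    have "\<EE> D (\<lambda>\<omega>. xav \<omega> k (fst (\<omega> e)) (\<lambda>p. \<phi> \<omega> (e # p))) \<omega>0
      = \<EE> D (\<lambda>\<omega>1. \<EE> (insert e D) (\<lambda>\<omega>. xav \<omega> k (fst (\<omega>1 e)) (\<lambda>p. \<phi> \<omega> (e # p))) \<omega>1) \<omega>0"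
      by (rule cexp_reveal[of D "\<lambda>\<omega> h. xav \<omega> k (fst h) (\<lambda>p. \<phi> \<omega> (e # p))"])
    also have "\<dots> = \<EE> D (\<lambda>\<omega>1. \<EE> (insert e D) (\<lambda>\<omega>. xav \<omega> k (fst (\<omega>1 e))
        (\<lambda>p z. \<EE> (insert e D \<union> set p) (\<lambda>\<omega>'. \<phi> \<omega>' (e # p) z) \<omega>)) \<omega>1) \<omega>0"
      by (intro cexp_cong Suc.IH)
    also have "\<dots> = \<EE> D (\<lambda>\<omega>. xav \<omega> k (fst (\<omega> e))
        (\<lambda>p z. \<EE> (insert e D \<union> set p) (\<lambda>\<omega>'. \<phi> \<omega>' (e # p) z) \<omega>)) \<omega>0"
      by (rule cexp_reveal[of D "\<lambda>\<omega> h. xav \<omega> k (fst h)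
        (\<lambda>p z. \<EE> (insert e D \<union> set p) (\<lambda>\<omega>'. \<phi> \<omega>' (e # p) z) \<omega>)", symmetric])
    finally show ?thesis by simp
  qed
  thus ?case by (simp add: cexp_divide cexp_sum)
qed

text \<open>The set \<open>A\<close> of forbidden vertices grows by the current vertex at each step.
  All explored tails start in \<open>A\<close>, so the tail used next is always fresh and hits the
  enlarged set with probability at most \<open>\<tau> N\<close>.\<close>

lemma non_saw_prob:
  assumes "D \<subseteq> E" "\<omega>0 \<in> \<Omega>" "v < n" "finite A" "fst ` D \<subseteq> A" "v \<notin> A"
    and "card D + k \<le> N" "card A + k \<le> N" "N \<le> n"
  shows "\<EE> D (\<lambda>\<omega>. xav \<omega> k v (\<lambda>p z. of_bool (\<not> (saw p z \<and> set (map fst p @ [z]) \<inter> A = {})))) \<omega>0 \<le> k * \<tau> N"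
  using assms(1-8)
proof (induction k arbitrary: D v A \<omega>0)
  case 0
  thus ?case by (simp add: saw_def cexp_const)
next
  case (Suc k)
  note D = Suc.prems(1) and w = Suc.prems(2) and v = Suc.prems(3)
  have finD: "finite D" using D finite_E finite_subset by blast
  let ?A = "insert v A"
  have eq: "(\<not> (saw ((v, l) # p) z \<and> set (map fst ((v, l) # p) @ [z]) \<inter> A = {}))
      \<longleftrightarrow> \<not> (saw p z \<and> set (map fst p @ [z]) \<inter> ?A = {})" for l p z
    using Suc.prems(6) by (auto simp: saw_def)
  have tail: "\<EE> D (\<lambda>\<omega>. xav \<omega> k (fst (\<omega> (v, l))) (\<lambda>p z. of_bool (\<not> (saw p z \<and> set (map fst p @ [z]) \<inter> ?A = {})))) \<omega>0
       \<le> Suc k * \<tau> N" if l: "l < dout v" for l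
  proof -
    let ?e = "(v, l)" and ?g = "\<lambda>p z. of_bool (\<not> (saw p z \<and> set (map fst p @ [z]) \<inter> ?A = {})) :: real"
    have e: "?e \<in> E - D" using l v Suc.prems(5,6) by (force simp: mem_E)
    have cX: "card ?A \<le> N + 2" using Suc.prems(4,6,8) by simp
    have "\<EE> D (\<lambda>\<omega>. xav \<omega> k (fst (\<omega> ?e)) ?g) \<omega>0 \<le> k * \<tau> N + \<tau> N * 1"
    proof (rule reveal_bound[where X = ?A])
      fix \<omega>1 assume \<omega>1: "\<omega>1 \<in> agr D \<omega>0"
      note w1 = agr_bijs[OF \<omega>1]
      have u: "fst (\<omega>1 ?e) < n" using head_lt[OF w1] e by auto
      have "\<EE> (insert ?e D) (\<lambda>\<omega>. xav \<omega> k (fst (\<omega>1 ?e)) ?g) \<omega>1 \<le> 1"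
        using w1 u by (intro cexp_le_const xav_le_const) (auto dest: agr_bijs)
      moreover have "0 \<le> k * \<tau> N" using tau_nonneg by simp
      ultimately show "\<EE> (insert ?e D) (\<lambda>\<omega>. xav \<omega> k (fst (\<omega>1 ?e)) ?g) \<omega>1 \<le> k * \<tau> N + 1" by linarith
      show "\<EE> (insert ?e D) (\<lambda>\<omega>. xav \<omega> k (fst (\<omega>1 ?e)) ?g) \<omega>1 \<le> k * \<tau> N" if "fst (\<omega>1 ?e) \<notin> ?A"
        by (rule Suc.IH) (use Suc.prems D e u w1 that finD in \<open>auto simp: card_insert_if\<close>)
    qed (use e D w finD tau_ge[OF cX] Suc.prems assms(9) in auto)
    thus ?thesis by (simp add: algebra_simps)
  qed
  have "\<EE> D (\<lambda>\<omega>. xav \<omega> (Suc k) v (\<lambda>p z. of_bool (\<not> (saw p z \<and> set (map fst p @ [z]) \<inter> A = {})))) \<omega>0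
    = (\<Sum>l<dout v. \<EE> D (\<lambda>\<omega>. xav \<omega> k (fst (\<omega> (v, l))) (\<lambda>p z. of_bool (\<not> (saw p z \<and> set (map fst p @ [z]) \<inter> ?A = {})))) \<omega>0) / dout v"
    unfolding xav.simps eq cexp_divide cexp_sum ..
  also have "\<dots> \<le> Suc k * \<tau> N" using tail tau_nonneg by (intro sum_div_le) auto
  finally show ?case .
qed

lemma path_props:
  "path \<omega> v p z \<Longrightarrow> v \<in> set (map fst p @ [z]) \<and> set p \<subseteq> E \<and> (\<forall>d\<in>set p. fst (\<omega> d) \<in> set (map fst p @ [z]))"
  by (induction p arbitrary: v) auto

text \<open>The budget \<open>3 * s + 5\<close> pays for \<open>s + 1\<close> vertices,
  \<open>s\<close> tails, \<open>s\<close> further steps and the additive constant in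
  \<open>explored\<close>.\<close>

lemma path_explored:
  assumes "path \<omega> x p z" "length p \<le> s" "\<omega> \<in> \<Omega>" "3 * s + 5 \<le> n"
  shows "explored (set p) \<omega> (set (map fst p @ [z])) z s (3 * s + 5)"
proof -
  have "card (set (map fst p @ [z])) \<le> length (map fst p @ [z])" by (rule card_length)
  moreover have "card (set p) \<le> length p" by (rule card_length)
  ultimately show ?thesis using path_props[OF assms(1)] assms(2-4) by (auto simp: explored_def)
qed

text \<open>Each vertex of the path other than \<open>z\<close> carries exactly one explored tail
  and has out-degree at least 2, so every explored step costs a factor 1/2. On explored arcs the
  walk cannot deviate, hence it is at \<open>z\<close> only after exactly \<open>length p\<close>
  steps.\<close>

lemma saw_hit:
  assumes P: "distinct (map fst P)" "z \<notin> fst ` set P"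
  shows "path \<omega> v p z \<Longrightarrow> set p \<subseteq> set P \<Longrightarrow> hit {} z (set P) \<omega> k True v \<le> of_bool (length p = k) * (1 / 2) ^ k"
proof (induction p arbitrary: v k)
  case Nil
  have "hit {} z (set P) \<omega> k True v = of_bool (k = 0)"
  proof (cases k)
    case (Suc k')
    have "(v, l) \<notin> set P" for l using P(2) Nil by force
    thus ?thesis using Suc by simp
  qed (use Nil in auto)
  thus ?case by simp
next
  case (Cons e p)
  obtain l0 where e: "e = (v, l0)" and eE: "e \<in> E" and p: "path \<omega> (fst (\<omega> e)) p z"
    using Cons.prems by (cases e) auto
  have v: "v < n" "l0 < dout v" "2 \<le> dout v" using eE e degrees[of v] by (auto simp: mem_E)
  have vz: "v \<noteq> z" using P(2) Cons.prems e by force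
  have uniq: "(v, l) \<in> set P \<longleftrightarrow> l = l0" for l
  proof
    assume "(v, l) \<in> set P"
    moreover have "(v, l0) \<in> set P" using Cons.prems e by simp
    moreover have "inj_on fst (set P)" using P(1) by (simp add: distinct_map)
    ultimately show "l = l0" by (metis fst_conv inj_onD prod.inject)
  qed (use Cons.prems e in simp)
  show ?case
  proof (cases k)
    case (Suc k')
    have "hit {} z (set P) \<omega> k True v = hit {} z (set P) \<omega> k' True (fst (\<omega> e)) / dout v"
      using v(2) by (simp add: Suc uniq e)
    also have "\<dots> \<le> hit {} z (set P) \<omega> k' True (fst (\<omega> e)) / 2"
      using v(3) by (intro divide_left_mono) (auto simp: hit_nonneg)
    also have "\<dots> \<le> (of_bool (length p = k') * (1 / 2) ^ k') / 2"
      using Cons.IH[OF p, of k'] Cons.prems by (intro divide_right_mono) auto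
    finally show ?thesis by (simp add: Suc)
  qed (use vz in auto)
qed

text \<open>Only one suffix of the path has length exactly \<open>k\<close>, so at most one explored
  arc contributes.\<close>

lemma saw_W:
  assumes P: "path \<omega> x P z" "saw P z"
  shows "W (set P) \<omega> z k \<le> (1 / 2) ^ k"
proof -
  have d: "distinct (map fst P)" "z \<notin> fst ` set P" using P(2) by (auto simp: saw_def)
  have "(\<Sum>e\<in>set p. hit {} z (set P) \<omega> k True (fst (\<omega> e))) \<le> of_bool (k < length p) * (1 / 2) ^ k"
    if "path \<omega> v p z" "set p \<subseteq> set P" "distinct p" for v p
    using that
  proof (induction p arbitrary: v)
    case (Cons e p)
    have "hit {} z (set P) \<omega> k True (fst (\<omega> e)) \<le> of_bool (length p = k) * (1 / 2) ^ k"
      using Cons.prems by (intro saw_hit[OF d]) auto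
    moreover have "(\<Sum>e\<in>set p. hit {} z (set P) \<omega> k True (fst (\<omega> e))) \<le> of_bool (k < length p) * (1 / 2) ^ k"
      using Cons.prems by (intro Cons.IH[of "fst (\<omega> e)"]) auto
    ultimately show ?case using Cons.prems(3) by (auto simp: of_bool_def split: if_splits)
  qed simp
  from this[OF P(1) subset_refl] d have "W (set P) \<omega> z k \<le> of_bool (k < length P) * (1 / 2) ^ k"
    by (simp add: W_def distinct_map)
  also have "\<dots> \<le> (1 / 2) ^ k" by simp
  finally show ?thesis .
qed

text \<open>The unit of second-order error, polylog(n) / n^2 for logarithmic \<open>s\<close>. Two
  powers of \<open>s + 1\<close> come from \<open>hit_second_order\<close>, the third from summing
  over up to \<open>s\<close> times as in \<open>saw_U_shift\<close>.\<close>

definition R where "R s = real \<Delta> * (real s + 1) ^ 3 * (\<tau> (3 * s + 5))\<^sup>2"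

lemma R_nonneg: "0 \<le> R s" by (simp add: R_def)

lemma sq_le_R:
  assumes "a \<le> (real s + 1) ^ 3" shows "real \<Delta> * (a * (\<tau> (3 * s + 5))\<^sup>2) \<le> R s"
  using mult_right_mono[OF assms, of "(\<tau> (3 * s + 5))\<^sup>2"] mult_left_mono[of _ _ "real \<Delta>"]
  by (simp add: R_def mult.assoc)

lemma sq_le_R2:
  assumes "a \<le> 2 * (real s + 1) ^ 3" shows "a * (\<tau> (3 * s + 5))\<^sup>2 \<le> R s"
proof -
  have "2 * (real s + 1) ^ 3 \<le> \<Delta> * (real s + 1) ^ 3"
    using Delta_ge by (intro mult_right_mono) auto
  hence "a \<le> \<Delta> * (real s + 1) ^ 3" using assms by linarith
  thus ?thesis unfolding R_def by (intro mult_right_mono) auto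
qed

lemma cube_ge: "(real s + 1)\<^sup>2 \<le> (real s + 1) ^ 3"
  by (rule power_increasing) auto

lemma saw_eta:
  assumes "path \<omega> x p z" "saw p z" "k \<le> s"
  shows "\<eta> (set p) \<omega> z k (3 * s + 5) \<le> \<Delta> * (1 / 2) ^ k / m + 2 * R s"
proof -
  have "(real k + 1)\<^sup>2 \<le> (real s + 1) ^ 3"
    using assms(3) by (intro order_trans[OF _ cube_ge] power_mono) auto
  hence "real \<Delta> * ((real k + 1)\<^sup>2 * (\<tau> (3 * s + 5))\<^sup>2) \<le> R s" by (rule sq_le_R)
  moreover have "\<Delta> * W (set p) \<omega> z k / m \<le> \<Delta> * (1 / 2) ^ k / m"
    using saw_W[OF assms(1,2)] by (intro divide_right_mono mult_left_mono) auto
  moreover have "\<eta> (set p) \<omega> z k (3 * s + 5) = \<Delta> * W (set p) \<omega> z k / m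
      + 2 * (real \<Delta> * ((real k + 1)\<^sup>2 * (\<tau> (3 * s + 5))\<^sup>2))"
    by (simp add: \<eta>_def algebra_simps)
  ultimately show ?thesis by linarith
qed

lemma geometric_half: "h \<le> s \<Longrightarrow> (\<Sum>k=h..<s. (1 / 2 :: real) ^ k) \<le> 2 * (1 / 2) ^ h"
proof -
  assume "h \<le> s"
  hence "(\<Sum>k=h..<s. (1 / 2 :: real) ^ k) = 2 * (1 / 2) ^ h - 2 * (1 / 2) ^ s"
  proof (induction s rule: dec_induct)
    case (step s)
    have "(\<Sum>k=h..<Suc s. (1 / 2 :: real) ^ k) = (\<Sum>k=h..<s. (1 / 2) ^ k) + (1 / 2) ^ s"
      using step.hyps by simp
    thus ?case using step.IH by simp
  qed simp
  thus ?thesis by simp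
qed

lemma saw_U_shift:
  assumes p: "path \<omega> x p z" "saw p z" "length p \<le> s" and w: "\<omega> \<in> \<Omega>" and n: "3 * s + 5 \<le> n" and h: "h \<le> s"
  shows "\<bar>U (set p) \<omega> z s - U (set p) \<omega> z h\<bar> \<le> 4 * \<Delta> * (1 / 2) ^ h / m + 4 * R s"
proof -
  let ?C = "real \<Delta> * (2 * (real s + 1)\<^sup>2 * (\<tau> (3 * s + 5))\<^sup>2)"
  have "\<eta> (set p) \<omega> z k (3 * s + 5) \<le> \<Delta> / m * (1 / 2) ^ k + ?C" if "k < s" for k
  proof -
    have "(real k + 1)\<^sup>2 \<le> (real s + 1)\<^sup>2" using that by (intro power_mono) auto
    hence "real \<Delta> * (2 * (real k + 1)\<^sup>2 * (\<tau> (3 * s + 5))\<^sup>2) \<le> ?C"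
      by (intro mult_left_mono mult_right_mono) auto
    moreover have "\<Delta> * W (set p) \<omega> z k / m \<le> \<Delta> * (1 / 2) ^ k / m"
      using saw_W[OF p(1,2)] by (intro divide_right_mono mult_left_mono) auto
    moreover have "\<eta> (set p) \<omega> z k (3 * s + 5) = \<Delta> * W (set p) \<omega> z k / m
        + real \<Delta> * (2 * (real k + 1)\<^sup>2 * (\<tau> (3 * s + 5))\<^sup>2)"
      by (simp add: \<eta>_def distrib_left)
    ultimately show ?thesis by simp
  qed
  hence "(\<Sum>k=h..<s. 2 * \<eta> (set p) \<omega> z k (3 * s + 5)) \<le> (\<Sum>k=h..<s. 2 * \<Delta> / m * (1 / 2) ^ k + 2 * ?C)"
    by (intro sum_mono) fastforce
  also have "\<dots> = 2 * \<Delta> / m * (\<Sum>k=h..<s. (1 / 2) ^ k) + real (s - h) * (2 * ?C)"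
    by (simp add: sum.distrib sum_distrib_left sum_divide_distrib)
  also have "\<dots> \<le> 2 * \<Delta> / m * (2 * (1 / 2) ^ h) + (real s + 1) * (2 * ?C)"
    using geometric_half[OF h] by (intro add_mono mult_left_mono mult_right_mono) auto
  also have "(real s + 1) * (2 * ?C) = 4 * R s"
    by (simp add: R_def power2_eq_square power3_eq_cube)
  finally show ?thesis
    using U_shift[OF path_explored[OF p(1,3) w n] h] by simp
qed

text \<open>Distance to the endpoint along a self-avoiding path.\<close>
lemma saw_levels:
  "path \<omega> x P z \<Longrightarrow> saw P z \<Longrightarrow> \<exists>L. L z = (0::nat) \<and> (\<forall>d\<in>set P. L (fst d) = L (fst (\<omega> d)) + 1) \<and>
     (\<forall>q e p. P = q @ e # p \<longrightarrow> L (fst e) = Suc (length p)) \<and> (\<forall>u. L u \<le> length P)"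
proof (induction P arbitrary: x)
  case Nil
  show ?case by (intro exI[of _ "\<lambda>_. 0"]) auto
next
  case (Cons e P)
  have pth: "path \<omega> (fst (\<omega> e)) P z" and s: "saw P z" and nin: "fst e \<notin> set (map fst P @ [z])"
    using Cons.prems by (auto simp: saw_def)
  obtain L where L0: "L z = (0::nat) \<and> (\<forall>d\<in>set P. L (fst d) = L (fst (\<omega> d)) + 1) \<and>
     (\<forall>q e p. P = q @ e # p \<longrightarrow> L (fst e) = Suc (length p)) \<and> (\<forall>u. L u \<le> length P)"
    using Cons.IH[OF pth s] by (rule exE)
  have L: "L z = 0" "\<forall>d\<in>set P. L (fst d) = L (fst (\<omega> d)) + 1"
      "\<And>q e p. P = q @ e # p \<Longrightarrow> L (fst e) = Suc (length p)" "\<And>u. L u \<le> length P"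
    using L0 by blast+
  let ?L = "L(fst e := Suc (length P))"
  note pp = path_props[OF pth]
  have start: "L (fst (\<omega> e)) = length P"
  proof (cases P)
    case Nil thus ?thesis using pth L(1) by simp
  next
    case (Cons e' P')
    thus ?thesis using pth L(3)[of "[]" e' P'] by simp
  qed
  have "?L z = 0" using nin L(1) by auto
  moreover have "?L (fst d) = ?L (fst (\<omega> d)) + 1" if "d \<in> set (e # P)" for d
  proof (cases "d = e")
    case True
    have "fst (\<omega> e) \<noteq> fst e" using pp nin by metis
    thus ?thesis using True start by simp
  next
    case False
    hence "d \<in> set P" using that by simp
    moreover have "fst d \<in> set (map fst P @ [z])" using \<open>d \<in> set P\<close> by simp
    hence "fst d \<noteq> fst e" using nin by metis
    moreover have "fst (\<omega> d) \<noteq> fst e" using pp nin \<open>d \<in> set P\<close> by metis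
    ultimately show ?thesis using L(2) by simp
  qed
  moreover have "?L (fst e') = Suc (length p)" if "e # P = q @ e' # p" for q e' p
  proof (cases q)
    case Nil thus ?thesis using that by simp
  next
    case (Cons a q')
    hence P: "P = q' @ e' # p" using that by simp
    hence "fst e' \<noteq> fst e" using nin by auto
    thus ?thesis using L(3)[OF P] by simp
  qed
  moreover have "?L u \<le> length (e # P)" for u using L(4)[of u] by simp
  ultimately show ?case by (intro exI[of _ ?L]) auto
qed

text \<open>A walker leaving the path behaves like one starting from a fresh tail: before it can use
  the explored tail of its own departure vertex it would have to come back, and then it is late.\<close>
lemma branch_J:
  assumes P: "path \<omega> x P z" "saw P z" and w: "\<omega> \<in> \<Omega>" and split: "P = q @ e # p"
    and len: "length P \<le> s" and n: "3 * s + 5 \<le> n"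
    and e1: "e1 \<in> E" "fst e1 = fst e" "e1 \<noteq> e" and e': "e' \<in> E" "fst e' \<notin> set (map fst P @ [z])"
  shows "J (set P) \<omega> z (length p) e1 \<le> J (set P) \<omega> z (length p) e' + R s"
proof -
  let ?V = "set (map fst P @ [z])" and ?k = "length p" and ?N = "3 * s + 5"
  obtain L where L0: "L z = (0::nat) \<and> (\<forall>d\<in>set P. L (fst d) = L (fst (\<omega> d)) + 1) \<and>
     (\<forall>q e p. P = q @ e # p \<longrightarrow> L (fst e) = Suc (length p)) \<and> (\<forall>u. L u \<le> length P)"
    using saw_levels[OF P] by (rule exE)
  have L: "L z = 0" "\<And>d. d\<in>set P \<Longrightarrow> L (fst d) = L (fst (\<omega> d)) + 1" "L (fst e) = Suc ?k"
    using L0 split by blast+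
  define C where "C = {u \<in> ?V. L u \<le> ?k}"
  define lv where "lv u = (if u \<in> C then L u else Suc ?k)" for u
  let ?S = "{fst e1, fst e'}"
  note pp = path_props[OF P(1)]
  have z: "z \<in> C" using L(1) by (simp add: C_def)
  have eP: "e \<in> set P" using split by simp
  have eC: "fst e \<notin> C" using L(3) by (simp add: C_def)
  have e'C: "fst e' \<notin> C" using e' by (simp add: C_def)
  have notP: "e1 \<notin> set P" "e' \<notin> set P"
  proof -
    show "e1 \<notin> set P"
      using P(2) eP e1(2,3) by (auto simp: saw_def distinct_map inj_on_def)
    show "e' \<notin> set P" using e'(2) by auto
  qed
  have cards: "card C \<le> s + 1" "card (set P) \<le> s" "card ?S \<le> 2" "?k + 1 \<le> s"
  proof -
    have "card C \<le> card ?V" unfolding C_def by (intro card_mono) auto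
    also have "\<dots> \<le> length (map fst P @ [z])" by (rule card_length)
    finally show "card C \<le> s + 1" using len by simp
    show "card (set P) \<le> s" using card_length[of P] len by simp
  qed (use split len in \<open>auto simp: card_insert_if\<close>)
  have so: "\<EE> (set P) (\<lambda>\<omega>'. hit ?S z E \<omega>' ?k False (fst (\<omega>' d))) \<omega> \<le> (real (?k + 1))\<^sup>2 * (\<tau> ?N)\<^sup>2"
    if "d \<in> E" "d \<notin> set P" "fst d \<notin> C" for d
  proof (rule hit_second_order[where C = C and lv = lv and K = "Suc ?k"])
    show "fst (\<omega> d) \<in> C" if "d \<in> set P" "fst d \<in> C" for d
      using that L(2)[of d] pp by (auto simp: C_def)
    show "lv (fst d) \<le> lv (fst (\<omega> d)) + 1" if "d \<in> set P" for d
      using that L(2)[of d] pp by (auto simp: C_def lv_def)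
    show "lv z = 0" using z L(1) by (simp add: lv_def)
    show "?S \<inter> C = {}" using eC e'C e1(2) by auto
  qed (use that pp w z cards n in \<open>auto simp: C_def lv_def\<close>)
  have "(real (?k + 1))\<^sup>2 \<le> (real s + 1) ^ 3"
    using cards(4) by (intro order_trans[OF _ cube_ge] power_mono) auto
  hence r: "2 * (real (?k + 1))\<^sup>2 * (\<tau> ?N)\<^sup>2 \<le> R s" by (intro sq_le_R2) simp
  have fl: "\<EE> (set P) (\<lambda>\<omega>'. hit ?S z E \<omega>' ?k True (fst (\<omega>' d))) \<omega> = J (set P) \<omega> z ?k d" for d
    unfolding J_def by (intro cexp_cong hit_flag)
  have "set P \<subseteq> E" using pp by blast
  from tail_exchange[OF this w _ _ refl, of e1 e' z ?k]
  show ?thesis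
    using so[OF e1(1) notP(1)] so[OF e'(1) notP(2) e'C] e1 e' notP eC r unfolding fl by simp
qed

lemma off_path_tail:
  assumes "path \<omega> x p z" "length p \<le> s" "\<omega> \<in> \<Omega>" "3 * s + 5 \<le> n"
  obtains e' where "e' \<in> E" "fst e' \<notin> set (map fst p @ [z])"
  using off_tail[OF path_explored[OF assms]] .

text \<open>A walk from \<open>x\<close> may retrace \<open>P\<close>. At each vertex it stays on
  \<open>P\<close> with probability at most 1/2; otherwise it leaves through another tail and by
  \<open>branch_J\<close> its mean then hardly exceeds \<open>U\<close>. The excess thus halves at
  every step, up to second-order errors.\<close>

lemma saw_return:
  assumes P: "path \<omega> x P z" "saw P z" and w: "\<omega> \<in> \<Omega>" and len: "length P = s" and n: "3 * s + 5 \<le> n"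
  shows "\<EE> (set P) (\<lambda>\<omega>'. pr \<omega>' s x z) \<omega> - U (set P) \<omega> z s \<le> (1 / 2) ^ s * (1 + 5 * \<Delta>) + 14 * R s"
proof -
  let ?U = "U (set P) \<omega> z s" and ?c = "10 * real \<Delta> / m"
  have ex: "explored (set P) \<omega> (set (map fst P @ [z])) z s (3 * s + 5)"
    using path_explored[OF P(1) _ w n] len by simp
  obtain e' where e': "e' \<in> E" "fst e' \<notin> set (map fst P @ [z])"
    using off_path_tail[OF P(1) _ w n] len by auto
  have d: "distinct (map fst P)" using P(2) by (auto simp: saw_def)
  \<comment> \<open>With \<open>k = length p\<close>, the bound
    \<open>y k = (1 / 2) ^ k * (1 + ?c * k) + 14 * R s\<close> solves \<open>y (k + 1) = y k / 2 + 5
    * \<Delta> * (1 / 2) ^ k / m + 7 * R s\<close>. This determines \<open>?c\<close> and the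
    constant 14.\<close>
  have claim: "\<EE> (set P) (\<lambda>\<omega>'. pr \<omega>' (length p) v z) \<omega> - ?U
      \<le> (1 / 2) ^ length p * (1 + ?c * length p) + 14 * R s"
    if "path \<omega> v p z" "P = q @ p" for q v p
    using that
  proof (induction p arbitrary: v q)
    case Nil
    have "0 \<le> ?U" using U_nonneg[OF w] .
    thus ?case using Nil w R_nonneg[of s] by (simp add: cexp_const)
  next
    case (Cons e p)
    obtain l0 where e: "e = (v, l0)" and eE: "e \<in> E" and p: "path \<omega> (fst (\<omega> e)) p z"
      using Cons.prems by (cases e) auto
    have v: "v < n" "l0 < dout v" "2 \<le> dout v" using eE e degrees[of v] by (auto simp: mem_E)
    let ?k = "length p" and ?d = "dout v"
    let ?y = "(1 / 2) ^ ?k * (1 + ?c * ?k) + 14 * R s"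
    let ?\<xi> = "5 * real \<Delta> * (1 / 2) ^ ?k / m + 7 * R s"
    have ks: "?k \<le> s" using Cons.prems(2) len by simp
    have IH: "\<EE> (set P) (\<lambda>\<omega>'. pr \<omega>' ?k (fst (\<omega> e)) z) \<omega> - ?U \<le> ?y"
      using Cons.IH[OF p, of "q @ [e]"] Cons.prems by simp
    have eP: "e \<in> set P" using Cons.prems by simp
    have eJ: "J (set P) \<omega> z ?k e = \<EE> (set P) (\<lambda>\<omega>'. pr \<omega>' ?k (fst (\<omega> e)) z) \<omega>"
      unfolding J_def by (intro cexp_cong) (simp add: agr_eq[OF _ eP])
    \<comment> \<open>The constants add up: \<open>7 = 1 + 2 + 4\<close> from branching, from
      \<open>saw_eta\<close> and from the time shift, and \<open>5 = 1 + 4\<close> from the last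
      two.\<close>
    have other: "J (set P) \<omega> z ?k (v, l) - ?U \<le> ?\<xi>" if "l < ?d" "l \<noteq> l0" for l
    proof -
      have "J (set P) \<omega> z ?k (v, l) \<le> J (set P) \<omega> z ?k e' + R s"
        by (rule branch_J[OF P w Cons.prems(2) _ n]) (use len that v e e' in \<open>auto simp: mem_E\<close>)
      moreover have "\<bar>U (set P) \<omega> z ?k - J (set P) \<omega> z ?k e'\<bar> \<le> \<eta> (set P) \<omega> z ?k (3 * s + 5)"
        by (rule U_J_close(1)[OF explored_mono[OF ex ks] e'])
      moreover have "\<eta> (set P) \<omega> z ?k (3 * s + 5) \<le> \<Delta> * (1 / 2) ^ ?k / m + 2 * R s"
        by (rule saw_eta[OF P ks])
      moreover have "\<bar>?U - U (set P) \<omega> z ?k\<bar> \<le> 4 * \<Delta> * (1 / 2) ^ ?k / m + 4 * R s"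
        by (rule saw_U_shift[OF P _ w n ks]) (use len in simp)
      moreover have "?\<xi> = \<Delta> * (1 / 2) ^ ?k / m + 4 * \<Delta> * (1 / 2) ^ ?k / m + 7 * R s"
        by (simp add: field_simps)
      ultimately show ?thesis by linarith
    qed
    have y0: "0 \<le> ?y" and xi0: "0 \<le> ?\<xi>" using R_nonneg[of s] by auto
    have eq: "\<EE> (set P) (\<lambda>\<omega>'. pr \<omega>' (Suc ?k) v z) \<omega> = (\<Sum>l<?d. J (set P) \<omega> z ?k (v, l)) / ?d"
      unfolding hit_Suc_E[OF v(1)] cexp_divide cexp_sum J_def by simp
    have "\<EE> (set P) (\<lambda>\<omega>'. pr \<omega>' (Suc ?k) v z) \<omega> - ?U = (\<Sum>l<?d. J (set P) \<omega> z ?k (v, l) - ?U) / ?d"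
      unfolding eq using v(3) by (simp add: sum_subtractf diff_divide_distrib)
    also have "\<dots> \<le> (\<Sum>l<?d. (if l = l0 then ?y else 0) + ?\<xi>) / ?d"
    proof (intro divide_right_mono sum_mono)
      fix l assume "l \<in> {..<?d}"
      thus "J (set P) \<omega> z ?k (v, l) - ?U \<le> (if l = l0 then ?y else 0) + ?\<xi>"
        using other[of l] IH eJ e xi0 by auto
    qed simp
    also have "\<dots> = ?y / ?d + ?\<xi>"
      using v by (simp add: sum.distrib add_divide_distrib)
    also have "?y / ?d \<le> ?y / 2" using y0 v(3) by (intro divide_left_mono) auto
    also have "?y / 2 + ?\<xi> = (1 / 2) ^ Suc ?k * (1 + ?c * Suc ?k) + 14 * R s"
      using m_pos by (simp add: field_simps)
    finally show ?case by simp
  qed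
  have "?c * s \<le> 5 * \<Delta>"
  proof -
    have "2 * real s \<le> real m" using m_ge n by linarith
    from mult_left_mono[OF this, of "5 * real \<Delta>"]
    have "10 * real \<Delta> * real s \<le> 5 * real \<Delta> * real m" by simp
    thus ?thesis using m_pos by (simp add: field_simps)
  qed
  hence "(1 / 2) ^ s * (1 + ?c * s) \<le> (1 / 2) ^ s * (1 + 5 * \<Delta>)" by (intro mult_left_mono) auto
  moreover have "\<EE> (set P) (\<lambda>\<omega>'. pr \<omega>' s x z) \<omega> - ?U \<le> (1 / 2) ^ s * (1 + ?c * s) + 14 * R s"
    using claim[OF P(1), of "[]", OF append_Nil[symmetric]] unfolding len .
  ultimately show ?thesis by linarith
qed

section \<open>Mixing from most vertices\<close>

definition mean :: "((nat \<times> nat \<Rightarrow> nat \<times> nat) \<Rightarrow> real) \<Rightarrow> real" where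
  "mean \<phi> = (\<Sum>\<omega>\<in>\<Omega>. \<phi> \<omega>) / card \<Omega>"

lemma mean_cexp: "mean \<phi> = \<EE> {} \<phi> \<omega>0"
  by (simp add: mean_def cexp_def agreeing_def)

lemma mean_mono: "(\<And>\<omega>. \<omega> \<in> \<Omega> \<Longrightarrow> \<phi> \<omega> \<le> \<psi> \<omega>) \<Longrightarrow> mean \<phi> \<le> mean \<psi>"
  unfolding mean_def by (intro divide_right_mono sum_mono) auto

lemma mean_cong: "(\<And>\<omega>. \<omega> \<in> \<Omega> \<Longrightarrow> \<phi> \<omega> = \<psi> \<omega>) \<Longrightarrow> mean \<phi> = mean \<psi>"
  unfolding mean_def by simp

lemma mean_add: "mean (\<lambda>\<omega>. \<phi> \<omega> + \<psi> \<omega>) = mean \<phi> + mean \<psi>"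
  by (simp add: mean_def sum.distrib add_divide_distrib)

lemma mean_diff: "mean (\<lambda>\<omega>. \<phi> \<omega> - \<psi> \<omega>) = mean \<phi> - mean \<psi>"
  by (simp add: mean_def sum_subtractf diff_divide_distrib)

lemma mean_cmult: "mean (\<lambda>\<omega>. c * \<phi> \<omega>) = c * mean \<phi>"
  by (simp add: mean_def sum_distrib_left)

lemma mean_sum: "mean (\<lambda>\<omega>. \<Sum>i\<in>I. \<phi> i \<omega>) = (\<Sum>i\<in>I. mean (\<phi> i))"
  unfolding mean_def by (subst sum.swap) (simp add: sum_divide_distrib)

lemma mean_const: "mean (\<lambda>_. c) = c"
  using finite_bijs bijs_nonempty by (simp add: mean_def)

lemma mean_xav:
  "mean (\<lambda>\<omega>. xav \<omega> k v (\<phi> \<omega>)) = mean (\<lambda>\<omega>. xav \<omega> k v (\<lambda>p z. \<EE> (set p) (\<lambda>\<omega>'. \<phi> \<omega>' p z) \<omega>))"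
  unfolding mean_cexp[of _ undefined] by (subst cexp_xav) simp

lemma mean_non_saw:
  assumes "v < n" "3 * s + 5 \<le> n" "k \<le> s"
  shows "mean (\<lambda>\<omega>. xav \<omega> k v (\<lambda>p z. of_bool (\<not> saw p z))) \<le> s * \<tau> (3 * s + 5)"
proof -
  obtain \<omega>0 where "\<omega>0 \<in> \<Omega>" using bijs_nonempty by blast
  from non_saw_prob[OF _ this assms(1), of "{}" "{}" k "3 * s + 5"] assms
  have "mean (\<lambda>\<omega>. xav \<omega> k v (\<lambda>p z. of_bool (\<not> saw p z))) \<le> k * \<tau> (3 * s + 5)"
    by (simp add: mean_cexp[of _ \<omega>0])
  also have "\<dots> \<le> s * \<tau> (3 * s + 5)" using assms tau_nonneg by (intro mult_right_mono) auto
  finally show ?thesis .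
qed

text \<open>Given its path the walk obeys the bound \<open>a\<close> if the path is self-avoiding.
  The other paths may cost \<open>b\<close> more, but their mean total mass is at most
  \<open>s * \<tau> (3 * s + 5)\<close>.\<close>

lemma mean_xav_le:
  assumes v: "v < n" and n: "3 * s + 5 \<le> n" and k: "k \<le> s" and b: "0 \<le> b"
    and saw: "\<And>\<omega> p z. \<omega> \<in> \<Omega> \<Longrightarrow> length p = k \<Longrightarrow> path \<omega> v p z \<Longrightarrow> saw p z \<Longrightarrow>
       \<EE> (set p) (\<lambda>\<omega>'. \<phi> \<omega>' p z) \<omega> \<le> a"
    and non: "\<And>\<omega> p z. \<omega> \<in> \<Omega> \<Longrightarrow> length p = k \<Longrightarrow> path \<omega> v p z \<Longrightarrow> \<not> saw p z \<Longrightarrow>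
       \<EE> (set p) (\<lambda>\<omega>'. \<phi> \<omega>' p z) \<omega> \<le> a + b"
  shows "mean (\<lambda>\<omega>. xav \<omega> k v (\<phi> \<omega>)) \<le> a + b * (s * \<tau> (3 * s + 5))"
proof -
  have "mean (\<lambda>\<omega>. xav \<omega> k v (\<phi> \<omega>)) \<le> mean (\<lambda>\<omega>. xav \<omega> k v (\<lambda>p z. a + b * of_bool (\<not> saw p z)))"
    unfolding mean_xav[of k v \<phi>]
  proof (intro mean_mono xav_mono v)
    fix \<omega> p z assume *: "\<omega> \<in> \<Omega>" "length p = k" "path \<omega> v p z"
    show "\<EE> (set p) (\<lambda>\<omega>'. \<phi> \<omega>' p z) \<omega> \<le> a + b * of_bool (\<not> saw p z)"
      using saw[OF *] non[OF *] by (cases "saw p z") auto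
  qed
  also have "\<dots> = a + b * mean (\<lambda>\<omega>. xav \<omega> k v (\<lambda>p z. of_bool (\<not> saw p z)))"
  proof -
    have "mean (\<lambda>\<omega>. xav \<omega> k v (\<lambda>p z. a + b * of_bool (\<not> saw p z)))
      = mean (\<lambda>\<omega>. a + b * xav \<omega> k v (\<lambda>p z. of_bool (\<not> saw p z)))"
      by (intro mean_cong) (simp add: xav_add xav_cmult xav_const v)
    thus ?thesis by (simp add: mean_add mean_cmult mean_const)
  qed
  also have "\<dots> \<le> a + b * (s * \<tau> (3 * s + 5))"
    using mean_non_saw[OF v n k] b by (intro add_left_mono mult_left_mono)
  finally show ?thesis .
qed

lemma inlaw_endpoint:
  assumes "\<omega> \<in> \<Omega>"
  shows "(\<Sum>z<n. inlaw \<omega> k z * g z) = (\<Sum>y<n. real (din y) / m * xav \<omega> k y (\<lambda>p z. g z))"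
proof -
  have "(\<Sum>z<n. inlaw \<omega> k z * g z) = (\<Sum>y<n. real (din y) / m * (\<Sum>z<n. pr \<omega> k y z * g z))"
    unfolding inlaw_def sum_distrib_right sum_distrib_left by (subst sum.swap) (simp add: mult.assoc)
  also have "\<dots> = (\<Sum>y<n. real (din y) / m * xav \<omega> k y (\<lambda>p z. g z))"
    using xav_endpoint[OF assms] by (intro sum.cong refl) auto
  finally show ?thesis .
qed

lemma mean_inlaw_le:
  assumes "\<And>y. y < n \<Longrightarrow> mean (\<lambda>\<omega>. xav \<omega> k y (\<lambda>p z. g \<omega> z)) \<le> c"
  shows "mean (\<lambda>\<omega>. \<Sum>z<n. inlaw \<omega> k z * g \<omega> z) \<le> c"
proof -
  have "mean (\<lambda>\<omega>. \<Sum>z<n. inlaw \<omega> k z * g \<omega> z)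
      = mean (\<lambda>\<omega>. \<Sum>y<n. real (din y) / m * xav \<omega> k y (\<lambda>p z. g \<omega> z))"
    by (intro mean_cong inlaw_endpoint)
  also have "\<dots> = (\<Sum>y<n. real (din y) / m * mean (\<lambda>\<omega>. xav \<omega> k y (\<lambda>p z. g \<omega> z)))"
    by (simp only: mean_sum mean_cmult)
  also have "\<dots> \<le> (\<Sum>y<n. real (din y) / m * c)"
    using assms by (intro sum_mono mult_left_mono) auto
  also have "\<dots> = c" unfolding sum_distrib_right[symmetric] din_mass by simp
  finally show ?thesis .
qed

text \<open>The sum of squares is the mean of \<open>inlaw \<omega> t\<close> at the endpoint of a
  walk started from the in-degree distribution; given the path of that walk, \<open>U_le\<close>
  applies.\<close>

lemma inlaw_second_moment:
  assumes n: "3 * t + 5 \<le> n"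
  shows "mean (\<lambda>\<omega>. \<Sum>z<n. (inlaw \<omega> t z)\<^sup>2) \<le> (real t + 2) * \<tau> (3 * t + 5)"
  unfolding power2_eq_square
proof (rule mean_inlaw_le)
  fix y assume y: "y < n"
  have "\<EE> (set p) (\<lambda>\<omega>'. inlaw \<omega>' t z) \<omega> \<le> (real t + 2) * \<tau> (3 * t + 5)"
    if "\<omega> \<in> \<Omega>" "length p = t" "path \<omega> y p z" for \<omega> p z
    using U_le[OF path_explored[OF that(3) _ that(1) n]] that(2) by (simp add: U_def)
  hence "mean (\<lambda>\<omega>. xav \<omega> t y (\<lambda>p. inlaw \<omega> t)) \<le> (real t + 2) * \<tau> (3 * t + 5) + 0 * (t * \<tau> (3 * t + 5))"
    by (intro mean_xav_le[OF y n order_refl order_refl]) auto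
  thus "mean (\<lambda>\<omega>. xav \<omega> t y (\<lambda>p. inlaw \<omega> t)) \<le> (real t + 2) * \<tau> (3 * t + 5)"
    by simp
qed

text \<open>With \<open>d = inlaw \<omega> s z - inlaw \<omega> h z\<close> the square is
  \<open>inlaw \<omega> s z * d - inlaw \<omega> h z * d\<close>. Both parts are means of
  \<open>c * d\<close>, with a sign \<open>c\<close>, at the endpoint of a walk of length
  \<open>s\<close> or \<open>h\<close>, and given a self-avoiding path \<open>saw_U_shift\<close>
  bounds them.\<close>

lemma inlaw_cauchy:
  assumes h: "h \<le> s" and n: "3 * s + 5 \<le> n"
  shows "mean (\<lambda>\<omega>. \<Sum>z<n. (inlaw \<omega> s z - inlaw \<omega> h z)\<^sup>2) \<le> 8 * \<Delta> * (1 / 2) ^ h / m + 10 * R s"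
proof -
  let ?a = "4 * \<Delta> * (1 / 2) ^ h / m + 4 * R s" and ?b = "(real s + 2) * \<tau> (3 * s + 5)"
  have t0: "0 \<le> \<tau> (3 * s + 5)" by (rule tau_nonneg)
  have sb: "?b * (s * \<tau> (3 * s + 5)) \<le> R s"
  proof -
    have "(real s + 2) * real s \<le> 2 * (real s + 1)\<^sup>2"
      by (simp add: power2_eq_square algebra_simps)
    also have "\<dots> \<le> 2 * (real s + 1) ^ 3" using cube_ge by simp
    finally have "((real s + 2) * real s) * (\<tau> (3 * s + 5))\<^sup>2 \<le> R s" by (rule sq_le_R2)
    thus ?thesis by (simp add: power2_eq_square algebra_simps)
  qed
  have sgn: "mean (\<lambda>\<omega>. \<Sum>z<n. inlaw \<omega> r z * (c * (inlaw \<omega> s z - inlaw \<omega> h z))) \<le> ?a + R s"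
    if r: "r \<le> s" and c: "c = 1 \<or> c = -1" for r and c :: real
  proof (rule mean_inlaw_le)
    fix y assume y: "y < n"
    have ce: "\<EE> (set p) (\<lambda>\<omega>'. c * (inlaw \<omega>' s z - inlaw \<omega>' h z)) \<omega>
       = c * (U (set p) \<omega> z s - U (set p) \<omega> z h)" for p z \<omega>
      by (simp add: U_def cexp_cmult cexp_diff)
    have "mean (\<lambda>\<omega>. xav \<omega> r y (\<lambda>p z. c * (inlaw \<omega> s z - inlaw \<omega> h z))) \<le> ?a + ?b * (s * \<tau> (3 * s + 5))"
    proof (rule mean_xav_le[OF y n r])
      fix \<omega> p z assume *: "\<omega> \<in> \<Omega>" "length p = r" "path \<omega> y p z"
      show "\<EE> (set p) (\<lambda>\<omega>'. c * (inlaw \<omega>' s z - inlaw \<omega>' h z)) \<omega> \<le> ?a" if "saw p z"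
        using saw_U_shift[OF *(3) that _ *(1) n h] *(2) r c unfolding ce by auto
      have ex: "explored (set p) \<omega> (set (map fst p @ [z])) z s (3 * s + 5)"
        using path_explored[OF *(3) _ *(1) n] *(2) r by simp
      have "U (set p) \<omega> z s \<le> ?b" using U_le[OF ex] .
      moreover have "U (set p) \<omega> z h \<le> ?b"
        using U_le[OF explored_mono[OF ex h]] h t0
          mult_right_mono[of "real h + 2" "real s + 2" "\<tau> (3 * s + 5)"] by linarith
      moreover have "0 \<le> U (set p) \<omega> z s" "0 \<le> U (set p) \<omega> z h" using U_nonneg[OF *(1)] by auto
      moreover have "0 \<le> ?a" using R_nonneg by simp
      ultimately show "\<EE> (set p) (\<lambda>\<omega>'. c * (inlaw \<omega>' s z - inlaw \<omega>' h z)) \<omega> \<le> ?a + ?b"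
        unfolding ce using c by auto
    qed (use t0 in auto)
    thus "mean (\<lambda>\<omega>. xav \<omega> r y (\<lambda>p z. c * (inlaw \<omega> s z - inlaw \<omega> h z))) \<le> ?a + R s"
      using sb by linarith
  qed
  have "mean (\<lambda>\<omega>. \<Sum>z<n. (inlaw \<omega> s z - inlaw \<omega> h z)\<^sup>2)
     = mean (\<lambda>\<omega>. (\<Sum>z<n. inlaw \<omega> s z * (1 * (inlaw \<omega> s z - inlaw \<omega> h z)))
        + (\<Sum>z<n. inlaw \<omega> h z * ((- 1) * (inlaw \<omega> s z - inlaw \<omega> h z))))"
    by (simp add: power2_eq_square algebra_simps flip: sum.distrib)
  also have "\<dots> \<le> (?a + R s) + (?a + R s)"
    unfolding mean_add by (intro add_mono sgn) (use h in auto)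
  finally show ?thesis by simp
qed

text \<open>The mass carried by self-avoiding paths. The other paths are not covered by
  \<open>saw_return\<close>, so their small mass is cut off before anything is squared.\<close>

definition sw where "sw \<omega> k x z = xav \<omega> k x (\<lambda>p y. of_bool (saw p y \<and> y = z))"

lemma sw_endpoint:
  assumes "\<omega> \<in> \<Omega>" "x < n"
  shows "(\<Sum>z<n. sw \<omega> k x z * g z) = xav \<omega> k x (\<lambda>p z. of_bool (saw p z) * g z)"
proof -
  have end_lt: "path \<omega> v p z \<Longrightarrow> v < n \<Longrightarrow> z < n" for v p z
  proof (induction p arbitrary: v)
    case (Cons e p)
    hence "fst (\<omega> e) < n" "path \<omega> (fst (\<omega> e)) p z" using head_lt[OF assms(1), of e] by auto
    thus ?case using Cons.IH by blast
  qed simp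
  have "(\<Sum>z<n. sw \<omega> k x z * g z) = xav \<omega> k x (\<lambda>p y. \<Sum>z<n. of_bool (saw p y \<and> y = z) * g z)"
  proof -
    have "xav \<omega> k x (\<lambda>p y. of_bool (saw p y \<and> y = z) * g z) = sw \<omega> k x z * g z" for z
      using xav_cmult[of \<omega> k x "g z" "\<lambda>p y. of_bool (saw p y \<and> y = z)"]
      by (simp add: sw_def mult.commute)
    thus ?thesis unfolding xav_sum by simp
  qed
  also have "\<dots> = xav \<omega> k x (\<lambda>p z. of_bool (saw p z) * g z)"
  proof (rule antisym; rule xav_mono[OF assms])
    fix p z assume "path \<omega> x p z"
    hence "z < n" using end_lt assms(2) by blast
    hence "(\<Sum>z'<n. of_bool (saw p z \<and> z = z') * g z') = of_bool (saw p z) * g z"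
      by (cases "saw p z") (auto simp: of_bool_def if_distrib[of "\<lambda>x. x * _"] cong: if_cong)
    thus "(\<Sum>z'<n. of_bool (saw p z \<and> z = z') * g z') \<le> of_bool (saw p z) * g z"
      "of_bool (saw p z) * g z \<le> (\<Sum>z'<n. of_bool (saw p z \<and> z = z') * g z')" by auto
  qed
  finally show ?thesis .
qed

lemma sw_nonneg: "\<omega> \<in> \<Omega> \<Longrightarrow> x < n \<Longrightarrow> 0 \<le> sw \<omega> k x z"
proof -
  assume *: "\<omega> \<in> \<Omega>" "x < n"
  have "xav \<omega> k x (\<lambda>_ _. 0) \<le> sw \<omega> k x z" unfolding sw_def by (rule xav_mono[OF *]) simp
  thus ?thesis by (simp add: xav_const *)
qed

lemma sw_le_pr: "\<omega> \<in> \<Omega> \<Longrightarrow> x < n \<Longrightarrow> sw \<omega> k x z \<le> pr \<omega> k x z"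
proof -
  assume *: "\<omega> \<in> \<Omega>" "x < n"
  show ?thesis unfolding sw_def pr_xav[OF *] by (rule xav_mono[OF *]) simp
qed

lemma pr_minus_sw:
  assumes "\<omega> \<in> \<Omega>" "x < n"
  shows "(\<Sum>z<n. g z * (pr \<omega> k x z - sw \<omega> k x z)) = xav \<omega> k x (\<lambda>p z. of_bool (\<not> saw p z) * g z)"
proof -
  have "(\<Sum>z<n. g z * (pr \<omega> k x z - sw \<omega> k x z)) = (\<Sum>z<n. pr \<omega> k x z * g z) - (\<Sum>z<n. sw \<omega> k x z * g z)"
    by (simp add: algebra_simps sum_subtractf)
  also have "\<dots> = xav \<omega> k x (\<lambda>p z. g z - of_bool (saw p z) * g z)"
    by (simp add: xav_endpoint[OF assms] sw_endpoint[OF assms] xav_diff)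
  also have "(\<lambda>p z. g z - of_bool (saw p z) * g z) = (\<lambda>p z. of_bool (\<not> saw p z) * g z)"
    by (auto simp: fun_eq_iff)
  finally show ?thesis .
qed

text \<open>For \<open>x\<close> off the path, all tails at \<open>x\<close> are off the path and
  their \<open>J\<close> at time \<open>s - 1\<close> is close to \<open>U\<close> at time
  \<open>s\<close>; this uses \<open>1 \<le> s\<close>. The at most \<open>s + 1\<close> starting
  points on the path are bounded by \<open>U_le\<close>, which is affordable because the sum runs
  over all \<open>x\<close>.\<close>

lemma saw_cases_bound:
  assumes y: "y < n" and s: "1 \<le> s" and n: "3 * s + 5 \<le> n"
  shows "mean (\<lambda>\<omega>. xav \<omega> s y (\<lambda>p z. \<Sum>x<n. inlaw \<omega> s z - pr \<omega> s x z)) \<le> \<Delta> * (1 / 2) ^ s + 4 * n * R s"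
proof -
  let ?t = "\<tau> (3 * s + 5)"
  let ?u = "(real s + 2) * ?t"
  let ?a = "n * (\<Delta> * (1 / 2) ^ (s - 1) / m + 2 * R s) + (real s + 1) * ?u" and ?b = "n * ?u"
  have t0: "0 \<le> ?t" by (rule tau_nonneg)
  have u0: "0 \<le> ?u" using t0 by simp
  have "mean (\<lambda>\<omega>. xav \<omega> s y (\<lambda>p z. \<Sum>x<n. inlaw \<omega> s z - pr \<omega> s x z)) \<le> ?a + ?b * (s * ?t)"
  proof (rule mean_xav_le[OF y n order_refl])
    fix \<omega> p z assume w: "\<omega> \<in> \<Omega>" and len: "length p = s" and p: "path \<omega> y p z"
    let ?V = "set (map fst p @ [z])" and ?D = "set p"
    have ex: "explored ?D \<omega> ?V z s (3 * s + 5)" using path_explored[OF p _ w n] len by simp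
    have A0: "0 \<le> \<EE> ?D (\<lambda>\<omega>'. pr \<omega>' s x z) \<omega>" for x
      by (rule cexp_nonneg[OF w]) (rule hit_nonneg)
    have eq: "\<EE> ?D (\<lambda>\<omega>'. \<Sum>x<n. inlaw \<omega>' s z - pr \<omega>' s x z) \<omega>
       = (\<Sum>x<n. U ?D \<omega> z s - \<EE> ?D (\<lambda>\<omega>'. pr \<omega>' s x z) \<omega>)"
      by (simp add: cexp_sum cexp_diff U_def)
    have triv: "U ?D \<omega> z s - \<EE> ?D (\<lambda>\<omega>'. pr \<omega>' s x z) \<omega> \<le> ?u" for x
      using U_le[OF ex] A0[of x] by linarith
    have nn: "0 \<le> n * (\<Delta> * (1 / 2) ^ (s - 1) / m + 2 * R s)" using R_nonneg[of s] by simp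
    show "\<EE> ?D (\<lambda>\<omega>'. \<Sum>x<n. inlaw \<omega>' s z - pr \<omega>' s x z) \<omega> \<le> ?a + ?b"
    proof -
      have "(\<Sum>x<n. U ?D \<omega> z s - \<EE> ?D (\<lambda>\<omega>'. pr \<omega>' s x z) \<omega>) \<le> (\<Sum>x<n. ?u)"
        using triv by (intro sum_mono) auto
      moreover have "0 \<le> (real s + 1) * ?u" using u0 by (simp only: mult_nonneg_nonneg of_nat_0_le_iff add_nonneg_nonneg zero_le_one)
      ultimately show ?thesis unfolding eq using nn by (simp only: sum_constant card_lessThan)
    qed
    assume saw: "saw p z"
    let ?h = "\<Delta> * (1 / 2) ^ (s - 1) / m + 2 * R s"
    have off: "U ?D \<omega> z s - \<EE> ?D (\<lambda>\<omega>'. pr \<omega>' s x z) \<omega> \<le> ?h" if x: "x < n" "x \<notin> ?V" for x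
    proof -
      have d: "dout x > 0" using degrees[OF x(1)] by simp
      have eqA: "\<EE> ?D (\<lambda>\<omega>'. pr \<omega>' (Suc (s - 1)) x z) \<omega> = (\<Sum>l<dout x. J ?D \<omega> z (s - 1) (x, l)) / dout x"
        unfolding hit_Suc_E[OF x(1)] cexp_divide cexp_sum J_def by simp
      have "U ?D \<omega> z s - J ?D \<omega> z (s - 1) (x, l) \<le> ?h" if "l < dout x" for l
      proof -
        have "\<bar>U ?D \<omega> z (Suc (s - 1)) - J ?D \<omega> z (s - 1) (x, l)\<bar> \<le> \<eta> ?D \<omega> z (s - 1) (3 * s + 5)"
          by (rule U_J_close(2)[OF explored_mono[OF ex]]) (use that x in \<open>auto simp: mem_E\<close>)
        moreover have "\<eta> ?D \<omega> z (s - 1) (3 * s + 5) \<le> ?h" by (rule saw_eta[OF p saw]) simp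
        ultimately show ?thesis using s by simp
      qed
      hence "(\<Sum>l<dout x. U ?D \<omega> z s - J ?D \<omega> z (s - 1) (x, l)) / dout x \<le> ?h"
        using R_nonneg[of s] by (intro sum_div_le) auto
      thus ?thesis using d s eqA by (simp add: sum_subtractf diff_divide_distrib)
    qed
    have cV: "card ?V \<le> s + 1" using card_length[of "map fst p @ [z]"] len by simp
    have "(\<Sum>x<n. U ?D \<omega> z s - \<EE> ?D (\<lambda>\<omega>'. pr \<omega>' s x z) \<omega>) \<le> (\<Sum>x<n. ?h + (if x \<in> ?V then ?u else 0))"
    proof (intro sum_mono)
      fix x assume "x \<in> {..<n}"
      moreover have "0 \<le> ?h" using R_nonneg[of s] by simp
      ultimately show "U ?D \<omega> z s - \<EE> ?D (\<lambda>\<omega>'. pr \<omega>' s x z) \<omega> \<le> ?h + (if x \<in> ?V then ?u else 0)"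
        using triv[of x] off[of x] by (cases "x \<in> ?V") auto
    qed
    also have "\<dots> = n * ?h + real (card ({..<n} \<inter> ?V)) * ?u"
      by (simp add: sum.distrib sum.If_cases del: set_append set_map) 
    also have "\<dots> \<le> n * ?h + (real s + 1) * ?u"
    proof -
      have "card ({..<n} \<inter> ?V) \<le> card ?V" by (intro card_mono) auto
      hence "real (card ({..<n} \<inter> ?V)) \<le> real s + 1" using cV by linarith
      from mult_right_mono[OF this u0] show ?thesis by simp
    qed
    finally show "\<EE> ?D (\<lambda>\<omega>'. \<Sum>x<n. inlaw \<omega>' s z - pr \<omega>' s x z) \<omega> \<le> ?a" unfolding eq .
  qed (use u0 in auto)
  also have "?a + ?b * (s * ?t) \<le> \<Delta> * (1 / 2) ^ s + 4 * n * R s"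
  proof -
    have np: "real n > 0" using n_pos by simp
    have h1: "n * (\<Delta> * (1 / 2) ^ (s - 1) / m) \<le> \<Delta> * (1 / 2) ^ s"
    proof -
      have e: "(1 / 2 :: real) ^ (s - 1) = 2 * (1 / 2) ^ s" using s by (cases s) auto
      have "2 * real n / m \<le> 1" using m_ge m_pos by (simp add: field_simps flip: of_nat_mult)
      from mult_left_mono[OF this, of "\<Delta> * (1 / 2) ^ s"] show ?thesis unfolding e by (simp add: mult_ac)
    qed
    \<comment> \<open>Since \<open>n * ?t\<close> is at least 1, the first-order terms of the path
      vertices fit into \<open>n\<close> times a second-order error.\<close>
    have t1: "1 \<le> n * ?t" using np Delta_ge mult_mono[of 1 "real \<Delta>" 1 "real (3 * s + 5) + 2"] by (simp add: \<tau>_def)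
    have sq1: "(real s + 1) * (real s + 2) * ?t\<^sup>2 \<le> R s"
    proof -
      have "(real s + 1) * (real s + 2) \<le> 2 * (real s + 1)\<^sup>2" by (simp add: power2_eq_square algebra_simps)
      hence "(real s + 1) * (real s + 2) \<le> 2 * (real s + 1) ^ 3" using cube_ge[of s] by linarith
      thus ?thesis by (rule sq_le_R2)
    qed
    have sq2: "(real s + 2) * s * ?t\<^sup>2 \<le> R s"
    proof (rule sq_le_R2)
      have "(real s + 2) * s \<le> 2 * (real s + 1)\<^sup>2" by (simp add: power2_eq_square algebra_simps)
      thus "(real s + 2) * s \<le> 2 * (real s + 1) ^ 3" using cube_ge[of s] by linarith
    qed
    have "(real s + 1) * ?u \<le> (real s + 1) * ?u * (n * ?t)"
      using mult_left_mono[OF t1, of "(real s + 1) * ?u"] u0 by simp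
    also have "\<dots> = n * ((real s + 1) * (real s + 2) * ?t\<^sup>2)" by (simp add: power2_eq_square)
    also have "\<dots> \<le> n * R s" using sq1 np by (intro mult_left_mono) auto
    finally have h2: "(real s + 1) * ?u \<le> n * R s" .
    have "?b * (s * ?t) = n * ((real s + 2) * s * ?t\<^sup>2)" by (simp add: power2_eq_square)
    also have "\<dots> \<le> n * R s" using sq2 np by (intro mult_left_mono) auto
    finally have h3: "?b * (s * ?t) \<le> n * R s" .
    show ?thesis using h1 h2 h3 by (simp add: distrib_left)
  qed
  finally show ?thesis .
qed

text \<open>Each square is at most the sum of three terms, the slack being
  \<open>sw * (pr - sw)\<close>. \<open>T1\<close> is the return estimate for the same starting
  point, \<open>T2\<close> compares with a walk from the in-degree distribution, and
  \<open>T3\<close> accounts for the paths cut off. \<open>T2\<close> is controlled only after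
  summation over \<open>x\<close>, so the result is a statement about the sum.\<close>

lemma local_mixing:
  assumes s: "1 \<le> s" and n: "3 * s + 5 \<le> n"
  shows "(\<Sum>x<n. mean (\<lambda>\<omega>. \<Sum>z<n. (sw \<omega> s x z - inlaw \<omega> s z)\<^sup>2)) \<le> n * (7 * \<Delta> * (1 / 2) ^ s + 19 * R s)"
proof -
  let ?t = "\<tau> (3 * s + 5)"
  let ?a = "(1 / 2) ^ s * (1 + 5 * \<Delta>) + 14 * R s"
  have t0: "0 \<le> ?t" by (rule tau_nonneg)
  define T1 where "T1 x = mean (\<lambda>\<omega>. \<Sum>z<n. sw \<omega> s x z * (pr \<omega> s x z - inlaw \<omega> s z))" for x
  define T2 where "T2 x = mean (\<lambda>\<omega>. \<Sum>z<n. inlaw \<omega> s z * (inlaw \<omega> s z - pr \<omega> s x z))" for x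
  define T3 where "T3 x = mean (\<lambda>\<omega>. \<Sum>z<n. inlaw \<omega> s z * (pr \<omega> s x z - sw \<omega> s x z))" for x
  have split: "mean (\<lambda>\<omega>. \<Sum>z<n. (sw \<omega> s x z - inlaw \<omega> s z)\<^sup>2) \<le> T1 x + T2 x + T3 x" if x: "x < n" for x
    unfolding T1_def T2_def T3_def mean_add[symmetric] sum.distrib[symmetric]
  proof (intro mean_mono sum_mono)
    fix \<omega> z assume w: "\<omega> \<in> \<Omega>"
    have "0 \<le> sw \<omega> s x z * (pr \<omega> s x z - sw \<omega> s x z)"
      using sw_nonneg[OF w x] sw_le_pr[OF w x] by (intro mult_nonneg_nonneg) auto
    thus "(sw \<omega> s x z - inlaw \<omega> s z)\<^sup>2 \<le> sw \<omega> s x z * (pr \<omega> s x z - inlaw \<omega> s z)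
       + inlaw \<omega> s z * (inlaw \<omega> s z - pr \<omega> s x z) + inlaw \<omega> s z * (pr \<omega> s x z - sw \<omega> s x z)"
      by (simp add: power2_eq_square algebra_simps)
  qed
  have T1: "T1 x \<le> ?a" if x: "x < n" for x
  proof -
    have "T1 x = mean (\<lambda>\<omega>. xav \<omega> s x (\<lambda>p z. of_bool (saw p z) * (pr \<omega> s x z - inlaw \<omega> s z)))"
      unfolding T1_def by (intro mean_cong sw_endpoint x)
    also have "\<dots> \<le> ?a + 0 * (s * ?t)"
    proof (rule mean_xav_le[OF x n order_refl order_refl])
      fix \<omega> p z assume w: "\<omega> \<in> \<Omega>" and len: "length p = s" and p: "path \<omega> x p z"
      have "\<EE> (set p) (\<lambda>\<omega>'. of_bool (saw p z) * (pr \<omega>' s x z - inlaw \<omega>' s z)) \<omega>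
        = of_bool (saw p z) * (\<EE> (set p) (\<lambda>\<omega>'. pr \<omega>' s x z) \<omega> - U (set p) \<omega> z s)"
        by (simp only: cexp_cmult cexp_diff U_def)
      also have "\<dots> \<le> ?a"
        using saw_return[OF p _ w len n] R_nonneg[of s] by (cases "saw p z") auto
      finally show "\<EE> (set p) (\<lambda>\<omega>'. of_bool (saw p z) * (pr \<omega>' s x z - inlaw \<omega>' s z)) \<omega> \<le> ?a"
        "\<EE> (set p) (\<lambda>\<omega>'. of_bool (saw p z) * (pr \<omega>' s x z - inlaw \<omega>' s z)) \<omega> \<le> ?a + 0" by auto
    qed
    finally show ?thesis by simp
  qed
  have T3: "T3 x \<le> R s" if x: "x < n" for x
  proof -
    have "T3 x = mean (\<lambda>\<omega>. xav \<omega> s x (\<lambda>p z. of_bool (\<not> saw p z) * inlaw \<omega> s z))"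
      unfolding T3_def by (intro mean_cong pr_minus_sw x)
    also have "\<dots> \<le> 0 + ((real s + 2) * ?t) * (s * ?t)"
    proof (rule mean_xav_le[OF x n order_refl])
      fix \<omega> p z assume w: "\<omega> \<in> \<Omega>" and len: "length p = s" and p: "path \<omega> x p z"
      show "\<EE> (set p) (\<lambda>\<omega>'. of_bool (\<not> saw p z) * inlaw \<omega>' s z) \<omega> \<le> 0" if "saw p z"
        using that w by (simp add: cexp_const)
      show "\<EE> (set p) (\<lambda>\<omega>'. of_bool (\<not> saw p z) * inlaw \<omega>' s z) \<omega> \<le> 0 + (real s + 2) * ?t" if "\<not> saw p z"
        using that U_le[OF path_explored[OF p _ w n]] len by (simp add: U_def)
    qed (use t0 in auto)
    also have "\<dots> = ((real s + 2) * s) * ?t\<^sup>2" by (simp add: power2_eq_square)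
    also have "\<dots> \<le> R s"
    proof (rule sq_le_R2)
      have "(real s + 2) * s \<le> 2 * (real s + 1)\<^sup>2" by (simp add: power2_eq_square algebra_simps)
      thus "(real s + 2) * s \<le> 2 * (real s + 1) ^ 3" using cube_ge[of s] by linarith
    qed
    finally show ?thesis .
  qed
  have T2: "(\<Sum>x<n. T2 x) \<le> \<Delta> * (1 / 2) ^ s + 4 * n * R s"
  proof -
    have "(\<Sum>x<n. T2 x) = mean (\<lambda>\<omega>. \<Sum>z<n. inlaw \<omega> s z * (\<Sum>x<n. inlaw \<omega> s z - pr \<omega> s x z))"
      unfolding T2_def mean_sum[symmetric] sum_distrib_left by (subst sum.swap) simp
    also have "\<dots> \<le> \<Delta> * (1 / 2) ^ s + 4 * n * R s"
      by (rule mean_inlaw_le) (rule saw_cases_bound[OF _ s n])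
    finally show ?thesis .
  qed
  have "(\<Sum>x<n. mean (\<lambda>\<omega>. \<Sum>z<n. (sw \<omega> s x z - inlaw \<omega> s z)\<^sup>2)) \<le> (\<Sum>x<n. (?a + R s) + T2 x)"
  proof (intro sum_mono)
    fix x assume "x \<in> {..<n}"
    hence x: "x < n" by simp
    show "mean (\<lambda>\<omega>. \<Sum>z<n. (sw \<omega> s x z - inlaw \<omega> s z)\<^sup>2) \<le> (?a + R s) + T2 x"
      using split[OF x] T1[OF x] T3[OF x] by linarith
  qed
  also have "\<dots> = n * (?a + R s) + (\<Sum>x<n. T2 x)" by (simp add: sum.distrib)
  also have "\<dots> \<le> n * (?a + R s) + (\<Delta> * (1 / 2) ^ s + 4 * n * R s)" using T2 by simp
  also have "\<dots> \<le> n * (7 * \<Delta> * (1 / 2) ^ s + 19 * R s)"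
  proof -
    have "\<Delta> * (1 / 2) ^ s \<le> n * (\<Delta> * (1 / 2) ^ s)"
      using n_pos mult_right_mono[of 1 "real n" "\<Delta> * (1 / 2) ^ s"] by simp
    moreover have "n * (1 / 2) ^ s \<le> n * (\<Delta> * (1 / 2) ^ s)"
      using Delta_ge mult_right_mono[of 1 "real \<Delta>" "(1 / 2) ^ s"] by (intro mult_left_mono) auto
    ultimately show ?thesis by (simp add: algebra_simps)
  qed
  finally show ?thesis .
qed

section \<open>Composition of walk laws and the number of exceptional starting vertices\<close>

lemma pr_nonneg: "0 \<le> pr \<omega> k x z" by (rule hit_nonneg)

lemma pr_sum: "\<omega> \<in> \<Omega> \<Longrightarrow> x < n \<Longrightarrow> (\<Sum>z<n. pr \<omega> k x z) = 1"
  using xav_endpoint[of \<omega> x k "\<lambda>_. 1"] by (simp add: xav_const)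

lemma pr_Suc:
  "x < n \<Longrightarrow> pr \<omega> (Suc k) x z = (\<Sum>l<dout x. pr \<omega> k (fst (\<omega> (x, l))) z) / dout x"
  by (simp add: hit_Suc_E del: hit.simps)

lemma pr_add:
  assumes w: "\<omega> \<in> \<Omega>" and x: "x < n"
  shows "pr \<omega> (a + b) x z = (\<Sum>y<n. pr \<omega> a x y * pr \<omega> b y z)"
proof -
  have "pr \<omega> (a + b) x z = xav \<omega> a x (\<lambda>p y. pr \<omega> b y z)"
    using x
  proof (induction a arbitrary: x)
    case (Suc a)
    have "pr \<omega> (a + b) (fst (\<omega> (x, l))) z = xav \<omega> a (fst (\<omega> (x, l))) (\<lambda>p y. pr \<omega> b y z)"
      if "l < dout x" for l
      by (rule Suc.IH) (use Suc.prems that head_lt[OF w, of "(x, l)"] in \<open>auto simp: mem_E\<close>)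
    thus ?case unfolding add_Suc pr_Suc[OF Suc.prems] xav.simps by simp
  qed simp
  thus ?thesis using xav_endpoint[OF w x] by simp
qed

lemma inlaw_add:
  assumes w: "\<omega> \<in> \<Omega>"
  shows "inlaw \<omega> (a + b) z = (\<Sum>y<n. inlaw \<omega> a y * pr \<omega> b y z)"
proof -
  have "inlaw \<omega> (a + b) z = (\<Sum>x<n. \<Sum>y<n. real (din x) / m * (pr \<omega> a x y * pr \<omega> b y z))"
    unfolding inlaw_def using pr_add[OF w] by (intro sum.cong refl) (simp add: sum_distrib_left)
  also have "\<dots> = (\<Sum>y<n. inlaw \<omega> a y * pr \<omega> b y z)"
    unfolding inlaw_def by (subst sum.swap) (simp add: sum_distrib_right mult.assoc)
  finally show ?thesis .
qed

lemma inlaw_sum: "\<omega> \<in> \<Omega> \<Longrightarrow> (\<Sum>z<n. inlaw \<omega> k z) = 1"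
proof -
  assume w: "\<omega> \<in> \<Omega>"
  have "(\<Sum>z<n. inlaw \<omega> k z) = (\<Sum>x<n. real (din x) / m * (\<Sum>z<n. pr \<omega> k x z))"
    unfolding inlaw_def by (subst sum.swap) (simp add: sum_distrib_left)
  also have "\<dots> = (\<Sum>x<n. real (din x) / m)" using pr_sum[OF w] by (intro sum.cong refl) simp
  finally show ?thesis using din_mass by simp
qed

definition bad where "bad \<omega> s \<epsilon> = {x. x < n \<and> (\<Sum>z<n. \<bar>pr \<omega> s x z - inlaw \<omega> s z\<bar>) > \<epsilon>}"

lemma bad_sub: "bad \<omega> s \<epsilon> \<subseteq> {..<n}" and finite_bad: "finite (bad \<omega> s \<epsilon>)"
  by (auto simp: bad_def)

text \<open>A bad vertex has either much mass on paths that are not self-avoiding or a large L1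
  distance between \<open>sw\<close> and \<open>inlaw\<close>. For the latter Cauchy-Schwarz loses a
  factor \<open>n\<close>, yet the sum in \<open>local_mixing\<close> is of order polylog(n) / n
  when \<open>(1 / 2) ^ s\<close> is at most the inverse square of \<open>n\<close>, so the bound is
  polylogarithmic.\<close>

lemma mean_bad:
  assumes s: "1 \<le> s" and n: "3 * s + 5 \<le> n" and \<epsilon>: "0 < \<epsilon>"
  shows "mean (\<lambda>\<omega>. real (card (bad \<omega> s \<epsilon>)))
    \<le> 2 / \<epsilon> * (n * (s * \<tau> (3 * s + 5))) + 4 / \<epsilon>\<^sup>2 * n * (n * (7 * \<Delta> * (1 / 2) ^ s + 19 * R s))"
proof -
  have pw: "of_bool (x \<in> bad \<omega> s \<epsilon>) \<le> 2 / \<epsilon> * xav \<omega> s x (\<lambda>p z. of_bool (\<not> saw p z))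
      + 4 / \<epsilon>\<^sup>2 * n * (\<Sum>z<n. (sw \<omega> s x z - inlaw \<omega> s z)\<^sup>2)" (is "_ \<le> ?A + ?B")
    if w: "\<omega> \<in> \<Omega>" and x: "x < n" for \<omega> x
  proof -
    let ?a = "\<Sum>z<n. pr \<omega> s x z - sw \<omega> s x z" and ?b = "\<Sum>z<n. \<bar>sw \<omega> s x z - inlaw \<omega> s z\<bar>"
    have a: "?a = xav \<omega> s x (\<lambda>p z. of_bool (\<not> saw p z))"
      using pr_minus_sw[OF w x, of "\<lambda>_. 1"] by simp
    have a0: "0 \<le> ?a" using sw_le_pr[OF w x] by (intro sum_nonneg) auto
    have b: "?b\<^sup>2 \<le> n * (\<Sum>z<n. (sw \<omega> s x z - inlaw \<omega> s z)\<^sup>2)"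
      using Cauchy_Schwarz_ineq_sum[of "\<lambda>_. 1" "\<lambda>z. \<bar>sw \<omega> s x z - inlaw \<omega> s z\<bar>" "{..<n}"] by simp
    have A0: "0 \<le> ?A" using a a0 \<epsilon> by simp
    have B0: "0 \<le> ?B" using \<epsilon> by (intro mult_nonneg_nonneg sum_nonneg) auto
    show ?thesis
    proof (cases "x \<in> bad \<omega> s \<epsilon>")
      case True
      have "(\<Sum>z<n. \<bar>pr \<omega> s x z - inlaw \<omega> s z\<bar>) \<le> (\<Sum>z<n. (pr \<omega> s x z - sw \<omega> s x z) + \<bar>sw \<omega> s x z - inlaw \<omega> s z\<bar>)"
      proof (intro sum_mono)
        fix z
        show "\<bar>pr \<omega> s x z - inlaw \<omega> s z\<bar> \<le> (pr \<omega> s x z - sw \<omega> s x z) + \<bar>sw \<omega> s x z - inlaw \<omega> s z\<bar>"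
          using sw_le_pr[OF w x, of s z] by linarith
      qed
      hence "\<epsilon> < ?a + ?b" using True by (simp add: bad_def sum.distrib)
      then consider "\<epsilon> / 2 \<le> ?a" | "\<epsilon> / 2 \<le> ?b" by linarith
      thus ?thesis
      proof cases
        case 1
        hence "1 \<le> 2 / \<epsilon> * ?a" using \<epsilon> by (simp add: field_simps)
        thus ?thesis using B0 a True by simp
      next
        case 2
        hence "(\<epsilon> / 2)\<^sup>2 \<le> ?b\<^sup>2" using \<epsilon> by (intro power_mono) auto
        hence "(\<epsilon> / 2)\<^sup>2 \<le> n * (\<Sum>z<n. (sw \<omega> s x z - inlaw \<omega> s z)\<^sup>2)" using b by linarith
        hence "1 \<le> ?B" using \<epsilon> by (simp add: field_simps power2_eq_square)
        thus ?thesis using A0 True by simp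
      qed
    next
      case False thus ?thesis using A0 B0 by simp
    qed
  qed
  have "mean (\<lambda>\<omega>. real (card (bad \<omega> s \<epsilon>))) = mean (\<lambda>\<omega>. \<Sum>x<n. of_bool (x \<in> bad \<omega> s \<epsilon>))"
  proof (intro mean_cong)
    fix \<omega>
    have "(\<Sum>x<n. of_bool (x \<in> bad \<omega> s \<epsilon>)) = real (card ({..<n} \<inter> bad \<omega> s \<epsilon>))"
      by (simp add: of_bool_def sum.If_cases Int_def)
    thus "real (card (bad \<omega> s \<epsilon>)) = (\<Sum>x<n. of_bool (x \<in> bad \<omega> s \<epsilon>))"
      using bad_sub by (simp add: Int_absorb1)
  qed
  also have "\<dots> \<le> mean (\<lambda>\<omega>. \<Sum>x<n. 2 / \<epsilon> * xav \<omega> s x (\<lambda>p z. of_bool (\<not> saw p z))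
      + 4 / \<epsilon>\<^sup>2 * n * (\<Sum>z<n. (sw \<omega> s x z - inlaw \<omega> s z)\<^sup>2))"
    using pw by (intro mean_mono sum_mono) auto
  also have "\<dots> = 2 / \<epsilon> * (\<Sum>x<n. mean (\<lambda>\<omega>. xav \<omega> s x (\<lambda>p z. of_bool (\<not> saw p z))))
      + 4 / \<epsilon>\<^sup>2 * n * (\<Sum>x<n. mean (\<lambda>\<omega>. \<Sum>z<n. (sw \<omega> s x z - inlaw \<omega> s z)\<^sup>2))"
    by (simp only: mean_sum mean_add mean_cmult sum.distrib sum_distrib_left)
  also have "\<dots> \<le> 2 / \<epsilon> * (n * (s * \<tau> (3 * s + 5))) + 4 / \<epsilon>\<^sup>2 * n * (n * (7 * \<Delta> * (1 / 2) ^ s + 19 * R s))"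
  proof (intro add_mono mult_left_mono local_mixing s n)
    have "(\<Sum>x<n. mean (\<lambda>\<omega>. xav \<omega> s x (\<lambda>p z. of_bool (\<not> saw p z)))) \<le> (\<Sum>x<n. s * \<tau> (3 * s + 5))"
      using mean_non_saw[OF _ n order_refl] by (intro sum_mono) auto
    thus "(\<Sum>x<n. mean (\<lambda>\<omega>. xav \<omega> s x (\<lambda>p z. of_bool (\<not> saw p z)))) \<le> n * (s * \<tau> (3 * s + 5))" by simp
  qed (use \<epsilon> in auto)
  finally show ?thesis .
qed

section \<open>Escaping the bad vertices\<close>

text \<open>The probability that the walk from \<open>x\<close> is in \<open>B\<close> at every time
  from 0 to \<open>k\<close>, both included.\<close>

primrec stay :: "(nat \<times> nat \<Rightarrow> nat \<times> nat) \<Rightarrow> nat set \<Rightarrow> nat \<Rightarrow> nat \<Rightarrow> real" where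
  "stay \<omega> B 0 x = of_bool (x \<in> B)"
| "stay \<omega> B (Suc k) x = (if x \<in> B then (\<Sum>l<dout x. stay \<omega> B k (fst (\<omega> (x, l)))) / dout x else 0)"

lemma stay_bounds: "0 \<le> stay \<omega> B k x \<and> stay \<omega> B k x \<le> 1"
  by (induction k arbitrary: x) (auto intro!: sum_div_le divide_nonneg_nonneg sum_nonneg)

lemma stay_out: "x \<notin> B \<Longrightarrow> stay \<omega> B k x = 0"
  by (cases k) auto

lemma stay_Suc_le:
  assumes "\<omega> \<in> \<Omega>" "x < n" shows "stay \<omega> B (Suc k) x \<le> stay \<omega> B k x"
  using assms(2)
proof (induction k arbitrary: x)
  case 0
  show ?case using stay_bounds[of \<omega> B "Suc 0" x] stay_out[of x B \<omega> "Suc 0"]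
    by (cases "x \<in> B") (auto simp del: stay.simps(2))
next
  case (Suc k)
  have "(\<Sum>l<dout x. stay \<omega> B (Suc k) (fst (\<omega> (x, l)))) / dout x \<le> (\<Sum>l<dout x. stay \<omega> B k (fst (\<omega> (x, l)))) / dout x"
    by (intro divide_right_mono sum_mono Suc.IH head_lt[OF assms(1)]) (use Suc.prems in \<open>auto simp: mem_E\<close>)
  thus ?case by (simp only: stay.simps(2)[of \<omega> B "Suc k" x] stay.simps(2)[of \<omega> B k x]) simp
qed

lemma stay_add_le:
  assumes w: "\<omega> \<in> \<Omega>" and b: "\<And>x. x < n \<Longrightarrow> stay \<omega> B b x \<le> c" and x: "x < n" and c: "0 \<le> c"
  shows "stay \<omega> B (a + b) x \<le> stay \<omega> B a x * c"
  using x
proof (induction a arbitrary: x)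
  case 0
  thus ?case using b[of x] stay_out[of x B \<omega> b] by auto
next
  case (Suc a)
  have "(\<Sum>l<dout x. stay \<omega> B (a + b) (fst (\<omega> (x, l)))) / dout x \<le> (\<Sum>l<dout x. stay \<omega> B a (fst (\<omega> (x, l))) * c) / dout x"
    by (intro divide_right_mono sum_mono Suc.IH head_lt[OF w]) (use Suc.prems in \<open>auto simp: mem_E\<close>)
  thus ?case by (simp add: sum_distrib_right)
qed

lemma stay_power:
  assumes w: "\<omega> \<in> \<Omega>" and b: "\<And>x. x < n \<Longrightarrow> stay \<omega> B b x \<le> c" and x: "x < n" and c: "0 \<le> c"
  shows "stay \<omega> B (j * b) x \<le> c ^ j"
  using x
proof (induction j arbitrary: x)
  case (Suc j)
  have "stay \<omega> B (b + j * b) x \<le> stay \<omega> B b x * c ^ j"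
    by (rule stay_add_le[OF w Suc.IH Suc.prems]) (use c in auto)
  also have "\<dots> \<le> c * c ^ j" using b[OF Suc.prems] c by (intro mult_right_mono) auto
  finally show ?case by simp
qed auto

definition locked :: "(nat \<times> nat \<Rightarrow> nat \<times> nat) \<Rightarrow> nat set \<Rightarrow> nat set" where
  "locked \<omega> S = {v \<in> S. \<forall>l<dout v. fst (\<omega> (v, l)) \<in> S}"

text \<open>The fraction 3/4 suits the union bound in \<open>mean_not_expanding\<close>: two tails
  at each of more than \<open>3 / 4 * card S\<close> vertices give an exponent above
  \<open>3 / 2 * card S\<close>, enough to beat the roughly \<open>n ^ card S\<close> choices of
  \<open>S\<close>.\<close>

definition expanding :: "(nat \<times> nat \<Rightarrow> nat \<times> nat) \<Rightarrow> nat \<Rightarrow> bool" where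
  "expanding \<omega> K \<longleftrightarrow> (\<forall>S. S \<subseteq> {..<n} \<and> S \<noteq> {} \<and> card S \<le> K \<longrightarrow> 4 * card (locked \<omega> S) \<le> 3 * card S)"

text \<open>Iterating \<open>locked\<close> shrinks a small set geometrically, so each of its vertices has a short
  path to the outside.\<close>
lemma stay_escape:
  assumes w: "\<omega> \<in> \<Omega>" and ex: "expanding \<omega> K" and B: "B \<subseteq> {..<n}" "card B \<le> K"
    and J: "(3 / 4 :: real) ^ j0 * K < 1" and x: "x < n"
  shows "stay \<omega> B j0 x \<le> 1 - 1 / real \<Delta> ^ j0"
proof -
  define L where "L j = (locked \<omega> ^^ j) B" for j
  have finB: "finite B" using B(1) finite_subset by blast
  have L_sub: "L j \<subseteq> B" for j by (induction j) (auto simp: L_def locked_def)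
  have L_card: "real (card (L j)) \<le> (3 / 4) ^ j * K" for j
  proof (induction j)
    case 0 thus ?case using B by (simp add: L_def)
  next
    case (Suc j)
    show ?case
    proof (cases "L j = {}")
      case True thus ?thesis by (simp add: L_def locked_def)
    next
      case False
      have "card (L j) \<le> card B" using L_sub finB by (intro card_mono) auto
      hence "4 * card (locked \<omega> (L j)) \<le> 3 * card (L j)"
        using ex False L_sub[of j] B by (auto simp: expanding_def)
      hence "real (card (L (Suc j))) \<le> 3 / 4 * card (L j)" by (simp add: L_def)
      also have "\<dots> \<le> 3 / 4 * ((3 / 4) ^ j * K)" using Suc.IH by simp
      finally show ?thesis by simp
    qed
  qed
  have D1: "1 \<le> real \<Delta>" using Delta_ge by simp
  have esc: "stay \<omega> B j x \<le> 1 - 1 / real \<Delta> ^ j" if "x < n" "x \<notin> L j" for j x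
    using that
  proof (induction j arbitrary: x)
    case 0 thus ?case by (simp add: L_def)
  next
    case (Suc j)
    show ?case
    proof (cases "x \<in> L j")
      case False
      have "stay \<omega> B (Suc j) x \<le> 1 - 1 / real \<Delta> ^ j"
        using stay_Suc_le[OF w Suc.prems(1), of B j] Suc.IH[OF Suc.prems(1) False] by linarith
      also have "\<dots> \<le> 1 - 1 / real \<Delta> ^ Suc j"
        using D1 power_increasing[of j "Suc j" "real \<Delta>"] by (intro diff_left_mono frac_le) auto
      finally show ?thesis .
    next
      case True
      then obtain l where l: "l < dout x" "fst (\<omega> (x, l)) \<notin> L j"
        using Suc.prems(2) by (auto simp: L_def locked_def)
      have xB: "x \<in> B" using True L_sub by blast
      let ?f = "\<lambda>l. stay \<omega> B j (fst (\<omega> (x, l)))"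
      have y: "?f l \<le> 1 - 1 / real \<Delta> ^ j"
        using Suc.IH[OF head_lt[OF w] l(2)] l(1) Suc.prems(1) by (simp add: mem_E)
      have d: "0 < real (dout x)" "real (dout x) \<le> \<Delta>" using degrees[OF Suc.prems(1)] by auto
      \<comment> \<open>Only the escaping tail improves on the trivial bound 1. Its weight is at
        least \<open>1 / \<Delta>\<close>, whence one factor \<open>\<Delta>\<close> per
        step.\<close>
      have "(\<Sum>l'<dout x. ?f l') \<le> (\<Sum>l'<dout x. 1 - (if l' = l then 1 / real \<Delta> ^ j else 0))"
        using y stay_bounds by (intro sum_mono) auto
      also have "\<dots> = dout x - 1 / real \<Delta> ^ j" using l(1) by (simp add: sum_subtractf)
      finally have "stay \<omega> B (Suc j) x \<le> (dout x - 1 / real \<Delta> ^ j) / dout x"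
        using xB by (simp add: divide_right_mono)
      also have "\<dots> = 1 - 1 / (real \<Delta> ^ j * dout x)" using d by (simp add: diff_divide_distrib)
      also have "\<dots> \<le> 1 - 1 / real \<Delta> ^ Suc j"
      proof -
        have "real \<Delta> ^ j * dout x \<le> real \<Delta> ^ Suc j" using d D1 by (simp add: mult.commute mult_right_mono)
        thus ?thesis using d D1 by (intro diff_left_mono frac_le) auto
      qed
      finally show ?thesis .
    qed
  qed
  have "card (L j0) = 0" using L_card[of j0] J by linarith
  hence "L j0 = {}" using L_sub finB finite_subset by (metis card_0_eq)
  thus ?thesis using esc[OF x, of j0] by simp
qed

text \<open>From a good vertex the law at time \<open>s\<close> is within \<open>\<epsilon>\<close>
  of \<open>inlaw \<omega> s\<close> in L1, and the probability of being in \<open>B\<close> after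
  \<open>k\<close> further steps is a test function with values between 0 and 1.\<close>

lemma good_return:
  assumes w: "\<omega> \<in> \<Omega>" and y: "y < n" "y \<notin> bad \<omega> s \<epsilon>" and B: "B \<subseteq> {..<n}"
    and mass: "(\<Sum>z\<in>B. inlaw \<omega> (s + k) z) \<le> \<delta>"
  shows "(\<Sum>z\<in>B. pr \<omega> (s + k) y z) \<le> \<epsilon> + \<delta>"
proof -
  have "(\<Sum>z\<in>B. pr \<omega> (s + k) y z) - (\<Sum>z\<in>B. inlaw \<omega> (s + k) z)
      = (\<Sum>z\<in>B. \<Sum>u<n. (pr \<omega> s y u - inlaw \<omega> s u) * pr \<omega> k u z)"
    by (simp add: pr_add[OF w y(1)] inlaw_add[OF w] left_diff_distrib sum_subtractf)
  also have "\<dots> = (\<Sum>u<n. (pr \<omega> s y u - inlaw \<omega> s u) * (\<Sum>z\<in>B. pr \<omega> k u z))"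
    by (subst sum.swap) (simp add: sum_distrib_left)
  also have "\<dots> \<le> (\<Sum>u<n. \<bar>pr \<omega> s y u - inlaw \<omega> s u\<bar> * 1)"
  proof (intro sum_mono)
    fix u assume "u \<in> {..<n}"
    hence u: "(\<Sum>z<n. pr \<omega> k u z) = 1" using pr_sum[OF w] by simp
    have "(\<Sum>z\<in>B. pr \<omega> k u z) \<le> (\<Sum>z<n. pr \<omega> k u z)"
      using B by (intro sum_mono2) (auto simp: pr_nonneg)
    moreover have "0 \<le> (\<Sum>z\<in>B. pr \<omega> k u z)" by (intro sum_nonneg pr_nonneg)
    ultimately show "(pr \<omega> s y u - inlaw \<omega> s u) * (\<Sum>z\<in>B. pr \<omega> k u z) \<le> \<bar>pr \<omega> s y u - inlaw \<omega> s u\<bar> * 1"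
      using u by (intro mult_mono) auto
  qed
  also have "\<dots> \<le> \<epsilon>" using y by (simp add: bad_def)
  finally show ?thesis using mass by linarith
qed

text \<open>The walk is followed until it first leaves \<open>B\<close>. If that happens within
  \<open>k\<close> steps, \<open>good_return\<close> applies with a remaining time between
  \<open>s\<close> and \<open>s + k\<close>, which is why the mass of \<open>B\<close> must be small
  at all these times.\<close>

lemma bad_mass_stay:
  assumes w: "\<omega> \<in> \<Omega>" and B: "B = bad \<omega> s \<epsilon>"
    and mass: "\<And>t. s \<le> t \<Longrightarrow> t \<le> s + k \<Longrightarrow> (\<Sum>z\<in>B. inlaw \<omega> t z) \<le> \<delta>"
    and x: "x < n" and e: "0 \<le> \<epsilon> + \<delta>"
  shows "(\<Sum>z\<in>B. pr \<omega> (s + k) x z) \<le> stay \<omega> B k x + (\<epsilon> + \<delta>)"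
  using x mass
proof (induction k arbitrary: x)
  case (0 x)
  show ?case
  proof (cases "x \<in> B")
    case True
    have "(\<Sum>z\<in>B. pr \<omega> s x z) \<le> (\<Sum>z<n. pr \<omega> s x z)"
      using bad_sub B by (intro sum_mono2) (auto simp: pr_nonneg)
    thus ?thesis using pr_sum[OF w 0(1)] True e by simp
  next
    case False
    thus ?thesis using good_return[OF w 0(1), of s \<epsilon> B 0 \<delta>] 0(2)[of s] B bad_sub by simp
  qed
next
  case (Suc k)
  show ?case
  proof (cases "x \<in> B")
    case False
    have "(\<Sum>z\<in>B. pr \<omega> (s + Suc k) x z) \<le> \<epsilon> + \<delta>"
      by (rule good_return[OF w Suc.prems(1)]) (use False B bad_sub Suc.prems(2) in auto)
    thus ?thesis using stay_bounds[of \<omega> B "Suc k" x] by linarith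
  next
    case True
    have d: "0 < real (dout x)" using degrees[OF Suc.prems(1)] by auto
    have "(\<Sum>z\<in>B. pr \<omega> (s + Suc k) x z) = (\<Sum>l<dout x. \<Sum>z\<in>B. pr \<omega> (s + k) (fst (\<omega> (x, l))) z) / dout x"
      unfolding add_Suc_right pr_Suc[OF Suc.prems(1)] sum_divide_distrib[symmetric] by (subst sum.swap) simp
    also have "\<dots> \<le> (\<Sum>l<dout x. stay \<omega> B k (fst (\<omega> (x, l))) + (\<epsilon> + \<delta>)) / dout x"
      by (intro divide_right_mono sum_mono Suc.IH head_lt[OF w]) (use Suc.prems in \<open>auto simp: mem_E\<close>)
    also have "\<dots> = stay \<omega> B (Suc k) x + (\<epsilon> + \<delta>)"
      using True d by (simp add: sum.distrib add_divide_distrib)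
    finally show ?thesis .
  qed
qed

text \<open>At time \<open>T\<close> the walk is at a good vertex except with probability
  \<open>\<theta>\<close>; on the exceptional part the trivial L1 bound 2 is used.\<close>

lemma uniform_mixing:
  assumes w: "\<omega> \<in> \<Omega>" and B: "B = bad \<omega> s \<epsilon>" and x: "x < n" and \<epsilon>: "0 \<le> \<epsilon>"
    and mass: "(\<Sum>z\<in>B. pr \<omega> T x z) \<le> \<theta>"
  shows "(\<Sum>z<n. \<bar>pr \<omega> (T + s) x z - inlaw \<omega> s z\<bar>) \<le> \<epsilon> + 2 * \<theta>"
proof -
  have two: "(\<Sum>z<n. \<bar>pr \<omega> s y z - inlaw \<omega> s z\<bar>) \<le> \<epsilon> + 2 * of_bool (y \<in> B)" if y: "y < n" for y
  proof (cases "y \<in> B")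
    case True
    have "(\<Sum>z<n. \<bar>pr \<omega> s y z - inlaw \<omega> s z\<bar>) \<le> (\<Sum>z<n. pr \<omega> s y z + inlaw \<omega> s z)"
    proof (intro sum_mono)
      fix z
      show "\<bar>pr \<omega> s y z - inlaw \<omega> s z\<bar> \<le> pr \<omega> s y z + inlaw \<omega> s z"
        using pr_nonneg[of z \<omega> s y] inlaw_nonneg[of \<omega> s z] by linarith
    qed
    thus ?thesis using True \<epsilon> pr_sum[OF w y] inlaw_sum[OF w] by (simp add: sum.distrib)
  next
    case False thus ?thesis using y B by (simp add: bad_def)
  qed
  have "(\<Sum>z<n. \<bar>pr \<omega> (T + s) x z - inlaw \<omega> s z\<bar>)
      = (\<Sum>z<n. \<bar>\<Sum>y<n. pr \<omega> T x y * (pr \<omega> s y z - inlaw \<omega> s z)\<bar>)"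
    using pr_sum[OF w x] pr_add[OF w x]
    by (simp add: right_diff_distrib sum_subtractf flip: sum_distrib_right)
  also have "\<dots> \<le> (\<Sum>z<n. \<Sum>y<n. pr \<omega> T x y * \<bar>pr \<omega> s y z - inlaw \<omega> s z\<bar>)"
  proof (intro sum_mono order_trans[OF sum_abs])
    fix z y
    show "\<bar>pr \<omega> T x y * (pr \<omega> s y z - inlaw \<omega> s z)\<bar> \<le> pr \<omega> T x y * \<bar>pr \<omega> s y z - inlaw \<omega> s z\<bar>"
      using pr_nonneg[of y \<omega> T x] by (simp add: abs_mult)
  qed
  also have "\<dots> = (\<Sum>y<n. pr \<omega> T x y * (\<Sum>z<n. \<bar>pr \<omega> s y z - inlaw \<omega> s z\<bar>))"
    by (subst sum.swap) (simp add: sum_distrib_left)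
  also have "\<dots> \<le> (\<Sum>y<n. pr \<omega> T x y * (\<epsilon> + 2 * of_bool (y \<in> B)))"
    using two pr_nonneg by (intro sum_mono mult_left_mono) auto
  also have "\<dots> = \<epsilon> * (\<Sum>y<n. pr \<omega> T x y) + 2 * (\<Sum>y<n. pr \<omega> T x y * of_bool (y \<in> B))"
  proof -
    have "pr \<omega> T x y * (\<epsilon> + 2 * of_bool (y \<in> B)) = \<epsilon> * pr \<omega> T x y + 2 * (pr \<omega> T x y * of_bool (y \<in> B))" for y
      by algebra
    thus ?thesis by (simp only: sum.distrib sum_distrib_left)
  qed
  also have "(\<Sum>y<n. pr \<omega> T x y * of_bool (y \<in> B)) = (\<Sum>y\<in>B. pr \<omega> T x y)"
    using bad_sub[of \<omega> s \<epsilon>] B by (simp add: of_bool_def if_distrib[of "\<lambda>c. _ * c"] sum.If_cases Int_absorb1 cong: if_cong)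
  finally show ?thesis using pr_sum[OF w x] mass by simp
qed

section \<open>Invariant laws of a uniformly mixing walk\<close>

definition invariant :: "(nat \<times> nat \<Rightarrow> nat \<times> nat) \<Rightarrow> (nat \<Rightarrow> real) \<Rightarrow> bool" where
  "invariant \<omega> \<pi> \<longleftrightarrow> (\<forall>i. i \<ge> n \<longrightarrow> \<pi> i = 0) \<and> (\<forall>i<n. 0 \<le> \<pi> i) \<and> (\<Sum>i<n. \<pi> i) = 1 \<and>
     (\<forall>j<n. (\<Sum>i<n. \<pi> i * pr \<omega> 1 i j) = \<pi> j)"

lemma invariant_pow:
  assumes w: "\<omega> \<in> \<Omega>" and inv: "invariant \<omega> \<pi>" and j: "j < n"
  shows "(\<Sum>i<n. \<pi> i * pr \<omega> k i j) = \<pi> j"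
  using j
proof (induction k arbitrary: j)
  case 0
  thus ?case by (simp add: of_bool_def if_distrib[of "\<lambda>c. _ * c"] cong: if_cong)
next
  case (Suc k)
  have "(\<Sum>i<n. \<pi> i * pr \<omega> (k + 1) i j) = (\<Sum>i<n. \<Sum>y<n. \<pi> i * pr \<omega> k i y * pr \<omega> 1 y j)"
    using pr_add[OF w, of _ j k 1] by (intro sum.cong refl) (simp add: sum_distrib_left mult.assoc del: hit.simps)
  also have "\<dots> = (\<Sum>y<n. (\<Sum>i<n. \<pi> i * pr \<omega> k i y) * pr \<omega> 1 y j)"
    by (subst sum.swap) (simp only: sum_distrib_right)
  also have "\<dots> = (\<Sum>y<n. \<pi> y * pr \<omega> 1 y j)" using Suc.IH by (intro sum.cong refl) simp
  also have "\<dots> = \<pi> j" using inv Suc.prems by (simp add: invariant_def)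
  finally show ?case by simp
qed

text \<open>On vectors of total mass zero, \<open>\<beta>\<close> can be subtracted from every row
  for free, so the \<open>N\<close>-step kernel contracts the L1 norm by \<open>c\<close>. For
  \<open>c < 1\<close> this yields both uniqueness and existence of the invariant law.\<close>

lemma contraction:
  assumes mix: "\<And>x. x < n \<Longrightarrow> (\<Sum>z<n. \<bar>pr \<omega> N x z - \<beta> z\<bar>) \<le> c" and d: "(\<Sum>x<n. d x) = 0"
  shows "(\<Sum>z<n. \<bar>\<Sum>x<n. d x * pr \<omega> N x z\<bar>) \<le> c * (\<Sum>x<n. \<bar>d x\<bar>)"
proof -
  have "(\<Sum>z<n. \<bar>\<Sum>x<n. d x * pr \<omega> N x z\<bar>) = (\<Sum>z<n. \<bar>\<Sum>x<n. d x * (pr \<omega> N x z - \<beta> z)\<bar>)"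
    using d by (simp add: right_diff_distrib sum_subtractf flip: sum_distrib_right)
  also have "\<dots> \<le> (\<Sum>z<n. \<Sum>x<n. \<bar>d x\<bar> * \<bar>pr \<omega> N x z - \<beta> z\<bar>)"
    by (intro sum_mono order_trans[OF sum_abs]) (simp add: abs_mult)
  also have "\<dots> = (\<Sum>x<n. \<bar>d x\<bar> * (\<Sum>z<n. \<bar>pr \<omega> N x z - \<beta> z\<bar>))"
    by (subst sum.swap) (simp add: sum_distrib_left)
  also have "\<dots> \<le> (\<Sum>x<n. \<bar>d x\<bar> * c)" using mix by (intro sum_mono mult_left_mono) auto
  finally show ?thesis by (simp add: sum_distrib_left mult.commute)
qed

lemma invariant_unique:
  assumes w: "\<omega> \<in> \<Omega>" and mix: "\<And>x. x < n \<Longrightarrow> (\<Sum>z<n. \<bar>pr \<omega> N x z - \<beta> z\<bar>) \<le> c" and c: "c < 1"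
    and \<pi>: "invariant \<omega> \<pi>" "invariant \<omega> \<pi>'"
  shows "\<pi> = \<pi>'"
proof -
  let ?d = "\<lambda>x. \<pi> x - \<pi>' x"
  have "(\<Sum>x<n. ?d x) = 0" using \<pi> by (simp add: invariant_def sum_subtractf)
  from contraction[OF mix this]
  have le: "(\<Sum>z<n. \<bar>\<Sum>x<n. ?d x * pr \<omega> N x z\<bar>) \<le> c * (\<Sum>x<n. \<bar>?d x\<bar>)" by simp
  have d: "(\<Sum>x<n. ?d x * pr \<omega> N x z) = ?d z" if "z < n" for z
    using invariant_pow[OF w \<pi>(1) that] invariant_pow[OF w \<pi>(2) that]
    by (simp add: left_diff_distrib sum_subtractf)
  define S where "S = (\<Sum>x<n. \<bar>?d x\<bar>)"
  have "(\<Sum>z<n. \<bar>\<Sum>x<n. ?d x * pr \<omega> N x z\<bar>) = S"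
    unfolding S_def by (intro sum.cong refl arg_cong[where f = abs] d) simp
  hence "S \<le> c * S" using le by (simp only: S_def)
  moreover have "0 \<le> S" unfolding S_def by (intro sum_nonneg) simp
  ultimately have "S = 0" using mult_strict_right_mono[OF c, of S] by linarith
  hence "?d x = 0" if "x < n" for x
    using that unfolding S_def by (subst (asm) sum_nonneg_eq_0_iff) auto
  moreover have "?d x = 0" if "x \<ge> n" for x using that \<pi> by (simp add: invariant_def)
  ultimately show ?thesis by (metis eq_iff_diff_eq_0 ext not_le)
qed

lemma invariant_near:
  assumes w: "\<omega> \<in> \<Omega>" and mix: "\<And>x. x < n \<Longrightarrow> (\<Sum>z<n. \<bar>pr \<omega> N x z - \<beta> z\<bar>) \<le> c"
    and \<pi>: "invariant \<omega> \<pi>"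
  shows "(\<Sum>z<n. \<bar>\<pi> z - \<beta> z\<bar>) \<le> c"
proof -
  have s1: "(\<Sum>x<n. \<pi> x) = 1" and nn: "\<And>x. x < n \<Longrightarrow> 0 \<le> \<pi> x" using \<pi> by (auto simp: invariant_def)
  have "(\<Sum>z<n. \<bar>\<pi> z - \<beta> z\<bar>) = (\<Sum>z<n. \<bar>\<Sum>x<n. \<pi> x * (pr \<omega> N x z - \<beta> z)\<bar>)"
    using invariant_pow[OF w \<pi>] s1 by (simp add: right_diff_distrib sum_subtractf flip: sum_distrib_right)
  also have "\<dots> \<le> (\<Sum>z<n. \<Sum>x<n. \<pi> x * \<bar>pr \<omega> N x z - \<beta> z\<bar>)"
    using nn by (intro sum_mono order_trans[OF sum_abs]) (simp add: abs_mult)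
  also have "\<dots> = (\<Sum>x<n. \<pi> x * (\<Sum>z<n. \<bar>pr \<omega> N x z - \<beta> z\<bar>))"
    by (subst sum.swap) (simp add: sum_distrib_left)
  also have "\<dots> \<le> (\<Sum>x<n. \<pi> x * c)" using mix nn by (intro sum_mono mult_left_mono) auto
  finally show ?thesis using s1 by (simp flip: sum_distrib_right)
qed

lemma invariant_exists:
  assumes w: "\<omega> \<in> \<Omega>" and mix: "\<And>x. x < n \<Longrightarrow> (\<Sum>z<n. \<bar>pr \<omega> N x z - \<beta> z\<bar>) \<le> c" and c: "c < 1"
  shows "\<exists>\<pi>. invariant \<omega> \<pi>"
proof -
  have "0 \<le> (\<Sum>z<n. \<bar>pr \<omega> N 0 z - \<beta> z\<bar>)" by (intro sum_nonneg) simp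
  hence c0: "0 \<le> c" using mix[OF n_pos] by linarith
  let ?v = "\<lambda>k z. pr \<omega> k 0 z"
  \<comment> \<open>The laws at times \<open>r\<close> and \<open>0\<close> differ by a vector of
    total mass zero, which is then contracted \<open>i\<close> times. General \<open>r\<close> gives
    the Cauchy property along multiples of \<open>N\<close>, and \<open>r = 1\<close> shows that the
    limit is invariant.\<close>
  have near: "(\<Sum>z<n. \<bar>?v (i * N + r) z - ?v (i * N) z\<bar>) \<le> 2 * c ^ i" for i r
  proof (induction i)
    case 0
    have "(\<Sum>z<n. \<bar>?v r z - ?v 0 z\<bar>) \<le> (\<Sum>z<n. ?v r z + ?v 0 z)"
    proof (intro sum_mono)
      fix z
      show "\<bar>?v r z - ?v 0 z\<bar> \<le> ?v r z + ?v 0 z"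
        using pr_nonneg[of z \<omega> r 0] pr_nonneg[of z \<omega> 0 0] by linarith
    qed
    also have "\<dots> = 2" using pr_sum[OF w n_pos, of r] pr_sum[OF w n_pos, of 0] by (simp only: sum.distrib)
    finally show ?case by simp
  next
    case (Suc i)
    let ?d = "\<lambda>x. ?v (i * N + r) x - ?v (i * N) x"
    have d0: "(\<Sum>x<n. ?d x) = 0" using pr_sum[OF w n_pos] by (simp add: sum_subtractf)
    have "?v (Suc i * N + r) z - ?v (Suc i * N) z = (\<Sum>x<n. ?d x * pr \<omega> N x z)" for z
      using pr_add[OF w n_pos, of z "i * N + r" N] pr_add[OF w n_pos, of z "i * N" N]
      by (simp add: algebra_simps sum_subtractf)
    hence "(\<Sum>z<n. \<bar>?v (Suc i * N + r) z - ?v (Suc i * N) z\<bar>) \<le> c * (\<Sum>x<n. \<bar>?d x\<bar>)"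
      using contraction[OF mix d0] by simp
    also have "\<dots> \<le> c * (2 * c ^ i)" using Suc.IH c0 by (intro mult_left_mono)
    finally show ?case by simp
  qed
  have nearz: "\<bar>?v (i * N + r) z - ?v (i * N) z\<bar> \<le> 2 * c ^ i" if "z < n" for i r z
  proof -
    have "\<bar>?v (i * N + r) z - ?v (i * N) z\<bar> \<le> (\<Sum>z<n. \<bar>?v (i * N + r) z - ?v (i * N) z\<bar>)"
      using that by (intro member_le_sum) auto
    thus ?thesis using near[of i r] by linarith
  qed
  have c_lim: "(\<lambda>i. 2 * c ^ i) \<longlonglongrightarrow> 0"
    using LIMSEQ_realpow_zero[OF c0 c] tendsto_mult_right_zero by blast
  have conv: "convergent (\<lambda>i. ?v (i * N) z)" if z: "z < n" for z
  proof (rule Cauchy_convergent, rule CauchyI)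
    fix e :: real assume "0 < e"
    then obtain M where M: "\<And>i. i \<ge> M \<Longrightarrow> \<bar>2 * c ^ i\<bar> < e / 2"
      using LIMSEQ_D[OF c_lim, of "e / 2"] by auto
    have "\<bar>?v (i * N) z - ?v (M * N) z\<bar> < e / 2" if "i \<ge> M" for i
    proof -
      have "i * N = M * N + (i - M) * N" using that by (simp add: algebra_simps flip: diff_mult_distrib)
      thus ?thesis using nearz[OF z, of M "(i - M) * N"] M[of M] by simp
    qed
    hence "\<bar>?v (i * N) z - ?v (j * N) z\<bar> < e" if "i \<ge> M" "j \<ge> M" for i j
      using that by (smt (verit, best) field_sum_of_halves)
    thus "\<exists>M. \<forall>i\<ge>M. \<forall>j\<ge>M. norm (?v (i * N) z - ?v (j * N) z) < e" by auto
  qed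
  define \<pi> where "\<pi> z = (if z < n then lim (\<lambda>i. ?v (i * N) z) else 0)" for z
  have lim: "(\<lambda>i. ?v (i * N) z) \<longlonglongrightarrow> \<pi> z" if "z < n" for z
    using conv[OF that] that by (simp add: \<pi>_def convergent_LIMSEQ_iff)
  have "0 \<le> \<pi> z" if "z < n" for z
    by (rule LIMSEQ_le_const[OF lim[OF that]]) (auto simp: pr_nonneg)
  moreover have "(\<Sum>z<n. \<pi> z) = 1"
  proof -
    have "(\<lambda>i. \<Sum>z<n. ?v (i * N) z) \<longlonglongrightarrow> (\<Sum>z<n. \<pi> z)" by (intro tendsto_sum lim) simp
    hence "(\<lambda>i. 1) \<longlonglongrightarrow> (\<Sum>z<n. \<pi> z)" unfolding pr_sum[OF w n_pos] .
    thus ?thesis by (rule LIMSEQ_unique) (rule tendsto_const)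
  qed
  moreover have "(\<Sum>i<n. \<pi> i * pr \<omega> 1 i j) = \<pi> j" if j: "j < n" for j
  proof -
    have "(\<lambda>i. \<Sum>y<n. ?v (i * N) y * pr \<omega> 1 y j) \<longlonglongrightarrow> (\<Sum>y<n. \<pi> y * pr \<omega> 1 y j)"
      by (intro tendsto_sum tendsto_mult lim tendsto_const) simp
    hence a: "(\<lambda>i. ?v (i * N + 1) j) \<longlonglongrightarrow> (\<Sum>y<n. \<pi> y * pr \<omega> 1 y j)"
      unfolding pr_add[OF w n_pos] .
    have "(\<lambda>i. ?v (i * N + 1) j - ?v (i * N) j) \<longlonglongrightarrow> 0"
      by (rule Lim_null_comparison[OF _ c_lim]) (use nearz[OF j, of _ 1] in auto)
    from tendsto_add[OF this lim[OF j]] have "(\<lambda>i. ?v (i * N + 1) j) \<longlonglongrightarrow> \<pi> j" by simp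
    with a show ?thesis by (rule LIMSEQ_unique)
  qed
  ultimately have "invariant \<omega> \<pi>" by (auto simp: invariant_def \<pi>_def)
  thus ?thesis by blast
qed

section \<open>Expansion of small vertex sets\<close>

lemma targets_prob:
  assumes "finite G" "G \<subseteq> E - D" "D \<subseteq> E" "\<omega>0 \<in> \<Omega>" "finite S" "card D + card G \<le> n"
  shows "\<EE> D (\<lambda>\<omega>. of_bool (\<forall>e\<in>G. fst (\<omega> e) \<in> S)) \<omega>0 \<le> (real \<Delta> * card S / n) ^ card G"
  using assms(1,2,3,4,6)
proof (induction G arbitrary: D \<omega>0 rule: finite_induct)
  case empty thus ?case by (simp add: cexp_const)
next
  case (insert e G)
  let ?q = "real \<Delta> * card S / n"
  have finD: "finite D" using insert.prems finite_E finite_subset by blast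
  have eD: "e \<notin> D" using insert.prems by auto
  have "\<EE> D (\<lambda>\<omega>. of_bool (\<forall>e\<in>insert e G. fst (\<omega> e) \<in> S)) \<omega>0
      = \<EE> D (\<lambda>\<omega>. (\<lambda>\<omega> u. of_bool (u \<in> S) * of_bool (\<forall>e\<in>G. fst (\<omega> e) \<in> S)) \<omega> (fst (\<omega> e))) \<omega>0"
    by (intro cexp_cong) simp
  also have "\<dots> \<le> 0 + ?q * ?q ^ card G"
  proof (rule reveal_bound[where X = S])
    fix \<omega>1 assume "\<omega>1 \<in> agr D \<omega>0"
    hence w1: "\<omega>1 \<in> \<Omega>" by (rule agr_bijs)
    show "\<EE> (insert e D) (\<lambda>\<omega>. of_bool (fst (\<omega>1 e) \<in> S) * of_bool (\<forall>e\<in>G. fst (\<omega> e) \<in> S)) \<omega>1 \<le> 0 + ?q ^ card G"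
      if "fst (\<omega>1 e) \<in> S"
    proof -
      have "\<EE> (insert e D) (\<lambda>\<omega>. of_bool (\<forall>e\<in>G. fst (\<omega> e) \<in> S)) \<omega>1 \<le> ?q ^ card G"
        by (rule insert.IH) (use insert.prems insert.hyps w1 finD eD in auto)
      thus ?thesis using that by simp
    qed
    show "\<EE> (insert e D) (\<lambda>\<omega>. of_bool (fst (\<omega>1 e) \<in> S) * of_bool (\<forall>e\<in>G. fst (\<omega> e) \<in> S)) \<omega>1 \<le> 0"
      if "fst (\<omega>1 e) \<notin> S" using that w1 by (simp add: cexp_const)
  qed (use insert.prems assms(5) in auto)
  finally show ?case using insert.hyps by simp
qed

text \<open>Union bound over \<open>S\<close> and a subset \<open>O'\<close> of more than
  \<open>3 / 4 * card S\<close> vertices. If all of \<open>O'\<close> is locked, two tails of each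
  of its vertices land in \<open>S\<close>, with probability at most
  \<open>y ^ (4 * card O')\<close>, hence at most \<open>y ^ (3 * card S)\<close>. There are at most
  \<open>2 ^ card S\<close> choices of \<open>O'\<close>, and the sum over nonempty \<open>S\<close>
  is the binomial expression. The square root \<open>y\<close> keeps the exponents integral.\<close>

lemma mean_not_expanding:
  assumes K: "2 * K \<le> n" "\<Delta> * K \<le> n" and y: "0 \<le> y" "y \<le> 1" "y\<^sup>2 = real \<Delta> * K / n"
  shows "mean (\<lambda>\<omega>. of_bool (\<not> expanding \<omega> K)) \<le> (1 + 2 * y ^ 3) ^ n - 1"
proof -
  let ?SS = "{S \<in> Pow {..<n}. S \<noteq> {} \<and> card S \<le> K}"
  let ?OO = "\<lambda>S. {O' \<in> Pow S. 4 * card O' > 3 * card S}"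
  let ?ev = "\<lambda>\<omega> S O'. of_bool (\<forall>e\<in>O' \<times> {..<2}. fst (\<omega> e) \<in> S) :: real"
  have finS: "finite ?SS" by simp
  have one: "mean (\<lambda>\<omega>. ?ev \<omega> S O') \<le> y ^ (3 * card S)" if S: "S \<in> ?SS" and O': "O' \<in> ?OO S" for S O'
  proof -
    obtain \<omega>0 where w: "\<omega>0 \<in> \<Omega>" using bijs_nonempty by blast
    have fin: "finite S" "finite O'" and O'S: "O' \<subseteq> S" using S O' finite_subset by fastforce+
    have cO: "card O' \<le> card S" using fin O'S by (intro card_mono)
    have "mean (\<lambda>\<omega>. ?ev \<omega> S O') \<le> (real \<Delta> * card S / n) ^ card (O' \<times> {..<2::nat})"
      unfolding mean_cexp[of _ \<omega>0]
    proof (rule targets_prob)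
      show "O' \<times> {..<2} \<subseteq> E - {}" using S O' degrees by (fastforce simp: E_def)
    qed (use fin w S K cO in \<open>auto simp: card_cartesian_product\<close>)
    also have "\<dots> = (real \<Delta> * card S / n) ^ (2 * card O')" by (simp add: card_cartesian_product mult.commute)
    also have "\<dots> \<le> (y\<^sup>2) ^ (2 * card O')"
      unfolding y(3) using S by (intro power_mono divide_right_mono mult_left_mono) auto
    also have "\<dots> = y ^ (4 * card O')" by (simp flip: power_mult)
    also have "\<dots> \<le> y ^ (3 * card S)" using O' y by (intro power_decreasing) auto
    finally show ?thesis .
  qed
  have "mean (\<lambda>\<omega>. of_bool (\<not> expanding \<omega> K)) \<le> mean (\<lambda>\<omega>. \<Sum>S\<in>?SS. \<Sum>O'\<in>?OO S. ?ev \<omega> S O')"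
  proof (rule mean_mono)
    fix \<omega> assume w: "\<omega> \<in> \<Omega>"
    have nn: "0 \<le> (\<Sum>S\<in>?SS. \<Sum>O'\<in>?OO S. ?ev \<omega> S O')" by (intro sum_nonneg) auto
    show "of_bool (\<not> expanding \<omega> K) \<le> (\<Sum>S\<in>?SS. \<Sum>O'\<in>?OO S. ?ev \<omega> S O')"
    proof (cases "expanding \<omega> K")
      case False
      then obtain S where S: "S \<in> ?SS" and L: "4 * card (locked \<omega> S) > 3 * card S"
        by (auto simp: expanding_def not_le)
      have "finite S" using S finite_subset by auto
      hence LO: "locked \<omega> S \<in> ?OO S" "finite (?OO S)" using L by (auto simp: locked_def)
      have "dout v \<ge> 2" if "v \<in> S" for v using that S degrees[of v] by auto
      hence "?ev \<omega> S (locked \<omega> S) = 1" by (fastforce simp: locked_def)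
      hence "1 \<le> (\<Sum>O'\<in>?OO S. ?ev \<omega> S O')"
        using member_le_sum[OF LO(1), of "?ev \<omega> S"] LO(2) by simp
      also have "\<dots> \<le> (\<Sum>S\<in>?SS. \<Sum>O'\<in>?OO S. ?ev \<omega> S O')"
        by (rule member_le_sum[OF S _ finS]) (auto intro!: sum_nonneg)
      finally show ?thesis using False by simp
    qed (use nn in simp)
  qed
  also have "\<dots> = (\<Sum>S\<in>?SS. \<Sum>O'\<in>?OO S. mean (\<lambda>\<omega>. ?ev \<omega> S O'))"
    by (simp only: mean_sum)
  also have "\<dots> \<le> (\<Sum>S\<in>?SS. \<Sum>O'\<in>?OO S. y ^ (3 * card S))"
    by (intro sum_mono one)
  also have "\<dots> \<le> (\<Sum>S\<in>?SS. (2 * y ^ 3) ^ card S)"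
  proof (intro sum_mono)
    fix S assume S: "S \<in> ?SS"
    hence fin: "finite S" using finite_subset by auto
    have "card (?OO S) \<le> card (Pow S)" using fin by (intro card_mono) auto
    hence "real (card (?OO S)) \<le> 2 ^ card S" using fin by (simp add: card_Pow flip: of_nat_le_iff)
    hence "real (card (?OO S)) * y ^ (3 * card S) \<le> 2 ^ card S * y ^ (3 * card S)"
      using y by (intro mult_right_mono) auto
    thus "(\<Sum>O'\<in>?OO S. y ^ (3 * card S)) \<le> (2 * y ^ 3) ^ card S"
      by (simp add: power_mult_distrib power_mult)
  qed
  also have "\<dots> \<le> (\<Sum>S\<in>Pow {..<n} - {{}}. (2 * y ^ 3) ^ card S)"
    using y by (intro sum_mono2) auto
  also have "\<dots> = (\<Sum>S\<in>Pow {..<n}. (2 * y ^ 3) ^ card S) - 1"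
    by (subst sum_diff1) auto
  also have "(\<Sum>S\<in>Pow {..<n}. (2 * y ^ 3) ^ card S) = (1 + 2 * y ^ 3) ^ n"
    using prod_add[of "{..<n}" "\<lambda>_. 2 * y ^ 3" "\<lambda>_. 1"] by (simp add: add.commute)
  finally show ?thesis .
qed

section \<open>Probability that the invariant law is close to a law of bounded time\<close>

lemma mean_markov:
  assumes "0 < c" "\<And>\<omega>. \<omega> \<in> \<Omega> \<Longrightarrow> 0 \<le> X \<omega>"
  shows "mean (\<lambda>\<omega>. of_bool (X \<omega> > c)) \<le> mean X / c"
proof -
  have "mean (\<lambda>\<omega>. of_bool (X \<omega> > c)) \<le> mean (\<lambda>\<omega>. (1 / c) * X \<omega>)"
    using assms by (intro mean_mono) (auto simp: field_simps)
  thus ?thesis by (simp only: mean_cmult) simp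
qed

lemma inlaw_mass_small:
  assumes B: "B \<subseteq> {..<n}" "card B \<le> K" and e: "0 \<le> \<epsilon>" and le: "K * (\<Sum>z<n. (inlaw \<omega> t z)\<^sup>2) \<le> \<epsilon>\<^sup>2"
  shows "(\<Sum>z\<in>B. inlaw \<omega> t z) \<le> \<epsilon>"
proof (rule power2_le_imp_le[OF _ e])
  have "(\<Sum>z\<in>B. inlaw \<omega> t z)\<^sup>2 \<le> card B * (\<Sum>z\<in>B. (inlaw \<omega> t z)\<^sup>2)"
    using Cauchy_Schwarz_ineq_sum[of "\<lambda>_. 1" "inlaw \<omega> t" B] by simp
  also have "\<dots> \<le> K * (\<Sum>z<n. (inlaw \<omega> t z)\<^sup>2)"
    using B by (intro mult_mono sum_mono2 sum_nonneg) auto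
  finally show "(\<Sum>z\<in>B. inlaw \<omega> t z)\<^sup>2 \<le> \<epsilon>\<^sup>2" using le by linarith
qed

text \<open>At time \<open>?T\<close> the bad vertices carry at most \<open>3 * \<epsilon>\<close>:
  one \<open>\<epsilon>\<close> for never having escaped, two from \<open>bad_mass_stay\<close>.
  With \<open>uniform_mixing\<close> this gives \<open>\<epsilon> + 2 * (3 * \<epsilon>)\<close>.
  The hypothesis \<open>mass\<close> adds up all times, so that a single application of Markov's
  inequality will control them together.\<close>

lemma stationary_close:
  assumes w: "\<omega> \<in> \<Omega>" and ex: "expanding \<omega> K" and bad: "card (bad \<omega> s \<epsilon>) \<le> K"
    and mass: "K * (\<Sum>t\<le>s + j * j0. \<Sum>z<n. (inlaw \<omega> t z)\<^sup>2) \<le> \<epsilon>\<^sup>2"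
    and j0: "(3 / 4 :: real) ^ j0 * K < 1" and j: "(1 - 1 / real \<Delta> ^ j0) ^ j \<le> \<epsilon>" and \<epsilon>: "0 < \<epsilon>" "7 * \<epsilon> < 1"
  shows "\<exists>\<pi>. invariant \<omega> \<pi> \<and> (\<forall>\<pi>'. invariant \<omega> \<pi>' \<longrightarrow> \<pi>' = \<pi>) \<and> (\<Sum>z<n. \<bar>\<pi> z - inlaw \<omega> s z\<bar>) \<le> 7 * \<epsilon>"
proof -
  let ?B = "bad \<omega> s \<epsilon>" and ?T = "s + j * j0"
  have m: "(\<Sum>z\<in>?B. inlaw \<omega> t z) \<le> \<epsilon>" if "t \<le> ?T" for t
  proof (rule inlaw_mass_small[OF bad_sub bad])
    have "(\<Sum>z<n. (inlaw \<omega> t z)\<^sup>2) \<le> (\<Sum>t\<le>?T. \<Sum>z<n. (inlaw \<omega> t z)\<^sup>2)"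
      using that by (intro member_le_sum sum_nonneg) auto
    hence "K * (\<Sum>z<n. (inlaw \<omega> t z)\<^sup>2) \<le> K * (\<Sum>t\<le>?T. \<Sum>z<n. (inlaw \<omega> t z)\<^sup>2)"
      by (rule mult_left_mono) simp
    thus "K * (\<Sum>z<n. (inlaw \<omega> t z)\<^sup>2) \<le> \<epsilon>\<^sup>2" using mass by linarith
  qed (use \<epsilon> in auto)
  have mix: "(\<Sum>z<n. \<bar>pr \<omega> (?T + s) x z - inlaw \<omega> s z\<bar>) \<le> 7 * \<epsilon>" if x: "x < n" for x
  proof -
    have "1 \<le> real \<Delta> ^ j0" using Delta_ge by (intro one_le_power) simp
    hence D1: "0 \<le> 1 - 1 / real \<Delta> ^ j0"
      unfolding diff_ge_0_iff_ge by (intro divide_le_eq_1[THEN iffD2]) linarith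
    have "stay \<omega> ?B (j * j0) x \<le> (1 - 1 / real \<Delta> ^ j0) ^ j"
      by (rule stay_power[OF w stay_escape[OF w ex bad_sub bad j0] x D1])
    moreover have "(\<Sum>z\<in>?B. pr \<omega> ?T x z) \<le> stay \<omega> ?B (j * j0) x + (\<epsilon> + \<epsilon>)"
      by (rule bad_mass_stay[OF w refl _ x]) (use m \<epsilon> in auto)
    ultimately have "(\<Sum>z\<in>?B. pr \<omega> ?T x z) \<le> 3 * \<epsilon>" using j by linarith
    from uniform_mixing[OF w refl x _ this] \<epsilon> show ?thesis by simp
  qed
  obtain \<pi> where \<pi>: "invariant \<omega> \<pi>" using invariant_exists[OF w mix \<epsilon>(2)] by blast
  have "\<pi>' = \<pi>" if "invariant \<omega> \<pi>'" for \<pi>' by (rule invariant_unique[OF w mix \<epsilon>(2) that \<pi>])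
  moreover have "(\<Sum>z<n. \<bar>\<pi> z - inlaw \<omega> s z\<bar>) \<le> 7 * \<epsilon>" by (rule invariant_near[OF w mix \<pi>])
  ultimately show ?thesis using \<pi> by blast
qed

definition near_stationary :: "(nat \<times> nat \<Rightarrow> nat \<times> nat) \<Rightarrow> nat \<Rightarrow> real \<Rightarrow> bool" where
  "near_stationary \<omega> h \<epsilon> \<longleftrightarrow> (\<exists>\<pi>. invariant \<omega> \<pi> \<and> (\<forall>\<pi>'. invariant \<omega> \<pi>' \<longrightarrow> \<pi>' = \<pi>) \<and>
     (\<Sum>z<n. \<bar>\<pi> z - inlaw \<omega> h z\<bar>) \<le> \<epsilon>)"

lemma near_stationaryI:
  assumes w: "\<omega> \<in> \<Omega>" and ex: "expanding \<omega> K" and bad: "card (bad \<omega> s \<epsilon>) \<le> K"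
    and mass: "K * (\<Sum>t\<le>s + j * j0. \<Sum>z<n. (inlaw \<omega> t z)\<^sup>2) \<le> \<epsilon>\<^sup>2"
    and j0: "(3 / 4 :: real) ^ j0 * K < 1" and j: "(1 - 1 / real \<Delta> ^ j0) ^ j \<le> \<epsilon>" and \<epsilon>: "0 < \<epsilon>" "7 * \<epsilon> < 1"
    and h: "n * (\<Sum>z<n. (inlaw \<omega> s z - inlaw \<omega> h z)\<^sup>2) \<le> \<epsilon>\<^sup>2"
  shows "near_stationary \<omega> h (8 * \<epsilon>)"
proof -
  obtain \<pi> where \<pi>: "invariant \<omega> \<pi>" "\<And>\<pi>'. invariant \<omega> \<pi>' \<Longrightarrow> \<pi>' = \<pi>"
      "(\<Sum>z<n. \<bar>\<pi> z - inlaw \<omega> s z\<bar>) \<le> 7 * \<epsilon>"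
    using stationary_close[OF w ex bad mass j0 j \<epsilon>] by blast
  have "(\<Sum>z<n. \<bar>inlaw \<omega> s z - inlaw \<omega> h z\<bar>) \<le> \<epsilon>"
  proof (rule power2_le_imp_le)
    have "(\<Sum>z<n. \<bar>inlaw \<omega> s z - inlaw \<omega> h z\<bar>)\<^sup>2 \<le> n * (\<Sum>z<n. (inlaw \<omega> s z - inlaw \<omega> h z)\<^sup>2)"
      using Cauchy_Schwarz_ineq_sum[of "\<lambda>_. 1" "\<lambda>z. \<bar>inlaw \<omega> s z - inlaw \<omega> h z\<bar>" "{..<n}"] by simp
    thus "(\<Sum>z<n. \<bar>inlaw \<omega> s z - inlaw \<omega> h z\<bar>)\<^sup>2 \<le> \<epsilon>\<^sup>2" using h by linarith
  qed (use \<epsilon> in simp)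
  moreover have "(\<Sum>z<n. \<bar>\<pi> z - inlaw \<omega> h z\<bar>) \<le> (\<Sum>z<n. \<bar>\<pi> z - inlaw \<omega> s z\<bar> + \<bar>inlaw \<omega> s z - inlaw \<omega> h z\<bar>)"
    by (intro sum_mono) linarith
  ultimately have "(\<Sum>z<n. \<bar>\<pi> z - inlaw \<omega> h z\<bar>) \<le> 8 * \<epsilon>" using \<pi>(3) by (simp add: sum.distrib)
  thus ?thesis using \<pi> unfolding near_stationary_def by blast
qed

text \<open>The four summands belong to four failures: expansion, too many bad vertices, a large
  second moment at some time up to \<open>T\<close>, and a large distance between the laws at times
  \<open>s\<close> and \<open>h\<close>.\<close>

lemma mean_not_near:
  assumes s: "1 \<le> s" "h \<le> s" and T: "T = s + j * j0" "3 * T + 5 \<le> n" and K: "1 \<le> K" "2 * K \<le> n" "\<Delta> * K \<le> n"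
    and y: "0 \<le> y" "y \<le> 1" "y\<^sup>2 = real \<Delta> * K / n"
    and j0: "(3 / 4 :: real) ^ j0 * K < 1" and j: "(1 - 1 / real \<Delta> ^ j0) ^ j \<le> \<epsilon>" and \<epsilon>: "0 < \<epsilon>" "7 * \<epsilon> < 1"
  shows "mean (\<lambda>\<omega>. of_bool (\<not> near_stationary \<omega> h (8 * \<epsilon>))) \<le>
     ((1 + 2 * y ^ 3) ^ n - 1)
     + (2 / \<epsilon> * (n * (s * \<tau> (3 * s + 5))) + 4 / \<epsilon>\<^sup>2 * n * (n * (7 * \<Delta> * (1 / 2) ^ s + 19 * R s))) / K
     + K * ((real T + 1) * ((real T + 2) * \<tau> (3 * T + 5))) / \<epsilon>\<^sup>2
     + (4 * \<Delta> * (1 / 2) ^ h + 10 * n * R s) / \<epsilon>\<^sup>2"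
proof -
  let ?X = "\<lambda>\<omega>. K * (\<Sum>t\<le>T. \<Sum>z<n. (inlaw \<omega> t z)\<^sup>2)"
  let ?Y = "\<lambda>\<omega>. n * (\<Sum>z<n. (inlaw \<omega> s z - inlaw \<omega> h z)\<^sup>2)"
  have sn: "3 * s + 5 \<le> n" using T by simp
  have "mean (\<lambda>\<omega>. of_bool (\<not> near_stationary \<omega> h (8 * \<epsilon>))) \<le> mean (\<lambda>\<omega>. of_bool (\<not> expanding \<omega> K)
     + of_bool (real (card (bad \<omega> s \<epsilon>)) > K) + of_bool (?X \<omega> > \<epsilon>\<^sup>2) + of_bool (?Y \<omega> > \<epsilon>\<^sup>2))"
  proof (rule mean_mono)
    fix \<omega> assume w: "\<omega> \<in> \<Omega>"
    have "near_stationary \<omega> h (8 * \<epsilon>)"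
      if "expanding \<omega> K" "\<not> real (card (bad \<omega> s \<epsilon>)) > K" "\<not> ?X \<omega> > \<epsilon>\<^sup>2" "\<not> ?Y \<omega> > \<epsilon>\<^sup>2"
      by (rule near_stationaryI[where s = s, OF w that(1) _ _ j0 j \<epsilon>]) (use that T in auto)
    thus "of_bool (\<not> near_stationary \<omega> h (8 * \<epsilon>)) \<le> (of_bool (\<not> expanding \<omega> K)
     + of_bool (real (card (bad \<omega> s \<epsilon>)) > K) + of_bool (?X \<omega> > \<epsilon>\<^sup>2) + of_bool (?Y \<omega> > \<epsilon>\<^sup>2) :: real)"
      by (auto simp: of_bool_def)
  qed
  hence union: "mean (\<lambda>\<omega>. of_bool (\<not> near_stationary \<omega> h (8 * \<epsilon>))) \<le> mean (\<lambda>\<omega>. of_bool (\<not> expanding \<omega> K))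
      + mean (\<lambda>\<omega>. of_bool (real (card (bad \<omega> s \<epsilon>)) > K))
      + mean (\<lambda>\<omega>. of_bool (?X \<omega> > \<epsilon>\<^sup>2)) + mean (\<lambda>\<omega>. of_bool (?Y \<omega> > \<epsilon>\<^sup>2))"
    by (simp only: mean_add)
  have b1: "mean (\<lambda>\<omega>. of_bool (\<not> expanding \<omega> K)) \<le> (1 + 2 * y ^ 3) ^ n - 1"
    by (rule mean_not_expanding[OF K(2,3) y])
  have b2: "mean (\<lambda>\<omega>. of_bool (real (card (bad \<omega> s \<epsilon>)) > K)) \<le>
     (2 / \<epsilon> * (n * (s * \<tau> (3 * s + 5))) + 4 / \<epsilon>\<^sup>2 * n * (n * (7 * \<Delta> * (1 / 2) ^ s + 19 * R s))) / K"
  proof -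
    have "mean (\<lambda>\<omega>. of_bool (real (card (bad \<omega> s \<epsilon>)) > K)) \<le> mean (\<lambda>\<omega>. real (card (bad \<omega> s \<epsilon>))) / K"
      by (rule mean_markov) (use K in auto)
    thus ?thesis using divide_right_mono[OF mean_bad[OF s(1) sn \<epsilon>(1)], of "real K"] by linarith
  qed
  have b3: "mean (\<lambda>\<omega>. of_bool (?X \<omega> > \<epsilon>\<^sup>2)) \<le> K * ((real T + 1) * ((real T + 2) * \<tau> (3 * T + 5))) / \<epsilon>\<^sup>2"
  proof -
    have one: "mean (\<lambda>\<omega>. \<Sum>z<n. (inlaw \<omega> t z)\<^sup>2) \<le> (real T + 2) * \<tau> (3 * T + 5)" if "t \<le> T" for t
    proof -
      have "mean (\<lambda>\<omega>. \<Sum>z<n. (inlaw \<omega> t z)\<^sup>2) \<le> (real t + 2) * \<tau> (3 * t + 5)"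
        using that T by (intro inlaw_second_moment) simp
      also have "\<dots> \<le> (real T + 2) * \<tau> (3 * T + 5)"
        using that by (intro mult_mono tau_nonneg) (auto simp: \<tau>_def intro!: divide_right_mono mult_left_mono)
      finally show ?thesis .
    qed
    have "(\<Sum>t\<le>T. mean (\<lambda>\<omega>. \<Sum>z<n. (inlaw \<omega> t z)\<^sup>2)) \<le> (\<Sum>t\<le>T. (real T + 2) * \<tau> (3 * T + 5))"
      using one by (intro sum_mono) auto
    hence "(\<Sum>t\<le>T. mean (\<lambda>\<omega>. \<Sum>z<n. (inlaw \<omega> t z)\<^sup>2)) \<le> (real T + 1) * ((real T + 2) * \<tau> (3 * T + 5))"
      by (simp add: add.commute)
    hence "K * (\<Sum>t\<le>T. mean (\<lambda>\<omega>. \<Sum>z<n. (inlaw \<omega> t z)\<^sup>2)) \<le> K * ((real T + 1) * ((real T + 2) * \<tau> (3 * T + 5)))"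
      by (rule mult_left_mono) simp
    moreover have "mean ?X = K * (\<Sum>t\<le>T. mean (\<lambda>\<omega>. \<Sum>z<n. (inlaw \<omega> t z)\<^sup>2))"
      by (simp only: mean_cmult mean_sum)
    ultimately have "mean ?X \<le> K * ((real T + 1) * ((real T + 2) * \<tau> (3 * T + 5)))" by linarith
    moreover have "mean (\<lambda>\<omega>. of_bool (?X \<omega> > \<epsilon>\<^sup>2)) \<le> mean ?X / \<epsilon>\<^sup>2"
      using \<epsilon> by (intro mean_markov mult_nonneg_nonneg sum_nonneg) auto
    ultimately show ?thesis by (meson divide_right_mono order_trans zero_le_power2)
  qed
  have b4: "mean (\<lambda>\<omega>. of_bool (?Y \<omega> > \<epsilon>\<^sup>2)) \<le> (4 * \<Delta> * (1 / 2) ^ h + 10 * n * R s) / \<epsilon>\<^sup>2"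
  proof -
    have "mean ?Y = n * mean (\<lambda>\<omega>. \<Sum>z<n. (inlaw \<omega> s z - inlaw \<omega> h z)\<^sup>2)" by (rule mean_cmult)
    moreover have "n * mean (\<lambda>\<omega>. \<Sum>z<n. (inlaw \<omega> s z - inlaw \<omega> h z)\<^sup>2) \<le> n * (8 * \<Delta> * (1 / 2) ^ h / m + 10 * R s)"
      by (intro mult_left_mono inlaw_cauchy s sn) simp
    moreover have "n * (8 * \<Delta> * (1 / 2) ^ h / m + 10 * R s) = (2 * real n / m) * (4 * \<Delta> * (1 / 2) ^ h) + 10 * n * R s"
      by (simp add: algebra_simps)
    moreover have "(2 * real n / m) * (4 * \<Delta> * (1 / 2) ^ h) \<le> 1 * (4 * \<Delta> * (1 / 2) ^ h)"
    proof (rule mult_right_mono)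
      show "2 * real n / m \<le> 1" using m_ge m_pos by (simp add: field_simps flip: of_nat_mult)
    qed simp
    ultimately have "mean ?Y \<le> 4 * \<Delta> * (1 / 2) ^ h + 10 * n * R s" by linarith
    moreover have "mean (\<lambda>\<omega>. of_bool (?Y \<omega> > \<epsilon>\<^sup>2)) \<le> mean ?Y / \<epsilon>\<^sup>2"
      using \<epsilon> by (intro mean_markov mult_nonneg_nonneg sum_nonneg) auto
    ultimately show ?thesis by (meson divide_right_mono order_trans zero_le_power2)
  qed
  show ?thesis using union b1 b2 b3 b4 by linarith
qed

end

section \<open>Laplace transform of the inflow\<close>

lemma bijs_inverse:
  assumes "\<omega> \<in> bijs A B"
  shows "restrict (inv_into A \<omega>) B \<in> bijs B A"
    and "restrict (inv_into B (restrict (inv_into A \<omega>) B)) A = \<omega>"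
proof -
  let ?t = "restrict (inv_into A \<omega>) B"
  have b: "bij_betw \<omega> A B" using assms by (simp add: bijs_def)
  have "bij_betw (inv_into A \<omega>) B A" using b by (rule bij_betw_inv_into)
  hence t: "bij_betw ?t B A" by (subst bij_betw_cong[of B _ "inv_into A \<omega>"]) auto
  thus "?t \<in> bijs B A" by (auto simp: bijs_def bij_betw_def)
  show "restrict (inv_into B ?t) A = \<omega>"
  proof
    fix x
    show "restrict (inv_into B ?t) A x = \<omega> x"
    proof (cases "x \<in> A")
      case True
      have "\<omega> x \<in> B" using b True by (auto simp: bij_betw_def)
      moreover have "?t (\<omega> x) = x" using b True \<open>\<omega> x \<in> B\<close> by (simp add: bij_betw_def)
      ultimately have "inv_into B ?t x = \<omega> x" using t by (intro inv_into_f_eq) (auto simp: bij_betw_def)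
      thus ?thesis using True by simp
    next
      case False thus ?thesis using assms by (auto simp: bijs_def PiE_def extensional_def)
    qed
  qed
qed

context digraph_env
begin

text \<open>The inverse of a uniform bijection is uniform, so the conditional calculus is also
  available from heads to tails, for exploration against the direction of the walk.\<close>

sublocale rev: equicard F E
  by standard (simp_all add: finite_E finite_F card_E card_F)

text \<open>\<open>\<theta>\<close> is the inverse environment, from heads to tails. Up to the factor \<open>m\<close>, \<open>inflow \<theta> h f\<close>
  is the mass at time \<open>h\<close> that enters through the head \<open>f\<close> when every head starts with mass one.\<close>
primrec inflow :: "(nat \<times> nat \<Rightarrow> nat \<times> nat) \<Rightarrow> nat \<Rightarrow> nat \<times> nat \<Rightarrow> real" where
  "inflow \<theta> 0 f = 1"
| "inflow \<theta> (Suc h) f = (\<Sum>j<din (fst (\<theta> f)). inflow \<theta> h (fst (\<theta> f), j)) / dout (fst (\<theta> f))"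

text \<open>The Laplace transform of the \<open>h\<close>-th iterate of the smoothing map started at
  the point mass at 1. Averaging over tails realises the out-degree-biased vertex.\<close>

primrec phi :: "nat \<Rightarrow> real \<Rightarrow> real" where
  "phi 0 t = exp (- t)"
| "phi (Suc h) t = (\<Sum>e\<in>E. phi h (t / dout (fst e)) ^ din (fst e)) / m"

lemma inflow_nonneg: "0 \<le> inflow \<theta> h f"
  by (induction h arbitrary: f) (auto intro!: divide_nonneg_nonneg sum_nonneg)

lemma phi_bounds: "0 \<le> t \<Longrightarrow> 0 \<le> phi h t \<and> phi h t \<le> 1"
proof (induction h arbitrary: t)
  case (Suc h)
  have b: "0 \<le> phi h (t / dout (fst e)) ^ din (fst e) \<and> phi h (t / dout (fst e)) ^ din (fst e) \<le> 1" for e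
    using Suc.IH[of "t / dout (fst e)"] Suc.prems by (auto intro: power_le_one)
  have "(\<Sum>e\<in>E. phi h (t / dout (fst e)) ^ din (fst e)) \<le> (\<Sum>e\<in>E. 1)"
    using b by (intro sum_mono) auto
  thus ?case using b m_pos card_E by (auto intro!: divide_nonneg_nonneg sum_nonneg)
qed auto

lemma prod_01: "(\<And>i. i \<in> I \<Longrightarrow> 0 \<le> g i \<and> g i \<le> (1::real)) \<Longrightarrow> 0 \<le> prod g I \<and> prod g I \<le> 1"
  using prod_nonneg[of I g] prod_le_1[of I g] by auto

definition heads_at :: "nat \<Rightarrow> (nat \<times> nat) set" where
  "heads_at v = {v} \<times> {..<din v}"

lemma heads_at_F: "v < n \<Longrightarrow> heads_at v \<subseteq> F"
  by (auto simp: heads_at_def F_def)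

lemma finite_heads_at: "finite (heads_at v)" by (simp add: heads_at_def)

lemma card_heads_at_eq: "card (heads_at v) = din v" by (simp add: heads_at_def card_cartesian_product)

lemma sum_heads_at: "(\<Sum>f\<in>heads_at v. g f) = (\<Sum>j<din v. g (v, j))"
  unfolding heads_at_def by (simp add: sum.cartesian_product')

text \<open>A fresh head is matched to a uniform unexplored tail, and dropping \<open>card D\<close>
  of the \<open>m\<close> terms of an average of numbers between 0 and 1 moves it by at most
  \<open>card D / m\<close>.\<close>

lemma fresh_average:
  assumes D: "D \<subseteq> F" "card D \<le> n" and f: "f \<in> F - D" and w: "\<theta>0 \<in> bijs F E"
    and g: "\<And>v. 0 \<le> g v \<and> g v \<le> (1::real)"
  shows "\<bar>cexp F E D (\<lambda>\<theta>. g (fst (\<theta> f))) \<theta>0 - (\<Sum>e\<in>E. g (fst e)) / m\<bar> \<le> card D / m"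
proof -
  let ?d = "card D"
  let ?S = "\<Sum>e\<in>E. g (fst e)" and ?S' = "\<Sum>e\<in>E - \<theta>0 ` D. g (fst e)"
  have finD: "finite D" using D(1) finite_F finite_subset by blast
  have dm: "real ?d < m" using D m_ge n_pos by simp
  have im: "\<theta>0 ` D \<subseteq> E" "card (\<theta>0 ` D) = ?d"
    using rev.bijs_in[OF w] D card_image[OF inj_on_subset[OF rev.bijs_inj[OF w] D(1)]] by auto
  have S: "?S = ?S' + (\<Sum>e\<in>\<theta>0 ` D. g (fst e))"
    using finite_E im by (simp add: sum.subset_diff)
  have "(\<Sum>e\<in>\<theta>0 ` D. g (fst e)) \<le> (\<Sum>e\<in>\<theta>0 ` D. 1)" using g by (intro sum_mono) auto
  moreover have "0 \<le> (\<Sum>e\<in>\<theta>0 ` D. g (fst e))" using g by (intro sum_nonneg) auto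
  ultimately have SS: "?S' \<le> ?S" "?S \<le> ?S' + ?d" using S im(2) by auto
  have "?S' \<le> (\<Sum>e\<in>E - \<theta>0 ` D. 1)" using g by (intro sum_mono) auto
  also have "\<dots> = m - real ?d" using card_Diff_subset[OF _ im(1)] finite_subset[OF im(1) finite_E] card_E im(2) dm by simp
  finally have S'm: "?S' \<le> m - real ?d" .
  have S'0: "0 \<le> ?S'" using g by (intro sum_nonneg) auto
  have eq: "cexp F E D (\<lambda>\<theta>. g (fst (\<theta> f))) \<theta>0 = ?S' / (m - real ?d)"
    using rev.cexp_fresh[OF f w D(1), of "\<lambda>e. g (fst e)"] card_F dm by simp
  have "?S' / (m - real ?d) - ?S / m \<le> ?S' / (m - real ?d) - ?S' / m"
    using SS by (intro diff_left_mono divide_right_mono) auto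
  also have "\<dots> = (?S' / (m - real ?d)) * (?d / m)" using dm m_pos by (simp add: field_simps)
  also have "\<dots> \<le> 1 * (?d / m)" using S'm dm by (intro mult_right_mono) auto
  finally have up: "?S' / (m - real ?d) - ?S / m \<le> ?d / m" by simp
  have "?S / m - ?S' / (m - real ?d) \<le> ?S / m - ?S' / m"
    using S'0 dm by (intro diff_left_mono divide_left_mono) auto
  also have "\<dots> \<le> ?d / m" using SS m_pos by (simp add: divide_right_mono flip: diff_divide_distrib)
  finally show ?thesis using up unfolding eq by linarith
qed

lemma tail_landing:
  assumes D: "D \<subseteq> F" "card D \<le> n" and f: "f \<in> F - D" and w: "\<theta>0 \<in> bijs F E" and X: "finite X"
  shows "cexp F E D (\<lambda>\<theta>. of_bool (fst (\<theta> f) \<in> X)) \<theta>0 \<le> real \<Delta> * card X / n"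
proof -
  have "cexp F E D (\<lambda>\<theta>. of_bool (\<theta> f \<in> {e \<in> E. fst e \<in> X})) \<theta>0
      \<le> real (card ({e \<in> E. fst e \<in> X} \<inter> E)) / real (card F - card D)"
    by (rule rev.cexp_fresh_prob[OF f w D(1)])
  also have "\<dots> \<le> (real \<Delta> * card X) / n"
  proof (intro frac_le)
    have "card ({e \<in> E. fst e \<in> X} \<inter> E) \<le> \<Delta> * card X"
      using card_tails_le[OF X] by (simp add: Int_absorb2)
    thus "real (card ({e \<in> E. fst e \<in> X} \<inter> E)) \<le> real \<Delta> * card X" by (metis of_nat_le_iff of_nat_mult)
    show "real n \<le> real (card F - card D)" using m_ge D(2) card_F by simp
  qed (use n_pos in auto)
  finally have "cexp F E D (\<lambda>\<theta>. of_bool (\<theta> f \<in> {e \<in> E. fst e \<in> X})) \<theta>0 \<le> real \<Delta> * card X / n" .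
  moreover have "cexp F E D (\<lambda>\<theta>. of_bool (fst (\<theta> f) \<in> X)) \<theta>0 = cexp F E D (\<lambda>\<theta>. of_bool (\<theta> f \<in> {e \<in> E. fst e \<in> X})) \<theta>0"
    by (intro rev.cexp_cong) (use f rev.bijs_in rev.agr_bijs in auto)
  ultimately show ?thesis by simp
qed

text \<open>\<open>H\<close> and \<open>Q\<close> are unexplored heads at depth \<open>h + 1\<close> and \<open>h\<close>; \<open>pot\<close> bounds the number of
  heads that are still to be revealed.\<close>
definition LT where
  "LT t h H Q \<theta> = exp (- ((\<Sum>f\<in>H. t f * inflow \<theta> (Suc h) f) + (\<Sum>f\<in>Q. t f * inflow \<theta> h f)))"

definition LT0 where
  "LT0 t h H Q = (\<Prod>f\<in>H. phi (Suc h) (t f)) * (\<Prod>f\<in>Q. phi h (t f))"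

definition pot :: "nat \<Rightarrow> (nat \<times> nat) set \<Rightarrow> (nat \<times> nat) set \<Rightarrow> nat" where
  "pot h H Q = card H * (1 + \<Delta>) ^ Suc h + card Q * (1 + \<Delta>) ^ h"

lemma LT_bounds: "(\<And>f. 0 \<le> t f) \<Longrightarrow> 0 \<le> LT t h H Q \<theta> \<and> LT t h H Q \<theta> \<le> 1"
proof -
  assume t: "\<And>f. 0 \<le> t f"
  have "0 \<le> (\<Sum>f\<in>H. t f * inflow \<theta> (Suc h) f) + (\<Sum>f\<in>Q. t f * inflow \<theta> h f)"
    by (intro add_nonneg_nonneg sum_nonneg mult_nonneg_nonneg inflow_nonneg t)
  thus ?thesis unfolding LT_def by (simp del: inflow.simps)
qed

lemma LT0_bounds: "(\<And>f. 0 \<le> t f) \<Longrightarrow> 0 \<le> LT0 t h H Q \<and> LT0 t h H Q \<le> 1"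
proof -
  assume t: "\<And>f. 0 \<le> t f"
  have "0 \<le> (\<Prod>f\<in>H. phi (Suc h) (t f)) \<and> (\<Prod>f\<in>H. phi (Suc h) (t f)) \<le> 1"
    using phi_bounds[OF t] by (intro prod_01)
  moreover have "0 \<le> (\<Prod>f\<in>Q. phi h (t f)) \<and> (\<Prod>f\<in>Q. phi h (t f)) \<le> 1"
    using phi_bounds[OF t] by (intro prod_01)
  ultimately show ?thesis unfolding LT0_def by (auto intro: mult_le_one)
qed

text \<open>Revealing one head of \<open>H\<close> replaces it by the heads of the vertex behind it.\<close>
lemma LT_reveal:
  assumes f: "f \<in> H" and fin: "finite H" "finite Q" and v: "v = fst (\<theta> f)"
    and dis: "heads_at v \<inter> (H \<union> Q) = {}"
    and t': "t' = (\<lambda>f'. if f' \<in> heads_at v then t f / dout v else t f')"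
  shows "LT t h H Q \<theta> = LT t' h (H - {f}) (Q \<union> heads_at v) \<theta>"
    and "LT0 t' h (H - {f}) (Q \<union> heads_at v) = LT0 t h (H - {f}) Q * phi h (t f / dout v) ^ din v"
proof -
  have H: "(\<Sum>f\<in>H. t f * inflow \<theta> (Suc h) f) = t f * inflow \<theta> (Suc h) f + (\<Sum>f\<in>H - {f}. t f * inflow \<theta> (Suc h) f)"
    using f fin by (simp add: sum.remove del: inflow.simps)
  have "t f * inflow \<theta> (Suc h) f = (\<Sum>f'\<in>heads_at v. t' f' * inflow \<theta> h f')"
  proof -
    have "(\<Sum>f'\<in>heads_at v. t' f' * inflow \<theta> h f') = (\<Sum>f'\<in>heads_at v. t f / dout v * inflow \<theta> h f')"
      by (intro sum.cong refl) (simp add: t')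
    thus ?thesis by (simp add: sum_heads_at sum_distrib_left v sum_divide_distrib)
  qed
  moreover have "(\<Sum>f\<in>H - {f}. t f * inflow \<theta> (Suc h) f) = (\<Sum>f\<in>H - {f}. t' f * inflow \<theta> (Suc h) f)"
    using dis by (intro sum.cong refl) (auto simp: t')
  moreover have "(\<Sum>f\<in>Q \<union> heads_at v. t' f * inflow \<theta> h f) = (\<Sum>f\<in>Q. t f * inflow \<theta> h f) + (\<Sum>f'\<in>heads_at v. t' f' * inflow \<theta> h f')"
  proof -
    have "(\<Sum>f\<in>Q. t' f * inflow \<theta> h f) = (\<Sum>f\<in>Q. t f * inflow \<theta> h f)"
      using dis by (intro sum.cong refl) (auto simp: t')
    thus ?thesis using dis fin finite_heads_at by (subst sum.union_disjoint) auto
  qed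
  ultimately show "LT t h H Q \<theta> = LT t' h (H - {f}) (Q \<union> heads_at v) \<theta>"
    unfolding LT_def H by (simp del: inflow.simps)
  have "(\<Prod>f\<in>H - {f}. phi (Suc h) (t' f)) = (\<Prod>f\<in>H - {f}. phi (Suc h) (t f))"
    using dis by (intro prod.cong refl) (auto simp: t')
  moreover have "(\<Prod>f\<in>Q \<union> heads_at v. phi h (t' f)) = (\<Prod>f\<in>Q. phi h (t f)) * phi h (t f / dout v) ^ din v"
  proof -
    have "(\<Prod>f\<in>Q. phi h (t' f)) = (\<Prod>f\<in>Q. phi h (t f))"
      using dis by (intro prod.cong refl) (auto simp: t')
    moreover have "(\<Prod>f'\<in>heads_at v. phi h (t' f')) = (\<Prod>f'\<in>heads_at v. phi h (t f / dout v))"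
      by (intro prod.cong refl) (simp add: t')
    ultimately show ?thesis using dis fin finite_heads_at card_heads_at_eq by (subst prod.union_disjoint) auto
  qed
  ultimately show "LT0 t' h (H - {f}) (Q \<union> heads_at v) = LT0 t h (H - {f}) Q * phi h (t f / dout v) ^ din v"
    by (simp add: LT0_def del: phi.simps)
qed

text \<open>The budget \<open>c\<close> covers the heads known so far and up to
  \<open>\<Delta>\<close> new heads for each of the at most \<open>pot h H Q\<close> revelations to
  come, so it can stay fixed during the whole exploration.\<close>

definition laplace_ok ::
  "nat \<Rightarrow> (nat \<times> nat) set \<Rightarrow> (nat \<times> nat) set \<Rightarrow> (nat \<times> nat) set \<Rightarrow> (nat \<times> nat \<Rightarrow> nat \<times> nat) \<Rightarrow>
    (nat \<times> nat \<Rightarrow> real) \<Rightarrow> nat \<Rightarrow> bool" where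
  "laplace_ok h H Q D \<theta>0 t c \<longleftrightarrow> H \<subseteq> F \<and> Q \<subseteq> F \<and> D \<subseteq> F \<and> H \<inter> Q = {} \<and> H \<inter> D = {} \<and> Q \<inter> D = {} \<and>
     \<theta>0 \<in> bijs F E \<and> (\<forall>f. 0 \<le> t f) \<and> card D + card H + card Q + \<Delta> * pot h H Q \<le> c \<and> c \<le> n"

definition laplace_err where
  "laplace_err h H Q D \<theta>0 t = \<bar>cexp F E D (LT t h H Q) \<theta>0 - LT0 t h H Q\<bar>"

text \<open>The heads of \<open>H\<close> are revealed one by one, at a price of
  \<open>2 * \<Delta> * c / n\<close> each. One half pays for meeting a vertex already known, which
  would spoil the tree structure; the other half pays for replacing the average over unexplored
  tails by that over all tails.\<close>

lemma laplace_grow: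
  assumes base: "\<And>Q D \<theta>0 t. laplace_ok h {} Q D \<theta>0 t c \<Longrightarrow>
      laplace_err h {} Q D \<theta>0 t \<le> pot h {} Q * (2 * real \<Delta> * c / n)"
  shows "laplace_ok h H Q D \<theta>0 t c \<Longrightarrow> laplace_err h H Q D \<theta>0 t \<le> pot h H Q * (2 * real \<Delta> * c / n)"
proof (induction "card H" arbitrary: H Q D \<theta>0 t)
  case 0
  hence H: "H = {}" using finite_subset[OF _ finite_F, of H] by (auto simp: laplace_ok_def)
  show ?case unfolding H by (rule base) (use 0 H in simp)
next
  case (Suc r)
  have ok: "H \<subseteq> F" "Q \<subseteq> F" "D \<subseteq> F" "H \<inter> Q = {}" "H \<inter> D = {}" "Q \<inter> D = {}" "\<theta>0 \<in> bijs F E"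
    and t: "\<And>f. 0 \<le> t f" and c: "card D + card H + card Q + \<Delta> * pot h H Q \<le> c" "c \<le> n"
    using Suc.prems by (auto simp: laplace_ok_def)
  have fin: "finite H" "finite Q" "finite D" using ok(1-3) finite_F finite_subset by blast+
  obtain f where f: "f \<in> H" using Suc.hyps(2) by (metis card.empty equals0I nat.distinct(1))
  have fF: "f \<in> F - D" using f ok by blast
  define \<kappa> where "\<kappa> = 2 * real \<Delta> * c / n"
  define p where "p = pot h H Q - 1"
  let ?H = "H - {f}" and ?D = "insert f D" and ?X = "fst ` (D \<union> H \<union> Q)"
  let ?A = "LT0 t h ?H Q" and ?g = "\<lambda>v. phi h (t f / dout v) ^ din v"
  have np: "0 < real n" using n_pos by simp
  have potS: "pot h H Q = card ?H * (1 + \<Delta>) ^ Suc h + (1 + \<Delta>) ^ Suc h + card Q * (1 + \<Delta>) ^ h"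
  proof -
    have cH: "card H = card ?H + 1" using card_Suc_Diff1[OF fin(1) f] by simp
    show ?thesis by (simp only: pot_def cH add_mult_distrib mult_1)
  qed
  have A: "0 \<le> ?A" "?A \<le> 1" using LT0_bounds[of t h ?H Q] t by auto
  have g: "0 \<le> ?g v \<and> ?g v \<le> 1" for v
    using phi_bounds[of "t f / dout v" h] t by (auto intro: power_le_one)
  have inner: "\<bar>cexp F E ?D (LT t h H Q) \<theta>1 - ?A * ?g (fst (\<theta>1 f))\<bar> \<le> p * \<kappa> + of_bool (fst (\<theta>1 f) \<in> ?X)"
    if \<theta>1: "\<theta>1 \<in> agreeing F E D \<theta>0" for \<theta>1
  proof -
    have w1: "\<theta>1 \<in> bijs F E" using rev.agr_bijs[OF \<theta>1] .
    let ?v = "fst (\<theta>1 f)"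
    have v: "?v < n" using rev.bijs_in[OF w1, of f] fF by (auto simp: E_def)
    have \<kappa>0: "0 \<le> p * \<kappa>" by (simp add: \<kappa>_def)
    show ?thesis
    proof (cases "?v \<in> ?X")
      case True
      have "0 \<le> cexp F E ?D (LT t h H Q) \<theta>1 \<and> cexp F E ?D (LT t h H Q) \<theta>1 \<le> 1"
        using LT_bounds[of t h H Q] t w1 by (intro conjI rev.cexp_nonneg rev.cexp_le_const) auto
      moreover have "0 \<le> ?A * ?g ?v \<and> ?A * ?g ?v \<le> 1" using A g[of ?v] by (auto intro: mult_le_one)
      ultimately show ?thesis using True \<kappa>0 by (simp add: abs_le_iff)
    next
      case False
      have dis: "heads_at ?v \<inter> (D \<union> H \<union> Q) = {}"
      proof -
        have "fst f' = ?v" if "f' \<in> heads_at ?v" for f' using that by (auto simp: heads_at_def)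
        thus ?thesis using False by (metis disjoint_iff imageI)
      qed
      define t' where "t' = (\<lambda>f'. if f' \<in> heads_at ?v then t f / dout ?v else t f')"
      let ?Q = "Q \<union> heads_at ?v"
      have cQ: "card ?Q \<le> card Q + \<Delta>"
        using card_Un_le[of Q "heads_at ?v"] degrees[OF v] by (simp add: card_heads_at_eq)
      \<comment> \<open>Removing \<open>f\<close> frees \<open>(1 + \<Delta>) ^ Suc h\<close>, and
        the at most \<open>\<Delta>\<close> new heads use
        \<open>\<Delta> * (1 + \<Delta>) ^ h\<close>. The surplus \<open>(1 + \<Delta>) ^ h\<close>
        is at least 1 and pays for this revelation.\<close>
      have pot': "pot h ?H ?Q \<le> p"
      proof -
        have "card ?Q * (1 + \<Delta>) ^ h \<le> card Q * (1 + \<Delta>) ^ h + \<Delta> * (1 + \<Delta>) ^ h"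
          using mult_right_mono[OF cQ, of "(1 + \<Delta>) ^ h"] by (simp add: add_mult_distrib)
        moreover have "(1 + \<Delta>) ^ Suc h = (1 + \<Delta>) ^ h + \<Delta> * (1 + \<Delta>) ^ h" by simp
        moreover have "1 \<le> (1 + \<Delta>) ^ h" by (rule one_le_power) simp
        moreover have "pot h ?H ?Q = card ?H * (1 + \<Delta>) ^ Suc h + card ?Q * (1 + \<Delta>) ^ h"
          by (simp add: pot_def)
        ultimately show ?thesis using potS unfolding p_def by linarith
      qed
      have pp: "pot h H Q = Suc p"
        using potS one_le_power[of "1 + \<Delta>" "Suc h"] unfolding p_def by linarith
      have okI: "laplace_ok h ?H ?Q ?D \<theta>1 t' c"
      proof -
        have "card ?D = card D + 1" "card H = card ?H + 1"
          using fF fin f card_Suc_Diff1[OF fin(1) f] by auto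
        moreover have "\<Delta> * pot h ?H ?Q + \<Delta> \<le> \<Delta> * pot h H Q"
          using mult_left_mono[OF pot', of \<Delta>] pp by simp
        ultimately have "card ?D + card ?H + card ?Q + \<Delta> * pot h ?H ?Q \<le> c" using c(1) cQ by linarith
        thus ?thesis using ok w1 t dis fF f heads_at_F[OF v] c(2) unfolding laplace_ok_def
          by (auto simp: t'_def)
      qed
      have "card ?H = r" using Suc.hyps(2) f fin by simp
      hence IH: "laplace_err h ?H ?Q ?D \<theta>1 t' \<le> pot h ?H ?Q * \<kappa>"
        using Suc.hyps(1)[of ?H, OF _ okI] by (simp add: \<kappa>_def)
      have "cexp F E ?D (LT t h H Q) \<theta>1 = cexp F E ?D (LT t' h ?H ?Q) \<theta>1"
      proof (rule rev.cexp_cong)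
        fix \<theta> assume "\<theta> \<in> agreeing F E ?D \<theta>1"
        hence "\<theta> f = \<theta>1 f" by (rule rev.agr_eq) simp
        hence vf: "?v = fst (\<theta> f)" by simp
        show "LT t h H Q \<theta> = LT t' h ?H ?Q \<theta>"
          by (rule LT_reveal(1)[where t = t and t' = t' and \<theta> = \<theta>, OF f fin(1,2) vf]) (use dis t'_def in blast)+
      qed
      moreover have "LT0 t' h ?H ?Q = ?A * ?g ?v"
        by (rule LT_reveal(2)[where t = t and t' = t' and \<theta> = \<theta>1, OF f fin(1,2) refl]) (use dis t'_def in blast)+
      ultimately have "\<bar>cexp F E ?D (LT t h H Q) \<theta>1 - ?A * ?g ?v\<bar> \<le> pot h ?H ?Q * \<kappa>"
        using IH unfolding laplace_err_def by simp
      also have "\<dots> \<le> p * \<kappa>" using pot' by (intro mult_right_mono) (auto simp: \<kappa>_def)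
      finally show ?thesis by simp
    qed
  qed
  have cD: "card D \<le> n" using c by linarith
  have "\<bar>cexp F E D (LT t h H Q) \<theta>0 - cexp F E D (\<lambda>\<theta>1. ?A * ?g (fst (\<theta>1 f))) \<theta>0\<bar>
      \<le> cexp F E D (\<lambda>\<theta>1. p * \<kappa> + of_bool (fst (\<theta>1 f) \<in> ?X)) \<theta>0"
  proof -
    have "cexp F E D (LT t h H Q) \<theta>0 = cexp F E D (cexp F E ?D (LT t h H Q)) \<theta>0"
      by (rule rev.cexp_tower[symmetric]) auto
    hence "\<bar>cexp F E D (LT t h H Q) \<theta>0 - cexp F E D (\<lambda>\<theta>1. ?A * ?g (fst (\<theta>1 f))) \<theta>0\<bar>
      = \<bar>cexp F E D (\<lambda>\<theta>1. cexp F E ?D (LT t h H Q) \<theta>1 - ?A * ?g (fst (\<theta>1 f))) \<theta>0\<bar>"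
      by (simp only: rev.cexp_diff)
    also have "\<dots> \<le> cexp F E D (\<lambda>\<theta>1. \<bar>cexp F E ?D (LT t h H Q) \<theta>1 - ?A * ?g (fst (\<theta>1 f))\<bar>) \<theta>0"
      by (rule rev.cexp_abs_le)
    also have "\<dots> \<le> cexp F E D (\<lambda>\<theta>1. p * \<kappa> + of_bool (fst (\<theta>1 f) \<in> ?X)) \<theta>0"
      by (rule rev.cexp_mono[OF ok(7) inner])
    finally show ?thesis .
  qed
  moreover have "cexp F E D (\<lambda>\<theta>1. p * \<kappa> + of_bool (fst (\<theta>1 f) \<in> ?X)) \<theta>0
     = p * \<kappa> + cexp F E D (\<lambda>\<theta>1. of_bool (fst (\<theta>1 f) \<in> ?X)) \<theta>0"
    by (simp only: rev.cexp_add rev.cexp_const[OF ok(7)])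
  moreover have "cexp F E D (\<lambda>\<theta>1. of_bool (fst (\<theta>1 f) \<in> ?X)) \<theta>0 \<le> real \<Delta> * c / n"
  proof -
    have "card ?X \<le> card (D \<union> H \<union> Q)" using fin by (intro card_image_le) auto
    also have "\<dots> \<le> card D + card H + card Q" by (meson add_mono card_Un_le le_refl le_trans)
    finally have "card ?X \<le> c" using c by linarith
    hence "real \<Delta> * card ?X / n \<le> real \<Delta> * c / n"
      by (intro divide_right_mono mult_left_mono) auto
    thus ?thesis using tail_landing[OF ok(3) cD fF ok(7), of ?X] fin by force
  qed
  moreover have "\<bar>cexp F E D (\<lambda>\<theta>1. ?A * ?g (fst (\<theta>1 f))) \<theta>0 - LT0 t h H Q\<bar> \<le> real \<Delta> * c / n"
  proof -
    have L0: "LT0 t h H Q = ?A * phi (Suc h) (t f)"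
      using f fin by (simp add: LT0_def prod.remove del: phi.simps)
    have "cexp F E D (\<lambda>\<theta>1. ?A * ?g (fst (\<theta>1 f))) \<theta>0 = ?A * cexp F E D (\<lambda>\<theta>1. ?g (fst (\<theta>1 f))) \<theta>0"
      by (rule rev.cexp_cmult)
    hence "\<bar>cexp F E D (\<lambda>\<theta>1. ?A * ?g (fst (\<theta>1 f))) \<theta>0 - LT0 t h H Q\<bar>
       = ?A * \<bar>cexp F E D (\<lambda>\<theta>1. ?g (fst (\<theta>1 f))) \<theta>0 - phi (Suc h) (t f)\<bar>"
      unfolding L0 using A by (simp only: abs_mult abs_of_nonneg flip: right_diff_distrib)
    also have "\<dots> \<le> 1 * \<bar>cexp F E D (\<lambda>\<theta>1. ?g (fst (\<theta>1 f))) \<theta>0 - phi (Suc h) (t f)\<bar>"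
      using A by (intro mult_right_mono) auto
    also have "\<dots> \<le> card D / m" using fresh_average[OF ok(3) cD fF ok(7), of ?g] g by simp
    also have "\<dots> \<le> real c / n" using c m_ge np by (intro frac_le) auto
    also have "\<dots> \<le> real \<Delta> * c / n"
      using Delta_ge mult_right_mono[of 1 "real \<Delta>" "real c"] by (intro divide_right_mono) auto
    finally show ?thesis .
  qed
  ultimately have "\<bar>cexp F E D (LT t h H Q) \<theta>0 - LT0 t h H Q\<bar> \<le> p * \<kappa> + \<kappa>"
    unfolding \<kappa>_def by linarith
  moreover have "pot h H Q = Suc p"
    using potS one_le_power[of "1 + \<Delta>" "Suc h"] unfolding p_def by linarith
  ultimately show ?case unfolding laplace_err_def \<kappa>_def[symmetric] by (simp add: algebra_simps)
qed

text \<open>Once \<open>H\<close> is used up, the heads of \<open>Q\<close> play the role of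
  \<open>H\<close> one level lower, and \<open>pot\<close> has the same value in both readings. At
  depth 0 the inflow is constant and there is no error.\<close>

lemma laplace_local:
  "laplace_ok h H Q D \<theta>0 t c \<Longrightarrow> laplace_err h H Q D \<theta>0 t \<le> pot h H Q * (2 * real \<Delta> * c / n)"
proof (induction h arbitrary: H Q D \<theta>0 t)
  case 0
  show ?case
  proof (rule laplace_grow[OF _ 0])
    fix Q D \<theta>0 t assume ok: "laplace_ok 0 {} Q D \<theta>0 t c"
    have "finite Q" using ok finite_F finite_subset by (auto simp: laplace_ok_def)
    hence "(\<Prod>f\<in>Q. exp (- t f)) = exp (- (\<Sum>f\<in>Q. t f))"
      by (simp add: exp_sum flip: sum_negf)
    moreover have "cexp F E D (LT t 0 {} Q) \<theta>0 = exp (- (\<Sum>f\<in>Q. t f))"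
      by (rule rev.cexp_constI) (use ok in \<open>auto simp: LT_def laplace_ok_def\<close>)
    ultimately have "laplace_err 0 {} Q D \<theta>0 t = 0"
      by (simp add: laplace_err_def LT0_def)
    thus "laplace_err 0 {} Q D \<theta>0 t \<le> pot 0 {} Q * (2 * real \<Delta> * c / n)" by simp
  qed
next
  case (Suc h)
  show ?case
  proof (rule laplace_grow[OF _ Suc.prems])
    fix Q D \<theta>0 t assume ok: "laplace_ok (Suc h) {} Q D \<theta>0 t c"
    have "laplace_ok h Q {} D \<theta>0 t c" using ok by (auto simp: laplace_ok_def pot_def)
    note IH = Suc.IH[OF this]
    have "LT t h Q {} = LT t (Suc h) {} Q" by (rule ext) (simp add: LT_def del: inflow.simps)
    with IH show "laplace_err (Suc h) {} Q D \<theta>0 t \<le> pot (Suc h) {} Q * (2 * real \<Delta> * c / n)"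
      by (simp add: laplace_err_def LT_def LT0_def pot_def del: inflow.simps phi.simps)
  qed
qed

section \<open>Inflow, the law of the walk, and concentration of the empirical transform\<close>

definition inverse_env :: "(nat \<times> nat \<Rightarrow> nat \<times> nat) \<Rightarrow> nat \<times> nat \<Rightarrow> nat \<times> nat" where
  "inverse_env \<omega> = restrict (inv_into E \<omega>) F"

lemma inverse_env_bijs: "\<omega> \<in> \<Omega> \<Longrightarrow> inverse_env \<omega> \<in> bijs F E"
  unfolding inverse_env_def by (rule bijs_inverse)

lemma env_inverse_env: "\<omega> \<in> \<Omega> \<Longrightarrow> f \<in> F \<Longrightarrow> \<omega> (inverse_env \<omega> f) = f"
  using bijs_bij[of \<omega>] by (simp add: inverse_env_def bij_betw_def f_inv_into_f)

lemma mean_inverse_env: "mean (\<lambda>\<omega>. \<phi> (inverse_env \<omega>)) = cexp F E {} \<phi> \<theta>0"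
proof -
  have b: "bij_betw inverse_env \<Omega> (bijs F E)"
    unfolding inverse_env_def
    by (rule bij_betw_byWitness[where f' = "\<lambda>\<theta>. restrict (inv_into F \<theta>) E"]) (auto simp: bijs_inverse)
  from sum.reindex_bij_betw[OF b, of \<phi>] bij_betw_same_card[OF b]
  show ?thesis by (simp add: mean_def cexp_def agreeing_def)
qed

text \<open>The last step of the walk enters \<open>z\<close> through one of its heads. Indexing the
  arcs by their heads turns this forward step into the recursion of \<open>inflow\<close>.\<close>

lemma inlaw_inflow:
  assumes w: "\<omega> \<in> \<Omega>" and z: "z < n"
  shows "m * inlaw \<omega> h z = (\<Sum>f\<in>heads_at z. inflow (inverse_env \<omega>) h f)"
  using z
proof (induction h arbitrary: z)
  case 0
  have "inlaw \<omega> 0 z = (\<Sum>x<n. if x = z then real (din x) / m else 0)"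
    unfolding inlaw_def by (intro sum.cong refl) auto
  also have "\<dots> = real (din z) / m" using 0 by simp
  finally show ?case using m_pos card_heads_at_eq by simp
next
  case (Suc h)
  let ?\<theta> = "inverse_env \<omega>"
  define G where "G e = inlaw \<omega> h (fst e) / dout (fst e) * of_bool (fst (\<omega> e) = z)" for e
  have "inlaw \<omega> (h + 1) z = (\<Sum>y<n. inlaw \<omega> h y * pr \<omega> (Suc 0) y z)"
    unfolding inlaw_add[OF w] by simp
  also have "\<dots> = (\<Sum>y<n. \<Sum>l<dout y. G (y, l))"
  proof (intro sum.cong refl)
    fix y assume "y \<in> {..<n}"
    hence y: "y < n" by simp
    have "pr \<omega> (Suc 0) y z = (\<Sum>l<dout y. of_bool (fst (\<omega> (y, l)) = z)) / dout y"
      unfolding pr_Suc[OF y] by simp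
    thus "inlaw \<omega> h y * pr \<omega> (Suc 0) y z = (\<Sum>l<dout y. G (y, l))"
      by (simp only: G_def fst_conv sum_distrib_left sum_divide_distrib times_divide_eq_left times_divide_eq_right)
  qed
  also have "\<dots> = (\<Sum>e\<in>E. G e)" by (simp only: sum_E)
  also have "\<dots> = (\<Sum>f\<in>F. G (?\<theta> f))"
    by (rule sum.reindex_bij_betw[OF rev.bijs_bij[OF inverse_env_bijs[OF w]], symmetric])
  also have "\<dots> = (\<Sum>f\<in>heads_at z. G (?\<theta> f))"
  proof (rule sum.mono_neutral_right[OF finite_F heads_at_F[OF Suc.prems]])
    show "\<forall>f\<in>F - heads_at z. G (?\<theta> f) = 0"
      using env_inverse_env[OF w] by (auto simp: G_def heads_at_def F_def)
  qed
  finally have eq: "m * inlaw \<omega> (Suc h) z = (\<Sum>f\<in>heads_at z. m * G (?\<theta> f))"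
    by (simp only: Suc_eq_plus1 sum_distrib_left)
  have "m * G (?\<theta> f) = inflow ?\<theta> (Suc h) f" if f: "f \<in> heads_at z" for f
  proof -
    let ?v = "fst (?\<theta> f)"
    have fF: "f \<in> F" using f heads_at_F[OF Suc.prems] by blast
    have v: "?v < n" using rev.bijs_in[OF inverse_env_bijs[OF w] fF] by (auto simp: E_def)
    have "G (?\<theta> f) = inlaw \<omega> h ?v / dout ?v"
      using f env_inverse_env[OF w fF] by (auto simp: G_def heads_at_def)
    hence "m * G (?\<theta> f) = (m * inlaw \<omega> h ?v) / dout ?v" by simp
    also have "\<dots> = inflow ?\<theta> (Suc h) f" unfolding Suc.IH[OF v] sum_heads_at by simp
    finally show ?thesis .
  qed
  thus ?case unfolding eq by (intro sum.cong refl)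
qed

text \<open>The bound \<open>2 * \<Delta>\<close> on the size of \<open>Q\<close> leaves room for
  the heads of two vertices, as the second moment requires; \<open>c\<close> is the exploration
  budget for that size.\<close>

lemma laplace_mean:
  assumes Q: "Q \<subseteq> F" "card Q \<le> 2 * \<Delta>" and u: "0 \<le> u" and c: "c = 2 * \<Delta> + \<Delta> * (2 * \<Delta> * (1 + \<Delta>) ^ h)" "c \<le> n"
  shows "\<bar>mean (\<lambda>\<omega>. exp (- (\<Sum>f\<in>Q. u * inflow (inverse_env \<omega>) h f))) - phi h u ^ card Q\<bar>
    \<le> 2 * \<Delta> * (1 + \<Delta>) ^ h * (2 * real \<Delta> * c) / n"
proof -
  obtain \<theta>0 where w: "\<theta>0 \<in> bijs F E" using rev.bijs_nonempty by blast
  have p: "pot h {} Q \<le> 2 * \<Delta> * (1 + \<Delta>) ^ h" using Q by (simp add: pot_def)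
  have "laplace_ok h {} Q {} \<theta>0 (\<lambda>_. u) c"
  proof -
    have "card Q + \<Delta> * pot h {} Q \<le> c"
      using Q(2) mult_left_mono[OF p, of \<Delta>] unfolding c(1) by linarith
    thus ?thesis using Q w u c(2) by (auto simp: laplace_ok_def)
  qed
  from laplace_local[OF this]
  have "\<bar>cexp F E {} (LT (\<lambda>_. u) h {} Q) \<theta>0 - LT0 (\<lambda>_. u) h {} Q\<bar> \<le> pot h {} Q * (2 * real \<Delta> * c / n)"
    by (simp add: laplace_err_def)
  also have "\<dots> \<le> real (2 * \<Delta> * (1 + \<Delta>) ^ h) * (2 * real \<Delta> * c / n)"
    using p by (intro mult_right_mono of_nat_mono) auto
  finally have *: "\<bar>cexp F E {} (LT (\<lambda>_. u) h {} Q) \<theta>0 - LT0 (\<lambda>_. u) h {} Q\<bar> \<le> \<dots>" .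
  have "mean (\<lambda>\<omega>. exp (- (\<Sum>f\<in>Q. u * inflow (inverse_env \<omega>) h f))) = cexp F E {} (LT (\<lambda>_. u) h {} Q) \<theta>0"
    using mean_inverse_env[of "LT (\<lambda>_. u) h {} Q" \<theta>0] by (simp add: LT_def)
  moreover have "LT0 (\<lambda>_. u) h {} Q = phi h u ^ card Q" by (simp add: LT0_def)
  ultimately show ?thesis using * by simp
qed

text \<open>For distinct vertices the product of the two deviations has mean at most
  \<open>3 * C / n\<close>: one error from the joint transform and one from each single transform.
  Each of the \<open>n\<close> diagonal terms is bounded by an additional 1.\<close>

lemma laplace_concentration:
  assumes u: "0 \<le> u" and c: "c = 2 * \<Delta> + \<Delta> * (2 * \<Delta> * (1 + \<Delta>) ^ h)" "c \<le> n"
    and C: "C = 2 * \<Delta> * (1 + \<Delta>) ^ h * (2 * real \<Delta> * c)"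
  shows "mean (\<lambda>\<omega>. ((\<Sum>i<n. exp (- u * (m * inlaw \<omega> h i)) - phi h u ^ din i) / n)\<^sup>2) \<le> (3 * C + 1) / n"
proof -
  let ?X = "\<lambda>\<omega> i. exp (- u * (m * inlaw \<omega> h i))" and ?y = "\<lambda>i. phi h u ^ din i"
  have X: "?X \<omega> i = exp (- (\<Sum>f\<in>heads_at i. u * inflow (inverse_env \<omega>) h f))" if "\<omega> \<in> \<Omega>" "i < n" for \<omega> i
    using inlaw_inflow[OF that] by (simp add: sum_distrib_left sum_negf)
  have y: "0 \<le> ?y i \<and> ?y i \<le> 1" for i using phi_bounds[OF u, of h] by (auto intro: power_le_one)
  have np: "0 < real n" using n_pos by simp
  have C0: "0 \<le> C" using C by simp
  have one: "\<bar>mean (\<lambda>\<omega>. ?X \<omega> i) - ?y i\<bar> \<le> C / n" if i: "i < n" for i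
  proof -
    have "card (heads_at i) \<le> 2 * \<Delta>" using degrees[OF i] by (simp add: card_heads_at_eq)
    from laplace_mean[OF heads_at_F[OF i] this u c] show ?thesis
      using mean_cong[of "\<lambda>\<omega>. ?X \<omega> i", OF X[OF _ i]] by (simp add: card_heads_at_eq C)
  qed
  have two: "\<bar>mean (\<lambda>\<omega>. ?X \<omega> i * ?X \<omega> j) - ?y i * ?y j\<bar> \<le> C / n" if ij: "i < n" "j < n" "i \<noteq> j" for i j
  proof -
    have dis: "heads_at i \<inter> heads_at j = {}" using ij by (auto simp: heads_at_def)
    have cd: "card (heads_at i \<union> heads_at j) = din i + din j"
      using dis by (simp add: card_Un_disjoint finite_heads_at card_heads_at_eq)
    have "card (heads_at i \<union> heads_at j) \<le> 2 * \<Delta>" using degrees[OF ij(1)] degrees[OF ij(2)] cd by simp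
    from laplace_mean[OF Un_least[OF heads_at_F[OF ij(1)] heads_at_F[OF ij(2)]] this u c]
    have "\<bar>mean (\<lambda>\<omega>. exp (- (\<Sum>f\<in>heads_at i \<union> heads_at j. u * inflow (inverse_env \<omega>) h f))) - phi h u ^ (din i + din j)\<bar> \<le> C / n"
      by (simp add: cd C)
    moreover have "mean (\<lambda>\<omega>. ?X \<omega> i * ?X \<omega> j) = mean (\<lambda>\<omega>. exp (- (\<Sum>f\<in>heads_at i \<union> heads_at j. u * inflow (inverse_env \<omega>) h f)))"
    proof (rule mean_cong)
      fix \<omega> assume w: "\<omega> \<in> \<Omega>"
      show "?X \<omega> i * ?X \<omega> j = exp (- (\<Sum>f\<in>heads_at i \<union> heads_at j. u * inflow (inverse_env \<omega>) h f))"
        unfolding X[OF w ij(1)] X[OF w ij(2)] exp_add[symmetric] sum.union_disjoint[OF finite_heads_at finite_heads_at dis]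
        by simp
    qed
    ultimately show ?thesis by (simp add: power_add)
  qed
  let ?Y = "\<lambda>\<omega> i. ?X \<omega> i - ?y i"
  have cov: "mean (\<lambda>\<omega>. ?Y \<omega> i * ?Y \<omega> j) \<le> 3 * C / n + of_bool (i = j)" if ij: "i < n" "j < n" for i j
  proof (cases "i = j")
    case True
    have "mean (\<lambda>\<omega>. ?Y \<omega> i * ?Y \<omega> j) \<le> mean (\<lambda>_. 1)"
    proof (rule mean_mono)
      fix \<omega> assume w: "\<omega> \<in> \<Omega>"
      have "0 \<le> ?X \<omega> i \<and> ?X \<omega> i \<le> 1"
        using u inlaw_nonneg[of \<omega> h i] by (auto simp: mult_nonneg_nonneg)
      hence "\<bar>?Y \<omega> i\<bar> \<le> 1" using y[of i] by linarith
      hence "(?Y \<omega> i)\<^sup>2 \<le> 1" by (simp add: abs_square_le_1)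
      thus "?Y \<omega> i * ?Y \<omega> j \<le> 1" using True by (simp add: power2_eq_square)
    qed
    moreover have "0 \<le> 3 * C / n" using C0 np by simp
    ultimately show ?thesis using True by (simp only: mean_const of_bool_eq simp_thms)
  next
    case False
    have "mean (\<lambda>\<omega>. ?Y \<omega> i * ?Y \<omega> j) = mean (\<lambda>\<omega>. ?X \<omega> i * ?X \<omega> j - ?y i * ?X \<omega> j - ?y j * ?X \<omega> i + ?y i * ?y j)"
      by (rule mean_cong) (simp add: algebra_simps)
    also have "\<dots> = (mean (\<lambda>\<omega>. ?X \<omega> i * ?X \<omega> j) - ?y i * ?y j) - ?y i * (mean (\<lambda>\<omega>. ?X \<omega> j) - ?y j)
        - ?y j * (mean (\<lambda>\<omega>. ?X \<omega> i) - ?y i)"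
      unfolding mean_add mean_diff mean_cmult mean_const by (simp add: algebra_simps)
    finally have eq: "mean (\<lambda>\<omega>. ?Y \<omega> i * ?Y \<omega> j) = \<dots>" .
    have small: "\<bar>?y a * r\<bar> \<le> C / n" if "\<bar>r\<bar> \<le> C / n" for a r
      using mult_mono[of "?y a" 1 "\<bar>r\<bar>" "C / n"] y[of a] that by (simp add: abs_mult)
    show ?thesis using two[OF ij False] small[OF one[OF ij(2)], of i] small[OF one[OF ij(1)], of j] False
      unfolding eq by simp
  qed
  have "mean (\<lambda>\<omega>. ((\<Sum>i<n. ?Y \<omega> i) / n)\<^sup>2) = (\<Sum>i<n. \<Sum>j<n. mean (\<lambda>\<omega>. ?Y \<omega> i * ?Y \<omega> j)) / (real n)\<^sup>2"
  proof -
    have "mean (\<lambda>\<omega>. ((\<Sum>i<n. ?Y \<omega> i) / n)\<^sup>2) = mean (\<lambda>\<omega>. (1 / (real n)\<^sup>2) * (\<Sum>i<n. \<Sum>j<n. ?Y \<omega> i * ?Y \<omega> j))"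
      by (rule mean_cong) (simp add: power_divide power2_eq_square[of "sum _ _"] sum_product)
    thus ?thesis unfolding mean_cmult mean_sum by simp
  qed
  also have "\<dots> \<le> (\<Sum>i<n. \<Sum>j<n. 3 * C / n + of_bool (i = j)) / (real n)\<^sup>2"
    using cov by (intro divide_right_mono sum_mono) auto
  also have "\<dots> = (3 * C + 1) / n"
  proof -
    have "(\<Sum>j<n. of_bool (i = j)) = (1::real)" if "i < n" for i
      using that by (simp add: of_bool_def)
    hence "(\<Sum>i<n. \<Sum>j<n. 3 * C / n + of_bool (i = j)) = (\<Sum>i<n. 3 * C + 1)"
      using np by (intro sum.cong refl) (simp add: sum.distrib)
    thus ?thesis using np by (simp add: power2_eq_square)
  qed
  finally show ?thesis .
qed

end

section \<open>Wasserstein distance and Laplace transforms\<close>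

definition laplace :: "real measure \<Rightarrow> real \<Rightarrow> real" where
  "laplace P t = (\<integral>x. exp (- t * x) \<partial>P)"

definition mean_one :: "real measure \<Rightarrow> bool" where
  "mean_one P \<longleftrightarrow> prob_space P \<and> sets P = sets borel \<and> (AE x in P. 0 \<le> x) \<and> integrable P (\<lambda>x. x) \<and> (\<integral>x. x \<partial>P) = 1"

text \<open>The binomial frequency has variance \<open>u * (1 - u) / N\<close>. The distance
  \<open>r\<close> of \<open>u\<close> from \<open>k / N\<close> is bounded by
  \<open>(a + r\<^sup>2 / a) / 2\<close> with \<open>a = 1 / sqrt N\<close>, which replaces
  Cauchy-Schwarz and is linear in the variance.\<close>

lemma bernstein_lipschitz:
  assumes F: "\<And>u v. 0 \<le> u \<Longrightarrow> u \<le> 1 \<Longrightarrow> 0 \<le> v \<Longrightarrow> v \<le> 1 \<Longrightarrow> \<bar>F u - F v\<bar> \<le> c * \<bar>u - v\<bar>"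
    and u: "0 \<le> u" "u \<le> 1" and N: "1 \<le> N" and c: "0 \<le> c"
  shows "\<bar>F u - (\<Sum>k\<le>N. F (k / N) * Bernstein N k u)\<bar> \<le> c / sqrt N"
proof -
  let ?B = "\<lambda>k. Bernstein N k u" and ?a = "1 / sqrt N"
  have Np: "0 < real N" using N by simp
  have B0: "0 \<le> ?B k" for k using u by (rule Bernstein_nonneg)
  have var: "(\<Sum>k\<le>N. (u - k / N)\<^sup>2 * ?B k) = u * (1 - u) / N"
  proof -
    have pw: "(u - k / N)\<^sup>2 * ?B k = u\<^sup>2 * ?B k - 2 * u / N * (k * ?B k)
        + (1 / (real N)\<^sup>2) * (k * (real k - 1) * ?B k) + (1 / (real N)\<^sup>2) * (k * ?B k)" for k
      using Np by (simp add: power2_eq_square field_simps)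
    have eq: "(\<Sum>k\<le>N. (u - k / N)\<^sup>2 * ?B k) = u\<^sup>2 * (\<Sum>k\<le>N. ?B k) - 2 * u / N * (\<Sum>k\<le>N. k * ?B k)
        + (1 / (real N)\<^sup>2) * (\<Sum>k\<le>N. k * (real k - 1) * ?B k) + (1 / (real N)\<^sup>2) * (\<Sum>k\<le>N. k * ?B k)"
      unfolding pw by (simp only: sum.distrib sum_subtractf sum_distrib_left)
    show ?thesis unfolding eq sum_Bernstein sum_k_Bernstein sum_kk_Bernstein
      using Np by (simp add: power2_eq_square field_simps)
  qed
  have "\<bar>F u - (\<Sum>k\<le>N. F (k / N) * ?B k)\<bar> = \<bar>\<Sum>k\<le>N. (F u - F (k / N)) * ?B k\<bar>"
    by (simp add: left_diff_distrib sum_subtractf flip: sum_distrib_left)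
  also have "\<dots> \<le> (\<Sum>k\<le>N. c * ((1 / 2) * (?a * ?B k + (1 / ?a) * ((u - k / N)\<^sup>2 * ?B k))))"
  proof (intro order_trans[OF sum_abs] sum_mono)
    fix k assume "k \<in> {..N}"
    hence k: "0 \<le> real k / N" "real k / N \<le> 1" using Np by auto
    let ?r = "\<bar>u - k / N\<bar>"
    have a: "0 < ?a" using Np by simp
    have "0 \<le> (?a - ?r)\<^sup>2" by simp
    hence "2 * ?a * ?r \<le> ?a\<^sup>2 + ?r\<^sup>2" by (simp add: power2_diff)
    hence "2 * ?a * ?r / ?a \<le> (?a\<^sup>2 + ?r\<^sup>2) / ?a" using a by (intro divide_right_mono) auto
    moreover have "2 * ?a * ?r / ?a = 2 * ?r" using a by simp
    moreover have "(?a\<^sup>2 + ?r\<^sup>2) / ?a = ?a + (1 / ?a) * ?r\<^sup>2"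
    proof -
      have "(b\<^sup>2 + r\<^sup>2) / b = b + (1 / b) * r\<^sup>2" if "0 < b" for b r :: real
        using that by (simp add: field_simps power2_eq_square)
      from this[OF a] show ?thesis .
    qed
    ultimately have r: "?r \<le> (1 / 2) * (?a + (1 / ?a) * (u - k / N)\<^sup>2)" by simp
    have "\<bar>(F u - F (k / N)) * ?B k\<bar> = \<bar>F u - F (k / N)\<bar> * ?B k" using B0 by (simp add: abs_mult)
    also have "\<dots> \<le> (c * ?r) * ?B k" using F[OF u k] B0 by (intro mult_right_mono) auto
    also have "\<dots> \<le> (c * ((1 / 2) * (?a + (1 / ?a) * (u - k / N)\<^sup>2))) * ?B k"
      using r c B0 by (intro mult_right_mono mult_left_mono) auto
    finally show "\<bar>(F u - F (k / N)) * ?B k\<bar> \<le> c * ((1 / 2) * (?a * ?B k + (1 / ?a) * ((u - k / N)\<^sup>2 * ?B k)))"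
      by (simp add: algebra_simps)
  qed
  also have "\<dots> = c * ((1 / 2) * (?a * (\<Sum>k\<le>N. ?B k) + (1 / ?a) * (\<Sum>k\<le>N. (u - k / N)\<^sup>2 * ?B k)))"
    by (simp only: sum.distrib flip: sum_distrib_left)
  also have "\<dots> = c * ((1 / 2) * (?a + (1 / ?a) * (u * (1 - u) / N)))" unfolding var by simp
  also have "\<dots> \<le> c * ((1 / 2) * (?a + (1 / ?a) * (1 / N)))"
  proof -
    have "u * (1 - u) \<le> 1 * 1" using u by (intro mult_mono) auto
    thus ?thesis using c Np by (intro mult_left_mono add_left_mono divide_right_mono) auto
  qed
  also have "(1 / ?a) * (1 / N) = ?a" using Np by (simp add: field_simps)
  finally show ?thesis by simp
qed

text \<open>Above \<open>exp (- K)\<close> the logarithm has slope at most \<open>exp K\<close>, so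
  truncation makes \<open>x = - ln u\<close> a Lipschitz function of \<open>u\<close> in spite of
  the singularity at 0.\<close>

lemma truncated_log_lipschitz:
  fixes K u v :: real
  assumes K: "0 \<le> K" and u: "0 \<le> u" "u \<le> 1" "0 \<le> v" "v \<le> 1"
  shows "\<bar>- ln (max u (exp (- K))) + ln (max v (exp (- K)))\<bar> \<le> exp K * \<bar>u - v\<bar>"
proof -
  have le: "ln (max v (exp (- K))) - ln (max u (exp (- K))) \<le> exp K * \<bar>u - v\<bar>" for u v :: real
  proof -
    let ?a = "max u (exp (- K))" and ?b = "max v (exp (- K))"
    have a: "0 < ?a" "exp (- K) \<le> ?a" by (auto simp: less_max_iff_disj)
    have b: "0 < ?b" by (auto simp: less_max_iff_disj)
    have "ln ?b - ln ?a = ln (?b / ?a)" using a b by (simp add: ln_div)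
    also have "\<dots> \<le> ?b / ?a - 1" using a b by (intro ln_le_minus_one) simp
    also have "\<dots> = (?b - ?a) / ?a" using a by (simp add: diff_divide_distrib)
    also have "\<dots> \<le> \<bar>u - v\<bar> / ?a" using a by (intro divide_right_mono) auto
    also have "\<dots> \<le> \<bar>u - v\<bar> / exp (- K)" using a by (intro divide_left_mono) auto
    finally show ?thesis by (simp add: exp_minus field_simps)
  qed
  show ?thesis using le[of v u] le[of u v] by (auto simp: abs_le_iff abs_minus_commute)
qed

lemma integrable_laplace:
  assumes "mean_one P" "0 \<le> t" shows "integrable P (\<lambda>x. exp (- t * x))"
proof -
  interpret prob_space P using assms by (simp add: mean_one_def)
  have [measurable_cong]: "sets P = sets borel" using assms by (simp add: mean_one_def)
  have "AE x in P. norm (exp (- t * x)) \<le> 1"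
    using assms(1) unfolding mean_one_def by (auto elim!: eventually_mono simp: assms(2))
  thus ?thesis by (intro integrable_const_bound[where B = 1]) auto
qed

text \<open>Pointwise \<open>1 - exp (- t * x)\<close> is at most \<open>1\<close> and at most
  \<open>t * x\<close>, so \<open>x - (1 - exp (- t * x)) / t\<close> dominates the excess of
  \<open>x\<close> over \<open>1 / t\<close>. As the mean is exactly 1, a transform close to
  \<open>1 - t\<close> leaves little mass far out.\<close>

lemma laplace_tail:
  assumes P: "mean_one P" and t: "0 < t"
  shows "integrable P (\<lambda>x. max (x - 1 / t) 0)" "(\<integral>x. max (x - 1 / t) 0 \<partial>P) \<le> 1 - (1 - laplace P t) / t"
proof -
  interpret prob_space P using P by (simp add: mean_one_def)
  have [measurable_cong]: "sets P = sets borel" using P by (simp add: mean_one_def)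
  have int: "integrable P (\<lambda>x. x)" and nn: "AE x in P. 0 \<le> x" and one: "(\<integral>x. x \<partial>P) = 1"
    using P by (auto simp: mean_one_def)
  show i: "integrable P (\<lambda>x. max (x - 1 / t) 0)" using int by (intro integrable_max) auto
  note e = integrable_laplace[OF P less_imp_le[OF t]]
  have "(\<integral>x. max (x - 1 / t) 0 \<partial>P) \<le> (\<integral>x. x - (1 - exp (- t * x)) / t \<partial>P)"
  proof (rule integral_mono_AE[OF i])
    show "integrable P (\<lambda>x. x - (1 - exp (- t * x)) / t)" using int e by auto
    show "AE x in P. max (x - 1 / t) 0 \<le> x - (1 - exp (- t * x)) / t"
      using nn
    proof eventually_elim
      case (elim x)
      have "(1 - exp (- t * x)) / t \<le> 1 / t" using t by (intro divide_right_mono) auto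
      moreover have "1 - exp (- t * x) \<le> t * x" using exp_ge_add_one_self[of "- t * x"] by simp
      hence "(1 - exp (- t * x)) / t \<le> x" using t by (simp add: field_simps)
      ultimately show ?case by simp
    qed
  qed
  also have "\<dots> = 1 - (1 - laplace P t) / t"
    using int e one by (simp add: laplace_def prob_space)
  finally show "(\<integral>x. max (x - 1 / t) 0 \<partial>P) \<le> 1 - (1 - laplace P t) / t" .
qed

lemma binomial_laplace:
  assumes P: "mean_one P"
  shows "integrable P (\<lambda>x. exp (- x) ^ k * (1 - exp (- x)) ^ r)"
    and "(\<integral>x. exp (- x) ^ k * (1 - exp (- x)) ^ r \<partial>P) = (\<Sum>j\<le>r. real (r choose j) * (- 1) ^ j * laplace P (real (k + j)))"
proof -
  have eq: "exp (- x) ^ k * (1 - exp (- x)) ^ r = (\<Sum>j\<le>r. real (r choose j) * (- 1) ^ j * exp (- real (k + j) * x))" for x :: real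
  proof -
    have "(1 - exp (- x)) ^ r = (- exp (- x) + 1) ^ r" by simp
    also have "\<dots> = (\<Sum>j\<le>r. real (r choose j) * (- exp (- x)) ^ j * 1 ^ (r - j))" by (rule binomial_ring)
    finally have "exp (- x) ^ k * (1 - exp (- x)) ^ r = (\<Sum>j\<le>r. exp (- x) ^ k * (real (r choose j) * (- exp (- x)) ^ j))"
      by (simp add: sum_distrib_left)
    also have "\<dots> = (\<Sum>j\<le>r. real (r choose j) * (- 1) ^ j * exp (- real (k + j) * x))"
    proof (intro sum.cong refl)
      fix j
      have "exp (- x) ^ k * exp (- x) ^ j = exp (- real (k + j) * x)"
        by (simp add: exp_of_nat_mult[symmetric] exp_add[symmetric] algebra_simps)
      thus "exp (- x) ^ k * (real (r choose j) * (- exp (- x)) ^ j) = real (r choose j) * (- 1) ^ j * exp (- real (k + j) * x)"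
        by (simp add: power_minus[of "exp (- x)"])
    qed
    finally show ?thesis .
  qed
  note e = integrable_laplace[OF P of_nat_0_le_iff]
  show "integrable P (\<lambda>x. exp (- x) ^ k * (1 - exp (- x)) ^ r)"
    unfolding eq by (intro Bochner_Integration.integrable_sum integrable_mult_right e)
  have "(\<integral>x. exp (- x) ^ k * (1 - exp (- x)) ^ r \<partial>P)
      = (\<Sum>j\<le>r. \<integral>x. real (r choose j) * (- 1) ^ j * exp (- real (k + j) * x) \<partial>P)"
    unfolding eq by (intro Bochner_Integration.integral_sum integrable_mult_right e)
  thus "(\<integral>x. exp (- x) ^ k * (1 - exp (- x)) ^ r \<partial>P) = (\<Sum>j\<le>r. real (r choose j) * (- 1) ^ j * laplace P (real (k + j)))"
    by (simp add: laplace_def)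
qed

text \<open>In the variable \<open>u = exp (- x)\<close>, a truncated Lipschitz function is approximated by its
  Bernstein polynomial at a rate that does not depend on the function, and the integral of a
  polynomial in \<open>u\<close> is a combination of Laplace transforms.\<close>
lemma lipschitz_integral_diff:
  assumes P: "mean_one P" and Q: "mean_one Q" and f: "\<And>x y. \<bar>f x - f y\<bar> \<le> \<bar>x - y\<bar>"
    and t: "0 < t" and N: "1 \<le> N"
    and close: "\<And>i. i \<le> N \<Longrightarrow> \<bar>laplace P (real i) - laplace Q (real i)\<bar> \<le> \<delta>"
  shows "\<bar>(\<integral>x. f x \<partial>P) - (\<integral>x. f x \<partial>Q)\<bar> \<le> (1 - (1 - laplace P t) / t) + (1 - (1 - laplace Q t) / t)
     + 2 * exp (1 / t) / sqrt N + (1 / t) * 3 ^ N * \<delta>"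
proof -
  define K where "K = 1 / t"
  have K0: "0 < K" using t by (simp add: K_def)
  \<comment> \<open>The truncated function \<open>f (min x K) - f 0\<close> in the variable
    \<open>u = exp (- x)\<close>. Subtracting \<open>f 0\<close> makes it bounded by
    \<open>K\<close> whatever \<open>f\<close> is.\<close>
  define F where "F u = f (- ln (max u (exp (- K)))) - f 0" for u
  let ?b = "\<lambda>x. \<Sum>k\<le>N. F (k / N) * Bernstein N k (exp (- x))"
  have cont: "continuous_on UNIV f"
  proof (rule continuous_onI)
    fix x e :: real assume "0 < e"
    moreover have "dist (f x') (f x) \<le> e" if "dist x' x < e" for x'
      using f[of x' x] that by (simp add: dist_real_def)
    ultimately show "\<exists>d>0. \<forall>x'\<in>UNIV. dist x' x < d \<longrightarrow> dist (f x') (f x) \<le> e" by blast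
  qed
  have fm: "f \<in> borel_measurable borel" using cont by (rule borel_measurable_continuous_onI)
  have Flip: "\<bar>F u - F v\<bar> \<le> exp K * \<bar>u - v\<bar>" if "0 \<le> u" "u \<le> 1" "0 \<le> v" "v \<le> 1" for u v
    using f[of "- ln (max u (exp (- K)))" "- ln (max v (exp (- K)))"]
      truncated_log_lipschitz[OF less_imp_le[OF K0] that] by (simp add: F_def)
  have Fb: "\<bar>F u\<bar> \<le> K" if "0 \<le> u" "u \<le> 1" for u
  proof -
    have "- ln (max u (exp (- K))) \<le> K"
      using ln_ge_iff[of "max u (exp (- K))" "- K"] by (simp add: less_max_iff_disj)
    moreover have "0 \<le> - ln (max u (exp (- K)))"
      using that K0 ln_le_zero_iff[of "max u (exp (- K))"] by (simp add: less_max_iff_disj)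
    ultimately show ?thesis using f[of "- ln (max u (exp (- K)))" 0] by (simp add: F_def)
  qed
  have pw: "\<bar>f x - f 0 - ?b x\<bar> \<le> max (x - K) 0 + exp K / sqrt N" if x: "0 \<le> x" for x
  proof -
    have "F (exp (- x)) = f (min x K) - f 0"
    proof -
      have "max (exp (- x)) (exp (- K)) = exp (- min x K)" by (auto simp: max_def min_def)
      thus ?thesis by (simp add: F_def)
    qed
    moreover have "\<bar>F (exp (- x)) - ?b x\<bar> \<le> exp K / sqrt N"
      by (rule bernstein_lipschitz) (use Flip x N in auto)
    moreover have "\<bar>f x - f (min x K)\<bar> \<le> max (x - K) 0" using f[of x "min x K"] by (auto simp: min_def)
    ultimately show ?thesis by linarith
  qed
  define c where "c k = F (k / N) * real (N choose k)" for k
  have b_int: "integrable M ?b" and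
    b_val: "(\<integral>x. ?b x \<partial>M) = (\<Sum>k\<le>N. c k * (\<Sum>j\<le>N - k. real ((N - k) choose j) * (- 1) ^ j * laplace M (real (k + j))))"
    if M: "mean_one M" for M
  proof -
    have eq: "?b x = (\<Sum>k\<le>N. c k * (exp (- x) ^ k * (1 - exp (- x)) ^ (N - k)))" for x
      by (simp add: Bernstein_def c_def mult_ac)
    show "integrable M ?b" unfolding eq
      by (intro Bochner_Integration.integrable_sum integrable_mult_right binomial_laplace M)
    have "(\<integral>x. ?b x \<partial>M) = (\<Sum>k\<le>N. \<integral>x. c k * (exp (- x) ^ k * (1 - exp (- x)) ^ (N - k)) \<partial>M)"
      unfolding eq by (intro Bochner_Integration.integral_sum integrable_mult_right binomial_laplace M)
    thus "(\<integral>x. ?b x \<partial>M) = (\<Sum>k\<le>N. c k * (\<Sum>j\<le>N - k. real ((N - k) choose j) * (- 1) ^ j * laplace M (real (k + j))))"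
      by (simp add: binomial_laplace(2)[OF M])
  qed
  have one: "\<bar>(\<integral>x. f x \<partial>M) - f 0 - (\<integral>x. ?b x \<partial>M)\<bar> \<le> (1 - (1 - laplace M t) / t) + exp K / sqrt N"
    if M: "mean_one M" for M
  proof -
    interpret prob_space M using M by (simp add: mean_one_def)
    have [measurable_cong]: "sets M = sets borel" using M by (simp add: mean_one_def)
    have nn: "AE x in M. 0 \<le> x" and int: "integrable M (\<lambda>x. x)" using M by (auto simp: mean_one_def)
    have f_int: "integrable M f"
    proof (rule Bochner_Integration.integrable_bound)
      show "integrable M (\<lambda>x. \<bar>f 0\<bar> + \<bar>x\<bar>)" using int by auto
      show "f \<in> borel_measurable M" using fm by simp
      have "\<bar>f x\<bar> \<le> \<bar>f 0\<bar> + \<bar>x\<bar>" for x using f[of x 0] by simp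
      thus "AE x in M. norm (f x) \<le> norm (\<bar>f 0\<bar> + \<bar>x\<bar>)" by auto
    qed
    have "(\<integral>x. f x \<partial>M) - f 0 - (\<integral>x. ?b x \<partial>M) = (\<integral>x. f x - f 0 - ?b x \<partial>M)"
      using f_int b_int[OF M] by (simp add: prob_space)
    hence "\<bar>(\<integral>x. f x \<partial>M) - f 0 - (\<integral>x. ?b x \<partial>M)\<bar> \<le> (\<integral>x. \<bar>f x - f 0 - ?b x\<bar> \<partial>M)"
      using integral_abs_bound[of M "\<lambda>x. f x - f 0 - ?b x"] by simp
    also have "\<dots> \<le> (\<integral>x. max (x - 1 / t) 0 + exp K / sqrt N \<partial>M)"
    proof (rule integral_mono_AE)
      show "integrable M (\<lambda>x. \<bar>f x - f 0 - ?b x\<bar>)" using f_int b_int[OF M] by auto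
      show "integrable M (\<lambda>x. max (x - 1 / t) 0 + exp K / sqrt N)" using laplace_tail(1)[OF M t] by auto
      show "AE x in M. \<bar>f x - f 0 - ?b x\<bar> \<le> max (x - 1 / t) 0 + exp K / sqrt N"
        using nn by eventually_elim (use pw in \<open>simp add: K_def\<close>)
    qed
    also have "\<dots> = (\<integral>x. max (x - 1 / t) 0 \<partial>M) + exp K / sqrt N"
      using laplace_tail(1)[OF M t] by (simp add: prob_space)
    finally show ?thesis using laplace_tail(2)[OF M t] by linarith
  qed
  have "\<bar>(\<integral>x. ?b x \<partial>P) - (\<integral>x. ?b x \<partial>Q)\<bar> \<le> K * 3 ^ N * \<delta>"
  proof -
    let ?d = "\<lambda>i. laplace P (real i) - laplace Q (real i)"
    have "(\<integral>x. ?b x \<partial>P) - (\<integral>x. ?b x \<partial>Q) = (\<Sum>k\<le>N. c k * (\<Sum>j\<le>N - k. real ((N - k) choose j) * (- 1) ^ j * ?d (k + j)))"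
      unfolding b_val[OF P] b_val[OF Q] by (simp add: right_diff_distrib sum_subtractf)
    hence "\<bar>(\<integral>x. ?b x \<partial>P) - (\<integral>x. ?b x \<partial>Q)\<bar>
        = \<bar>\<Sum>k\<le>N. c k * (\<Sum>j\<le>N - k. real ((N - k) choose j) * (- 1) ^ j * ?d (k + j))\<bar>" by simp
    also have "\<dots> \<le> (\<Sum>k\<le>N. (K * real (N choose k)) * (2 ^ (N - k) * \<delta>))"
    proof (intro order_trans[OF sum_abs] sum_mono)
      fix k assume k: "k \<in> {..N}"
      have "\<bar>\<Sum>j\<le>N - k. real ((N - k) choose j) * (- 1) ^ j * ?d (k + j)\<bar> \<le> (\<Sum>j\<le>N - k. real ((N - k) choose j) * \<delta>)"
      proof (intro order_trans[OF sum_abs] sum_mono)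
        fix j assume "j \<in> {..N - k}"
        hence "\<bar>?d (k + j)\<bar> \<le> \<delta>" using close[of "k + j"] k by simp
        thus "\<bar>real ((N - k) choose j) * (- 1) ^ j * ?d (k + j)\<bar> \<le> real ((N - k) choose j) * \<delta>"
          by (simp add: abs_mult power_abs mult_left_mono)
      qed
      also have "\<dots> = 2 ^ (N - k) * \<delta>"
        using choose_row_sum[of "N - k"] by (simp flip: sum_distrib_right of_nat_sum)
      finally have inner: "\<bar>\<Sum>j\<le>N - k. real ((N - k) choose j) * (- 1) ^ j * ?d (k + j)\<bar> \<le> 2 ^ (N - k) * \<delta>" .
      have "\<bar>F (k / N)\<bar> \<le> K" using k N by (intro Fb) auto
      hence "\<bar>c k\<bar> \<le> K * real (N choose k)" by (simp add: c_def abs_mult mult_right_mono)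
      thus "\<bar>c k * (\<Sum>j\<le>N - k. real ((N - k) choose j) * (- 1) ^ j * ?d (k + j))\<bar> \<le> (K * real (N choose k)) * (2 ^ (N - k) * \<delta>)"
        unfolding abs_mult using inner K0 by (intro mult_mono) auto
    qed
    \<comment> \<open>The factor \<open>2 ^ (N - k)\<close> bounds the alternating expansion of
      \<open>(1 - u) ^ (N - k)\<close>; with the binomial coefficients of the Bernstein basis the
      sum is \<open>(1 + 2) ^ N\<close>.\<close>
    also have "\<dots> = K * (\<Sum>k\<le>N. real (N choose k) * 1 ^ k * 2 ^ (N - k)) * \<delta>"
      by (simp add: sum_distrib_left sum_distrib_right mult_ac)
    also have "(\<Sum>k\<le>N. real (N choose k) * 1 ^ k * 2 ^ (N - k)) = (3::real) ^ N"
      using binomial_ring[of "1::real" 2 N] by simp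
    finally show ?thesis .
  qed
  thus ?thesis using one[OF P] one[OF Q] unfolding K_def by linarith
qed

lemma wasserstein1_le_laplace:
  assumes P: "mean_one P" and Q: "mean_one Q" and t: "0 < t" and N: "1 \<le> N"
    and close: "\<And>i. i \<le> N \<Longrightarrow> \<bar>laplace P (real i) - laplace Q (real i)\<bar> \<le> \<delta>"
  shows "wasserstein1 P Q \<le> (1 - (1 - laplace P t) / t) + (1 - (1 - laplace Q t) / t)
     + 2 * exp (1 / t) / sqrt N + (1 / t) * 3 ^ N * \<delta>"
  unfolding wasserstein1_def
proof (rule cSUP_least)
  show "{f :: real \<Rightarrow> real. \<forall>x y. \<bar>f x - f y\<bar> \<le> \<bar>x - y\<bar>} \<noteq> {}"
    by (intro ex_in_conv[THEN iffD1] exI[of _ "\<lambda>_. 0"]) auto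
qed (use lipschitz_integral_diff[OF P Q _ t N close] in blast)

section \<open>Laplace transforms near zero\<close>

lemma pow_diff_le:
  fixes a b :: real
  assumes "0 \<le> a" "a \<le> 1" "0 \<le> b" "b \<le> 1"
  shows "\<bar>a ^ k - b ^ k\<bar> \<le> k * \<bar>a - b\<bar>"
  using norm_power_diff[of a b k] assms by simp

text \<open>The upper bound rests on \<open>(1 + x + x\<^sup>2 / 2) * (1 - x + x\<^sup>2 / 2) = 1 +
  x ^ 4 / 4\<close> and on the quadratic lower bound for \<open>exp x\<close>.\<close>

lemma exp_minus_bounds:
  fixes x :: real
  assumes "0 \<le> x" shows "1 - x \<le> exp (- x)" "exp (- x) \<le> 1 - x + x\<^sup>2 / 2"
proof -
  show "1 - x \<le> exp (- x)" using exp_ge_add_one_self[of "- x"] by simp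
  have "1 + x + x\<^sup>2 / 2 \<le> exp x" using exp_lower_Taylor_quadratic[OF assms] by simp
  hence "1 \<le> (1 + x + x\<^sup>2 / 2) * (1 - x + x\<^sup>2 / 2)" "0 < 1 + x + x\<^sup>2 / 2"
    using assms by (auto simp: algebra_simps power2_eq_square add_pos_nonneg)
  hence "exp (- x) \<le> 1 / (1 + x + x\<^sup>2 / 2)"
    using \<open>1 + x + x\<^sup>2 / 2 \<le> exp x\<close> by (simp add: exp_minus inverse_eq_divide frac_le)
  also have "\<dots> \<le> 1 - x + x\<^sup>2 / 2"
    using \<open>1 \<le> (1 + x + x\<^sup>2 / 2) * (1 - x + x\<^sup>2 / 2)\<close> \<open>0 < 1 + x + x\<^sup>2 / 2\<close>
    by (simp add: divide_le_eq mult.commute)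
  finally show "exp (- x) \<le> 1 - x + x\<^sup>2 / 2" .
qed

lemma laplace_bounds:
  assumes P: "mean_one P" and t: "0 \<le> t" shows "0 \<le> laplace P t \<and> laplace P t \<le> 1"
proof -
  interpret prob_space P using P by (simp add: mean_one_def)
  have nn: "AE x in P. 0 \<le> x" using P by (simp add: mean_one_def)
  have "laplace P t \<le> (\<integral>x. 1 \<partial>P)" unfolding laplace_def
    by (rule integral_mono_AE[OF integrable_laplace[OF P t]])
       (use nn t in \<open>auto elim!: eventually_mono\<close>)
  thus ?thesis by (simp add: laplace_def prob_space)
qed

lemma tail_vanishes:
  assumes P: "mean_one P" and \<delta>: "0 < \<delta>"
  obtains K :: nat where "(\<integral>x. \<bar>x\<bar> * indicat_real {real K<..} x \<partial>P) \<le> \<delta>"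
proof -
  have [measurable_cong]: "sets P = sets borel" using P by (simp add: mean_one_def)
  have int: "integrable P (\<lambda>x. x)" using P by (simp add: mean_one_def)
  have "(\<lambda>K. \<integral>x. \<bar>x\<bar> * indicat_real {real K<..} x \<partial>P) \<longlonglongrightarrow> (\<integral>x. 0 \<partial>P)"
  proof (rule integral_dominated_convergence[where w = "\<lambda>x. \<bar>x\<bar>"])
    show "AE x in P. (\<lambda>K. \<bar>x\<bar> * indicat_real {real K<..} x) \<longlonglongrightarrow> 0"
    proof (rule AE_I2)
      fix x
      have "\<forall>\<^sub>F K in sequentially. \<bar>x\<bar> * indicat_real {real K<..} x = 0"
      proof -
        obtain K0 :: nat where "x \<le> real K0" using real_arch_simple by blast
        hence "\<forall>K\<ge>K0. \<bar>x\<bar> * indicat_real {real K<..} x = 0" by (auto simp: indicator_def)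
        thus ?thesis unfolding eventually_sequentially by blast
      qed
      thus "(\<lambda>K. \<bar>x\<bar> * indicat_real {real K<..} x) \<longlonglongrightarrow> 0" by (rule tendsto_eventually)
    qed
    show "integrable P (\<lambda>x. \<bar>x\<bar>)" using int by simp
    show "AE x in P. norm (\<bar>x\<bar> * indicat_real {real K<..} x) \<le> \<bar>x\<bar>" for K
      by (rule AE_I2) (simp add: indicator_def)
  qed measurable
  hence "\<forall>\<^sub>F K in sequentially. (\<integral>x. \<bar>x\<bar> * indicat_real {real K<..} x \<partial>P) < \<delta>"
    using \<delta> by (auto dest: order_tendstoD(2))
  then obtain K where "(\<integral>x. \<bar>x\<bar> * indicat_real {real K<..} x \<partial>P) < \<delta>"
    unfolding eventually_sequentially by blast
  thus ?thesis by (intro that[of K]) simp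
qed

text \<open>Both functions have slope -1 at 0, and a finite mean suffices for an error smaller than
  any multiple of \<open>u\<close>. Above a level \<open>K\<close> the error is at most
  \<open>u * x\<close>, which the tail of the mean absorbs; below it, the error is at most of order
  \<open>(u * K)\<^sup>2\<close>.\<close>

lemma laplace_at_0:
  assumes P: "mean_one P" and \<delta>: "0 < \<delta>"
  obtains u0 where "0 < u0" "\<And>u. 0 \<le> u \<Longrightarrow> u \<le> u0 \<Longrightarrow> \<bar>exp (- u) - laplace P u\<bar> \<le> \<delta> * u"
proof -
  interpret prob_space P using P by (simp add: mean_one_def)
  have [measurable_cong]: "sets P = sets borel" using P by (simp add: mean_one_def)
  have nn: "AE x in P. 0 \<le> x" and int: "integrable P (\<lambda>x. x)" and one: "(\<integral>x. x \<partial>P) = 1"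
    using P by (auto simp: mean_one_def)
  obtain K :: nat where K: "(\<integral>x. \<bar>x\<bar> * indicat_real {real K<..} x \<partial>P) \<le> \<delta> / 2"
    using tail_vanishes[OF P, of "\<delta> / 2"] \<delta> by auto
  \<comment> \<open>Chosen so that
    \<open>u\<^sup>2 * (real K)\<^sup>2 + u\<^sup>2 \<le> \<delta> * u\<close> for
    \<open>u \<le> u0\<close>, which absorbs the quadratic errors of both functions.\<close>
  define u0 where "u0 = \<delta> / ((real K)\<^sup>2 + 1)"
  have D0: "0 < (real K)\<^sup>2 + 1" by (simp add: add_nonneg_pos)
  have "\<bar>exp (- u) - laplace P u\<bar> \<le> \<delta> * u" if u: "0 \<le> u" "u \<le> u0" for u
  proof -
    note e = integrable_laplace[OF P u(1)]
    have tl: "integrable P (\<lambda>x. \<bar>x\<bar> * indicat_real {real K<..} x)"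
      by (rule Bochner_Integration.integrable_bound[OF int]) (auto simp: indicator_def)
    have low: "1 - u \<le> laplace P u"
    proof -
      have "1 - u = (\<integral>x. 1 - u * x \<partial>P)" using int one by (simp add: prob_space)
      also have "\<dots> \<le> laplace P u" unfolding laplace_def
      proof (rule integral_mono)
        show "integrable P (\<lambda>x. 1 - u * x)" using int by auto
        show "1 - u * x \<le> exp (- u * x)" for x using exp_ge_add_one_self[of "- u * x"] by simp
      qed (rule e)
      finally show ?thesis .
    qed
    have "laplace P u \<le> (\<integral>x. 1 - u * x + (u * (\<bar>x\<bar> * indicat_real {real K<..} x) + (u * K)\<^sup>2 / 2) \<partial>P)"
      unfolding laplace_def
    proof (rule integral_mono_AE[OF e])
      show "integrable P (\<lambda>x. 1 - u * x + (u * (\<bar>x\<bar> * indicat_real {real K<..} x) + (u * K)\<^sup>2 / 2))"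
        using int tl by auto
      show "AE x in P. exp (- u * x) \<le> 1 - u * x + (u * (\<bar>x\<bar> * indicat_real {real K<..} x) + (u * K)\<^sup>2 / 2)"
        using nn
      proof eventually_elim
        case (elim x)
        have ux: "0 \<le> u * x" using u elim by simp
        show ?case
        proof (cases "x > real K")
          case True
          have "exp (- u * x) \<le> 1" using ux by simp
          moreover have "0 \<le> (u * K)\<^sup>2 / 2" by simp
          moreover have "1 - u * x + (u * (\<bar>x\<bar> * indicat_real {real K<..} x) + (u * K)\<^sup>2 / 2) = 1 + (u * K)\<^sup>2 / 2"
            using True elim by (simp add: indicator_def)
          ultimately show ?thesis by linarith
        next
          case False
          have "(u * x)\<^sup>2 \<le> (u * K)\<^sup>2" using False u elim by (intro power_mono mult_left_mono) auto
          thus ?thesis using exp_minus_bounds(2)[OF ux] False by simp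
        qed
      qed
    qed
    also have "\<dots> = 1 - u + (u * (\<integral>x. \<bar>x\<bar> * indicat_real {real K<..} x \<partial>P) + (u * K)\<^sup>2 / 2)"
      using int tl one by (simp add: prob_space)
    also have "\<dots> \<le> 1 - u + (u * (\<delta> / 2) + (u * K)\<^sup>2 / 2)"
      using K u by (intro add_left_mono add_right_mono mult_left_mono) auto
    finally have up: "laplace P u \<le> 1 - u + (u * (\<delta> / 2) + (u * K)\<^sup>2 / 2)" .
    have "u * ((real K)\<^sup>2 + 1) \<le> \<delta>" using u D0 by (simp add: u0_def pos_le_divide_eq)
    from mult_left_mono[OF this u(1)] have "u\<^sup>2 * (real K)\<^sup>2 + u\<^sup>2 \<le> \<delta> * u"
      by (simp add: power2_eq_square algebra_simps)
    moreover have "exp (- u) \<le> 1 - u + u\<^sup>2 / 2" "1 - u \<le> exp (- u)" using exp_minus_bounds[OF u(1)] by auto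
    moreover have "0 \<le> u\<^sup>2" "0 \<le> u\<^sup>2 * (real K)\<^sup>2" by auto
    ultimately show ?thesis using up low by (simp add: power_mult_distrib abs_le_iff algebra_simps)
  qed
  moreover have "0 < u0" using \<delta> D0 by (simp add: u0_def)
  ultimately show ?thesis using that by blast
qed

section \<open>The limiting law\<close>

text \<open>Common form of the smoothing map, where \<open>a j\<close> is the inverse out-degree,
  and of the law of \<open>M_star\<close>, where \<open>a\<close> is constant.\<close>

definition mixture :: "'i pmf \<Rightarrow> ('i \<Rightarrow> real) \<Rightarrow> ('i \<Rightarrow> nat) \<Rightarrow> real measure \<Rightarrow> real measure" where
  "mixture p a d \<mu> = measure_pmf p \<bind> (\<lambda>j. distr (PiM {..<d j} (\<lambda>_. \<mu>)) borel (\<lambda>z. a j * (\<Sum>k<d j. z k)))"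

context
  fixes p :: "'i pmf" and a :: "'i \<Rightarrow> real" and d :: "'i \<Rightarrow> nat" and \<mu> :: "real measure"
  assumes \<mu>: "mean_one \<mu>" and a: "\<And>j. 0 \<le> a j"
begin

lemma mixture_kernel:
  "(\<lambda>j. distr (PiM {..<d j} (\<lambda>_. \<mu>)) borel (\<lambda>z. a j * (\<Sum>k<d j. z k))) \<in> measure_pmf p \<rightarrow>\<^sub>M prob_algebra borel"
proof -
  have [measurable_cong]: "sets \<mu> = sets borel" using \<mu> by (simp add: mean_one_def)
  have "prob_space (distr (PiM {..<d j} (\<lambda>_. \<mu>)) borel (\<lambda>z. a j * (\<Sum>k<d j. z k)))" for j
    using \<mu> by (intro prob_space.prob_space_distr prob_space_PiM) (auto simp: mean_one_def)
  thus ?thesis by (auto simp: space_prob_algebra)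
qed

lemma mixture_nn_integral:
  assumes "f \<in> borel_measurable borel"
  shows "(\<integral>\<^sup>+x. f x \<partial>mixture p a d \<mu>) = (\<integral>\<^sup>+j. (\<integral>\<^sup>+z. f (a j * (\<Sum>k<d j. z k)) \<partial>PiM {..<d j} (\<lambda>_. \<mu>)) \<partial>p)"
proof -
  have [measurable_cong]: "sets \<mu> = sets borel" using \<mu> by (simp add: mean_one_def)
  have "(\<integral>\<^sup>+x. f x \<partial>mixture p a d \<mu>)
     = (\<integral>\<^sup>+j. (\<integral>\<^sup>+x. f x \<partial>distr (PiM {..<d j} (\<lambda>_. \<mu>)) borel (\<lambda>z. a j * (\<Sum>k<d j. z k))) \<partial>p)"
    unfolding mixture_def by (rule nn_integral_bind[OF assms measurable_prob_algebraD[OF mixture_kernel]])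
  also have "\<dots> = (\<integral>\<^sup>+j. (\<integral>\<^sup>+z. f (a j * (\<Sum>k<d j. z k)) \<partial>PiM {..<d j} (\<lambda>_. \<mu>)) \<partial>p)"
    using assms by (intro nn_integral_cong nn_integral_distr) auto
  finally show ?thesis .
qed

lemma mixture_nonneg_AE: "AE z in PiM {..<d j} (\<lambda>_. \<mu>). \<forall>k<d j. 0 \<le> z k"
proof -
  have "AE z in PiM {..<d j} (\<lambda>_. \<mu>). \<forall>k\<in>{..<d j}. 0 \<le> z k"
    by (intro AE_finite_allI AE_PiM_component) (use \<mu> in \<open>auto simp: mean_one_def\<close>)
  thus ?thesis by (auto elim!: eventually_mono)
qed

lemma mixture_prob: "prob_space (mixture p a d \<mu>)" and sets_mixture: "sets (mixture p a d \<mu>) = sets borel"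
proof -
  have "measure_pmf p \<in> space (prob_algebra (count_space UNIV))"
    by (simp add: space_prob_algebra measure_pmf.prob_space_axioms)
  moreover have "(\<lambda>j. distr (PiM {..<d j} (\<lambda>_. \<mu>)) borel (\<lambda>z. a j * (\<Sum>k<d j. z k)))
      \<in> count_space UNIV \<rightarrow>\<^sub>M prob_algebra borel"
    using mixture_kernel by simp
  ultimately show "prob_space (mixture p a d \<mu>)" "sets (mixture p a d \<mu>) = sets borel"
    unfolding mixture_def by (rule prob_space_bind', rule sets_bind')
qed

lemma mixture_AE: "AE x in mixture p a d \<mu>. 0 \<le> x"
proof -
  have [measurable_cong]: "sets \<mu> = sets borel" using \<mu> by (simp add: mean_one_def)
  have "AE x in distr (PiM {..<d j} (\<lambda>_. \<mu>)) borel (\<lambda>z. a j * (\<Sum>k<d j. z k)). 0 \<le> x" for j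
  proof (subst AE_distr_iff)
    show "AE z in PiM {..<d j} (\<lambda>_. \<mu>). 0 \<le> a j * (\<Sum>k<d j. z k)"
      using mixture_nonneg_AE[of j] by eventually_elim (use a in \<open>auto intro!: mult_nonneg_nonneg sum_nonneg\<close>)
  qed auto
  thus ?thesis unfolding mixture_def
    by (subst AE_bind[OF measurable_prob_algebraD[OF mixture_kernel]]) auto
qed

text \<open>Stated for nonnegative integrals, so that integrability of the mixture is a consequence
  and not a precondition.\<close>

lemma mixture_mean:
  "(\<integral>\<^sup>+x. ennreal x \<partial>mixture p a d \<mu>) = (\<integral>\<^sup>+j. ennreal (a j * d j) \<partial>p)"
proof -
  have [measurable_cong]: "sets \<mu> = sets borel" using \<mu> by (simp add: mean_one_def)
  have pm: "prob_space \<mu>" using \<mu> by (simp add: mean_one_def)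
  have one: "(\<integral>\<^sup>+x. ennreal x \<partial>\<mu>) = 1"
    using \<mu> nn_integral_eq_integral[of \<mu> "\<lambda>x. x"] by (simp add: mean_one_def)
  have "(\<integral>\<^sup>+z. ennreal (a j * (\<Sum>k<d j. z k)) \<partial>PiM {..<d j} (\<lambda>_. \<mu>)) = ennreal (a j * d j)" for j
  proof -
    have "(\<integral>\<^sup>+z. ennreal (a j * (\<Sum>k<d j. z k)) \<partial>PiM {..<d j} (\<lambda>_. \<mu>))
        = (\<integral>\<^sup>+z. ennreal (a j) * (\<Sum>k<d j. ennreal (z k)) \<partial>PiM {..<d j} (\<lambda>_. \<mu>))"
    proof (rule nn_integral_cong_AE)
      show "AE z in PiM {..<d j} (\<lambda>_. \<mu>). ennreal (a j * (\<Sum>k<d j. z k)) = ennreal (a j) * (\<Sum>k<d j. ennreal (z k))"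
        using mixture_nonneg_AE[of j]
      proof eventually_elim
        case (elim z)
        have "(\<Sum>k<d j. ennreal (z k)) = ennreal (\<Sum>k<d j. z k)" using elim by (intro sum_ennreal) auto
        moreover have "0 \<le> (\<Sum>k<d j. z k)" using elim by (intro sum_nonneg) auto
        ultimately show ?case using a by (simp add: ennreal_mult)
      qed
    qed
    also have "\<dots> = ennreal (a j) * (\<Sum>k<d j. \<integral>\<^sup>+z. ennreal (z k) \<partial>PiM {..<d j} (\<lambda>_. \<mu>))"
    proof -
      have "(\<integral>\<^sup>+z. (\<Sum>k<d j. ennreal (z k)) \<partial>PiM {..<d j} (\<lambda>_. \<mu>)) = (\<Sum>k<d j. \<integral>\<^sup>+z. ennreal (z k) \<partial>PiM {..<d j} (\<lambda>_. \<mu>))"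
        by (rule nn_integral_sum) auto
      thus ?thesis by (subst nn_integral_cmult) auto
    qed
    also have "(\<Sum>k<d j. \<integral>\<^sup>+z. ennreal (z k) \<partial>PiM {..<d j} (\<lambda>_. \<mu>)) = (\<Sum>k<d j. 1)"
    proof (intro sum.cong refl)
      fix k assume k: "k \<in> {..<d j}"
      have "(\<integral>\<^sup>+x. ennreal x \<partial>distr (PiM {..<d j} (\<lambda>_. \<mu>)) \<mu> (\<lambda>z. z k)) = (\<integral>\<^sup>+z. ennreal (z k) \<partial>PiM {..<d j} (\<lambda>_. \<mu>))"
        using k by (intro nn_integral_distr) auto
      thus "(\<integral>\<^sup>+z. ennreal (z k) \<partial>PiM {..<d j} (\<lambda>_. \<mu>)) = 1"
        using distr_PiM_component[of "{..<d j}" "\<lambda>_. \<mu>" k] pm k one by simp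
    qed
    finally show ?thesis using a by (simp add: ennreal_mult ennreal_of_nat_eq_real_of_nat)
  qed
  thus ?thesis by (subst mixture_nn_integral) auto
qed

lemma mixture_laplace:
  assumes t: "0 \<le> t"
  shows "(\<integral>\<^sup>+x. ennreal (exp (- t * x)) \<partial>mixture p a d \<mu>) = (\<integral>\<^sup>+j. ennreal (laplace \<mu> (t * a j) ^ d j) \<partial>p)"
proof -
  have [measurable_cong]: "sets \<mu> = sets borel" using \<mu> by (simp add: mean_one_def)
  interpret prob_space \<mu> using \<mu> by (simp add: mean_one_def)
  interpret product_sigma_finite "\<lambda>_::nat. \<mu>" by standard
  have l: "(\<integral>\<^sup>+x. ennreal (exp (- u * x)) \<partial>\<mu>) = ennreal (laplace \<mu> u)" if "0 \<le> u" for u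
    unfolding laplace_def by (rule nn_integral_eq_integral[OF integrable_laplace[OF \<mu> that]]) simp
  have "(\<integral>\<^sup>+z. ennreal (exp (- t * (a j * (\<Sum>k<d j. z k)))) \<partial>PiM {..<d j} (\<lambda>_. \<mu>)) = ennreal (laplace \<mu> (t * a j) ^ d j)" for j
  proof -
    have "ennreal (exp (- t * (a j * (\<Sum>k<d j. z k)))) = (\<Prod>k<d j. ennreal (exp (- (t * a j) * z k)))" for z :: "nat \<Rightarrow> real"
      by (simp add: prod_ennreal sum_distrib_left mult.assoc flip: exp_sum sum_negf)
    hence "(\<integral>\<^sup>+z. ennreal (exp (- t * (a j * (\<Sum>k<d j. z k)))) \<partial>PiM {..<d j} (\<lambda>_. \<mu>))
        = (\<integral>\<^sup>+z. (\<Prod>k<d j. ennreal (exp (- (t * a j) * z k))) \<partial>PiM {..<d j} (\<lambda>_. \<mu>))" by simp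
    also have "\<dots> = (\<Prod>k<d j. \<integral>\<^sup>+x. ennreal (exp (- (t * a j) * x)) \<partial>\<mu>)"
      by (intro product_nn_integral_prod) auto
    also have "\<dots> = (\<Prod>k<d j. ennreal (laplace \<mu> (t * a j)))" using l[of "t * a j"] t a by simp
    also have "\<dots> = ennreal (laplace \<mu> (t * a j) ^ d j)"
      using laplace_bounds[OF \<mu>, of "t * a j"] t a by (simp add: ennreal_power)
    finally show ?thesis .
  qed
  thus ?thesis by (subst mixture_nn_integral) auto
qed

end

section \<open>Convergence of the iterated transforms to the fixed point\<close>

context digraph_env
begin

text \<open>Both linear terms are \<open>- t\<close>, because the weights \<open>din / dout\<close>
  have mean one by \<open>weights_mass\<close>; only quadratic remainders are left.\<close>

lemma phi_first_step:
  assumes t: "0 \<le> t" shows "\<bar>phi (Suc 0) t - phi 0 t\<bar> \<le> (real \<Delta>)\<^sup>2 * t\<^sup>2"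
proof -
  let ?r = "\<lambda>e. real (din (fst e)) / dout (fst e)"
  have r: "0 \<le> ?r e \<and> ?r e \<le> \<Delta>" if "e \<in> E" for e using weights_le[OF that] by simp
  have eq: "phi (Suc 0) t = (\<Sum>e\<in>E. exp (- (t * ?r e))) / m"
    by (simp add: exp_of_nat_mult[symmetric] mult.commute)
  have lin: "(\<Sum>e\<in>E. 1 - t * ?r e) / m = 1 - t"
  proof -
    have "(\<Sum>e\<in>E. 1 - t * ?r e) = m - t * m"
      by (simp only: sum_subtractf sum_distrib_left[symmetric] weights_mass) (simp add: card_E)
    thus ?thesis using m_pos by (simp add: diff_divide_distrib)
  qed
  have "(\<Sum>e\<in>E. 1 - t * ?r e) / m \<le> phi (Suc 0) t"
    unfolding eq using exp_minus_bounds(1) r t by (intro divide_right_mono sum_mono) auto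
  hence low: "1 - t \<le> phi (Suc 0) t" using lin by simp
  have "phi (Suc 0) t \<le> (\<Sum>e\<in>E. (1 - t * ?r e) + t\<^sup>2 * (real \<Delta>)\<^sup>2 / 2) / m"
    unfolding eq
  proof (intro divide_right_mono sum_mono)
    fix e assume e: "e \<in> E"
    have "(t * ?r e)\<^sup>2 \<le> (t * \<Delta>)\<^sup>2" using r[OF e] t by (intro power_mono mult_left_mono) auto
    moreover have "exp (- (t * ?r e)) \<le> 1 - t * ?r e + (t * ?r e)\<^sup>2 / 2"
      by (rule exp_minus_bounds(2)) (use t r[OF e] in auto)
    ultimately show "exp (- (t * ?r e)) \<le> (1 - t * ?r e) + t\<^sup>2 * (real \<Delta>)\<^sup>2 / 2"
      by (simp only: power_mult_distrib)
  qed simp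
  also have "\<dots> = 1 - t + t\<^sup>2 * (real \<Delta>)\<^sup>2 / 2"
    using lin m_pos card_E by (simp only: sum.distrib add_divide_distrib) simp
  finally have up: "phi (Suc 0) t \<le> 1 - t + t\<^sup>2 * (real \<Delta>)\<^sup>2 / 2" .
  have "t\<^sup>2 * 1 \<le> t\<^sup>2 * (real \<Delta>)\<^sup>2" using Delta_ge by (intro mult_left_mono one_le_power) auto
  moreover have "phi 0 t \<le> 1 - t + t\<^sup>2 / 2" "1 - t \<le> phi 0 t" using exp_minus_bounds[OF t] by auto
  ultimately show ?thesis using low up by (simp only: abs_le_iff mult.commute[of "(real \<Delta>)\<^sup>2"]) linarith
qed

text \<open>One smoothing step multiplies a quadratic error by this factor. Mean-one weights and
  out-degrees of at least 2 make it at most 1/2, which is the rate of convergence of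
  \<open>phi\<close>.\<close>

lemma weights_square: "(\<Sum>e\<in>E. real (din (fst e)) * (1 / dout (fst e))\<^sup>2) / m \<le> 1 / 2"
proof -
  have "(\<Sum>e\<in>E. real (din (fst e)) * (1 / dout (fst e))\<^sup>2) \<le> (\<Sum>e\<in>E. real (din (fst e)) / dout (fst e) * (1 / 2))"
  proof (intro sum_mono)
    fix e assume "e \<in> E"
    hence "2 \<le> dout (fst e)" using degrees[of "fst e"] by (auto simp: E_def)
    hence "real (din (fst e)) / dout (fst e) * (1 / dout (fst e)) \<le> real (din (fst e)) / dout (fst e) * (1 / 2)"
      by (intro mult_left_mono divide_left_mono) auto
    thus "real (din (fst e)) * (1 / dout (fst e))\<^sup>2 \<le> real (din (fst e)) / dout (fst e) * (1 / 2)"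
      by (simp add: power2_eq_square)
  qed
  also have "\<dots> = m / 2" unfolding sum_distrib_right[symmetric] weights_mass by simp
  finally show ?thesis using m_pos by (simp add: divide_le_eq)
qed

lemma phi_step: "0 \<le> t \<Longrightarrow> \<bar>phi (Suc h) t - phi h t\<bar> \<le> (real \<Delta>)\<^sup>2 * (1 / 2) ^ h * t\<^sup>2"
proof (induction h arbitrary: t)
  case 0
  show ?case using phi_first_step[OF 0] by simp
next
  case (Suc h)
  let ?c = "(real \<Delta>)\<^sup>2 * (1 / 2) ^ h * t\<^sup>2"
  have "phi (Suc (Suc h)) t - phi (Suc h) t
      = (\<Sum>e\<in>E. phi (Suc h) (t / dout (fst e)) ^ din (fst e) - phi h (t / dout (fst e)) ^ din (fst e)) / m"
    by (simp only: phi.simps(2)[of "Suc h" t] phi.simps(2)[of h t] sum_subtractf diff_divide_distrib)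
  hence "\<bar>phi (Suc (Suc h)) t - phi (Suc h) t\<bar>
      = \<bar>\<Sum>e\<in>E. phi (Suc h) (t / dout (fst e)) ^ din (fst e) - phi h (t / dout (fst e)) ^ din (fst e)\<bar> / m"
    by simp
  also have "\<dots> \<le> (\<Sum>e\<in>E. (real (din (fst e)) * (1 / dout (fst e))\<^sup>2) * ?c) / m"
  proof (intro divide_right_mono order_trans[OF sum_abs] sum_mono)
    fix e
    let ?u = "t / dout (fst e)"
    have u: "0 \<le> ?u" using Suc.prems by simp
    have "\<bar>phi (Suc h) ?u ^ din (fst e) - phi h ?u ^ din (fst e)\<bar> \<le> din (fst e) * \<bar>phi (Suc h) ?u - phi h ?u\<bar>"
      by (intro pow_diff_le conjunct1[OF phi_bounds] conjunct2[OF phi_bounds] u)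
    also have "\<dots> \<le> din (fst e) * ((real \<Delta>)\<^sup>2 * (1 / 2) ^ h * ?u\<^sup>2)"
      by (intro mult_left_mono Suc.IH u) auto
    finally show "\<bar>phi (Suc h) ?u ^ din (fst e) - phi h ?u ^ din (fst e)\<bar> \<le> (real (din (fst e)) * (1 / dout (fst e))\<^sup>2) * ?c"
      by (simp add: power_divide mult_ac)
  qed simp
  also have "\<dots> = ((\<Sum>e\<in>E. real (din (fst e)) * (1 / dout (fst e))\<^sup>2) / m) * ?c"
    by (simp flip: sum_distrib_right)
  also have "\<dots> \<le> (1 / 2) * ?c" by (intro mult_right_mono weights_square) simp
  finally show ?case by simp
qed

lemma phi_cauchy:
  assumes t: "0 \<le> t" and h: "h \<le> k"
  shows "\<bar>phi k t - phi h t\<bar> \<le> 2 * (real \<Delta>)\<^sup>2 * (1 / 2) ^ h * t\<^sup>2"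
proof -
  have "\<bar>phi k t - phi h t\<bar> \<le> (\<Sum>i=h..<k. (real \<Delta>)\<^sup>2 * (1 / 2) ^ i * t\<^sup>2)"
    using h
  proof (induction k rule: dec_induct)
    case (step k)
    have "(\<Sum>i=h..<Suc k. (real \<Delta>)\<^sup>2 * (1 / 2) ^ i * t\<^sup>2) = (\<Sum>i=h..<k. (real \<Delta>)\<^sup>2 * (1 / 2) ^ i * t\<^sup>2) + (real \<Delta>)\<^sup>2 * (1 / 2) ^ k * t\<^sup>2"
      using step.hyps by simp
    thus ?case using step.IH phi_step[OF t, of k] by linarith
  qed simp
  also have "\<dots> = (real \<Delta>)\<^sup>2 * (\<Sum>i=h..<k. (1 / 2) ^ i) * t\<^sup>2"
    by (simp only: sum_distrib_left sum_distrib_right)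
  also have "\<dots> \<le> (real \<Delta>)\<^sup>2 * (2 * (1 / 2) ^ h) * t\<^sup>2"
    by (intro mult_right_mono mult_left_mono geometric_half[OF h]) auto
  finally show ?thesis by simp
qed

text \<open>All weights at depth \<open>h\<close> are at most \<open>2 ^ (- h)\<close>, so only the behaviour of the Laplace
  transform at \<open>0\<close>, hence the mean, matters for uniqueness; no second moment is needed.\<close>
lemma phi_limit:
  assumes \<mu>: "mean_one \<mu>"
    and fixpoint: "\<And>t. 0 \<le> t \<Longrightarrow> laplace \<mu> t = (\<Sum>e\<in>E. laplace \<mu> (t / dout (fst e)) ^ din (fst e)) / m"
    and t: "0 \<le> t"
  shows "\<bar>phi h t - laplace \<mu> t\<bar> \<le> 2 * (real \<Delta>)\<^sup>2 * (1 / 2) ^ h * t\<^sup>2"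
proof (rule field_le_epsilon)
  fix \<epsilon> :: real assume \<epsilon>: "0 < \<epsilon>"
  define \<delta> where "\<delta> = \<epsilon> / (t + 1)"
  have \<delta>: "0 < \<delta>" "\<delta> * t \<le> \<epsilon>" using \<epsilon> t by (auto simp: \<delta>_def field_simps)
  obtain u0 where u0: "0 < u0" "\<And>u. 0 \<le> u \<Longrightarrow> u \<le> u0 \<Longrightarrow> \<bar>exp (- u) - laplace \<mu> u\<bar> \<le> \<delta> * u"
    using laplace_at_0[OF \<mu> \<delta>(1)] by blast
  have near: "\<bar>phi k u - laplace \<mu> u\<bar> \<le> \<delta> * u" if "0 \<le> u" "u \<le> 2 ^ k * u0" for k u
    using that
  proof (induction k arbitrary: u)
    case 0 thus ?case using u0(2)[of u] by simp
  next
    case (Suc k)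
    have "\<bar>phi (Suc k) u - laplace \<mu> u\<bar>
       = \<bar>\<Sum>e\<in>E. phi k (u / dout (fst e)) ^ din (fst e) - laplace \<mu> (u / dout (fst e)) ^ din (fst e)\<bar> / m"
      using fixpoint[OF Suc.prems(1)] by (simp add: sum_subtractf flip: diff_divide_distrib)
    also have "\<dots> \<le> (\<Sum>e\<in>E. (real (din (fst e)) / dout (fst e)) * (\<delta> * u)) / m"
    proof (intro divide_right_mono order_trans[OF sum_abs] sum_mono)
      fix e assume "e \<in> E"
      hence d: "2 \<le> dout (fst e)" using degrees[of "fst e"] by (auto simp: E_def)
      let ?v = "u / dout (fst e)"
      have v: "0 \<le> ?v" using Suc.prems by simp
      have "?v \<le> u / 2" using d Suc.prems by (intro divide_left_mono) auto
      moreover have "u / 2 \<le> 2 ^ k * u0" using Suc.prems by simp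
      ultimately have v2: "?v \<le> 2 ^ k * u0" by linarith
      have "\<bar>phi k ?v ^ din (fst e) - laplace \<mu> ?v ^ din (fst e)\<bar> \<le> din (fst e) * \<bar>phi k ?v - laplace \<mu> ?v\<bar>"
        using phi_bounds[OF v] laplace_bounds[OF \<mu> v] by (intro pow_diff_le) auto
      also have "\<dots> \<le> din (fst e) * (\<delta> * ?v)" by (intro mult_left_mono Suc.IH v v2) auto
      finally show "\<bar>phi k ?v ^ din (fst e) - laplace \<mu> ?v ^ din (fst e)\<bar> \<le> (real (din (fst e)) / dout (fst e)) * (\<delta> * u)"
        by simp
    qed simp
    also have "\<dots> = \<delta> * u" unfolding sum_distrib_right[symmetric] weights_mass using m_pos by simp
    finally show ?case .
  qed
  obtain k0 :: nat where k0: "t / u0 < 2 ^ k0" using real_arch_pow[of 2 "t / u0"] by auto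
  define k where "k = max h k0"
  have "t \<le> 2 ^ k0 * u0" using k0 u0(1) by (simp add: divide_less_eq)
  also have "\<dots> \<le> 2 ^ k * u0" using u0(1) by (intro mult_right_mono power_increasing) (auto simp: k_def)
  finally have "\<bar>phi k t - laplace \<mu> t\<bar> \<le> \<epsilon>" using near[OF t, of k] \<delta>(2) by linarith
  moreover have "\<bar>phi k t - phi h t\<bar> \<le> 2 * (real \<Delta>)\<^sup>2 * (1 / 2) ^ h * t\<^sup>2"
    by (rule phi_cauchy[OF t]) (simp add: k_def)
  ultimately show "\<bar>phi h t - laplace \<mu> t\<bar> \<le> 2 * (real \<Delta>)\<^sup>2 * (1 / 2) ^ h * t\<^sup>2 + \<epsilon>" by linarith
qed

lemma E_nonempty: "E \<noteq> {}" using card_E m_pos by auto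

lemma Z_law_fixpoint:
  assumes dt: "dt n = dout" "dn n = din" and Z: "Z_law dt dn n \<mu>"
  shows "mean_one \<mu>"
    and "0 \<le> t \<Longrightarrow> laplace \<mu> t = (\<Sum>e\<in>E. laplace \<mu> (t / dout (fst e)) ^ din (fst e)) / m"
proof -
  show m1: "mean_one \<mu>" using Z by (simp add: Z_law_def mean_one_def)
  have tE: "tails dt n = E" by (simp add: tails_def E_def dt)
  have \<mu>: "\<mu> = mixture (map_pmf fst (pmf_of_set E)) (\<lambda>j. 1 / real (dout j)) din \<mu>"
  proof -
    have "\<mu> = smoothing_map dt dn n \<mu>" using Z by (simp add: Z_law_def)
    also have "\<dots> = mixture (map_pmf fst (pmf_of_set E)) (\<lambda>j. 1 / real (dout j)) din \<mu>"
      by (simp add: smoothing_map_def mixture_def out_biased_def tE dt)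
    finally show ?thesis .
  qed
  assume t: "0 \<le> t"
  let ?g = "\<lambda>v. laplace \<mu> (t / dout v) ^ din v"
  have g: "0 \<le> ?g v" for v using laplace_bounds[OF m1, of "t / dout v"] t by simp
  have "ennreal (laplace \<mu> t) = (\<integral>\<^sup>+x. ennreal (exp (- t * x)) \<partial>\<mu>)"
    unfolding laplace_def by (rule nn_integral_eq_integral[OF integrable_laplace[OF m1 t], symmetric]) simp
  also have "\<dots> = (\<integral>\<^sup>+x. ennreal (exp (- t * x)) \<partial>mixture (map_pmf fst (pmf_of_set E)) (\<lambda>j. 1 / real (dout j)) din \<mu>)"
    using \<mu> by simp
  also have "\<dots> = (\<integral>\<^sup>+j. ennreal (laplace \<mu> (t * (1 / real (dout j))) ^ din j) \<partial>measure_pmf (map_pmf fst (pmf_of_set E)))"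
    by (rule mixture_laplace[OF m1 _ t]) simp
  also have "\<dots> = (\<Sum>e\<in>E. ennreal (?g (fst e))) / card E"
    by (simp add: nn_integral_pmf_of_set[OF E_nonempty finite_E])
  also have "\<dots> = ennreal ((\<Sum>e\<in>E. ?g (fst e)) / m)"
    using g m_pos card_E by (simp add: sum_nonneg divide_ennreal ennreal_of_nat_eq_real_of_nat)
  finally show "laplace \<mu> t = (\<Sum>e\<in>E. ?g (fst e)) / m"
    using laplace_bounds[OF m1 t] g by (subst (asm) ennreal_inj) (auto intro!: divide_nonneg_nonneg sum_nonneg)
qed

lemma M_star_mixture:
  assumes "dt n = dout" "dn n = din"
  shows "M_star_law dt dn n \<mu> = mixture (pmf_of_set {..<n}) (\<lambda>_. real n / real m) din \<mu>"
  using assms by (simp add: M_star_law_def mixture_def num_arcs_def m_def)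

lemma mean_one_M:
  assumes \<mu>: "mean_one \<mu>" shows "mean_one (mixture (pmf_of_set {..<n}) (\<lambda>_. real n / real m) din \<mu>)"
proof -
  let ?M = "mixture (pmf_of_set {..<n}) (\<lambda>_. real n / real m) din \<mu>"
  have a: "\<And>j::nat. 0 \<le> real n / real m" by simp
  have ne: "{..<n} \<noteq> {}" using n_pos by auto
  have AE: "AE x in ?M. 0 \<le> x" by (rule mixture_AE[OF \<mu> a])
  have sets: "sets ?M = sets borel" by (rule sets_mixture[OF \<mu> a])
  have "(\<integral>\<^sup>+x. ennreal x \<partial>?M) = (\<integral>\<^sup>+j. ennreal (real n / real m * real (din j)) \<partial>measure_pmf (pmf_of_set {..<n}))"
    by (rule mixture_mean[OF \<mu> a])
  also have "\<dots> = (\<Sum>j<n. ennreal (real n / real m * real (din j))) / card {..<n}"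
    by (rule nn_integral_pmf_of_set[OF ne]) simp
  also have "\<dots> = ennreal ((\<Sum>j<n. real n / real m * real (din j)) / n)"
    using n_pos by (simp add: sum_nonneg divide_ennreal ennreal_of_nat_eq_real_of_nat del: times_divide_eq_left)
  also have "(\<Sum>j<n. real n / real m * real (din j)) / n = 1"
  proof -
    have "(\<Sum>j<n. real n / real m * real (din j)) = n * (\<Sum>j<n. real (din j) / m)" by (simp add: sum_distrib_left)
    thus ?thesis using din_mass n_pos by simp
  qed
  finally have nn: "(\<integral>\<^sup>+x. ennreal x \<partial>?M) = ennreal 1" .
  have meas: "(\<lambda>x. x) \<in> borel_measurable ?M" using sets by (simp add: measurable_ident_sets)
  have int: "integrable ?M (\<lambda>x. x)" by (rule integrableI_nn_integral_finite[OF meas AE nn])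
  have "ennreal (\<integral>x. x \<partial>?M) = ennreal 1" using nn_integral_eq_integral[OF int AE] nn by simp
  hence "(\<integral>x. x \<partial>?M) = 1" using integral_nonneg_AE[OF AE] by (subst (asm) ennreal_inj) auto
  thus ?thesis using AE sets int mixture_prob[OF \<mu> a] by (simp add: mean_one_def)
qed

lemma laplace_M:
  assumes \<mu>: "mean_one \<mu>" and t: "0 \<le> t"
  shows "laplace (mixture (pmf_of_set {..<n}) (\<lambda>_. real n / real m) din \<mu>) t = (\<Sum>i<n. laplace \<mu> (t * (real n / real m)) ^ din i) / n"
proof -
  let ?M = "mixture (pmf_of_set {..<n}) (\<lambda>_. real n / real m) din \<mu>"
  have a: "\<And>j::nat. 0 \<le> real n / real m" by simp
  have ne: "{..<n} \<noteq> {}" using n_pos by auto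
  have g: "0 \<le> laplace \<mu> (t * (real n / real m)) ^ k" for k using laplace_bounds[OF \<mu>, of "t * (real n / real m)"] t by simp
  note M = mean_one_M[OF \<mu>]
  have "ennreal (laplace ?M t) = (\<integral>\<^sup>+x. ennreal (exp (- t * x)) \<partial>?M)"
    unfolding laplace_def by (rule nn_integral_eq_integral[OF integrable_laplace[OF M t], symmetric]) simp
  also have "\<dots> = (\<integral>\<^sup>+j. ennreal (laplace \<mu> (t * (real n / real m)) ^ din j) \<partial>measure_pmf (pmf_of_set {..<n}))"
    by (rule mixture_laplace[OF \<mu> a t])
  also have "\<dots> = (\<Sum>j<n. ennreal (laplace \<mu> (t * (real n / real m)) ^ din j)) / card {..<n}"
    by (rule nn_integral_pmf_of_set[OF ne]) simp
  also have "\<dots> = ennreal ((\<Sum>j<n. laplace \<mu> (t * (real n / real m)) ^ din j) / n)"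
    using g n_pos by (simp add: sum_nonneg divide_ennreal ennreal_of_nat_eq_real_of_nat del: times_divide_eq_right)
  finally show ?thesis
    using laplace_bounds[OF M t] g by (subst (asm) ennreal_inj) (auto intro!: divide_nonneg_nonneg sum_nonneg)
qed

text \<open>The coefficient depends on \<open>\<Delta>\<close> only, so by
  \<open>laplace_tail\<close> the mass of \<open>M_star\<close> at large values is small uniformly
  in \<open>n\<close>. It comes from \<open>phi_limit\<close> with \<open>h = 0\<close>, which
  compares the transform of \<open>\<mu>\<close> with \<open>exp (- u)\<close> up to a multiple of
  \<open>u\<^sup>2\<close>.\<close>

lemma laplace_M_quadratic:
  assumes \<mu>: "mean_one \<mu>"
    and fixpoint: "\<And>t. 0 \<le> t \<Longrightarrow> laplace \<mu> t = (\<Sum>e\<in>E. laplace \<mu> (t / dout (fst e)) ^ din (fst e)) / m"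
    and t: "0 \<le> t"
  shows "laplace (mixture (pmf_of_set {..<n}) (\<lambda>_. real n / real m) din \<mu>) t \<le> 1 - t + 3 * real \<Delta> ^ 3 * t\<^sup>2"
proof -
  define u where "u = t * (n / m)"
  have np: "0 < real n" using n_pos by simp
  have nm: "real n / m \<le> 1" using m_ge m_pos by simp
  have u: "0 \<le> u" "u \<le> t" using t nm mult_left_mono[OF nm t] by (auto simp: u_def)
  have D1: "1 \<le> real \<Delta>" using Delta_ge by simp
  have u2: "u\<^sup>2 \<le> t\<^sup>2" using u by (intro power_mono)
  have term_le: "laplace \<mu> u ^ din i \<le> (1 - u * din i) + 3 * real \<Delta> ^ 3 * t\<^sup>2" if i: "i < n" for i
  proof -
    have d: "real (din i) \<le> \<Delta>" using degrees[OF i] by simp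
    have "\<bar>exp (- u) ^ din i - laplace \<mu> u ^ din i\<bar> \<le> din i * \<bar>exp (- u) - laplace \<mu> u\<bar>"
      using u laplace_bounds[OF \<mu> u(1)] by (intro pow_diff_le) auto
    also have "\<dots> \<le> \<Delta> * (2 * (real \<Delta>)\<^sup>2 * u\<^sup>2)"
      using phi_limit[OF \<mu> fixpoint u(1), of 0] d by (intro mult_mono) auto
    also have "\<dots> \<le> \<Delta> * (2 * (real \<Delta>)\<^sup>2 * t\<^sup>2)" using u2 by (intro mult_left_mono) auto
    finally have a: "\<bar>exp (- u) ^ din i - laplace \<mu> u ^ din i\<bar> \<le> \<Delta> * (2 * (real \<Delta>)\<^sup>2 * t\<^sup>2)" .
    have "exp (- u) ^ din i = exp (- (u * din i))" by (simp add: exp_of_nat_mult[symmetric] mult.commute)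
    also have "\<dots> \<le> 1 - u * din i + (u * din i)\<^sup>2 / 2" by (rule exp_minus_bounds(2)) (use u in simp)
    finally have b: "exp (- u) ^ din i \<le> 1 - u * din i + (u * din i)\<^sup>2 / 2" .
    have "(u * din i)\<^sup>2 \<le> (t * \<Delta>)\<^sup>2" using u d by (intro power_mono mult_mono) auto
    also have "\<dots> = t\<^sup>2 * (real \<Delta>)\<^sup>2" by (simp add: power_mult_distrib)
    also have "\<dots> \<le> t\<^sup>2 * real \<Delta> ^ 3" using D1 by (intro mult_left_mono power_increasing) auto
    finally have c: "(u * din i)\<^sup>2 \<le> t\<^sup>2 * real \<Delta> ^ 3" .
    have "0 \<le> t\<^sup>2 * real \<Delta> ^ 3" by simp
    moreover have "\<Delta> * (2 * (real \<Delta>)\<^sup>2 * t\<^sup>2) = 2 * (t\<^sup>2 * real \<Delta> ^ 3)"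
      by (simp add: power2_eq_square power3_eq_cube)
    moreover have "3 * real \<Delta> ^ 3 * t\<^sup>2 = 3 * (t\<^sup>2 * real \<Delta> ^ 3)" by simp
    ultimately show ?thesis using a b c by linarith
  qed
  have "(\<Sum>i<n. laplace \<mu> u ^ din i) / n \<le> (\<Sum>i<n. (1 - u * din i) + 3 * real \<Delta> ^ 3 * t\<^sup>2) / n"
    using term_le by (intro divide_right_mono sum_mono) auto
  also have "\<dots> = (n - u * (\<Sum>i<n. real (din i)) + n * (3 * real \<Delta> ^ 3 * t\<^sup>2)) / n"
    by (simp only: sum.distrib sum_subtractf sum_distrib_left) simp
  also have "(\<Sum>i<n. real (din i)) = m" using degree_sums by (simp add: m_def flip: of_nat_sum)
  also have "(n - u * m + n * (3 * real \<Delta> ^ 3 * t\<^sup>2)) / n = 1 - t + 3 * real \<Delta> ^ 3 * t\<^sup>2"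
    using np m_pos by (simp add: u_def field_simps)
  finally show ?thesis unfolding laplace_M[OF \<mu> t] u_def .
qed

end

text \<open>\<open>empirical\<close> carries the discrete sigma-algebra.\<close>
definition empirical_borel :: "nat \<Rightarrow> (nat \<Rightarrow> real) \<Rightarrow> real measure" where
  "empirical_borel n \<pi> = distr (empirical n \<pi>) borel (\<lambda>x. x)"

lemma wasserstein1_empirical: "wasserstein1 (empirical n \<pi>) L = wasserstein1 (empirical_borel n \<pi>) L"
proof -
  have "(\<integral>x. f x \<partial>empirical n \<pi>) = (\<integral>x. f x \<partial>empirical_borel n \<pi>)"
    if f: "\<forall>x y. \<bar>f x - f y\<bar> \<le> \<bar>x - y\<bar>" for f :: "real \<Rightarrow> real"
  proof -
    have "continuous_on UNIV f"
    proof (rule continuous_onI)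
      fix x e :: real assume "0 < e"
      moreover have "dist (f x') (f x) \<le> e" if "dist x' x < e" for x'
        using f[rule_format, of x' x] that by (simp add: dist_real_def)
      ultimately show "\<exists>d>0. \<forall>x'\<in>UNIV. dist x' x < d \<longrightarrow> dist (f x') (f x) \<le> e" by blast
    qed
    hence "f \<in> borel_measurable borel" by (rule borel_measurable_continuous_onI)
    thus ?thesis unfolding empirical_borel_def empirical_def by (subst integral_distr) auto
  qed
  thus ?thesis unfolding wasserstein1_def by (intro SUP_cong refl) simp
qed

lemma empirical_integral:
  assumes "0 < n" "f \<in> borel_measurable borel"
  shows "(\<integral>x. f x \<partial>empirical_borel n \<pi>) = (\<Sum>i<n. f (real n * \<pi> i)) / n"
proof -
  have ne: "{..<n} \<noteq> {}" using assms by auto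
  have "(\<integral>x. f x \<partial>empirical_borel n \<pi>) = (\<integral>x. f x \<partial>map_pmf (\<lambda>i. real n * \<pi> i) (pmf_of_set {..<n}))"
    unfolding empirical_borel_def empirical_def using assms by (subst integral_distr) auto
  also have "\<dots> = (\<integral>i. f (real n * \<pi> i) \<partial>pmf_of_set {..<n})" by simp
  also have "\<dots> = (\<Sum>i<n. f (real n * \<pi> i)) / card {..<n}" by (rule integral_pmf_of_set[OF ne]) simp
  finally show ?thesis by simp
qed

lemma mean_one_empirical:
  assumes n: "0 < n" and \<pi>: "\<And>i. i < n \<Longrightarrow> 0 \<le> \<pi> i" "(\<Sum>i<n. \<pi> i) = 1"
  shows "mean_one (empirical_borel n \<pi>)"
proof -
  let ?p = "map_pmf (\<lambda>i. real n * \<pi> i) (pmf_of_set {..<n})"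
  have ne: "{..<n} \<noteq> {}" using n by auto
  have ps: "prob_space (empirical_borel n \<pi>)" unfolding empirical_borel_def empirical_def
    by (rule measure_pmf.prob_space_distr) simp
  have sets: "sets (empirical_borel n \<pi>) = sets borel" by (simp add: empirical_borel_def)
  have "AE x in measure_pmf ?p. 0 \<le> x"
    using \<pi>(1) by (simp add: AE_measure_pmf_iff set_pmf_of_set[OF ne])
  hence AE: "AE x in empirical_borel n \<pi>. 0 \<le> x" unfolding empirical_borel_def empirical_def
    by (subst AE_distr_iff) auto
  have "integrable (measure_pmf ?p) (\<lambda>x. x)"
    by (rule integrable_measure_pmf_finite) (simp add: set_pmf_of_set[OF ne])
  hence int: "integrable (empirical_borel n \<pi>) (\<lambda>x. x)" unfolding empirical_borel_def empirical_def
    by (subst integrable_distr_eq) auto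
  have "(\<integral>x. x \<partial>empirical_borel n \<pi>) = (\<Sum>i<n. real n * \<pi> i) / n"
    by (rule empirical_integral[OF n, of "\<lambda>x. x"]) simp
  also have "\<dots> = 1" unfolding sum_distrib_left[symmetric] \<pi>(2) using n by simp
  finally show ?thesis using ps sets AE int by (simp add: mean_one_def)
qed

lemma laplace_empirical:
  assumes "0 < n" shows "laplace (empirical_borel n \<pi>) t = (\<Sum>i<n. exp (- t * (real n * \<pi> i))) / n"
  unfolding laplace_def by (rule empirical_integral[OF assms]) simp

section \<open>Asymptotics\<close>

lemma polylog_over_sqrt: "(\<lambda>n. (4 * (log 2 (real n) + 1)) ^ a / sqrt (real n)) \<longlonglongrightarrow> 0"
proof -
  define c :: real where "c = 4 * (1 / ln 2 + 1)"
  have c: "0 < c" by (simp add: c_def add_pos_pos)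
  have z: "filterlim (\<lambda>n. ln (real n) / 2) at_top sequentially"
    using filterlim_compose[OF ln_at_top filterlim_real_sequentially]
    by (intro filterlim_at_top_mult_tendsto_pos[where f = "\<lambda>_. 1 / 2", OF tendsto_const, simplified]) auto
  have "(\<lambda>n. (2 * c) ^ a * ((ln (real n) / 2) ^ a / exp (ln (real n) / 2))) \<longlonglongrightarrow> (2 * c) ^ a * 0"
    by (intro tendsto_mult tendsto_const filterlim_compose[OF tendsto_power_div_exp_0 z])
  hence lim: "(\<lambda>n. (2 * c) ^ a * ((ln (real n) / 2) ^ a / exp (ln (real n) / 2))) \<longlonglongrightarrow> 0" by simp
  show ?thesis
  proof (rule Lim_null_comparison[OF _ lim])
    have "\<forall>\<^sub>F n in sequentially. exp 1 \<le> real n"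
      using eventually_ge_at_top[of "nat \<lceil>exp 1 :: real\<rceil>"] by eventually_elim linarith
    thus "\<forall>\<^sub>F n in sequentially. norm ((4 * (log 2 (real n) + 1)) ^ a / sqrt (real n))
        \<le> (2 * c) ^ a * ((ln (real n) / 2) ^ a / exp (ln (real n) / 2))"
    proof eventually_elim
      case (elim n)
      have n0: "0 < real n" using elim exp_gt_zero[of "1::real"] by linarith
      have l1: "1 \<le> ln (real n)" using elim n0 by (simp add: ln_ge_iff)
      have "4 * (log 2 (real n) + 1) \<le> c * ln (real n)"
        using l1 by (simp add: c_def log_def algebra_simps)
      moreover have "0 \<le> 4 * (log 2 (real n) + 1)" using l1 by (simp add: log_def add_nonneg_nonneg)
      ultimately have "(4 * (log 2 (real n) + 1)) ^ a \<le> (c * ln (real n)) ^ a" by (rule power_mono)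
      moreover have "(2 * c) ^ a * (ln (real n) / 2) ^ a = (c * ln (real n)) ^ a"
        unfolding power_mult_distrib[symmetric] by simp
      ultimately have "(4 * (log 2 (real n) + 1)) ^ a \<le> (2 * c) ^ a * (ln (real n) / 2) ^ a" by linarith
      moreover have "exp (ln (real n) / 2) = sqrt (real n)"
        using n0 by (simp add: powr_half_sqrt[symmetric] powr_def)
      moreover have "0 \<le> (4 * (log 2 (real n) + 1)) ^ a" using l1 by (simp add: log_def add_nonneg_nonneg)
      ultimately show ?case using n0 by (simp add: divide_right_mono)
    qed
  qed
qed

lemma one_plus_power_le_exp: "0 \<le> (z::real) \<Longrightarrow> (1 + z) ^ n \<le> exp (n * z)"
  using power_mono[OF exp_ge_add_one_self[of z], of n] by (simp add: exp_of_nat_mult)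

text \<open>The window \<open>s\<close> is logarithmic, \<open>x\<close> is the power of two just above it, and all other
  parameters are powers of \<open>x\<close>: the bad set has at most \<open>K = x ^ 9\<close> vertices, is left within
  \<open>j0\<close> steps with probability at least \<open>\<Delta> ^ (- j0)\<close>, and \<open>j\<close> attempts are allowed.\<close>
lemma parameter_bounds:
  fixes \<Delta> n :: nat
  assumes n: "2 \<le> n" and \<Delta>: "2 \<le> \<Delta>" "\<Delta> \<le> 2 ^ p"
  obtains s \<nu> j j0 K T :: nat and x :: real where
    "log 2 n \<le> real s" "(1 / 2 :: real) ^ s \<le> 1 / (real n)\<^sup>2" "real s \<le> x" "x \<le> 4 * (log 2 n + 1)" "1 \<le> x" "log 2 n \<le> x"
    "1 \<le> s" "1 \<le> K" "real K = x ^ 9" "(3 / 4 :: real) ^ j0 * K < 1" "T = s + j * j0" "real T \<le> 28 * x ^ (27 * p + 2)"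
    "(1 - 1 / real \<Delta> ^ j0) ^ j \<le> exp (- real \<nu>)" "x = 2 ^ \<nu>"
proof -
  define l where "l = nat \<lfloor>log 2 n\<rfloor> + 1"
  \<comment> \<open>Twice the logarithm of \<open>n\<close>, because in \<open>mean_bad\<close> the
    term \<open>(1 / 2) ^ s\<close> is multiplied by the square of \<open>n\<close>.\<close>
  define s where "s = 2 * l"
  define \<nu> where "\<nu> = nat \<lfloor>log 2 s\<rfloor> + 1"
  define x :: real where "x = 2 ^ \<nu>"
  define K :: nat where "K = 2 ^ (9 * \<nu>)"
  define j0 where "j0 = 27 * \<nu>"
  \<comment> \<open>\<open>\<Delta> ^ j0\<close> attempts with success probability
    \<open>1 / \<Delta> ^ j0\<close> push the failure probability below \<open>exp (- 1)\<close>;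
    \<open>\<nu>\<close> such blocks give \<open>exp (- \<nu>)\<close>.\<close>
  define j where "j = \<nu> * \<Delta> ^ j0"
  have up: "real a \<le> 2 ^ (nat \<lfloor>log 2 a\<rfloor> + 1)" "(2::real) ^ (nat \<lfloor>log 2 a\<rfloor> + 1) \<le> 2 * a" if a: "1 \<le> a" for a :: nat
  proof -
    have f0: "0 \<le> \<lfloor>log 2 a\<rfloor>" using a by simp
    have e: "(2::real) ^ nat \<lfloor>log 2 a\<rfloor> = 2 powr of_int \<lfloor>log 2 a\<rfloor>" using f0 by (simp add: powr_realpow[symmetric])
    have "2 powr log 2 a \<le> 2 powr (of_int \<lfloor>log 2 a\<rfloor> + 1)" by (intro powr_mono) linarith+
    thus "real a \<le> 2 ^ (nat \<lfloor>log 2 a\<rfloor> + 1)" using a e by (simp add: powr_add)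
    have "2 powr of_int \<lfloor>log 2 a\<rfloor> \<le> 2 powr log 2 a" by (intro powr_mono) linarith+
    thus "(2::real) ^ (nat \<lfloor>log 2 a\<rfloor> + 1) \<le> 2 * a" using a e by simp
  qed
  have n2: "real n \<le> 2 ^ l" using up(1)[of n] n by (simp add: l_def)
  have half: "(1 / 2 :: real) ^ s \<le> 1 / (real n)\<^sup>2"
  proof -
    have "(real n)\<^sup>2 \<le> (2 ^ l)\<^sup>2" using n2 by (intro power_mono) auto
    also have "\<dots> = 2 ^ s" by (simp add: s_def power_mult mult.commute[of 2 l])
    finally have "1 / (2::real) ^ s \<le> 1 / (real n)\<^sup>2" using n by (intro divide_left_mono) auto
    thus ?thesis by (simp add: power_one_over)
  qed
  have s1: "1 \<le> s" by (simp add: s_def l_def)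
  have sx: "real s \<le> x" "x \<le> 2 * s" using up[OF s1] by (auto simp: x_def \<nu>_def)
  have lg: "0 \<le> log 2 n" using n by simp
  have ls: "log 2 n \<le> real s" "real s \<le> 2 * (log 2 n + 1)" using lg by (auto simp: s_def l_def) linarith+
  have x1: "1 \<le> x" by (simp add: x_def)
  have Kx: "real K = x ^ 9" by (simp add: K_def x_def power_mult[symmetric] mult.commute)
  have nu1: "1 \<le> \<nu>" by (simp add: \<nu>_def)
  \<comment> \<open>Three factors \<open>3 / 4\<close> fall below \<open>1 / 2\<close>, so
    \<open>27 = 3 * 9\<close> of them beat the factor \<open>2 ^ 9\<close> that each unit of
    \<open>\<nu>\<close> contributes to \<open>K\<close>.\<close>
  have j0K: "(3 / 4 :: real) ^ j0 * K < 1"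
  proof -
    have eq: "(3 / 4 :: real) ^ j0 * K = ((3 / 4) ^ 27 * 2 ^ 9) ^ \<nu>"
      by (simp add: j0_def K_def power_mult power_mult_distrib)
    have "(3 / 4 :: real) ^ 27 * 2 ^ 9 < 1" by (simp add: power_divide)
    moreover have "z ^ \<nu> < 1" if "0 \<le> z" "z < 1" for z :: real
      using that nu1 power_le_one[of z "\<nu> - 1"] mult_left_mono[of "z ^ (\<nu> - 1)" 1 z]
      by (cases \<nu>) auto
    ultimately have "((3 / 4 :: real) ^ 27 * 2 ^ 9) ^ \<nu> < 1" by (meson mult_nonneg_nonneg zero_le_power zero_le_numeral divide_nonneg_nonneg)
    thus ?thesis using eq by linarith
  qed
  have Dj: "real \<Delta> ^ j0 \<le> x ^ (27 * p)"
  proof -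
    have "real \<Delta> \<le> 2 ^ p" using \<Delta>(2) of_nat_mono[of \<Delta> "2 ^ p", where 'a = real] by simp
    hence "real \<Delta> ^ j0 \<le> (2 ^ p) ^ j0" by (intro power_mono) auto
    also have "\<dots> = x ^ (27 * p)" by (simp add: x_def j0_def mult_ac flip: power_mult)
    finally show ?thesis .
  qed
  have nux: "real \<nu> \<le> x" using of_nat_less_two_power[of \<nu>] unfolding x_def by (rule less_imp_le)
  have Tb: "real (s + j * j0) \<le> 28 * x ^ (27 * p + 2)"
  proof -
    have "real j * real j0 = 27 * (real \<nu> * real \<nu> * real \<Delta> ^ j0)" by (simp add: j_def j0_def)
    also have "\<dots> \<le> 27 * (x * x * x ^ (27 * p))"
      using nux Dj x1 by (intro mult_left_mono mult_mono) auto
    finally have "real j * real j0 \<le> 27 * x ^ (27 * p + 2)" by (simp add: power_add power2_eq_square mult_ac)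
    moreover have "x ^ 1 \<le> x ^ (27 * p + 2)" using x1 by (intro power_increasing) auto
    ultimately show ?thesis using sx by simp
  qed
  have ex: "(1 - 1 / real \<Delta> ^ j0) ^ j \<le> exp (- real \<nu>)"
  proof -
    have D1: "1 \<le> real \<Delta> ^ j0" using \<Delta> by (intro one_le_power) simp
    hence "0 \<le> 1 - 1 / real \<Delta> ^ j0" unfolding diff_ge_0_iff_ge by (intro divide_le_eq_1[THEN iffD2]) linarith
    hence "(1 - 1 / real \<Delta> ^ j0) ^ j \<le> exp (- (1 / real \<Delta> ^ j0)) ^ j"
      using exp_ge_add_one_self[of "- (1 / real \<Delta> ^ j0)"] by (intro power_mono) auto
    also have "\<dots> = exp (- (real j * (1 / real \<Delta> ^ j0)))" by (simp flip: exp_of_nat_mult)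
    also have "real j * (1 / real \<Delta> ^ j0) = \<nu>" using \<Delta> by (simp add: j_def)
    finally show ?thesis .
  qed
  show thesis
  proof (rule that)
    show "log 2 n \<le> real s" by (rule ls)
    show "(1 / 2 :: real) ^ s \<le> 1 / (real n)\<^sup>2" by (rule half)
    show "real s \<le> x" by (rule sx)
    show "x \<le> 4 * (log 2 n + 1)" using sx ls by linarith
    show "1 \<le> x" by (rule x1)
    show "log 2 n \<le> x" using sx ls by linarith
    show "1 \<le> s" by (rule s1)
    show "1 \<le> K" by (simp add: K_def)
    show "real K = x ^ 9" by (rule Kx)
    show "(3 / 4 :: real) ^ j0 * K < 1" by (rule j0K)
    show "s + j * j0 = s + j * j0" ..
    show "real (s + j * j0) \<le> 28 * x ^ (27 * p + 2)" by (rule Tb)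
    show "(1 - 1 / real \<Delta> ^ j0) ^ j \<le> exp (- real \<nu>)" by (rule ex)
    show "x = 2 ^ \<nu>" by (rule x_def)
  qed
qed

context digraph_env begin

text \<open>\<open>r\<close> dominates all errors that are a power of \<open>x\<close> over
  \<open>sqrt n\<close> or over \<open>n\<close>. The expansion term needs exponent 18, from the
  square of \<open>K\<close>; the second moments need \<open>3 * q + 9\<close>, from
  \<open>K\<close> and three factors linear in \<open>T\<close>, with \<open>q = 27 * p + 2\<close>.
  The exponent \<open>3 * q + 18\<close> covers both.\<close>

lemma mean_not_near_log:
  fixes p :: nat and \<epsilon> :: real
  defines "r \<equiv> (4 * (log 2 n + 1)) ^ (3 * (27 * p + 2) + 18) / sqrt n"
  assumes n2: "2 \<le> n" and \<Delta>p: "\<Delta> \<le> 2 ^ p" and \<epsilon>: "0 < \<epsilon>" "7 * \<epsilon> < 1"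
    and lg: "real h \<le> log 2 n" "1 / \<epsilon> \<le> log 2 n" and r: "89 * (real \<Delta>)\<^sup>2 * r \<le> 1"
  shows "mean (\<lambda>\<omega>. of_bool (\<not> near_stationary \<omega> h (8 * \<epsilon>)))
    \<le> 4 * real \<Delta> * (1 / 2) ^ h / \<epsilon>\<^sup>2
      + (20 * real \<Delta> / \<epsilon> + 4 / \<epsilon>\<^sup>2 * (7 * real \<Delta> + 15200 * real \<Delta> ^ 3)) / log 2 n
      + (4 * (real \<Delta>)\<^sup>2 + 79170 * real \<Delta> / \<epsilon>\<^sup>2 + 8000 * real \<Delta> ^ 3 / \<epsilon>\<^sup>2) * r"
proof -
  define q where "q = 27 * p + 2"
  define l where "l = 4 * (log 2 n + 1)"
  define L where "L = l ^ (3 * q + 18)"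
  obtain s \<nu> j j0 K T :: nat and x :: real where
    s: "log 2 n \<le> real s" "(1 / 2 :: real) ^ s \<le> 1 / (real n)\<^sup>2" "real s \<le> x" and xl: "x \<le> l"
    and x1: "1 \<le> x" and lx: "log 2 n \<le> x" and s1: "1 \<le> s" and K1: "1 \<le> K" and Kx: "real K = x ^ 9"
    and j0: "(3 / 4 :: real) ^ j0 * K < 1" and T: "T = s + j * j0" and Tx: "real T \<le> 28 * x ^ q"
    and ex: "(1 - 1 / real \<Delta> ^ j0) ^ j \<le> exp (- real \<nu>)" and x\<nu>: "x = 2 ^ \<nu>"
    unfolding l_def q_def by (rule parameter_bounds[OF n2 Delta_ge \<Delta>p])
  have D2: "2 \<le> real \<Delta>" using Delta_ge by simp
  have D1: "1 \<le> real \<Delta> ^ a" for a using D2 by (intro one_le_power) simp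
  have n0: "0 < real n" using n2 by simp
  have sn: "1 \<le> sqrt n" "0 < sqrt n" "sqrt n \<le> n" using n2 by (auto simp: real_le_lsqrt self_le_power)
  have xL: "x ^ a \<le> L" if "a \<le> 3 * q + 18" for a
  proof -
    have "x ^ a \<le> x ^ (3 * q + 18)" using that x1 by (intro power_increasing)
    moreover have "x ^ (3 * q + 18) \<le> L" unfolding L_def using xl x1 by (intro power_mono) auto
    ultimately show ?thesis by linarith
  qed
  have L1: "1 \<le> L" using xL[of 0] by simp
  have rL: "L = r * sqrt n" using sn by (simp add: r_def L_def l_def q_def)
  have r0: "0 \<le> r" using L1 sn by (simp add: r_def L_def[symmetric] l_def[symmetric] q_def[symmetric])
  have small: "89 * (real \<Delta>)\<^sup>2 * L \<le> n"
  proof -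
    have "89 * (real \<Delta>)\<^sup>2 * r * sqrt n \<le> 1 * sqrt n" using r sn by (intro mult_right_mono) auto
    moreover have "89 * (real \<Delta>)\<^sup>2 * L = 89 * (real \<Delta>)\<^sup>2 * r * sqrt n" unfolding rL by simp
    ultimately show ?thesis using sn by linarith
  qed
  have Ln: "L / n \<le> r"
  proof -
    have "L / n \<le> L / sqrt n" using sn L1 by (intro divide_left_mono) auto
    thus ?thesis using sn by (simp add: rL)
  qed
  have DD: "real \<Delta> \<le> (real \<Delta>)\<^sup>2" using D2 by (simp add: power2_eq_square)
  have \<Delta>L: "1 * L \<le> (real \<Delta>)\<^sup>2 * L" "real \<Delta> * L \<le> (real \<Delta>)\<^sup>2 * L"
    using D1[of 2] L1 DD by (intro mult_right_mono; simp)+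
  have DK: "real \<Delta> * K \<le> real \<Delta> * L" unfolding Kx using xL[of 9] by (intro mult_left_mono) auto
  have c1: "3 * T + 5 \<le> n"
  proof -
    have "real (3 * T + 5) \<le> 89 * L" using Tx xL[of q] L1 by simp
    also have "\<dots> \<le> n" using small \<Delta>L by linarith
    finally show ?thesis by (simp only: of_nat_le_iff)
  qed
  have c2: "real \<Delta> * K \<le> n" using DK \<Delta>L small L1 by linarith
  have c3: "2 * K \<le> n"
  proof -
    have "2 * real K \<le> real \<Delta> * K" using D2 by (intro mult_right_mono) auto
    thus ?thesis using c2 by linarith
  qed
  have c4: "\<Delta> * K \<le> n" using c2 by (metis of_nat_le_iff of_nat_mult)
  have hs: "h \<le> s" using lg s by linarith
  have ej: "(1 - 1 / real \<Delta> ^ j0) ^ j \<le> \<epsilon>"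
  proof -
    have "(2::real) ^ \<nu> \<le> exp 1 ^ \<nu>" using exp_ge_add_one_self[of 1] by (intro power_mono) auto
    hence "x \<le> exp (real \<nu>)" by (simp add: x\<nu> flip: exp_of_nat_mult)
    hence "1 / \<epsilon> \<le> exp (real \<nu>)" using lg lx by linarith
    hence "exp (- real \<nu>) \<le> \<epsilon>" using \<epsilon> by (simp add: exp_minus field_simps)
    thus ?thesis using ex by linarith
  qed
  define y where "y = sqrt (real \<Delta> * K / n)"
  have y0: "0 \<le> y" by (simp add: y_def)
  have y2: "y\<^sup>2 = real \<Delta> * K / n" by (simp add: y_def)
  have y1: "y \<le> 1" unfolding y_def using c2 n0 by simp
  define A where "A = 2 / \<epsilon> * (n * (s * \<tau> (3 * s + 5))) + 4 / \<epsilon>\<^sup>2 * n * (n * (7 * \<Delta> * (1 / 2) ^ s + 19 * R s))"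
  define B where "B = K * ((real T + 1) * ((real T + 2) * \<tau> (3 * T + 5))) / \<epsilon>\<^sup>2"
  have main: "mean (\<lambda>\<omega>. of_bool (\<not> near_stationary \<omega> h (8 * \<epsilon>)))
      \<le> ((1 + 2 * y ^ 3) ^ n - 1) + A / K + B + (4 * \<Delta> * (1 / 2) ^ h + 10 * n * R s) / \<epsilon>\<^sup>2"
    unfolding A_def B_def
    by (rule mean_not_near[OF s1 hs T c1 K1 c3 c4 y0 y1 y2 j0 ej \<epsilon>])
  have x5: "x ^ a \<le> x ^ 5" if "a \<le> 5" for a using x1 that by (intro power_increasing)
  \<comment> \<open>Here \<open>n * y ^ 3\<close> equals \<open>\<Delta> * K * y\<close>, which is
    at most \<open>(\<Delta> * K)\<^sup>2 / sqrt n\<close>.\<close>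
  have b1: "(1 + 2 * y ^ 3) ^ n - 1 \<le> 4 * (real \<Delta>)\<^sup>2 * r"
  proof -
    have DK1: "1 \<le> real \<Delta> * K" using D2 K1 mult_mono[of 1 "real \<Delta>" 1 "real K"] by simp
    have "y \<le> real \<Delta> * K / sqrt n"
    proof -
      have "sqrt (real \<Delta> * K) \<le> real \<Delta> * K" using DK1 by (auto simp: real_le_lsqrt self_le_power)
      thus ?thesis using sn unfolding y_def real_sqrt_divide by (intro divide_right_mono) auto
    qed
    hence "real \<Delta> * K * y \<le> real \<Delta> * K * (real \<Delta> * K / sqrt n)" by (intro mult_left_mono) auto
    moreover have "real \<Delta> * K * (real \<Delta> * K / sqrt n) = (real \<Delta>)\<^sup>2 * (x ^ 18 / sqrt n)"
      by (simp add: Kx power2_eq_square flip: power_add)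
    moreover have "x ^ 18 / sqrt n \<le> r" using xL[of 18] sn by (simp add: rL divide_le_eq)
    hence "(real \<Delta>)\<^sup>2 * (x ^ 18 / sqrt n) \<le> (real \<Delta>)\<^sup>2 * r" by (intro mult_left_mono) auto
    moreover have "n * y ^ 3 = real \<Delta> * K * y"
      using y2 n0 by (simp add: power3_eq_cube power2_eq_square field_simps)
    ultimately have ny: "n * y ^ 3 \<le> (real \<Delta>)\<^sup>2 * r" by linarith
    define z where "z = n * (2 * y ^ 3)"
    have z: "0 \<le> z" "z \<le> 2 * (real \<Delta>)\<^sup>2 * r" using ny y0 by (auto simp: z_def)
    have "z \<le> 1" using z r r0 mult_nonneg_nonneg[of "(real \<Delta>)\<^sup>2" r] by simp
    hence "exp z \<le> 1 + z + z\<^sup>2" "z\<^sup>2 \<le> z"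
      using exp_bound[of z] z by (simp_all add: power2_eq_square[of z] mult_left_le_one_le)
    moreover have "(1 + 2 * y ^ 3) ^ n \<le> exp z" unfolding z_def using y0 by (intro one_plus_power_le_exp) simp
    ultimately show ?thesis using z by linarith
  qed
  have s7: "3 * real s + 7 \<le> 10 * x" using s x1 by linarith
  \<comment> \<open>The cube in \<open>R\<close> and the square of \<open>3 * s + 7\<close> in
    \<open>\<tau>\<close> give five powers of \<open>x\<close>, and
    \<open>800 = 2 ^ 3 * 10 ^ 2\<close>. Hence \<open>K = x ^ 9\<close> outgrows the mean number of
    bad vertices.\<close>
  have n2R: "n * (n * R s) \<le> 800 * real \<Delta> ^ 3 * x ^ 5"
  proof -
    have "n * (n * R s) = real \<Delta> ^ 3 * ((real s + 1) ^ 3 * (3 * real s + 7)\<^sup>2)"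
      using n0 by (simp add: R_def \<tau>_def power2_eq_square power3_eq_cube field_simps)
    moreover have "(real s + 1) ^ 3 * (3 * real s + 7)\<^sup>2 \<le> (2 * x) ^ 3 * (10 * x)\<^sup>2"
      using s7 s x1 by (intro mult_mono power_mono) auto
    hence "real \<Delta> ^ 3 * ((real s + 1) ^ 3 * (3 * real s + 7)\<^sup>2) \<le> real \<Delta> ^ 3 * ((2 * x) ^ 3 * (10 * x)\<^sup>2)"
      by (intro mult_left_mono) auto
    moreover have "real \<Delta> ^ 3 * ((2 * x) ^ 3 * (10 * x)\<^sup>2) = 800 * real \<Delta> ^ 3 * x ^ 5"
      by (simp add: power2_eq_square power3_eq_cube eval_nat_numeral)
    ultimately show ?thesis by linarith
  qed
  have b2: "A / K \<le> (20 * real \<Delta> / \<epsilon> + 4 / \<epsilon>\<^sup>2 * (7 * real \<Delta> + 15200 * real \<Delta> ^ 3)) / log 2 n"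
  proof -
    define C where "C = 20 * real \<Delta> / \<epsilon> + 4 / \<epsilon>\<^sup>2 * (7 * real \<Delta> + 15200 * real \<Delta> ^ 3)"
    have C0: "0 \<le> C" using \<epsilon> by (simp add: C_def)
    have "n * (s * \<tau> (3 * s + 5)) = real \<Delta> * (s * (3 * real s + 7))"
      using n0 by (simp add: \<tau>_def field_simps)
    moreover have "s * (3 * real s + 7) \<le> x * (10 * x)" using s7 s x1 by (intro mult_mono) auto
    hence "real \<Delta> * (s * (3 * real s + 7)) \<le> real \<Delta> * (x * (10 * x))" by (intro mult_left_mono) auto
    moreover have "real \<Delta> * (x * (10 * x)) = real \<Delta> * (10 * x ^ 2)" by (simp add: power2_eq_square)
    moreover have "real \<Delta> * (10 * x ^ 2) \<le> real \<Delta> * (10 * x ^ 5)" using x5[of 2] by (intro mult_left_mono) auto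
    ultimately have a1: "n * (s * \<tau> (3 * s + 5)) \<le> 10 * real \<Delta> * x ^ 5" by linarith
    have "n * (n * (7 * \<Delta> * (1 / 2) ^ s + 19 * R s)) = 7 * real \<Delta> * ((real n)\<^sup>2 * (1 / 2) ^ s) + 19 * (n * (n * R s))"
      by (simp add: power2_eq_square algebra_simps)
    moreover have "(real n)\<^sup>2 * (1 / 2) ^ s \<le> 1"
      using mult_left_mono[OF s(2), of "(real n)\<^sup>2"] n0 by simp
    hence "7 * real \<Delta> * ((real n)\<^sup>2 * (1 / 2) ^ s) \<le> 7 * real \<Delta> * x ^ 5"
      using x5[of 0] by (intro mult_left_mono) auto
    ultimately have a2: "n * (n * (7 * \<Delta> * (1 / 2) ^ s + 19 * R s)) \<le> (7 * real \<Delta> + 15200 * real \<Delta> ^ 3) * x ^ 5"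
      using n2R by (simp add: distrib_right)
    have "A = 2 / \<epsilon> * (n * (s * \<tau> (3 * s + 5))) + 4 / \<epsilon>\<^sup>2 * (n * (n * (7 * \<Delta> * (1 / 2) ^ s + 19 * R s)))"
      by (simp add: A_def)
    moreover have "2 / \<epsilon> * (n * (s * \<tau> (3 * s + 5))) \<le> 2 / \<epsilon> * (10 * real \<Delta> * x ^ 5)"
      using a1 \<epsilon> by (intro mult_left_mono) auto
    moreover have "4 / \<epsilon>\<^sup>2 * (n * (n * (7 * \<Delta> * (1 / 2) ^ s + 19 * R s)))
        \<le> 4 / \<epsilon>\<^sup>2 * ((7 * real \<Delta> + 15200 * real \<Delta> ^ 3) * x ^ 5)"
      using a2 \<epsilon> by (intro mult_left_mono) auto
    moreover have "2 / \<epsilon> * (10 * real \<Delta> * x ^ 5) + 4 / \<epsilon>\<^sup>2 * ((7 * real \<Delta> + 15200 * real \<Delta> ^ 3) * x ^ 5) = C * x ^ 5"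
      by (simp add: C_def algebra_simps add_divide_distrib)
    ultimately have AC: "A \<le> C * x ^ 5" by linarith
    have "A / K \<le> C * x ^ 5 / x ^ 9" unfolding Kx using AC x1 by (intro divide_right_mono) auto
    moreover have "C * x ^ 5 / x ^ 9 = C / x ^ 4" using x1 by (simp add: power_diff[symmetric] field_simps flip: power_add)
    moreover have "C / x ^ 4 \<le> C / log 2 n"
    proof (rule divide_left_mono[OF _ C0])
      show "log 2 n \<le> x ^ 4" using lx x1 power_increasing[of 1 4 x] by simp
      show "0 < x ^ 4 * log 2 n" using x1 n2 by (intro mult_pos_pos) auto
    qed
    ultimately show ?thesis unfolding C_def by linarith
  qed
  \<comment> \<open>\<open>79170 = 29 * 30 * 91\<close>, one factor for each of the three terms
    linear in \<open>T\<close>.\<close>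
  have b3: "B \<le> 79170 * real \<Delta> / \<epsilon>\<^sup>2 * r"
  proof -
    have xq: "1 \<le> x ^ q" using x1 by (intro one_le_power)
    have T1: "real T + 1 \<le> 29 * x ^ q" and T2: "real T + 2 \<le> 30 * x ^ q" using Tx xq by linarith+
    have "\<tau> (3 * T + 5) \<le> real \<Delta> * (91 * x ^ q) / n"
      unfolding \<tau>_def using Tx xq by (intro divide_right_mono mult_left_mono) auto
    hence "K * ((real T + 1) * ((real T + 2) * \<tau> (3 * T + 5)))
        \<le> x ^ 9 * ((29 * x ^ q) * ((30 * x ^ q) * (real \<Delta> * (91 * x ^ q) / n)))"
      unfolding Kx using T1 T2 x1 by (intro mult_mono mult_nonneg_nonneg) (auto simp: \<tau>_def)
    moreover have "x ^ 9 * ((29 * x ^ q) * ((30 * x ^ q) * (real \<Delta> * (91 * x ^ q) / n)))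
        = 79170 * real \<Delta> * (x ^ (9 + q + q + q) / n)" unfolding power_add by simp
    moreover have "x ^ (9 + q + q + q) / n \<le> r"
      using xL[of "9 + q + q + q"] Ln n0 divide_right_mono[of "x ^ (9 + q + q + q)" L n] by linarith
    hence "79170 * real \<Delta> * (x ^ (9 + q + q + q) / n) \<le> 79170 * real \<Delta> * r" by (intro mult_left_mono) auto
    ultimately have "K * ((real T + 1) * ((real T + 2) * \<tau> (3 * T + 5))) \<le> 79170 * real \<Delta> * r" by linarith
    thus ?thesis unfolding B_def times_divide_eq_left by (intro divide_right_mono) auto
  qed
  have b4: "10 * n * R s / \<epsilon>\<^sup>2 \<le> 8000 * real \<Delta> ^ 3 / \<epsilon>\<^sup>2 * r"
  proof -
    have "n * R s \<le> 800 * real \<Delta> ^ 3 * (x ^ 5 / n)" using n2R n0 by (simp add: le_divide_eq mult.commute)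
    moreover have "800 * real \<Delta> ^ 3 * (x ^ 5 / n) \<le> 800 * real \<Delta> ^ 3 * r"
      using xL[of 5] Ln n0 divide_right_mono[of "x ^ 5" L n] by (intro mult_left_mono) auto
    ultimately have "10 * n * R s \<le> 8000 * real \<Delta> ^ 3 * r" by linarith
    thus ?thesis unfolding times_divide_eq_left by (intro divide_right_mono) auto
  qed
  show ?thesis using main b1 b2 b3 b4 unfolding add_divide_distrib distrib_right by linarith
qed

section \<open>Transfer to the transition matrix, the invariant law and the law of M_star\<close>

lemma pr_one:
  assumes "dt n = dout" "i < n" shows "pr \<omega> 1 i j = trans_mat dt n \<omega> i j"
proof -
  have "pr \<omega> 1 i j = (\<Sum>l<dout i. of_bool (fst (\<omega> (i, l)) = j)) / dout i"
    unfolding One_nat_def pr_Suc[OF assms(2)] by simp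
  also have "(\<Sum>l<dout i. of_bool (fst (\<omega> (i, l)) = j)) = (\<Sum>l\<in>{k. k < dout i \<and> fst (\<omega> (i, k)) = j}. 1 :: real)"
    by (intro sum.mono_neutral_cong_right) auto
  finally show ?thesis by (simp add: trans_mat_def assms(1))
qed

lemma invariant_iff: "dt n = dout \<Longrightarrow> invariant \<omega> \<pi> \<longleftrightarrow> invariant_prob dt n \<omega> \<pi>"
proof -
  assume dt: "dt n = dout"
  have "(\<Sum>i<n. \<pi> i * pr \<omega> 1 i j) = (\<Sum>i<n. \<pi> i * trans_mat dt n \<omega> i j)" for j
    by (intro sum.cong refl arg_cong2[of _ _ _ _ "(*)"] pr_one[where dt = dt, OF dt]) simp
  thus ?thesis unfolding invariant_def invariant_prob_def by simp
qed

text \<open>The definite description denotes the invariant law, because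
  \<open>near_stationary\<close> includes uniqueness.\<close>

lemma near_stationary_pi_star:
  assumes "dt n = dout" "near_stationary \<omega> h \<epsilon>"
  shows "invariant \<omega> (pi_star dt n \<omega>)" "(\<Sum>z<n. \<bar>pi_star dt n \<omega> z - inlaw \<omega> h z\<bar>) \<le> \<epsilon>"
proof -
  obtain \<pi> where p: "invariant \<omega> \<pi>" "\<forall>\<pi>'. invariant \<omega> \<pi>' \<longrightarrow> \<pi>' = \<pi>" "(\<Sum>z<n. \<bar>\<pi> z - inlaw \<omega> h z\<bar>) \<le> \<epsilon>"
    using assms(2) unfolding near_stationary_def by (elim exE conjE) (rule that)
  have "pi_star dt n \<omega> = \<pi>"
    unfolding pi_star_def invariant_iff[where dt = dt, OF assms(1), symmetric]
    using p(1) p(2)[rule_format] by (rule the_equality)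
  thus "invariant \<omega> (pi_star dt n \<omega>)" "(\<Sum>z<n. \<bar>pi_star dt n \<omega> z - inlaw \<omega> h z\<bar>) \<le> \<epsilon>"
    using p(1,3) by simp_all
qed

definition deviation :: "(nat \<times> nat \<Rightarrow> nat \<times> nat) \<Rightarrow> nat \<Rightarrow> real \<Rightarrow> real" where
  "deviation \<omega> h u = (\<Sum>i<n. exp (- u * (m * inlaw \<omega> h i)) - phi h u ^ din i) / n"

abbreviation M_law :: "real measure \<Rightarrow> real measure" where
  "M_law \<mu> \<equiv> mixture (pmf_of_set {..<n}) (\<lambda>_. real n / real m) din \<mu>"

text \<open>Three comparisons: from \<open>\<pi>\<close> to \<open>inlaw\<close>, as
  \<open>exp (- x)\<close> is 1-Lipschitz on the half-line; from \<open>inlaw\<close> to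
  \<open>phi\<close>, which is \<open>deviation\<close>; from \<open>phi\<close> to the fixed point.
  The argument \<open>u = t * (n / m)\<close> carries the factor \<open>n / m\<close> of
  \<open>M_star\<close> and satisfies \<open>u * m = t * n\<close>.\<close>

lemma laplace_close:
  assumes \<mu>: "mean_one \<mu>"
    and fixpoint: "\<And>t. 0 \<le> t \<Longrightarrow> laplace \<mu> t = (\<Sum>e\<in>E. laplace \<mu> (t / dout (fst e)) ^ din (fst e)) / m"
    and t: "0 \<le> t" and \<pi>: "\<And>i. i < n \<Longrightarrow> 0 \<le> \<pi> i" and close: "(\<Sum>z<n. \<bar>\<pi> z - inlaw \<omega> h z\<bar>) \<le> \<epsilon>"
  shows "\<bar>laplace (empirical_borel n \<pi>) t - laplace (M_law \<mu>) t\<bar>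
    \<le> t * \<epsilon> + \<bar>deviation \<omega> h (t * (real n / real m))\<bar> + 2 * real \<Delta> ^ 3 * (1 / 2) ^ h * t\<^sup>2"
proof -
  define u where "u = t * (real n / real m)"
  have n0: "0 < real n" and m0: "0 < real m" using n_pos m_pos by simp_all
  have u0: "0 \<le> u" using t by (simp add: u_def)
  have "real n / real m \<le> 1" using m_ge m0 by (simp add: divide_le_eq)
  hence ut: "u \<le> t" unfolding u_def using t by (intro mult_left_le) auto
  define a where "a i = exp (- t * (real n * \<pi> i))" for i
  define b where "b i = exp (- u * (m * inlaw \<omega> h i))" for i
  define c where "c i = phi h u ^ din i" for i
  define d where "d i = laplace \<mu> u ^ din i" for i
  have ab: "\<bar>a i - b i\<bar> \<le> t * n * \<bar>\<pi> i - inlaw \<omega> h i\<bar>" if "i < n" for i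
  proof -
    have e: "\<bar>exp (- x) - exp (- y)\<bar> \<le> \<bar>x - y\<bar>" if "0 \<le> x" "0 \<le> y" for x y :: real
    proof -
      have *: "exp (- x) - exp (- y) \<le> y - x" if "0 \<le> x" "x \<le> y" for x y :: real
      proof -
        have "exp (- y) = exp (- x) * exp (- (y - x))" by (simp flip: exp_add)
        moreover have "exp (- x) * (1 - (y - x)) \<le> exp (- x) * exp (- (y - x))"
          by (intro mult_left_mono) (use exp_ge_add_one_self[of "- (y - x)"] in linarith, simp)
        moreover have "exp (- x) * (y - x) \<le> 1 * (y - x)" using that by (intro mult_right_mono) auto
        ultimately show ?thesis by (simp add: right_diff_distrib)
      qed
      show ?thesis using *[of x y] *[of y x] that by (cases "x \<le> y") auto
    qed
    have "u * m = t * n" using m0 by (simp add: u_def)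
    hence "b i = exp (- (t * n * inlaw \<omega> h i))" by (simp add: b_def flip: mult.assoc)
    moreover have "a i = exp (- (t * n * \<pi> i))" by (simp add: a_def mult.assoc)
    moreover have "0 \<le> t * n * \<pi> i" "0 \<le> t * n * inlaw \<omega> h i"
      using t \<pi>[OF that] inlaw_nonneg by (auto intro!: mult_nonneg_nonneg)
    hence "\<bar>exp (- (t * n * \<pi> i)) - exp (- (t * n * inlaw \<omega> h i))\<bar> \<le> \<bar>t * n * \<pi> i - t * n * inlaw \<omega> h i\<bar>" by (rule e)
    moreover have "\<bar>t * n * \<pi> i - t * n * inlaw \<omega> h i\<bar> = t * n * \<bar>\<pi> i - inlaw \<omega> h i\<bar>"
      using t by (simp flip: right_diff_distrib add: abs_mult)
    ultimately show ?thesis by simp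
  qed
  have "\<bar>\<Sum>i<n. a i - b i\<bar> \<le> (\<Sum>i<n. t * n * \<bar>\<pi> i - inlaw \<omega> h i\<bar>)"
    using ab by (intro order_trans[OF sum_abs] sum_mono) auto
  moreover have "(\<Sum>i<n. t * n * \<bar>\<pi> i - inlaw \<omega> h i\<bar>) \<le> t * n * \<epsilon>"
    unfolding sum_distrib_left[symmetric] using close t by (intro mult_left_mono) auto
  ultimately have "\<bar>\<Sum>i<n. a i - b i\<bar> \<le> t * \<epsilon> * n" by (simp add: mult_ac)
  hence A: "\<bar>(\<Sum>i<n. a i - b i) / n\<bar> \<le> t * \<epsilon>" using n0 by (simp add: divide_le_eq)
  have cd: "\<bar>c i - d i\<bar> \<le> 2 * real \<Delta> ^ 3 * (1 / 2) ^ h * t\<^sup>2" if "i < n" for i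
  proof -
    have "\<bar>c i - d i\<bar> \<le> din i * \<bar>phi h u - laplace \<mu> u\<bar>"
      unfolding c_def d_def using phi_bounds[OF u0] laplace_bounds[OF \<mu> u0] by (intro pow_diff_le) auto
    also have "\<dots> \<le> real \<Delta> * (2 * (real \<Delta>)\<^sup>2 * (1 / 2) ^ h * t\<^sup>2)"
    proof (intro mult_mono)
      have "\<bar>phi h u - laplace \<mu> u\<bar> \<le> 2 * (real \<Delta>)\<^sup>2 * (1 / 2) ^ h * u\<^sup>2" by (rule phi_limit[OF \<mu> fixpoint u0])
      moreover have "2 * (real \<Delta>)\<^sup>2 * (1 / 2) ^ h * u\<^sup>2 \<le> 2 * (real \<Delta>)\<^sup>2 * (1 / 2) ^ h * t\<^sup>2"
        using ut u0 by (intro mult_left_mono power_mono) auto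
      ultimately show "\<bar>phi h u - laplace \<mu> u\<bar> \<le> 2 * (real \<Delta>)\<^sup>2 * (1 / 2) ^ h * t\<^sup>2" by linarith
    qed (use degrees[OF that] in auto)
    also have "\<dots> = 2 * real \<Delta> ^ 3 * (1 / 2) ^ h * t\<^sup>2" by (simp add: power2_eq_square power3_eq_cube)
    finally show ?thesis .
  qed
  have "\<bar>\<Sum>i<n. c i - d i\<bar> \<le> (\<Sum>i<n. 2 * real \<Delta> ^ 3 * (1 / 2) ^ h * t\<^sup>2)"
    using cd by (intro order_trans[OF sum_abs] sum_mono) auto
  hence B: "\<bar>(\<Sum>i<n. c i - d i) / n\<bar> \<le> 2 * real \<Delta> ^ 3 * (1 / 2) ^ h * t\<^sup>2"
    using n0 by (simp add: divide_le_eq mult_ac)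
  have "laplace (empirical_borel n \<pi>) t - laplace (M_law \<mu>) t = ((\<Sum>i<n. a i) - (\<Sum>i<n. d i)) / n"
    unfolding laplace_empirical[OF n_pos] laplace_M[OF \<mu> t] a_def d_def u_def by (simp add: diff_divide_distrib)
  moreover have "deviation \<omega> h u = (\<Sum>i<n. b i - c i) / n" by (simp add: deviation_def b_def c_def)
  ultimately have "laplace (empirical_borel n \<pi>) t - laplace (M_law \<mu>) t
      = (\<Sum>i<n. a i - b i) / n + deviation \<omega> h u + (\<Sum>i<n. c i - d i) / n"
    by (simp add: sum_subtractf diff_divide_distrib)
  thus ?thesis using A B unfolding u_def by linarith
qed

text \<open>The quadratic bound at \<open>t\<close> is known for \<open>M_star\<close> only. The
  empirical transform inherits it through the comparison at \<open>t\<close>, at the price of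
  \<open>3 * \<kappa> / t\<close>; the integers up to \<open>N\<close> serve the polynomial
  approximation.\<close>

lemma wasserstein1_pi_star:
  assumes dt: "dt n = dout" "dn n = din" and Z: "Z_law dt dn n \<mu>"
    and t: "0 < t" "t \<le> 1" and N: "1 \<le> N"
    and near: "near_stationary \<omega> h \<epsilon>" and \<epsilon>: "0 \<le> \<epsilon>" "N * \<epsilon> \<le> \<kappa>" and h: "2 * real \<Delta> ^ 3 * (1 / 2) ^ h * (real N)\<^sup>2 \<le> \<kappa>"
    and dev: "\<And>v. v \<in> insert t (real ` {..N}) \<Longrightarrow> \<bar>deviation \<omega> h (v * (real n / real m))\<bar> \<le> \<kappa>"
  shows "wasserstein1 (empirical n (pi_star dt n \<omega>)) (M_star_law dt dn n \<mu>)
    \<le> 6 * real \<Delta> ^ 3 * t + 3 * \<kappa> / t + 2 * exp (1 / t) / sqrt N + (1 / t) * 3 ^ N * (3 * \<kappa>)"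
proof -
  define \<pi> where "\<pi> = pi_star dt n \<omega>"
  note ps = near_stationary_pi_star[of dt \<omega> h \<epsilon>, OF dt(1) near, folded \<pi>_def]
  have \<pi>: "\<And>i. i < n \<Longrightarrow> 0 \<le> \<pi> i" "(\<Sum>i<n. \<pi> i) = 1" using ps(1) by (auto simp: invariant_def)
  have \<mu>: "mean_one \<mu>" by (rule Z_law_fixpoint(1)[where dt = dt and dn = dn, OF dt Z])
  have fp: "laplace \<mu> t = (\<Sum>e\<in>E. laplace \<mu> (t / dout (fst e)) ^ din (fst e)) / m" if "0 \<le> t" for t
    by (rule Z_law_fixpoint(2)[where dt = dt and dn = dn, OF dt Z that])
  have close: "\<bar>laplace (empirical_borel n \<pi>) v - laplace (M_law \<mu>) v\<bar> \<le> 3 * \<kappa>"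
    if v: "v \<in> insert t (real ` {..N})" for v
  proof -
    have vN: "0 \<le> v" "v \<le> N" using v t N by auto
    have "\<bar>laplace (empirical_borel n \<pi>) v - laplace (M_law \<mu>) v\<bar>
      \<le> v * \<epsilon> + \<bar>deviation \<omega> h (v * (real n / real m))\<bar> + 2 * real \<Delta> ^ 3 * (1 / 2) ^ h * v\<^sup>2"
      by (rule laplace_close[OF \<mu> fp vN(1) \<pi>(1) ps(2)])
    moreover have "v * \<epsilon> \<le> N * \<epsilon>" using vN \<epsilon> by (intro mult_right_mono)
    moreover have "2 * real \<Delta> ^ 3 * (1 / 2) ^ h * v\<^sup>2 \<le> 2 * real \<Delta> ^ 3 * (1 / 2) ^ h * (real N)\<^sup>2"
      using vN by (intro mult_left_mono power_mono) auto
    ultimately show ?thesis using dev[OF v] \<epsilon> h by linarith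
  qed
  define LP LQ where "LP = laplace (empirical_borel n \<pi>) t" and "LQ = laplace (M_law \<mu>) t"
  have "wasserstein1 (empirical_borel n \<pi>) (M_law \<mu>) \<le> (1 - (1 - LP) / t) + (1 - (1 - LQ) / t)
     + 2 * exp (1 / t) / sqrt N + (1 / t) * 3 ^ N * (3 * \<kappa>)"
    unfolding LP_def LQ_def
    by (rule wasserstein1_le_laplace[OF mean_one_empirical[OF n_pos \<pi>] mean_one_M[OF \<mu>] t(1) N close]) auto
  moreover have Q: "LQ \<le> 1 - t + 3 * real \<Delta> ^ 3 * t\<^sup>2"
    unfolding LQ_def using t by (intro laplace_M_quadratic[OF \<mu> fp]) auto
  have LPQ: "LP \<le> LQ + 3 * \<kappa>" using close[of t] unfolding LP_def LQ_def by simp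
  have div: "1 - (1 - L) / t \<le> 3 * real \<Delta> ^ 3 * t + b / t" if "L \<le> 1 - t + 3 * real \<Delta> ^ 3 * t\<^sup>2 + b" for L b
  proof -
    have "(L - (1 - t)) / t \<le> (3 * real \<Delta> ^ 3 * t\<^sup>2 + b) / t" using that t by (intro divide_right_mono) auto
    moreover have "(L - (1 - t)) / t = 1 - (1 - L) / t" using t by (simp add: field_simps)
    moreover have "(3 * real \<Delta> ^ 3 * t\<^sup>2 + b) / t = 3 * real \<Delta> ^ 3 * t + b / t" using t by (simp add: field_simps power2_eq_square)
    ultimately show ?thesis by linarith
  qed
  have "1 - (1 - LQ) / t \<le> 3 * real \<Delta> ^ 3 * t"
    using div[of LQ 0] Q by simp
  moreover have "1 - (1 - LP) / t \<le> 3 * real \<Delta> ^ 3 * t + 3 * \<kappa> / t"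
    by (rule div) (use Q LPQ in linarith)
  moreover have "M_star_law dt dn n \<mu> = M_law \<mu>" by (rule M_star_mixture[where dt = dt and dn = dn, OF dt])
  ultimately show ?thesis unfolding \<pi>_def wasserstein1_empirical by simp
qed

lemma prob_env: "dt n = dout \<Longrightarrow> dn n = din \<Longrightarrow> measure_pmf.prob (env_pmf dt dn n) {\<omega>. P \<omega>} = mean (\<lambda>\<omega>. of_bool (P \<omega>))"
proof -
  assume dt: "dt n = dout" "dn n = din"
  have "environments dt dn n = \<Omega>"
    using dt by (simp add: environments_def bijs_def tails_def heads_def E_def F_def)
  hence "measure_pmf.prob (env_pmf dt dn n) {\<omega>. P \<omega>} = card (\<Omega> \<inter> {\<omega>. P \<omega>}) / card \<Omega>"
    unfolding env_pmf_def using bijs_nonempty finite_bijs by (simp add: measure_pmf_of_set)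
  also have "real (card (\<Omega> \<inter> {\<omega>. P \<omega>})) = (\<Sum>\<omega>\<in>\<Omega>. of_bool (P \<omega>))"
    using finite_bijs by simp
  finally show ?thesis by (simp add: mean_def)
qed

lemma prob_wasserstein1_pi_star:
  assumes dt: "dt n = dout" "dn n = din" and Z: "Z_law dt dn n \<mu>"
    and t: "0 < t" "t \<le> 1" and N: "1 \<le> N" and \<epsilon>: "0 \<le> \<epsilon>" "N * \<epsilon> \<le> \<kappa>"
    and \<kappa>: "0 < \<kappa>" "2 * real \<Delta> ^ 3 * (1 / 2) ^ h * (real N)\<^sup>2 \<le> \<kappa>"
    and c: "c = 2 * \<Delta> + \<Delta> * (2 * \<Delta> * (1 + \<Delta>) ^ h)" "c \<le> n"
    and C: "C = 2 * \<Delta> * (1 + \<Delta>) ^ h * (2 * real \<Delta> * c)"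
    and total: "6 * real \<Delta> ^ 3 * t + 3 * \<kappa> / t + 2 * exp (1 / t) / sqrt N + (1 / t) * 3 ^ N * (3 * \<kappa>) \<le> \<epsilon>'"
  shows "measure_pmf.prob (env_pmf dt dn n)
      {\<omega>. wasserstein1 (empirical n (pi_star dt n \<omega>)) (M_star_law dt dn n \<mu>) > \<epsilon>'}
    \<le> mean (\<lambda>\<omega>. of_bool (\<not> near_stationary \<omega> h \<epsilon>)) + (real N + 2) * ((3 * C + 1) / n / \<kappa>\<^sup>2)"
proof -
  \<comment> \<open>The arguments at which transforms are compared: \<open>t\<close> for the tails
    and the integers up to \<open>N\<close> for the polynomials, at most \<open>N + 2\<close> in
    all.\<close>
  define V where "V = insert t (real ` {..N})"
  have fV: "finite V" by (simp add: V_def)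
  have "card V \<le> Suc (card (real ` {..N}))" unfolding V_def by (rule card_insert_le_m1) simp_all
  also have "card (real ` {..N}) \<le> card {..N}" by (rule card_image_le) simp
  finally have cV: "real (card V) \<le> real N + 2" by simp
  define B where "B \<omega> v = (of_bool ((deviation \<omega> h (v * (real n / real m)))\<^sup>2 > \<kappa>\<^sup>2) :: real)" for \<omega> v
  have Bm: "mean (\<lambda>\<omega>. B \<omega> v) \<le> (3 * C + 1) / n / \<kappa>\<^sup>2" if v: "v \<in> V" for v
  proof -
    have v0: "0 \<le> v * (real n / real m)" using v t by (auto simp: V_def)
    have "mean (\<lambda>\<omega>. B \<omega> v) \<le> mean (\<lambda>\<omega>. (deviation \<omega> h (v * (real n / real m)))\<^sup>2) / \<kappa>\<^sup>2"
      unfolding B_def using \<kappa> by (intro mean_markov) auto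
    moreover have "mean (\<lambda>\<omega>. (deviation \<omega> h (v * (real n / real m)))\<^sup>2) \<le> (3 * C + 1) / n"
      unfolding deviation_def by (rule laplace_concentration[OF v0 c C])
    ultimately show ?thesis using \<kappa> divide_right_mono[of _ "(3 * C + 1) / n" "\<kappa>\<^sup>2"] by (meson order_trans zero_le_power2)
  qed
  have "measure_pmf.prob (env_pmf dt dn n)
      {\<omega>. wasserstein1 (empirical n (pi_star dt n \<omega>)) (M_star_law dt dn n \<mu>) > \<epsilon>'}
    = mean (\<lambda>\<omega>. of_bool (wasserstein1 (empirical n (pi_star dt n \<omega>)) (M_star_law dt dn n \<mu>) > \<epsilon>'))"
    by (rule prob_env[where dt = dt and dn = dn, OF dt])
  also have "\<dots> \<le> mean (\<lambda>\<omega>. of_bool (\<not> near_stationary \<omega> h \<epsilon>) + (\<Sum>v\<in>V. B \<omega> v))"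
  proof (rule mean_mono)
    fix \<omega> assume "\<omega> \<in> \<Omega>"
    have s0: "0 \<le> (\<Sum>v\<in>V. B \<omega> v)" by (intro sum_nonneg) (simp add: B_def)
    show "of_bool (wasserstein1 (empirical n (pi_star dt n \<omega>)) (M_star_law dt dn n \<mu>) > \<epsilon>')
        \<le> of_bool (\<not> near_stationary \<omega> h \<epsilon>) + (\<Sum>v\<in>V. B \<omega> v)"
    proof (cases "near_stationary \<omega> h \<epsilon> \<and> (\<forall>v\<in>V. (deviation \<omega> h (v * (real n / real m)))\<^sup>2 \<le> \<kappa>\<^sup>2)")
      case True
      have "\<bar>deviation \<omega> h (v * (real n / real m))\<bar> \<le> \<kappa>" if "v \<in> insert t (real ` {..N})" for v
      proof -
        have "(deviation \<omega> h (v * (real n / real m)))\<^sup>2 \<le> \<kappa>\<^sup>2" using True that unfolding V_def by blast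
        thus ?thesis using \<kappa> by (simp only: abs_le_square_iff[symmetric])
      qed
      hence "wasserstein1 (empirical n (pi_star dt n \<omega>)) (M_star_law dt dn n \<mu>)
        \<le> 6 * real \<Delta> ^ 3 * t + 3 * \<kappa> / t + 2 * exp (1 / t) / sqrt N + (1 / t) * 3 ^ N * (3 * \<kappa>)"
        using True by (intro wasserstein1_pi_star[where dt = dt and dn = dn, OF dt Z t N _ \<epsilon> \<kappa>(2)]) auto
      hence "\<not> wasserstein1 (empirical n (pi_star dt n \<omega>)) (M_star_law dt dn n \<mu>) > \<epsilon>'" using total by linarith
      thus ?thesis using s0 by simp
    next
      case False
      show ?thesis
      proof (cases "near_stationary \<omega> h \<epsilon>")
        case True
        then obtain v where v: "v \<in> V" "B \<omega> v = 1" using False by (auto simp: B_def not_le)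
        have "B \<omega> v \<le> (\<Sum>v\<in>V. B \<omega> v)" using v fV by (intro member_le_sum) (auto simp: B_def)
        thus ?thesis using v by (simp add: of_bool_def)
      qed (use s0 in \<open>simp add: of_bool_def\<close>)
    qed
  qed
  also have "\<dots> = mean (\<lambda>\<omega>. of_bool (\<not> near_stationary \<omega> h \<epsilon>)) + (\<Sum>v\<in>V. mean (\<lambda>\<omega>. B \<omega> v))"
    by (simp only: mean_add mean_sum)
  finally have 1: "measure_pmf.prob (env_pmf dt dn n)
      {\<omega>. wasserstein1 (empirical n (pi_star dt n \<omega>)) (M_star_law dt dn n \<mu>) > \<epsilon>'}
    \<le> mean (\<lambda>\<omega>. of_bool (\<not> near_stationary \<omega> h \<epsilon>)) + (\<Sum>v\<in>V. mean (\<lambda>\<omega>. B \<omega> v))" .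
  have "(\<Sum>v\<in>V. mean (\<lambda>\<omega>. B \<omega> v)) \<le> card V * ((3 * C + 1) / n / \<kappa>\<^sup>2)"
    using Bm by (intro sum_bounded_above)
  moreover have "card V * ((3 * C + 1) / n / \<kappa>\<^sup>2) \<le> (real N + 2) * ((3 * C + 1) / n / \<kappa>\<^sup>2)"
    using cV by (intro mult_right_mono) (auto simp: C)
  ultimately show ?thesis using 1 by linarith
qed

end

section \<open>Choice of scales and passage to the limit\<close>

lemma scale_choice:
  fixes D \<epsilon> :: real
  assumes D: "1 \<le> D" and \<epsilon>: "0 < \<epsilon>"
  obtains t \<kappa> :: real and N :: nat where "0 < t" "t \<le> 1" "1 \<le> N" "0 < \<kappa>"
    "6 * D ^ 3 * t + 3 * \<kappa> / t + 2 * exp (1 / t) / sqrt N + (1 / t) * 3 ^ N * (3 * \<kappa>) \<le> \<epsilon>"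
proof -
  \<comment> \<open>Each of the four terms receives a quarter of \<open>\<epsilon>\<close>. The
    order matters: \<open>N\<close> must beat \<open>exp (1 / t)\<close>, and
    \<open>\<kappa>\<close> must beat \<open>3 ^ N / t\<close>.\<close>
  define t where "t = min 1 (\<epsilon> / (24 * D ^ 3))"
  have D3: "0 < D ^ 3" using D by simp
  have t: "0 < t" "t \<le> 1" using \<epsilon> D3 by (auto simp: t_def)
  have "t \<le> \<epsilon> / (24 * D ^ 3)" by (simp add: t_def)
  hence 1: "6 * D ^ 3 * t \<le> \<epsilon> / 4" using D3 by (simp add: field_simps)
  define N where "N = nat \<lceil>(8 * exp (1 / t) / \<epsilon>)\<^sup>2\<rceil> + 1"
  have N: "1 \<le> N" by (simp add: N_def)
  have "(8 * exp (1 / t) / \<epsilon>)\<^sup>2 \<le> N" unfolding N_def by linarith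
  hence "8 * exp (1 / t) / \<epsilon> \<le> sqrt N" by (rule real_le_rsqrt)
  hence 2: "2 * exp (1 / t) / sqrt N \<le> \<epsilon> / 4" using \<epsilon> N by (simp add: field_simps)
  define \<kappa> where "\<kappa> = t * \<epsilon> / (12 * 3 ^ N)"
  have \<kappa>: "0 < \<kappa>" using t \<epsilon> by (simp add: \<kappa>_def)
  have 3: "(1 / t) * 3 ^ N * (3 * \<kappa>) = \<epsilon> / 4" using t by (simp add: \<kappa>_def)
  have "3 * \<kappa> / t = \<epsilon> / 4 / 3 ^ N" using t by (simp add: \<kappa>_def)
  moreover have "\<epsilon> / 4 / 3 ^ N \<le> \<epsilon> / 4 / 1" using \<epsilon> by (intro divide_left_mono) auto
  ultimately have 4: "3 * \<kappa> / t \<le> \<epsilon> / 4" by simp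
  have "6 * D ^ 3 * t + 3 * \<kappa> / t + 2 * exp (1 / t) / sqrt N + (1 / t) * 3 ^ N * (3 * \<kappa>) \<le> \<epsilon> / 4 + \<epsilon> / 4 + \<epsilon> / 4 + \<epsilon> / 4"
    by (intro add_mono 1 2 4 eq_refl[OF 3])
  hence "6 * D ^ 3 * t + 3 * \<kappa> / t + 2 * exp (1 / t) / sqrt N + (1 / t) * 3 ^ N * (3 * \<kappa>) \<le> \<epsilon>" by simp
  with t N \<kappa> show thesis by (rule that)
qed

theorem theorem4:
  fixes dout din :: "nat \<Rightarrow> nat \<Rightarrow> nat" and \<mu> :: "nat \<Rightarrow> real measure"
  assumes sums: "\<And>n. (\<Sum>i<n. din n i) = (\<Sum>i<n. dout n i)"
    and min_deg: "\<And>n i. i < n \<Longrightarrow> 2 \<le> dout n i \<and> 2 \<le> din n i"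
    and max_deg: "\<exists>D. \<forall>n i. i < n \<longrightarrow> dout n i \<le> D \<and> din n i \<le> D"
    and Z: "\<And>n. Z_law dout din n (\<mu> n)"
  shows "\<forall>\<epsilon>>0. (\<lambda>n. measure_pmf.prob (env_pmf dout din n)
            {\<omega>. wasserstein1 (empirical n (pi_star dout n \<omega>)) (M_star_law dout din n (\<mu> n)) > \<epsilon>})
          \<longlonglongrightarrow> 0"
proof (intro allI impI)
  fix \<epsilon> :: real assume \<epsilon>: "0 < \<epsilon>"
  obtain D where D: "\<And>n i. i < n \<Longrightarrow> dout n i \<le> D \<and> din n i \<le> D" using max_deg by blast
  have env: "digraph_env n (dout n) (din n) D" if "0 < n" for n
    using that sums min_deg D by unfold_locales auto
  have D1: "1 \<le> real D" using digraph_env.Delta_ge[OF env[of 1]] by simp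
  have Dp: "D \<le> 2 ^ D" by (rule less_imp_le[OF less_exp])
  obtain t \<kappa> :: real and N :: nat where t: "0 < t" "t \<le> 1" and N: "1 \<le> N" and \<kappa>: "0 < \<kappa>"
    and total: "6 * real D ^ 3 * t + 3 * \<kappa> / t + 2 * exp (1 / t) / sqrt N + (1 / t) * 3 ^ N * (3 * \<kappa>) \<le> \<epsilon>"
    by (rule scale_choice[OF D1 \<epsilon>])
  \<comment> \<open>\<open>near_stationary\<close> holds with L1 error
    \<open>8 * \<epsilon>1\<close>, and after multiplication by an argument of size up to
    \<open>N\<close> this must stay below \<open>\<kappa>\<close>.\<close>
  define \<epsilon>1 where "\<epsilon>1 = min (1 / 8) (\<kappa> / (8 * N))"
  have \<epsilon>1: "0 < \<epsilon>1" "7 * \<epsilon>1 < 1" "0 \<le> 8 * \<epsilon>1" using \<kappa> N by (auto simp: \<epsilon>1_def)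
  have "\<epsilon>1 \<le> \<kappa> / (8 * N)" by (simp add: \<epsilon>1_def)
  hence N\<epsilon>1: "N * (8 * \<epsilon>1) \<le> \<kappa>" using N by (simp add: field_simps)
  define P where "P n = measure_pmf.prob (env_pmf dout din n)
    {\<omega>. wasserstein1 (empirical n (pi_star dout n \<omega>)) (M_star_law dout din n (\<mu> n)) > \<epsilon>}" for n
  have small: "\<forall>\<^sub>F n in sequentially. P n < \<gamma>" if \<gamma>: "0 < \<gamma>" for \<gamma> :: real
  proof -
    \<comment> \<open>\<open>h\<close> is fixed before \<open>n\<close> grows. The first entry
      bounds the distance of \<open>phi h\<close> from the fixed point, the second the term with
      \<open>(1 / 2) ^ h\<close> in \<open>mean_not_near_log\<close>, which does not decay in
      \<open>n\<close>.\<close>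
    define \<beta> where "\<beta> = min (\<kappa> / (2 * real D ^ 3 * (real N)\<^sup>2)) (\<gamma> * \<epsilon>1\<^sup>2 / (16 * real D))"
    have "0 < \<beta>" using \<kappa> \<gamma> \<epsilon>1 D1 N by (auto simp: \<beta>_def)
    then obtain h where h: "(1 / 2 :: real) ^ h < \<beta>" using real_arch_pow_inv[of \<beta> "1 / 2"] by auto
    have "(1 / 2 :: real) ^ h \<le> \<kappa> / (2 * real D ^ 3 * (real N)\<^sup>2)" using h by (simp add: \<beta>_def)
    hence h1: "2 * real D ^ 3 * (1 / 2) ^ h * (real N)\<^sup>2 \<le> \<kappa>" using D1 N by (simp add: le_divide_eq mult_ac)
    have "(1 / 2 :: real) ^ h \<le> \<gamma> * \<epsilon>1\<^sup>2 / (16 * real D)" using h by (simp add: \<beta>_def)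
    hence h2: "4 * real D * (1 / 2) ^ h / \<epsilon>1\<^sup>2 \<le> \<gamma> / 4" using D1 \<epsilon>1 by (simp add: divide_le_eq le_divide_eq mult_ac)
    define c where "c = 2 * D + D * (2 * D * (1 + D) ^ h)"
    define C where "C = 2 * D * (1 + D) ^ h * (2 * real D * c)"
    define A B where "A = 20 * real D / \<epsilon>1 + 4 / \<epsilon>1\<^sup>2 * (7 * real D + 15200 * real D ^ 3)"
      and "B = 4 * (real D)\<^sup>2 + 79170 * real D / \<epsilon>1\<^sup>2 + 8000 * real D ^ 3 / \<epsilon>1\<^sup>2"
    define r where "r n = (4 * (log 2 (real n) + 1)) ^ (3 * (27 * D + 2) + 18) / sqrt n" for n :: nat
    have r: "r \<longlonglongrightarrow> 0" unfolding r_def by (rule polylog_over_sqrt)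
    have lg: "filterlim (\<lambda>n. log 2 (real n)) at_top sequentially"
      unfolding log_def
      by (rule filterlim_at_top_mult_tendsto_pos[OF tendsto_const _ filterlim_compose[OF ln_at_top filterlim_real_sequentially],
            of "1 / ln 2", simplified])
    have e: "\<forall>\<^sub>F n in sequentially. a n < b" if "a \<longlonglongrightarrow> 0" "0 < b" for a :: "nat \<Rightarrow> real" and b
      using order_tendstoD(2)[OF that] .
    have g: "\<forall>\<^sub>F n in sequentially. b \<le> log 2 (real n)" for b
      using lg by (simp add: filterlim_at_top)
    have e1: "\<forall>\<^sub>F n in sequentially. 89 * (real D)\<^sup>2 * r n < 1"
      using tendsto_mult_right_zero[OF r] by (intro e) auto
    have e2: "\<forall>\<^sub>F n in sequentially. B * r n < \<gamma> / 4"
      using tendsto_mult_right_zero[OF r] \<gamma> by (intro e) auto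
    have e3: "\<forall>\<^sub>F n in sequentially. A / log 2 (real n) < \<gamma> / 4"
      using real_tendsto_divide_at_top[OF tendsto_const lg] \<gamma> by (intro e) auto
    have e4: "\<forall>\<^sub>F n in sequentially. (real N + 2) * (3 * C + 1) / \<kappa>\<^sup>2 / n < \<gamma> / 4"
      by (rule e[OF real_tendsto_divide_at_top[OF tendsto_const filterlim_real_sequentially]]) (use \<gamma> in simp)
    show ?thesis
      using e1 e2 e3 e4 g[of "real h"] g[of "1 / \<epsilon>1"] eventually_ge_at_top[of c] eventually_ge_at_top[of 2]
    proof eventually_elim
      case (elim n)
      interpret digraph_env n "dout n" "din n" D using elim by (intro env) simp
      have "mean (\<lambda>\<omega>. of_bool (\<not> near_stationary \<omega> h (8 * \<epsilon>1)))
          \<le> 4 * real D * (1 / 2) ^ h / \<epsilon>1\<^sup>2 + A / log 2 n + B * r n"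
        unfolding A_def B_def r_def
        by (rule mean_not_near_log[OF _ Dp \<epsilon>1(1,2)]) (use elim in \<open>simp_all add: r_def\<close>)
      moreover have "P n \<le> mean (\<lambda>\<omega>. of_bool (\<not> near_stationary \<omega> h (8 * \<epsilon>1)))
          + (real N + 2) * ((3 * C + 1) / n / \<kappa>\<^sup>2)"
        unfolding P_def
        by (rule prob_wasserstein1_pi_star[where dt = dout and dn = din and t = t and h = h,
              OF refl refl Z t N \<epsilon>1(3) N\<epsilon>1 \<kappa> h1 c_def elim(7) C_def total])
      moreover have "(real N + 2) * ((3 * C + 1) / n / \<kappa>\<^sup>2) = (real N + 2) * (3 * C + 1) / \<kappa>\<^sup>2 / n" by simp
      ultimately show ?case using elim h2 by linarith
    qed
  qed
  have "P \<longlonglongrightarrow> 0"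
  proof (rule order_tendstoI)
    fix a :: real assume "a < 0"
    hence "a < P n" for n using measure_nonneg[of "measure_pmf (env_pmf dout din n)"] unfolding P_def by (meson less_le_trans)
    thus "\<forall>\<^sub>F n in sequentially. a < P n" by simp
  qed (rule small)
  thus "(\<lambda>n. measure_pmf.prob (env_pmf dout din n)
      {\<omega>. wasserstein1 (empirical n (pi_star dout n \<omega>)) (M_star_law dout din n (\<mu> n)) > \<epsilon>}) \<longlonglongrightarrow> 0"
    unfolding P_def .
qed

end
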